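(* Let $R$ be a commutative ring, let $(r_1,\dots,r_n)$ be a regular sequence in $R$ generating the ideal $I$, and put $S=R/I$. Let $\delta^*=\bigoplus_{s\ge0}\delta^s$ be the endomorphism of $\operatorname{Tor}_*^R(S,\operatorname{gr}_I^*(R))=\bigoplus_{s\geq 0}\operatorname{Tor}_*^R(S,I^s/I^{s+1})$ of bidegree $(-1,1)$, where $$\delta^s\colon \operatorname{Tor}_*^R(S, I^s/I^{s+1}) \to \operatorname{Tor}_{*-1}^R(S, I^{s+1}/I^{s+2})$$ is the connecting homomorphism of the short exact sequence $0 \to I^{s+1}/I^{s+2} \to I^s/I^{s+2} \to I^s/I^{s+1} \to 0$. Let $$\psi_*\colon \operatorname{Tor}_*^R(S, \operatorname{gr}^*_I(R)) \xrightarrow{\ \cong\ } \Lambda_*^{\operatorname{Sym}_{S}^*(W)}(\operatorname{Sym}_{S}^*(W) \otimes_S V)$$ be the isomorphism of bigraded algebras described in the context. Then $\delta^*$ corresponds under $\psi_*$ to the differential $d_*$ of the Koszul complex of $(f_1,\dots,f_n)$ over $\operatorname{Sym}_S^*(W)$, that is, $\psi_*\circ\delta^*=d_*\circ\psi_*$. In other words, the sequence of graded $S$-modules $$0 \longrightarrow S \xrightarrow{\ \eta\ } \operatorname{Tor}_*^R(S, S) \xrightarrow{\ \delta^0\ } \operatorname{Tor}_{*-1}^R(S, I/I^2) \xrightarrow{\ \delta^1\ } \operatorname{Tor}_{*-2}^R(S, I^2/I^3)\xrightarrow{\ \delta^2\ }\cdots$$ is mapped under $\psi_*$ to the model complex under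 $S$ of rank $n$, $$0 \longrightarrow S \xrightarrow{\ \epsilon\ } \Lambda_* \xrightarrow{\ \partial^0\ } \operatorname{Sym}^1_S(W) \otimes_S \Lambda_{*-1}\xrightarrow{\ \partial^1\ } \operatorname{Sym}^2_S(W) \otimes_S \Lambda_{*-2} \xrightarrow{\ \partial^2\ } \cdots.$$ In particular, the sequence of Tor groups is exact.
   Context: Rings are commutative with unit. $\operatorname{Tor}_*^R(S,-)$ is computed as the homology of $S\otimes_R Q_*$ for a projective resolution $Q_*$ of the second variable. Connecting homomorphisms are the usual ones obtained from a short exact sequence of such resolutions: lift a cycle, apply the differential, lift the result. $\operatorname{gr}_I^*(R)=\bigoplus_{s\geq0}I^s/I^{s+1}$ with $I^0=R$, and $\{r_j\}$ is the residue class of $r_j$ in $I/I^2$. $\eta$ is the composite $S\cong\operatorname{Tor}_*^R(S,R)\to\operatorname{Tor}_*^R(S,S)$ induced by the projection $R\to S$. Let $U$ be a free $R$-module with basis $e_1,\dots,e_n$. Let $V=S\otimes_R U$, with the images of the basis elements also denoted $e_j$, and let $W$ be a free $S$-module with basis $f_1,\dots,f_n$. Put $\Lambda_*=\Lambda_*^S(V)$, the exterior algebra graded with $V$ in degree one. A graded derivation $D$ of degree $-1$ satisfies $D(e\wedge f)=D(e)\wedge f+(-1)^{|e|}e\wedge D(f)$. The isomorphism $\psi_*$ is built from two standard facts. (1) The Koszul complex $K(r_1,\dots,r_n)=\Lambda_*^R(U)$, with differential the graded $R$-derivation sending $e_j$ to $r_j$, is an $R$-free resolution of $S$. This gives an algebra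 isomorphism $\operatorname{Tor}_*^R(S,S)\cong S\otimes_R\Lambda_*^R(U)=\Lambda_*$. (2) $I/I^2$ is a free $S$-module on $\{r_1\},\dots,\{r_n\}$ and $\operatorname{gr}_I^*(R)\cong\operatorname{Sym}_S^*(I/I^2)$ as graded algebras. Composing with the isomorphism induced by $I/I^2\cong W$, $\{r_j\}\mapsto -f_j$, gives an algebra isomorphism $\varphi\colon\operatorname{gr}_I^*(R)\cong\operatorname{Sym}^*_S(W)$ (note the minus sign). Since each $I^s/I^{s+1}$ is free over $S$, $\operatorname{Tor}_*^R(S,\operatorname{gr}_I^*(R))\cong\operatorname{gr}_I^*(R)\otimes_S\operatorname{Tor}_*^R(S,S)$. The map $\psi_*$ is the resulting isomorphism of bigraded algebras onto $\operatorname{Sym}_S^*(W)\otimes_S\Lambda_*\cong\Lambda_*^{\operatorname{Sym}_{S}^*(W)}(\operatorname{Sym}_{S}^*(W) \otimes_S V)$, given by $\varphi$ on $\operatorname{gr}_I^*(R)$ and by (1) on $\operatorname{Tor}_*^R(S,S)$. The Koszul differential $d_*$ on $\Lambda_*^{\operatorname{Sym}_{S}^*(W)}(\operatorname{Sym}_{S}^*(W)\otimes_S V)$ is the unique graded $\operatorname{Sym}_S^*(W)$-derivation of degree $-1$ with $d_*(e_j)=f_j$. The model complex has $\epsilon\colon S=\Lambda_0\to\Lambda_*$ the inclusion and $\partial^s\colon\operatorname{Sym}^s_S(W)\otimes_S\Lambda_{*-s}\to\operatorname{Sym}^{s+1}_S(W)\otimes_S\Lambda_{*-s-1}$ the corresponding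 component of $d_*$, that is, $\partial^s=\sum_{j=1}^n f_j\otimes\partial/\partial e_j$, where $f_j$ means multiplication by $f_j$ and $\partial/\partial e_j$ is the graded $S$-derivation of $\Lambda_*$ of degree $-1$ with $\partial e_i/\partial e_j=\delta_{ij}$. *)

theory Defs
  imports "HOL-Library.Multiset" "HOL-Algebra.Module" "HOL-Algebra.Ideal_Product" "HOL-Algebra.QuotRing"
begin

section \<open>Modules\<close>

text \<open>
  Modules are records over a ring given by a carrier. The fields \<open>mult\<close> and \<open>one\<close>, which
  the module record inherits from rings, are left undefined where there is no product.
\<close>

definition lin_hom ::
    "('a, 'c) ring_scheme \<Rightarrow> ('a, 'm, 'd) module_scheme \<Rightarrow> ('a, 'n, 'e) module_scheme \<Rightarrow> ('m \<Rightarrow> 'n) set"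
  where "lin_hom R M N = {f \<in> carrier M \<rightarrow> carrier N.
    (\<forall>x\<in>carrier M. \<forall>y\<in>carrier M. f (x \<oplus>\<^bsub>M\<^esub> y) = f x \<oplus>\<^bsub>N\<^esub> f y) \<and>
    (\<forall>a\<in>carrier R. \<forall>x\<in>carrier M. f (a \<odot>\<^bsub>M\<^esub> x) = a \<odot>\<^bsub>N\<^esub> f x)}"

definition self_module :: "('a, 'c) ring_scheme \<Rightarrow> ('a, 'a) module"
  where "self_module R = \<lparr>carrier = carrier R, monoid.mult = monoid.mult R, one = one R,
    zero = zero R, add = add R, smult = monoid.mult R\<rparr>"

definition quot_module :: "('a, 'm, 'd) module_scheme \<Rightarrow> 'm set \<Rightarrow> ('a, 'm set) module"
  where "quot_module M N = \<lparr>carrier = a_rcosets\<^bsub>M\<^esub> N, monoid.mult = undefined, one = undefined,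
    zero = N, add = set_add M, smult = (\<lambda>a X. \<Union>x\<in>X. N +>\<^bsub>M\<^esub> (a \<odot>\<^bsub>M\<^esub> x))\<rparr>"

definition restrict_scalars ::
    "('b \<Rightarrow> 'a) \<Rightarrow> ('a, 'm, 'd) module_scheme \<Rightarrow> ('b, 'm) module"
  where "restrict_scalars h M = \<lparr>carrier = carrier M, monoid.mult = monoid.mult M, one = one M,
    zero = zero M, add = add M, smult = (\<lambda>b x. h b \<odot>\<^bsub>M\<^esub> x)\<rparr>"

text \<open>
  An \<open>R\<close>-module annihilated by an ideal \<open>I\<close>, regarded as a module over \<open>R Quot I\<close>:
  all elements of a coset of \<open>I\<close> act on \<open>x\<close> in the same way.
\<close>

definition over_quotient :: "('a, 'm, 'd) module_scheme \<Rightarrow> ('a set, 'm) module"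
  where "over_quotient M = \<lparr>carrier = carrier M, monoid.mult = monoid.mult M, one = one M,
    zero = zero M, add = add M, smult = (\<lambda>C x. the_elem ((\<lambda>a. a \<odot>\<^bsub>M\<^esub> x) ` C))\<rparr>"

definition span_module :: "('a, 'c) ring_scheme \<Rightarrow> ('a, 'm, 'd) module_scheme \<Rightarrow> 'm set \<Rightarrow> 'm set"
  where "span_module R M G = \<Inter>{H. submodule H R M \<and> G \<subseteq> H}"

definition free_module :: "('a, 'c) ring_scheme \<Rightarrow> 'x set \<Rightarrow> ('a, 'x \<Rightarrow> 'a) module"
  where "free_module R X = \<lparr>
    carrier = {c. (\<forall>x\<in>X. c x \<in> carrier R) \<and> (\<forall>x. x \<notin> X \<longrightarrow> c x = \<zero>\<^bsub>R\<^esub>)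
                \<and> finite {x. c x \<noteq> \<zero>\<^bsub>R\<^esub>}},
    monoid.mult = undefined, one = undefined, zero = (\<lambda>_. \<zero>\<^bsub>R\<^esub>),
    add = (\<lambda>c d x. c x \<oplus>\<^bsub>R\<^esub> d x), smult = (\<lambda>a c x. a \<otimes>\<^bsub>R\<^esub> c x)\<rparr>"

definition free_gen :: "('a, 'c) ring_scheme \<Rightarrow> 'x \<Rightarrow> 'x \<Rightarrow> 'a"
  where "free_gen R x = (\<lambda>y. if y = x then \<one>\<^bsub>R\<^esub> else \<zero>\<^bsub>R\<^esub>)"

text \<open>
  The lifting property. A formula cannot quantify over types, so \<open>M\<close> and \<open>N\<close> range over
  two fixed types; these contain the free module on \<open>carrier P\<close> and \<open>P\<close> itself, hence force
  \<open>P\<close> to be a direct summand of a free module.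
\<close>

definition projective :: "('a, 'c) ring_scheme \<Rightarrow> ('a, 'm) module \<Rightarrow> bool"
  where "projective R P \<longleftrightarrow> module R P \<and>
    (\<forall>(M :: ('a, 'm \<Rightarrow> 'a) module) (N :: ('a, 'm) module) g f.
      module R M \<and> module R N \<and> g \<in> lin_hom R M N \<and> g ` carrier M = carrier N \<and> f \<in> lin_hom R P N
      \<longrightarrow> (\<exists>h\<in>lin_hom R P M. \<forall>x\<in>carrier P. g (h x) = f x))"


section \<open>Tensor products\<close>

definition tensor_rels ::
    "('a, 'c) ring_scheme \<Rightarrow> ('a, 'm) module \<Rightarrow> ('a, 'n) module \<Rightarrow> ('m \<times> 'n \<Rightarrow> 'a) set"
  where "tensor_rels R M N =
    (let F = free_module R (carrier M \<times> carrier N); e = free_gen R in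
      {e (x \<oplus>\<^bsub>M\<^esub> x', y) \<ominus>\<^bsub>F\<^esub> (e (x, y) \<oplus>\<^bsub>F\<^esub> e (x', y)) | x x' y.
         x \<in> carrier M \<and> x' \<in> carrier M \<and> y \<in> carrier N} \<union>
      {e (x, y \<oplus>\<^bsub>N\<^esub> y') \<ominus>\<^bsub>F\<^esub> (e (x, y) \<oplus>\<^bsub>F\<^esub> e (x, y')) | x y y'.
         x \<in> carrier M \<and> y \<in> carrier N \<and> y' \<in> carrier N} \<union>
      {e (a \<odot>\<^bsub>M\<^esub> x, y) \<ominus>\<^bsub>F\<^esub> a \<odot>\<^bsub>F\<^esub> e (x, y) | a x y.
         a \<in> carrier R \<and> x \<in> carrier M \<and> y \<in> carrier N} \<union>
      {e (x, a \<odot>\<^bsub>N\<^esub> y) \<ominus>\<^bsub>F\<^esub> a \<odot>\<^bsub>F\<^esub> e (x, y) | a x y.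
         a \<in> carrier R \<and> x \<in> carrier M \<and> y \<in> carrier N})"

definition tensor_null ::
    "('a, 'c) ring_scheme \<Rightarrow> ('a, 'm) module \<Rightarrow> ('a, 'n) module \<Rightarrow> ('m \<times> 'n \<Rightarrow> 'a) set"
  where "tensor_null R M N =
    span_module R (free_module R (carrier M \<times> carrier N)) (tensor_rels R M N)"

definition tensor ::
    "('a, 'c) ring_scheme \<Rightarrow> ('a, 'm) module \<Rightarrow> ('a, 'n) module \<Rightarrow> ('a, ('m \<times> 'n \<Rightarrow> 'a) set) module"
  where "tensor R M N = quot_module (free_module R (carrier M \<times> carrier N)) (tensor_null R M N)"

definition pure_tensor ::
    "('a, 'c) ring_scheme \<Rightarrow> ('a, 'm) module \<Rightarrow> ('a, 'n) module \<Rightarrow> 'm \<Rightarrow> 'n \<Rightarrow> ('m \<times> 'n \<Rightarrow> 'a) set"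
  where "pure_tensor R M N x y =
    tensor_null R M N +>\<^bsub>free_module R (carrier M \<times> carrier N)\<^esub> free_gen R (x, y)"

text \<open>The linear map on \<open>M \<otimes> N\<close> induced by a bilinear map \<open>b\<close>.\<close>

definition tensor_lift ::
    "('a, 'c) ring_scheme \<Rightarrow> ('a, 'm) module \<Rightarrow> ('a, 'n) module \<Rightarrow> ('a, 'l) module
      \<Rightarrow> ('m \<Rightarrow> 'n \<Rightarrow> 'l) \<Rightarrow> ('m \<times> 'n \<Rightarrow> 'a) set \<Rightarrow> 'l"
  where "tensor_lift R M N L b X = the_elem
    ((\<lambda>c. \<Oplus>\<^bsub>L\<^esub>z\<in>{z \<in> carrier M \<times> carrier N. c z \<noteq> \<zero>\<^bsub>R\<^esub>}. c z \<odot>\<^bsub>L\<^esub> b (fst z) (snd z)) ` X)"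

definition tensor_map ::
    "('a, 'c) ring_scheme \<Rightarrow> ('a, 'm) module \<Rightarrow> ('a, 'n) module \<Rightarrow> ('a, 'm') module
      \<Rightarrow> ('a, 'n') module \<Rightarrow> ('m \<Rightarrow> 'm') \<Rightarrow> ('n \<Rightarrow> 'n')
      \<Rightarrow> ('m \<times> 'n \<Rightarrow> 'a) set \<Rightarrow> ('m' \<times> 'n' \<Rightarrow> 'a) set"
  where "tensor_map R M N M' N' f g =
    tensor_lift R M N (tensor R M' N') (\<lambda>x y. pure_tensor R M' N' (f x) (g y))"


section \<open>Complexes and homology\<close>

text \<open>
  Complexes are homological, indexed by the integers: \<open>diff C k\<close> maps \<open>obj C k\<close> to
  \<open>obj C (k - 1)\<close>.
\<close>

record ('a, 'm) chain_complex =
  obj :: "int \<Rightarrow> ('a, 'm) module"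
  diff :: "int \<Rightarrow> 'm \<Rightarrow> 'm"

record ('a, 'm, 'b) resolution = "('a, 'm) chain_complex" +
  aug :: "'m \<Rightarrow> 'b"

definition cycles :: "('a, 'm, 'z) chain_complex_scheme \<Rightarrow> int \<Rightarrow> 'm set"
  where "cycles C k = a_kernel (obj C k) (obj C (k - 1)) (diff C k)"

definition boundaries :: "('a, 'm, 'z) chain_complex_scheme \<Rightarrow> int \<Rightarrow> 'm set"
  where "boundaries C k = diff C (k + 1) ` carrier (obj C (k + 1))"

definition homology :: "('a, 'm, 'z) chain_complex_scheme \<Rightarrow> int \<Rightarrow> ('a, 'm set) module"
  where "homology C k = quot_module ((obj C k)\<lparr>carrier := cycles C k\<rparr>) (boundaries C k)"

definition homology_class :: "('a, 'm, 'z) chain_complex_scheme \<Rightarrow> int \<Rightarrow> 'm \<Rightarrow> 'm set"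
  where "homology_class C k z = boundaries C k +>\<^bsub>obj C k\<^esub> z"

definition homology_map :: "('a, 'n, 'z) chain_complex_scheme \<Rightarrow> int \<Rightarrow> ('m \<Rightarrow> 'n) \<Rightarrow> 'm set \<Rightarrow> 'n set"
  where "homology_map D k F X = the_elem ((\<lambda>z. homology_class D k (F z)) ` X)"

text \<open>Lift a cycle along \<open>v\<close>, apply the differential, lift the result along \<open>u\<close>.\<close>

definition connecting_hom ::
    "('a, 'm, 'z) chain_complex_scheme \<Rightarrow> ('a, 'n, 'y) chain_complex_scheme
      \<Rightarrow> (int \<Rightarrow> 'm \<Rightarrow> 'n) \<Rightarrow> (int \<Rightarrow> 'n \<Rightarrow> 'l) \<Rightarrow> int \<Rightarrow> 'l set \<Rightarrow> 'm set"
  where "connecting_hom C' C u v k X = (THE Y. \<exists>z\<in>X. \<exists>w\<in>carrier (obj C k). \<exists>y\<in>carrier (obj C' (k - 1)).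
    v k w = z \<and> u (k - 1) y = diff C k w \<and> Y = homology_class C' (k - 1) y)"

definition proj_resolution ::
    "('a, 'c) ring_scheme \<Rightarrow> ('a, 'b) module \<Rightarrow> ('a, 'm, 'b) resolution \<Rightarrow> bool"
  where "proj_resolution R M Q \<longleftrightarrow>
    (\<forall>k. projective R (obj Q k)) \<and>
    (\<forall>k<0. carrier (obj Q k) = {\<zero>\<^bsub>obj Q k\<^esub>}) \<and>
    (\<forall>k. diff Q k \<in> lin_hom R (obj Q k) (obj Q (k - 1))) \<and>
    (\<forall>k>0. cycles Q k = boundaries Q k) \<and>
    aug Q \<in> lin_hom R (obj Q 0) M \<and>
    aug Q ` carrier (obj Q 0) = carrier M \<and>
    a_kernel (obj Q 0) M (aug Q) = boundaries Q 0"

text \<open>Chain maps \<open>F\<close> that lift a map \<open>f\<close> of the resolved modules.\<close>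

definition chain_lift ::
    "('a, 'c) ring_scheme \<Rightarrow> ('a, 'm, 'b) resolution \<Rightarrow> ('a, 'n, 'b') resolution
      \<Rightarrow> ('b \<Rightarrow> 'b') \<Rightarrow> (int \<Rightarrow> 'm \<Rightarrow> 'n) \<Rightarrow> bool"
  where "chain_lift R P Q f F \<longleftrightarrow>
    (\<forall>k. F k \<in> lin_hom R (obj P k) (obj Q k)) \<and>
    (\<forall>k. \<forall>x\<in>carrier (obj P k). F (k - 1) (diff P k x) = diff Q k (F k x)) \<and>
    (\<forall>x\<in>carrier (obj P 0). aug Q (F 0 x) = f (aug P x))"

text \<open>
  A short exact sequence of resolutions over a sequence of modules \<open>M' \<rightarrow> M \<rightarrow> M''\<close> with maps
  \<open>i\<close> and \<open>p\<close>.
\<close>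

definition ses_of_resolutions ::
    "('a, 'c) ring_scheme \<Rightarrow> ('b' \<Rightarrow> 'b) \<Rightarrow> ('b \<Rightarrow> 'b'') \<Rightarrow> ('a, 'l, 'b') resolution
      \<Rightarrow> ('a, 'm, 'b) resolution \<Rightarrow> ('a, 'n, 'b'') resolution
      \<Rightarrow> (int \<Rightarrow> 'l \<Rightarrow> 'm) \<Rightarrow> (int \<Rightarrow> 'm \<Rightarrow> 'n) \<Rightarrow> bool"
  where "ses_of_resolutions R i p Q' P Q'' u v \<longleftrightarrow>
    chain_lift R Q' P i u \<and> chain_lift R P Q'' p v \<and>
    (\<forall>k. inj_on (u k) (carrier (obj Q' k)) \<and>
         u k ` carrier (obj Q' k) = a_kernel (obj P k) (obj Q'' k) (v k) \<and>
         v k ` carrier (obj P k) = carrier (obj Q'' k))"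


section \<open>Tor over a quotient ring\<close>

definition tensor_complex ::
    "('a, 'c) ring_scheme \<Rightarrow> ('a, 'b) module \<Rightarrow> ('a, 'm, 'z) chain_complex_scheme
      \<Rightarrow> ('a, ('b \<times> 'm \<Rightarrow> 'a) set) chain_complex"
  where "tensor_complex R B C = \<lparr>
    obj = (\<lambda>k. tensor R B (obj C k)),
    diff = (\<lambda>k. tensor_map R B (obj C k) B (obj C (k - 1)) (\<lambda>x. x) (diff C k))\<rparr>"

text \<open>\<open>R/I\<close> as an \<open>R\<close>-module; its carrier is that of the ring \<open>R Quot I\<close>.\<close>

definition quot_ring_module :: "('a, 'c) ring_scheme \<Rightarrow> 'a set \<Rightarrow> ('a, 'a set) module"
  where "quot_ring_module R I = quot_module (self_module R) I"

type_synonym ('a, 'm) tens_el = "('a set \<times> 'm \<Rightarrow> 'a) set"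

definition tor_complex ::
    "('a, 'c) ring_scheme \<Rightarrow> 'a set \<Rightarrow> ('a, 'm, 'z) chain_complex_scheme
      \<Rightarrow> ('a, ('a, 'm) tens_el) chain_complex"
  where "tor_complex R I Q = tensor_complex R (quot_ring_module R I) Q"

text \<open>
  For a projective resolution \<open>Q\<close> of \<open>M\<close>, the module \<open>Tor R I Q k\<close> is
  \<open>Tor\<close> in degree \<open>k\<close> of \<open>R/I\<close> and \<open>M\<close> over \<open>R\<close>, computed by means of \<open>Q\<close>.
  It is an \<open>R\<close>-module annihilated by \<open>I\<close>; \<open>TorS\<close> is the same thing over \<open>R Quot I\<close>.
\<close>

definition Tor ::
    "('a, 'c) ring_scheme \<Rightarrow> 'a set \<Rightarrow> ('a, 'm, 'z) chain_complex_scheme \<Rightarrow> int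
      \<Rightarrow> ('a, ('a, 'm) tens_el set) module"
  where "Tor R I Q k = homology (tor_complex R I Q) k"

definition TorS ::
    "('a, 'c) ring_scheme \<Rightarrow> 'a set \<Rightarrow> ('a, 'm, 'z) chain_complex_scheme \<Rightarrow> int
      \<Rightarrow> ('a set, ('a, 'm) tens_el set) module"
  where "TorS R I Q k = over_quotient (Tor R I Q k)"

definition tor_chain_map ::
    "('a, 'c) ring_scheme \<Rightarrow> 'a set \<Rightarrow> ('a, 'm, 'z) chain_complex_scheme
      \<Rightarrow> ('a, 'n, 'y) chain_complex_scheme \<Rightarrow> (int \<Rightarrow> 'm \<Rightarrow> 'n)
      \<Rightarrow> int \<Rightarrow> ('a, 'm) tens_el \<Rightarrow> ('a, 'n) tens_el"
  where "tor_chain_map R I P Q F k = tensor_map R (quot_ring_module R I) (obj P k)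
     (quot_ring_module R I) (obj Q k) (\<lambda>x. x) (F k)"

text \<open>
  The map on Tor induced by \<open>f\<close>; any two chain maps lifting \<open>f\<close> are homotopic, so the choice
  is immaterial.
\<close>

definition tor_map ::
    "('a, 'c) ring_scheme \<Rightarrow> 'a set \<Rightarrow> ('a, 'm, 'b) resolution \<Rightarrow> ('a, 'n, 'b') resolution
      \<Rightarrow> ('b \<Rightarrow> 'b') \<Rightarrow> int \<Rightarrow> ('a, 'm) tens_el set \<Rightarrow> ('a, 'n) tens_el set"
  where "tor_map R I P Q f k =
    homology_map (tor_complex R I Q) k (tor_chain_map R I P Q (SOME F. chain_lift R P Q f F) k)"

definition tor_connecting ::
    "('a, 'c) ring_scheme \<Rightarrow> 'a set \<Rightarrow> ('a, 'l, 'b') resolution \<Rightarrow> ('a, 'm, 'b) resolution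
      \<Rightarrow> ('a, 'n, 'b'') resolution \<Rightarrow> (int \<Rightarrow> 'l \<Rightarrow> 'm) \<Rightarrow> (int \<Rightarrow> 'm \<Rightarrow> 'n)
      \<Rightarrow> int \<Rightarrow> ('a, 'n) tens_el set \<Rightarrow> ('a, 'l) tens_el set"
  where "tor_connecting R I Q' P Q'' u v = connecting_hom (tor_complex R I Q') (tor_complex R I P)
    (tor_chain_map R I Q' P u) (tor_chain_map R I P Q'' v)"


section \<open>The \<open>I\<close>-adic filtration\<close>

definition regular_seq :: "('a, 'c) ring_scheme \<Rightarrow> (nat \<Rightarrow> 'a) \<Rightarrow> nat \<Rightarrow> bool"
  where "regular_seq R r n \<longleftrightarrow> (\<forall>j<n. r j \<in> carrier R \<and>
    (let J = genideal R (r ` {..<j}) in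
      \<forall>X\<in>carrier (R Quot J). (J +>\<^bsub>R\<^esub> r j) \<otimes>\<^bsub>R Quot J\<^esub> X = \<zero>\<^bsub>R Quot J\<^esub> \<longrightarrow> X = \<zero>\<^bsub>R Quot J\<^esub>))"

fun ideal_pow :: "('a, 'c) ring_scheme \<Rightarrow> 'a set \<Rightarrow> nat \<Rightarrow> 'a set" where
  "ideal_pow R I 0 = carrier R"
| "ideal_pow R I (Suc s) = ideal_prod R I (ideal_pow R I s)"

definition filt_quot :: "('a, 'c) ring_scheme \<Rightarrow> 'a set \<Rightarrow> nat \<Rightarrow> nat \<Rightarrow> ('a, 'a set) module"
  where "filt_quot R I s t = quot_module ((self_module R)\<lparr>carrier := ideal_pow R I s\<rparr>) (ideal_pow R I t)"

definition gr :: "('a, 'c) ring_scheme \<Rightarrow> 'a set \<Rightarrow> nat \<Rightarrow> ('a, 'a set) module"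
  where "gr R I s = filt_quot R I s (Suc s)"

definition grS :: "('a, 'c) ring_scheme \<Rightarrow> 'a set \<Rightarrow> nat \<Rightarrow> ('a set, 'a set) module"
  where "grS R I s = over_quotient (gr R I s)"

text \<open>
  The maps of \<open>0 \<rightarrow> I\<^sup>s\<^sup>+\<^sup>1/I\<^sup>s\<^sup>+\<^sup>2 \<rightarrow> I\<^sup>s/I\<^sup>s\<^sup>+\<^sup>2 \<rightarrow> I\<^sup>s/I\<^sup>s\<^sup>+\<^sup>1 \<rightarrow> 0\<close>. The first one is the inclusion: both
  modules consist of cosets of the same ideal.
\<close>

definition gr_incl :: "'a set \<Rightarrow> 'a set"
  where "gr_incl X = X"

definition gr_proj :: "('a, 'c) ring_scheme \<Rightarrow> 'a set \<Rightarrow> nat \<Rightarrow> 'a set \<Rightarrow> 'a set"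
  where "gr_proj R I s X = ideal_pow R I (Suc s) <+>\<^bsub>R\<^esub> X"


section \<open>Polynomial rings\<close>

text \<open>
  The symmetric algebra of the free \<open>A\<close>-module on \<open>f\<^sub>0, \<dots>, f\<^sub>n\<^sub>-\<^sub>1\<close>, that is, the polynomial ring
  in these variables. As in \<open>HOL-Algebra.Indexed_Polynomials\<close>, a polynomial is a function from
  monomials, which are multisets of variables, to coefficients.
\<close>

definition sym_alg :: "('a, 'c) ring_scheme \<Rightarrow> nat \<Rightarrow> (nat multiset \<Rightarrow> 'a) ring"
  where "sym_alg A n = \<lparr>
    carrier = {p. (\<forall>m. p m \<in> carrier A) \<and> finite {m. p m \<noteq> \<zero>\<^bsub>A\<^esub>} \<and>
                (\<forall>m. p m \<noteq> \<zero>\<^bsub>A\<^esub> \<longrightarrow> set_mset m \<subseteq> {..<n})},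
    monoid.mult = (\<lambda>p q m. \<Oplus>\<^bsub>A\<^esub>a\<in>{a. a \<subseteq># m}. p a \<otimes>\<^bsub>A\<^esub> q (m - a)),
    one = (\<lambda>m. if m = {#} then \<one>\<^bsub>A\<^esub> else \<zero>\<^bsub>A\<^esub>),
    zero = (\<lambda>m. \<zero>\<^bsub>A\<^esub>),
    add = (\<lambda>p q m. p m \<oplus>\<^bsub>A\<^esub> q m)\<rparr>"

definition sym_const :: "('a, 'c) ring_scheme \<Rightarrow> 'a \<Rightarrow> nat multiset \<Rightarrow> 'a"
  where "sym_const A c = (\<lambda>m. if m = {#} then c else \<zero>\<^bsub>A\<^esub>)"

definition sym_var :: "('a, 'c) ring_scheme \<Rightarrow> nat \<Rightarrow> nat multiset \<Rightarrow> 'a"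
  where "sym_var A j = (\<lambda>m. if m = {#j#} then \<one>\<^bsub>A\<^esub> else \<zero>\<^bsub>A\<^esub>)"

definition sym_deg :: "('a, 'c) ring_scheme \<Rightarrow> nat \<Rightarrow> nat \<Rightarrow> (nat multiset \<Rightarrow> 'a) set"
  where "sym_deg A n s = {p \<in> carrier (sym_alg A n). \<forall>m. p m \<noteq> \<zero>\<^bsub>A\<^esub> \<longrightarrow> size m = s}"


section \<open>Exterior algebras and Koszul complexes\<close>

text \<open>
  The exterior algebra of the free \<open>A\<close>-module on \<open>e\<^sub>0, \<dots>, e\<^sub>n\<^sub>-\<^sub>1\<close>. The function \<open>x\<close> stands for
  the sum of all \<open>x J e\<^sub>J\<close>, where \<open>e\<^sub>J\<close> is the product of the \<open>e\<^sub>j\<close>, \<open>j \<in> J\<close>, in increasing order.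
  Then \<open>e\<^sub>J \<and> e\<^sub>K\<close> is zero unless \<open>J\<close> and \<open>K\<close> are disjoint, in which case it is \<open>e\<^sub>J\<^sub>\<union>\<^sub>K\<close> up to the
  sign counting the inversions between \<open>J\<close> and \<open>K\<close>.
\<close>

definition neg_one_pow :: "('a, 'c) ring_scheme \<Rightarrow> nat \<Rightarrow> 'a"
  where "neg_one_pow A k = (\<ominus>\<^bsub>A\<^esub> \<one>\<^bsub>A\<^esub>) [^]\<^bsub>A\<^esub> k"

definition inversions :: "nat set \<Rightarrow> nat set \<Rightarrow> nat"
  where "inversions J K = card {(j, k). j \<in> J \<and> k \<in> K \<and> k < j}"

definition ext_alg :: "('a, 'c) ring_scheme \<Rightarrow> nat \<Rightarrow> ('a, nat set \<Rightarrow> 'a) module"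
  where "ext_alg A n = \<lparr>
    carrier = {x. (\<forall>J. x J \<in> carrier A) \<and> (\<forall>J. \<not> J \<subseteq> {..<n} \<longrightarrow> x J = \<zero>\<^bsub>A\<^esub>)},
    monoid.mult = (\<lambda>x y L. if L \<subseteq> {..<n}
      then \<Oplus>\<^bsub>A\<^esub>J\<in>Pow L. neg_one_pow A (inversions J (L - J)) \<otimes>\<^bsub>A\<^esub> (x J \<otimes>\<^bsub>A\<^esub> y (L - J))
      else \<zero>\<^bsub>A\<^esub>),
    one = (\<lambda>J. if J = {} then \<one>\<^bsub>A\<^esub> else \<zero>\<^bsub>A\<^esub>),
    zero = (\<lambda>J. \<zero>\<^bsub>A\<^esub>),
    add = (\<lambda>x y J. x J \<oplus>\<^bsub>A\<^esub> y J),
    smult = (\<lambda>a x J. a \<otimes>\<^bsub>A\<^esub> x J)\<rparr>"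

definition ext_basis :: "('a, 'c) ring_scheme \<Rightarrow> nat \<Rightarrow> nat set \<Rightarrow> 'a"
  where "ext_basis A j = (\<lambda>J. if J = {j} then \<one>\<^bsub>A\<^esub> else \<zero>\<^bsub>A\<^esub>)"

definition ext_deg :: "('a, 'c) ring_scheme \<Rightarrow> nat \<Rightarrow> int \<Rightarrow> (nat set \<Rightarrow> 'a) set"
  where "ext_deg A n k = {x \<in> carrier (ext_alg A n). \<forall>J. x J \<noteq> \<zero>\<^bsub>A\<^esub> \<longrightarrow> int (card J) = k}"

text \<open>\<open>\<partial>/\<partial>e\<^sub>j\<close>, and the Koszul differential as the sum of all \<open>a\<^sub>j \<partial>/\<partial>e\<^sub>j\<close>.\<close>

definition ext_partial :: "('a, 'c) ring_scheme \<Rightarrow> nat \<Rightarrow> nat \<Rightarrow> (nat set \<Rightarrow> 'a) \<Rightarrow> nat set \<Rightarrow> 'a"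
  where "ext_partial A n j x = (\<lambda>J. if J \<subseteq> {..<n} \<and> j < n \<and> j \<notin> J
    then neg_one_pow A (card {i \<in> J. i < j}) \<otimes>\<^bsub>A\<^esub> x (insert j J) else \<zero>\<^bsub>A\<^esub>)"

definition koszul_diff ::
    "('a, 'c) ring_scheme \<Rightarrow> nat \<Rightarrow> (nat \<Rightarrow> 'a) \<Rightarrow> (nat set \<Rightarrow> 'a) \<Rightarrow> nat set \<Rightarrow> 'a"
  where "koszul_diff A n a x = (\<lambda>J. \<Oplus>\<^bsub>A\<^esub>j\<in>{..<n}. a j \<otimes>\<^bsub>A\<^esub> ext_partial A n j x J)"

definition graded_derivation ::
    "('a, 'c) ring_scheme \<Rightarrow> nat \<Rightarrow> ((nat set \<Rightarrow> 'a) \<Rightarrow> nat set \<Rightarrow> 'a) \<Rightarrow> bool"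
  where "graded_derivation A n D \<longleftrightarrow>
    D \<in> lin_hom A (ext_alg A n) (ext_alg A n) \<and>
    (\<forall>k. D ` ext_deg A n k \<subseteq> ext_deg A n (k - 1)) \<and>
    (\<forall>k. \<forall>x\<in>ext_deg A n (int k). \<forall>y\<in>carrier (ext_alg A n).
      D (x \<otimes>\<^bsub>ext_alg A n\<^esub> y) =
        D x \<otimes>\<^bsub>ext_alg A n\<^esub> y \<oplus>\<^bsub>ext_alg A n\<^esub>
        neg_one_pow A k \<odot>\<^bsub>ext_alg A n\<^esub> (x \<otimes>\<^bsub>ext_alg A n\<^esub> D y))"

lemma ext_alg_simps:
  "x \<oplus>\<^bsub>ext_alg A n\<^esub> y = (\<lambda>J. x J \<oplus>\<^bsub>A\<^esub> y J)"
  "a \<odot>\<^bsub>ext_alg A n\<^esub> x = (\<lambda>J. a \<otimes>\<^bsub>A\<^esub> x J)"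
  "x \<otimes>\<^bsub>ext_alg A n\<^esub> y = (\<lambda>L. if L \<subseteq> {..<n}
      then \<Oplus>\<^bsub>A\<^esub>J\<in>Pow L. neg_one_pow A (inversions J (L - J)) \<otimes>\<^bsub>A\<^esub> (x J \<otimes>\<^bsub>A\<^esub> y (L - J))
      else \<zero>\<^bsub>A\<^esub>)"
  by (simp_all add: ext_alg_def)

lemma (in cring) neg_one_pow_closed [simp]: "neg_one_pow R k \<in> carrier R"
  by (simp add: neg_one_pow_def)

lemma (in cring) neg_one_pow_Suc: "neg_one_pow R (Suc k) = \<ominus> neg_one_pow R k"
  by (simp add: neg_one_pow_def r_minus)

lemma (in cring) neg_one_pow_parity: "neg_one_pow R k = (if even k then \<one> else \<ominus> \<one>)"
  by (induction k) (auto simp: neg_one_pow_Suc, simp add: neg_one_pow_def)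

lemma (in cring) neg_one_pow_add: "neg_one_pow R a \<otimes> neg_one_pow R b = neg_one_pow R (a + b)"
  by (simp add: neg_one_pow_parity l_minus r_minus)

lemma inversions_insert_left:
  assumes "finite J" "finite K" "j \<notin> J"
  shows "inversions (insert j J) K = inversions J K + card {k \<in> K. k < j}"
proof -
  have fin: "finite {(i, k). i \<in> J \<and> k \<in> K \<and> k < i}"
    by (rule finite_subset[of _ "J \<times> K"]) (use assms in auto)
  have "{(i, k). i \<in> insert j J \<and> k \<in> K \<and> k < i} =
      {(i, k). i \<in> J \<and> k \<in> K \<and> k < i} \<union> Pair j ` {k \<in> K. k < j}"
    by auto
  also have "card \<dots> = inversions J K + card (Pair j ` {k \<in> K. k < j})"
    unfolding inversions_def by (rule card_Un_disjoint) (use assms fin in auto)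
  also have "card (Pair j ` {k \<in> K. k < j}) = card {k \<in> K. k < j}"
    by (rule card_image) (auto simp: inj_on_def)
  finally show ?thesis by (simp add: inversions_def)
qed

lemma inversions_insert_right:
  assumes "finite J" "finite K" "j \<notin> K"
  shows "inversions J (insert j K) = inversions J K + card {i \<in> J. j < i}"
proof -
  have fin: "finite {(i, k). i \<in> J \<and> k \<in> K \<and> k < i}"
    by (rule finite_subset[of _ "J \<times> K"]) (use assms in auto)
  have "{(i, k). i \<in> J \<and> k \<in> insert j K \<and> k < i} =
      {(i, k). i \<in> J \<and> k \<in> K \<and> k < i} \<union> (\<lambda>i. (i, j)) ` {i \<in> J. j < i}"
    by auto
  also have "card \<dots> = inversions J K + card ((\<lambda>i. (i, j)) ` {i \<in> J. j < i})"
    unfolding inversions_def by (rule card_Un_disjoint) (use assms fin in auto)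
  also have "card ((\<lambda>i. (i, j)) ` {i \<in> J. j < i}) = card {i \<in> J. j < i}"
    by (rule card_image) (auto simp: inj_on_def)
  finally show ?thesis by (simp add: inversions_def)
qed

lemma card_less_greater:
  assumes "finite J" "(j::nat) \<notin> J"
  shows "card J = card {i \<in> J. i < j} + card {i \<in> J. j < i}"
proof -
  have "J = {i \<in> J. i < j} \<union> {i \<in> J. j < i}"
    using assms(2) by auto (metis linorder_cases)
  then have "card J = card ({i \<in> J. i < j} \<union> {i \<in> J. j < i})" by simp
  also have "\<dots> = card {i \<in> J. i < j} + card {i \<in> J. j < i}"
    by (rule card_Un_disjoint) (use assms in auto)
  finally show ?thesis .
qed

lemma card_less_split:
  assumes "finite L" "J \<subseteq> L"
  shows "card {i \<in> L. i < (j::nat)} = card {i \<in> J. i < j} + card {i \<in> L - J. i < j}"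
proof -
  have "{i \<in> L. i < j} = {i \<in> J. i < j} \<union> {i \<in> L - J. i < j}"
    using assms by auto
  then have "card {i \<in> L. i < j} = card ({i \<in> J. i < j} \<union> {i \<in> L - J. i < j})" by simp
  also have "\<dots> = card {i \<in> J. i < j} + card {i \<in> L - J. i < j}"
    by (rule card_Un_disjoint) (use assms in \<open>auto intro: finite_subset\<close>)
  finally show ?thesis .
qed

lemma (in abelian_monoid) finsum_Pow_insert:
  assumes "finite L" "j \<notin> L" "f \<in> Pow (insert j L) \<rightarrow> carrier G"
  shows "(\<Oplus>J\<in>Pow (insert j L). f J) = (\<Oplus>J\<in>Pow L. f (insert j J)) \<oplus> (\<Oplus>J\<in>Pow L. f J)"
proof -
  have inj: "inj_on (insert j) (Pow L)"
    using assms(2) by (auto simp: inj_on_def)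
  have "(\<Oplus>J\<in>Pow (insert j L). f J) = (\<Oplus>J\<in>insert j ` Pow L \<union> Pow L. f J)"
    by (simp add: Pow_insert Un_commute)
  also have "\<dots> = (\<Oplus>J\<in>insert j ` Pow L. f J) \<oplus> (\<Oplus>J\<in>Pow L. f J)"
    by (rule finsum_Un_disjoint) (use assms in auto)
  also have "(\<Oplus>J\<in>insert j ` Pow L. f J) = (\<Oplus>J\<in>Pow L. f (insert j J))"
    by (rule finsum_reindex[OF _ inj]) (use assms in auto)
  finally show ?thesis .
qed

lemma (in cring) ext_alg_carrierD:
  assumes "x \<in> carrier (ext_alg R n)"
  shows "x J \<in> carrier R" "\<not> J \<subseteq> {..<n} \<Longrightarrow> x J = \<zero>"
  using assms by (auto simp: ext_alg_def)

lemma (in cring) ext_partial_closed: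
  assumes "x \<in> carrier (ext_alg R n)"
  shows "ext_partial R n j x \<in> carrier (ext_alg R n)"
  using assms by (auto simp: ext_alg_def ext_partial_def)

lemma (in cring) wedge_closed:
  assumes "x \<in> carrier (ext_alg R n)" "y \<in> carrier (ext_alg R n)"
  shows "x \<otimes>\<^bsub>ext_alg R n\<^esub> y \<in> carrier (ext_alg R n)"
  using assms by (auto simp: ext_alg_def intro!: finsum_closed)

lemma (in cring) sign_move:
  assumes "a \<in> carrier R" "b \<in> carrier R" "even (k + l) = even m"
  shows "neg_one_pow R k \<otimes> (neg_one_pow R l \<otimes> (a \<otimes> b)) = neg_one_pow R m \<otimes> (a \<otimes> b)"
  using assms by (simp add: m_assoc[symmetric] neg_one_pow_add) (simp add: neg_one_pow_parity)

lemma (in cring) sign_cancel: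
  assumes "a \<in> carrier R" "even (k + Suc l)"
  shows "neg_one_pow R k \<otimes> a \<oplus> neg_one_pow R l \<otimes> a = \<zero>"
  using assms by (cases "even k") (auto simp: neg_one_pow_parity l_minus l_neg r_neg)

lemma (in cring) ext_partial_leibniz:
  assumes x: "x \<in> ext_deg R n (int p)" and y: "y \<in> carrier (ext_alg R n)"
  shows "ext_partial R n j (x \<otimes>\<^bsub>ext_alg R n\<^esub> y) L =
    (ext_partial R n j x \<otimes>\<^bsub>ext_alg R n\<^esub> y) L \<oplus>
    neg_one_pow R p \<otimes> (x \<otimes>\<^bsub>ext_alg R n\<^esub> ext_partial R n j y) L"
proof -
  have xc: "x \<in> carrier (ext_alg R n)" and xdeg: "\<And>J. x J \<noteq> \<zero> \<Longrightarrow> card J = p"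
    using x by (auto simp: ext_deg_def)
  note [simp] = ext_alg_carrierD(1)[OF xc] ext_alg_carrierD(1)[OF y]
    ext_alg_carrierD(1)[OF ext_partial_closed[OF xc]] ext_alg_carrierD(1)[OF ext_partial_closed[OF y]]
  let ?s = "neg_one_pow R"
  consider (outside) "\<not> L \<subseteq> {..<n}" | (large) "\<not> j < n" "L \<subseteq> {..<n}"
    | (mem) "L \<subseteq> {..<n}" "j < n" "j \<in> L" | (new) "L \<subseteq> {..<n}" "j < n" "j \<notin> L" by blast
  then show ?thesis
  proof cases
    case outside
    then show ?thesis by (simp add: ext_alg_simps ext_partial_def)
  next
    case large
    then show ?thesis by (simp add: ext_alg_simps ext_partial_def)
  next
    case mem
    define M where "M = L - {j}"
    have L: "L = insert j M" and jM: "j \<notin> M" and Mn: "M \<subseteq> {..<n}" using mem by (auto simp: M_def)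
    have finM: "finite M" using Mn finite_subset by blast
    define f where "f J = ?s (inversions J (L - J)) \<otimes> (ext_partial R n j x J \<otimes> y (L - J))" for J
    define g where "g J = ?s (inversions J (L - J)) \<otimes> (x J \<otimes> ext_partial R n j y (L - J))" for J
    have [simp]: "f J \<in> carrier R" "g J \<in> carrier R" for J by (simp_all add: f_def g_def)
    have f0: "f (insert j J) = \<zero>" for J by (simp add: f_def ext_partial_def)
    have g0: "g J = \<zero>" if "J \<in> Pow M" for J
      using that jM mem by (auto simp: g_def ext_partial_def)
    have cancel: "f J \<oplus> ?s p \<otimes> g (insert j J) = \<zero>" if J: "J \<in> Pow M" for J
    proof (cases "x (insert j J) = \<zero>")
      case True
      then show ?thesis by (simp add: f_def g_def ext_partial_def)
    next
      case False
      have finJ: "finite J" and jJ: "j \<notin> J" using J finM jM finite_subset by auto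
      have p: "p = Suc (card J)" using xdeg[OF False] finJ jJ by simp
      have LJ: "L - J = insert j (M - J)" and LJ': "L - insert j J = M - J" using J jM L by auto
      have sub: "J \<subseteq> {..<n}" "M - J \<subseteq> {..<n}" using J Mn by auto
      have par: "even (inversions J (L - J) + card {i \<in> J. i < j} + Suc (p + (inversions (insert j J) (M - J) + card {i \<in> M - J. i < j})))"
        unfolding LJ p using finJ jJ finM jM card_less_greater[OF finJ jJ]
        by (simp add: inversions_insert_left inversions_insert_right) blast
      let ?z = "x (insert j J) \<otimes> y (insert j (M - J))"
      have f: "f J = ?s (inversions J (L - J) + card {i \<in> J. i < j}) \<otimes> ?z"
        using sub mem jJ unfolding f_def ext_partial_def LJ
        by (simp add: m_assoc[symmetric] neg_one_pow_add)
      have g: "?s p \<otimes> g (insert j J) =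
          ?s (p + (inversions (insert j J) (M - J) + card {i \<in> M - J. i < j})) \<otimes> ?z"
      proof -
        have "g (insert j J) = ?s (inversions (insert j J) (M - J)) \<otimes> (?s (card {i \<in> M - J. i < j}) \<otimes> ?z)"
          using sub mem jM unfolding g_def LJ' ext_partial_def by (simp add: m_lcomm)
        then show ?thesis by (simp add: m_assoc[symmetric] neg_one_pow_add add.assoc)
      qed
      show ?thesis unfolding f g by (rule sign_cancel[OF _ par]) simp
    qed
    have "(ext_partial R n j x \<otimes>\<^bsub>ext_alg R n\<^esub> y) L \<oplus>
        ?s p \<otimes> (x \<otimes>\<^bsub>ext_alg R n\<^esub> ext_partial R n j y) L = (\<Oplus>J\<in>Pow L. f J) \<oplus> ?s p \<otimes> (\<Oplus>J\<in>Pow L. g J)"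
      using mem by (simp add: ext_alg_simps f_def g_def)
    also have "(\<Oplus>J\<in>Pow L. f J) = (\<Oplus>J\<in>Pow M. f J)"
      unfolding L by (subst finsum_Pow_insert[OF finM jM]) (simp_all add: f0)
    also have "(\<Oplus>J\<in>Pow L. g J) = (\<Oplus>J\<in>Pow M. g (insert j J))"
    proof -
      have "(\<Oplus>J\<in>Pow M. g J) = (\<Oplus>J\<in>Pow M. \<zero>)" by (rule finsum_cong') (auto simp: g0)
      then show ?thesis unfolding L by (subst finsum_Pow_insert[OF finM jM]) simp_all
    qed
    also have "?s p \<otimes> (\<Oplus>J\<in>Pow M. g (insert j J)) = (\<Oplus>J\<in>Pow M. ?s p \<otimes> g (insert j J))"
      by (rule finsum_rdistr) (use finM in auto)
    also have "(\<Oplus>J\<in>Pow M. f J) \<oplus> \<dots> = (\<Oplus>J\<in>Pow M. f J \<oplus> ?s p \<otimes> g (insert j J))"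
      by (rule finsum_addf[symmetric]) auto
    also have "\<dots> = (\<Oplus>J\<in>Pow M. \<zero>)" by (rule finsum_cong') (auto simp: cancel)
    finally have "(ext_partial R n j x \<otimes>\<^bsub>ext_alg R n\<^esub> y) L \<oplus>
        ?s p \<otimes> (x \<otimes>\<^bsub>ext_alg R n\<^esub> ext_partial R n j y) L = \<zero>" by simp
    then show ?thesis using mem by (simp add: ext_partial_def)
  next
    case new
    have finL: "finite L" using new finite_subset by blast
    let ?L = "insert j L"
    define h where "h J = ?s (inversions J (?L - J)) \<otimes> (x J \<otimes> y (?L - J))" for J
    have [simp]: "h J \<in> carrier R" for J by (simp add: h_def)
    let ?c = "card {i \<in> L. i < j}"
    have sub: "?L \<subseteq> {..<n}" using new by auto
    have "ext_partial R n j (x \<otimes>\<^bsub>ext_alg R n\<^esub> y) L = ?s ?c \<otimes> (\<Oplus>J\<in>Pow ?L. h J)"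
      using new sub by (simp add: ext_partial_def ext_alg_simps h_def)
    also have "\<dots> = ?s ?c \<otimes> ((\<Oplus>J\<in>Pow L. h (insert j J)) \<oplus> (\<Oplus>J\<in>Pow L. h J))"
      by (subst finsum_Pow_insert[OF finL new(3)]) simp_all
    also have "\<dots> = (\<Oplus>J\<in>Pow L. ?s ?c \<otimes> h (insert j J)) \<oplus> (\<Oplus>J\<in>Pow L. ?s ?c \<otimes> h J)"
      using finL by (simp add: r_distr finsum_closed finsum_rdistr)
    also have "(\<Oplus>J\<in>Pow L. ?s ?c \<otimes> h (insert j J)) = (ext_partial R n j x \<otimes>\<^bsub>ext_alg R n\<^esub> y) L"
    proof -
      have "?s ?c \<otimes> h (insert j J) =
          ?s (inversions J (L - J)) \<otimes> (ext_partial R n j x J \<otimes> y (L - J))" if J: "J \<in> Pow L" for J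
      proof -
        have finJ: "finite J" "j \<notin> J" "J \<subseteq> {..<n}" using J finL new finite_subset by auto
        have LJ: "?L - insert j J = L - J" using new by auto
        have "?s ?c \<otimes> h (insert j J) =
          ?s (inversions J (L - J) + card {i \<in> J. i < j}) \<otimes> (x (insert j J) \<otimes> y (L - J))"
          unfolding h_def LJ
          by (rule sign_move)
            (use finJ finL J card_less_split[OF finL, of J j] in \<open>auto simp: inversions_insert_left\<close>)
        then show ?thesis using finJ new
          by (simp add: ext_partial_def m_assoc neg_one_pow_add[symmetric])
      qed
      then show ?thesis using new by (simp add: ext_alg_simps) (rule finsum_cong', auto)
    qed
    also have "(\<Oplus>J\<in>Pow L. ?s ?c \<otimes> h J) = ?s p \<otimes> (x \<otimes>\<^bsub>ext_alg R n\<^esub> ext_partial R n j y) L"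
    proof -
      have "?s ?c \<otimes> h J =
          ?s p \<otimes> (?s (inversions J (L - J)) \<otimes> (x J \<otimes> ext_partial R n j y (L - J)))"
        if J: "J \<in> Pow L" for J
      proof (cases "x J = \<zero>")
        case True
        then show ?thesis by (simp add: h_def)
      next
        case False
        have finJ: "finite J" "j \<notin> J" "J \<subseteq> {..<n}" using J finL new finite_subset by auto
        have p: "p = card {i \<in> J. i < j} + card {i \<in> J. j < i}"
          using xdeg[OF False] card_less_greater[OF finJ(1,2)] by simp
        have LJ: "?L - J = insert j (L - J)" using finJ by auto
        let ?z = "x J \<otimes> y (insert j (L - J))"
        have "?s ?c \<otimes> h J = ?s (p + inversions J (L - J) + card {i \<in> L - J. i < j}) \<otimes> ?z"
          unfolding h_def LJ
          by (rule sign_move)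
            (use finJ finL J new p card_less_split[OF finL, of J j] in \<open>auto simp: inversions_insert_right\<close>)
        moreover have "x J \<otimes> ext_partial R n j y (L - J) = ?s (card {i \<in> L - J. i < j}) \<otimes> ?z"
          using new by (auto simp: ext_partial_def m_lcomm)
        ultimately show ?thesis by (simp add: m_assoc[symmetric] neg_one_pow_add add.assoc)
      qed
      then have "(\<Oplus>J\<in>Pow L. ?s ?c \<otimes> h J) =
          (\<Oplus>J\<in>Pow L. ?s p \<otimes> (?s (inversions J (L - J)) \<otimes> (x J \<otimes> ext_partial R n j y (L - J))))"
        by (intro finsum_cong') auto
      also have "\<dots> = ?s p \<otimes> (\<Oplus>J\<in>Pow L. ?s (inversions J (L - J)) \<otimes> (x J \<otimes> ext_partial R n j y (L - J)))"
        by (rule finsum_rdistr[symmetric]) (use finL in auto)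
      finally show ?thesis using new by (simp add: ext_alg_simps)
    qed
    finally show ?thesis .
  qed
qed

lemma (in cring) wedge_add_left:
  assumes a: "a \<in> carrier R"
    and "x \<in> carrier (ext_alg R n)" "x' \<in> carrier (ext_alg R n)" "y \<in> carrier (ext_alg R n)"
  shows "((\<lambda>J. a \<otimes> x J \<oplus> x' J) \<otimes>\<^bsub>ext_alg R n\<^esub> y) L =
    a \<otimes> (x \<otimes>\<^bsub>ext_alg R n\<^esub> y) L \<oplus> (x' \<otimes>\<^bsub>ext_alg R n\<^esub> y) L"
proof (cases "L \<subseteq> {..<n}")
  case True
  have fin: "finite (Pow L)" using True finite_subset by blast
  note [simp] = assms(2-4)[THEN ext_alg_carrierD(1)] a
  let ?f = "\<lambda>J. neg_one_pow R (inversions J (L - J)) \<otimes> (x J \<otimes> y (L - J))"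
  let ?g = "\<lambda>J. neg_one_pow R (inversions J (L - J)) \<otimes> (x' J \<otimes> y (L - J))"
  have "(\<Oplus>J\<in>Pow L. neg_one_pow R (inversions J (L - J)) \<otimes> ((a \<otimes> x J \<oplus> x' J) \<otimes> y (L - J))) =
      (\<Oplus>J\<in>Pow L. a \<otimes> ?f J \<oplus> ?g J)"
    by (rule finsum_cong') (auto simp: l_distr r_distr m_ac)
  also have "\<dots> = (\<Oplus>J\<in>Pow L. a \<otimes> ?f J) \<oplus> (\<Oplus>J\<in>Pow L. ?g J)"
    by (rule finsum_addf) auto
  also have "(\<Oplus>J\<in>Pow L. a \<otimes> ?f J) = a \<otimes> (\<Oplus>J\<in>Pow L. ?f J)"
    by (rule finsum_rdistr[symmetric]) (use fin in auto)
  finally show ?thesis using True by (simp add: ext_alg_simps)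
qed (simp add: ext_alg_simps a)

lemma (in cring) wedge_add_right:
  assumes a: "a \<in> carrier R"
    and "x \<in> carrier (ext_alg R n)" "y \<in> carrier (ext_alg R n)" "y' \<in> carrier (ext_alg R n)"
  shows "(x \<otimes>\<^bsub>ext_alg R n\<^esub> (\<lambda>J. a \<otimes> y J \<oplus> y' J)) L =
    a \<otimes> (x \<otimes>\<^bsub>ext_alg R n\<^esub> y) L \<oplus> (x \<otimes>\<^bsub>ext_alg R n\<^esub> y') L"
proof (cases "L \<subseteq> {..<n}")
  case True
  have fin: "finite (Pow L)" using True finite_subset by blast
  note [simp] = assms(2-4)[THEN ext_alg_carrierD(1)] a
  let ?f = "\<lambda>J. neg_one_pow R (inversions J (L - J)) \<otimes> (x J \<otimes> y (L - J))"
  let ?g = "\<lambda>J. neg_one_pow R (inversions J (L - J)) \<otimes> (x J \<otimes> y' (L - J))"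
  have "(\<Oplus>J\<in>Pow L. neg_one_pow R (inversions J (L - J)) \<otimes> (x J \<otimes> (a \<otimes> y (L - J) \<oplus> y' (L - J)))) =
      (\<Oplus>J\<in>Pow L. a \<otimes> ?f J \<oplus> ?g J)"
    by (rule finsum_cong') (auto simp: l_distr r_distr m_ac)
  also have "\<dots> = (\<Oplus>J\<in>Pow L. a \<otimes> ?f J) \<oplus> (\<Oplus>J\<in>Pow L. ?g J)"
    by (rule finsum_addf) auto
  also have "(\<Oplus>J\<in>Pow L. a \<otimes> ?f J) = a \<otimes> (\<Oplus>J\<in>Pow L. ?f J)"
    by (rule finsum_rdistr[symmetric]) (use fin in auto)
  finally show ?thesis using True by (simp add: ext_alg_simps)
qed (simp add: ext_alg_simps a)

lemma (in cring) distr_aux: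
  assumes "a \<in> carrier R" "s \<in> carrier R" "x \<in> carrier R" "y \<in> carrier R"
    "z \<in> carrier R" "w \<in> carrier R"
  shows "a \<otimes> (x \<oplus> s \<otimes> y) \<oplus> (z \<oplus> s \<otimes> w) = (a \<otimes> x \<oplus> z) \<oplus> s \<otimes> (a \<otimes> y \<oplus> w)"
  using assms by algebra

lemma (in cring) ext_partial_sum_leibniz:
  assumes x: "x \<in> ext_deg R n (int p)" and y: "y \<in> carrier (ext_alg R n)"
    and T: "finite T" "\<And>j. j \<in> T \<Longrightarrow> a j \<in> carrier R"
  shows "(\<Oplus>j\<in>T. a j \<otimes> ext_partial R n j (x \<otimes>\<^bsub>ext_alg R n\<^esub> y) L) =
    ((\<lambda>J. \<Oplus>j\<in>T. a j \<otimes> ext_partial R n j x J) \<otimes>\<^bsub>ext_alg R n\<^esub> y) L \<oplus>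
    neg_one_pow R p \<otimes> (x \<otimes>\<^bsub>ext_alg R n\<^esub> (\<lambda>J. \<Oplus>j\<in>T. a j \<otimes> ext_partial R n j y J)) L"
  using T
proof (induction T rule: finite_induct)
  case empty
  have xc: "x \<in> carrier (ext_alg R n)" using x by (auto simp: ext_deg_def)
  note [simp] = ext_alg_carrierD(1)[OF xc] ext_alg_carrierD(1)[OF y]
  show ?case by (simp add: ext_alg_simps)
next
  case (insert j T)
  have xc: "x \<in> carrier (ext_alg R n)" using x by (auto simp: ext_deg_def)
  have [simp]: "a i \<in> carrier R" if "i \<in> insert j T" for i using insert.prems that by blast
  have aj: "a j \<in> carrier R" by simp
  have pc: "ext_partial R n i z \<in> carrier (ext_alg R n)" if "z \<in> carrier (ext_alg R n)" for i z
    using ext_partial_closed that .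
  have xy: "x \<otimes>\<^bsub>ext_alg R n\<^esub> y \<in> carrier (ext_alg R n)" using wedge_closed xc y .
  note [simp] = ext_alg_carrierD(1)[OF pc[OF xc]] ext_alg_carrierD(1)[OF pc[OF y]]
    ext_alg_carrierD(1)[OF pc[OF xy]]
  have sc: "(\<lambda>J. \<Oplus>i\<in>T. a i \<otimes> ext_partial R n i z J) \<in> carrier (ext_alg R n)"
    if z: "z \<in> carrier (ext_alg R n)" for z
  proof -
    have "(\<Oplus>i\<in>T. a i \<otimes> ext_partial R n i z J) \<in> carrier R" for J
      using ext_alg_carrierD(1)[OF pc[OF z]] by (intro finsum_closed) auto
    moreover have "(\<Oplus>i\<in>T. a i \<otimes> ext_partial R n i z J) = \<zero>" if "\<not> J \<subseteq> {..<n}" for J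
    proof -
      have "(\<Oplus>i\<in>T. a i \<otimes> ext_partial R n i z J) = (\<Oplus>i\<in>T. \<zero>)"
        by (rule finsum_cong') (use that in \<open>auto simp: ext_partial_def\<close>)
      then show ?thesis by simp
    qed
    ultimately show ?thesis by (simp add: ext_alg_def)
  qed
  have step: "(\<Oplus>i\<in>insert j T. a i \<otimes> ext_partial R n i z J) =
      a j \<otimes> ext_partial R n j z J \<oplus> (\<Oplus>i\<in>T. a i \<otimes> ext_partial R n i z J)"
    if z: "z \<in> carrier (ext_alg R n)" for z J
    using insert.hyps ext_alg_carrierD(1)[OF pc[OF z]] by (subst finsum_insert) auto
  have "(\<Oplus>i\<in>insert j T. a i \<otimes> ext_partial R n i (x \<otimes>\<^bsub>ext_alg R n\<^esub> y) L) =
      a j \<otimes> ((ext_partial R n j x \<otimes>\<^bsub>ext_alg R n\<^esub> y) L \<oplus>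
        neg_one_pow R p \<otimes> (x \<otimes>\<^bsub>ext_alg R n\<^esub> ext_partial R n j y) L) \<oplus>
      (((\<lambda>J. \<Oplus>i\<in>T. a i \<otimes> ext_partial R n i x J) \<otimes>\<^bsub>ext_alg R n\<^esub> y) L \<oplus>
        neg_one_pow R p \<otimes> (x \<otimes>\<^bsub>ext_alg R n\<^esub> (\<lambda>J. \<Oplus>i\<in>T. a i \<otimes> ext_partial R n i y J)) L)"
    unfolding step[OF xy] using insert.IH insert.prems by (simp only: ext_partial_leibniz[OF x y] insertI2)
  moreover have "(ext_partial R n j x \<otimes>\<^bsub>ext_alg R n\<^esub> y) L \<in> carrier R"
    "(x \<otimes>\<^bsub>ext_alg R n\<^esub> ext_partial R n j y) L \<in> carrier R"
    "((\<lambda>J. \<Oplus>i\<in>T. a i \<otimes> ext_partial R n i x J) \<otimes>\<^bsub>ext_alg R n\<^esub> y) L \<in> carrier R"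
    "(x \<otimes>\<^bsub>ext_alg R n\<^esub> (\<lambda>J. \<Oplus>i\<in>T. a i \<otimes> ext_partial R n i y J)) L \<in> carrier R"
    by (intro ext_alg_carrierD(1)[OF wedge_closed] pc sc xc y)+
  ultimately show ?case
    unfolding step[OF xc] step[OF y] wedge_add_left[OF aj pc[OF xc] sc[OF xc] y]
        wedge_add_right[OF aj xc pc[OF y] sc[OF y]]
    by (simp only: distr_aux[OF aj neg_one_pow_closed])
qed

lemma (in cring) koszul_diff_closed:
  assumes a: "\<And>j. j < n \<Longrightarrow> a j \<in> carrier R" and x: "x \<in> carrier (ext_alg R n)"
  shows "koszul_diff R n a x J \<in> carrier R"
  unfolding koszul_diff_def
  using ext_alg_carrierD(1)[OF ext_partial_closed[OF x]] a by (intro finsum_closed) auto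

lemma (in cring) koszul_diff_zero:
  assumes a: "\<And>j. j < n \<Longrightarrow> a j \<in> carrier R"
    and "\<And>j. j < n \<Longrightarrow> ext_partial R n j x J = \<zero>"
  shows "koszul_diff R n a x J = \<zero>"
proof -
  have "koszul_diff R n a x J = (\<Oplus>j\<in>{..<n}. \<zero>)"
    unfolding koszul_diff_def by (rule finsum_cong') (use assms in auto)
  then show ?thesis by simp
qed

text \<open>
  The Koszul differential is the graded derivation that takes \<open>e\<^sub>j\<close> to \<open>a\<^sub>j\<close>.
\<close>

theorem koszul_diff_graded_derivation:
  assumes "cring A" and a: "\<And>j. j < n \<Longrightarrow> a j \<in> carrier A"
  shows "graded_derivation A n (koszul_diff A n a)"
proof -
  interpret cring A by fact
  have lin: "koszul_diff A n a \<in> lin_hom A (ext_alg A n) (ext_alg A n)"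
  proof -
    have "koszul_diff A n a x \<in> carrier (ext_alg A n)" if x: "x \<in> carrier (ext_alg A n)" for x
      using koszul_diff_closed[of n a x, OF a x] koszul_diff_zero[of n a x, OF a]
      by (auto simp: ext_alg_def ext_partial_def)
    moreover have "koszul_diff A n a (x \<oplus>\<^bsub>ext_alg A n\<^esub> y) =
        koszul_diff A n a x \<oplus>\<^bsub>ext_alg A n\<^esub> koszul_diff A n a y"
      if x: "x \<in> carrier (ext_alg A n)" and y: "y \<in> carrier (ext_alg A n)" for x y
    proof
      fix J
      note [simp] = ext_alg_carrierD(1)[OF x] ext_alg_carrierD(1)[OF y]
        ext_alg_carrierD(1)[OF ext_partial_closed[OF x]] ext_alg_carrierD(1)[OF ext_partial_closed[OF y]]
      have "koszul_diff A n a (x \<oplus>\<^bsub>ext_alg A n\<^esub> y) J =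
          (\<Oplus>\<^bsub>A\<^esub>j\<in>{..<n}. a j \<otimes>\<^bsub>A\<^esub> ext_partial A n j x J \<oplus>\<^bsub>A\<^esub> a j \<otimes>\<^bsub>A\<^esub> ext_partial A n j y J)"
        unfolding koszul_diff_def
        by (rule finsum_cong') (use a in \<open>auto simp: ext_partial_def ext_alg_simps r_distr\<close>)
      also have "\<dots> = koszul_diff A n a x J \<oplus>\<^bsub>A\<^esub> koszul_diff A n a y J"
        unfolding koszul_diff_def by (rule finsum_addf) (use a in auto)
      finally show "koszul_diff A n a (x \<oplus>\<^bsub>ext_alg A n\<^esub> y) J =
        (koszul_diff A n a x \<oplus>\<^bsub>ext_alg A n\<^esub> koszul_diff A n a y) J" by (simp add: ext_alg_simps)
    qed
    moreover have "koszul_diff A n a (c \<odot>\<^bsub>ext_alg A n\<^esub> x) = c \<odot>\<^bsub>ext_alg A n\<^esub> koszul_diff A n a x"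
      if c: "c \<in> carrier A" and x: "x \<in> carrier (ext_alg A n)" for c x
    proof
      fix J
      note [simp] = ext_alg_carrierD(1)[OF x] ext_alg_carrierD(1)[OF ext_partial_closed[OF x]] c
      have "koszul_diff A n a (c \<odot>\<^bsub>ext_alg A n\<^esub> x) J =
          (\<Oplus>\<^bsub>A\<^esub>j\<in>{..<n}. c \<otimes>\<^bsub>A\<^esub> (a j \<otimes>\<^bsub>A\<^esub> ext_partial A n j x J))"
        unfolding koszul_diff_def
        by (rule finsum_cong') (use a in \<open>auto simp: ext_partial_def ext_alg_simps m_ac\<close>)
      also have "\<dots> = c \<otimes>\<^bsub>A\<^esub> koszul_diff A n a x J"
        unfolding koszul_diff_def by (rule finsum_rdistr[symmetric]) (use a in auto)
      finally show "koszul_diff A n a (c \<odot>\<^bsub>ext_alg A n\<^esub> x) J =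
          (c \<odot>\<^bsub>ext_alg A n\<^esub> koszul_diff A n a x) J" by (simp add: ext_alg_simps)
    qed
    ultimately show ?thesis by (auto simp: lin_hom_def)
  qed
  moreover have "koszul_diff A n a x \<in> ext_deg A n (k - 1)" if x: "x \<in> ext_deg A n k" for x k
  proof -
    have "int (card J) = k - 1" if J: "koszul_diff A n a x J \<noteq> \<zero>\<^bsub>A\<^esub>" for J
    proof -
      obtain j where j: "j < n" "ext_partial A n j x J \<noteq> \<zero>\<^bsub>A\<^esub>"
        using koszul_diff_zero[of n a x J, OF a] J by blast
      then have "x (insert j J) \<noteq> \<zero>\<^bsub>A\<^esub>" and J': "J \<subseteq> {..<n}" "j \<notin> J"
        by (auto simp: ext_partial_def split: if_splits)
      then have "int (card (insert j J)) = k" using x by (auto simp: ext_deg_def)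
      then show ?thesis using J' finite_subset[OF J'(1)] by simp
    qed
    then show ?thesis using x lin by (auto simp: ext_deg_def lin_hom_def)
  qed
  moreover have "koszul_diff A n a (x \<otimes>\<^bsub>ext_alg A n\<^esub> y) =
        koszul_diff A n a x \<otimes>\<^bsub>ext_alg A n\<^esub> y \<oplus>\<^bsub>ext_alg A n\<^esub>
        neg_one_pow A k \<odot>\<^bsub>ext_alg A n\<^esub> (x \<otimes>\<^bsub>ext_alg A n\<^esub> koszul_diff A n a y)"
    if x: "x \<in> ext_deg A n (int k)" and y: "y \<in> carrier (ext_alg A n)" for x y k
  proof
    fix L
    show "koszul_diff A n a (x \<otimes>\<^bsub>ext_alg A n\<^esub> y) L =
        (koszul_diff A n a x \<otimes>\<^bsub>ext_alg A n\<^esub> y \<oplus>\<^bsub>ext_alg A n\<^esub>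
        neg_one_pow A k \<odot>\<^bsub>ext_alg A n\<^esub> (x \<otimes>\<^bsub>ext_alg A n\<^esub> koszul_diff A n a y)) L"
      using ext_partial_sum_leibniz[OF x y, of "{..<n}" a L] a
      unfolding koszul_diff_def ext_alg_simps(1,2) by simp
  qed
  ultimately show ?thesis by (auto simp: graded_derivation_def)
qed

theorem koszul_diff_basis:
  assumes "cring A" and a: "\<And>j. j < n \<Longrightarrow> a j \<in> carrier A" and j: "j < n"
  shows "koszul_diff A n a (ext_basis A j) = a j \<odot>\<^bsub>ext_alg A n\<^esub> \<one>\<^bsub>ext_alg A n\<^esub>"
proof
  fix J
  interpret cring A by fact
  have part: "ext_partial A n i (ext_basis A j) J = (if i = j \<and> J = {} then \<one>\<^bsub>A\<^esub> else \<zero>\<^bsub>A\<^esub>)" if "i < n" for i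
    using that j by (auto simp: ext_partial_def ext_basis_def neg_one_pow_def)
  have "koszul_diff A n a (ext_basis A j) J =
      (\<Oplus>\<^bsub>A\<^esub>i\<in>{..<n}. if j = i then (if J = {} then a i else \<zero>\<^bsub>A\<^esub>) else \<zero>\<^bsub>A\<^esub>)"
    unfolding koszul_diff_def by (rule finsum_cong') (use a part in auto)
  also have "\<dots> = (if J = {} then a j else \<zero>\<^bsub>A\<^esub>)"
    by (rule add.finprod_singleton[simplified]) (use a j in auto)
  finally show "koszul_diff A n a (ext_basis A j) J = (a j \<odot>\<^bsub>ext_alg A n\<^esub> \<one>\<^bsub>ext_alg A n\<^esub>) J"
    using a[OF j] by (auto simp: ext_alg_def)
qed

section \<open>The isomorphism \<open>\<psi>\<close>\<close>

text \<open>
  Throughout, \<open>S\<close> is \<open>R Quot I\<close>, and \<open>Q s\<close> is a projective resolution of \<open>gr R I s\<close>. In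
  particular \<open>Q 0\<close> resolves \<open>R/I\<close>.
\<close>

definition koszul_resolution ::
    "('a, 'c) ring_scheme \<Rightarrow> 'a set \<Rightarrow> (nat \<Rightarrow> 'a) \<Rightarrow> nat \<Rightarrow> ('a, nat set \<Rightarrow> 'a, 'a set) resolution"
  where "koszul_resolution R I r n = \<lparr>
    obj = (\<lambda>k. (ext_alg R n)\<lparr>carrier := ext_deg R n k\<rparr>),
    diff = (\<lambda>k. koszul_diff R n r),
    aug = (\<lambda>x. I +>\<^bsub>R\<^esub> x {})\<rparr>"

text \<open>
  \<open>Tor(S,S) \<rightarrow> S \<otimes> \<Lambda>\<^sup>R(U) \<rightarrow> \<Lambda>\<^sup>S(V)\<close>: pass to the Koszul resolution, all of whose elements become
  cycles with vanishing boundaries over \<open>S\<close>, and reduce coefficients modulo \<open>I\<close>.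
\<close>

definition tor_to_ext ::
    "('a, 'c) ring_scheme \<Rightarrow> 'a set \<Rightarrow> (nat \<Rightarrow> 'a) \<Rightarrow> nat \<Rightarrow> ('a, 'q, 'a set) resolution
      \<Rightarrow> int \<Rightarrow> ('a, 'q) tens_el set \<Rightarrow> nat set \<Rightarrow> 'a set"
  where "tor_to_ext R I r n Q0 k t =
    (let K = koszul_resolution R I r n; E = ext_alg (R Quot I) n in
      the_elem (tensor_lift R (quot_ring_module R I) (obj K k) (restrict_scalars (a_r_coset R I) E)
          (\<lambda>c x. c \<odot>\<^bsub>E\<^esub> (\<lambda>J. I +>\<^bsub>R\<^esub> x J)) ` tor_map R I Q0 K (\<lambda>X. X) k t))"

text \<open>
  The inverse of \<open>\<phi>\<close> in degree \<open>s\<close>: the \<open>S\<close>-algebra map from the symmetric algebra to the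
  associated graded ring that takes \<open>f\<^sub>j\<close> to \<open>- {r\<^sub>j}\<close>.
\<close>

definition sym_to_gr ::
    "('a, 'c) ring_scheme \<Rightarrow> 'a set \<Rightarrow> (nat \<Rightarrow> 'a) \<Rightarrow> nat \<Rightarrow> nat \<Rightarrow> (nat multiset \<Rightarrow> 'a set) \<Rightarrow> 'a set"
  where "sym_to_gr R I r n s p = (\<Oplus>\<^bsub>grS R I s\<^esub>m\<in>{m. p m \<noteq> \<zero>\<^bsub>R Quot I\<^esub>}.
    p m \<odot>\<^bsub>grS R I s\<^esub>
      (ideal_pow R I (Suc s) +>\<^bsub>R\<^esub> (\<Otimes>\<^bsub>R\<^esub>j\<in>{..<n}. (\<ominus>\<^bsub>R\<^esub> r j) [^]\<^bsub>R\<^esub> count m j)))"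

definition gr_to_sym ::
    "('a, 'c) ring_scheme \<Rightarrow> 'a set \<Rightarrow> (nat \<Rightarrow> 'a) \<Rightarrow> nat \<Rightarrow> nat \<Rightarrow> 'a set \<Rightarrow> nat multiset \<Rightarrow> 'a set"
  where "gr_to_sym R I r n s = inv_into (sym_deg (R Quot I) n s) (sym_to_gr R I r n s)"

text \<open>
  \<open>gr\<^sup>s \<otimes>\<^sub>S Tor(S,S) \<rightarrow> Tor(S,gr\<^sup>s)\<close>, taking \<open>x \<otimes> t\<close> to the image of \<open>t\<close> under the map induced by
  multiplication with \<open>x\<close>, \<open>S \<rightarrow> gr\<^sup>s\<close>.
\<close>

definition gr_tensor_tor ::
    "('a, 'c) ring_scheme \<Rightarrow> 'a set \<Rightarrow> (nat \<Rightarrow> ('a, 'q, 'a set) resolution) \<Rightarrow> nat \<Rightarrow> int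
      \<Rightarrow> ('a set, ('a set \<times> ('a, 'q) tens_el set \<Rightarrow> 'a set) set) module"
  where "gr_tensor_tor R I Q s k = tensor (R Quot I) (grS R I s) (TorS R I (Q 0) k)"

definition gr_tor_mult ::
    "('a, 'c) ring_scheme \<Rightarrow> 'a set \<Rightarrow> (nat \<Rightarrow> ('a, 'q, 'a set) resolution) \<Rightarrow> nat \<Rightarrow> int
      \<Rightarrow> ('a set \<times> ('a, 'q) tens_el set \<Rightarrow> 'a set) set \<Rightarrow> ('a, 'q) tens_el set"
  where "gr_tor_mult R I Q s k =
    tensor_lift (R Quot I) (grS R I s) (TorS R I (Q 0) k) (TorS R I (Q s) k)
      (\<lambda>x t. tor_map R I (Q 0) (Q s) (\<lambda>c. c \<odot>\<^bsub>grS R I s\<^esub> x) k t)"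

text \<open>
  The exterior algebra over the symmetric algebra, as a module over \<open>A\<close>, and its component of
  bidegree \<open>(s, k)\<close>.
\<close>

definition koszul_alg :: "('a, 'c) ring_scheme \<Rightarrow> nat \<Rightarrow> ('a, nat set \<Rightarrow> nat multiset \<Rightarrow> 'a) module"
  where "koszul_alg A n = restrict_scalars (sym_const A) (ext_alg (sym_alg A n) n)"

definition koszul_comp ::
    "('a, 'c) ring_scheme \<Rightarrow> nat \<Rightarrow> nat \<Rightarrow> int \<Rightarrow> ('a, nat set \<Rightarrow> nat multiset \<Rightarrow> 'a) module"
  where "koszul_comp A n s k = (koszul_alg A n)\<lparr>carrier :=
    {x \<in> ext_deg (sym_alg A n) n k. \<forall>J. x J \<in> sym_deg A n s}\<rparr>"

definition psi ::
    "('a, 'c) ring_scheme \<Rightarrow> 'a set \<Rightarrow> (nat \<Rightarrow> 'a) \<Rightarrow> nat \<Rightarrow> (nat \<Rightarrow> ('a, 'q, 'a set) resolution)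
      \<Rightarrow> nat \<Rightarrow> int \<Rightarrow> ('a, 'q) tens_el set \<Rightarrow> nat set \<Rightarrow> nat multiset \<Rightarrow> 'a set"
  where "psi R I r n Q s k t =
    (let S = R Quot I in
      tensor_lift S (grS R I s) (TorS R I (Q 0) k) (koszul_alg S n)
        (\<lambda>x t'. gr_to_sym R I r n s x \<odot>\<^bsub>ext_alg (sym_alg S n) n\<^esub>
                  (\<lambda>J. sym_const S (tor_to_ext R I r n (Q 0) k t' J)))
        (inv_into (carrier (gr_tensor_tor R I Q s k)) (gr_tor_mult R I Q s k) t))"


section \<open>The maps \<open>\<eta>\<close> and \<open>\<epsilon>\<close>\<close>

text \<open>The resolution of \<open>R\<close> by itself, concentrated in degree zero.\<close>

definition trivial_resolution :: "('a, 'c) ring_scheme \<Rightarrow> ('a, 'a, 'a) resolution"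
  where "trivial_resolution R = \<lparr>
    obj = (\<lambda>k. if k = 0 then self_module R else (self_module R)\<lparr>carrier := {\<zero>\<^bsub>R\<^esub>}\<rparr>),
    diff = (\<lambda>k x. \<zero>\<^bsub>R\<^esub>),
    aug = (\<lambda>x. x)\<rparr>"

definition eta ::
    "('a, 'c) ring_scheme \<Rightarrow> 'a set \<Rightarrow> ('a, 'q, 'a set) resolution \<Rightarrow> 'a set \<Rightarrow> ('a, 'q) tens_el set"
  where "eta R I Q0 c =
    (let T = trivial_resolution R in
      tor_map R I T Q0 (a_r_coset R I) 0
        (homology_class (tor_complex R I T) 0
          (pure_tensor R (quot_ring_module R I) (obj T 0) c \<one>\<^bsub>R\<^esub>)))"

definition epsilon :: "('a, 'c) ring_scheme \<Rightarrow> nat \<Rightarrow> 'a \<Rightarrow> nat set \<Rightarrow> nat multiset \<Rightarrow> 'a"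
  where "epsilon A n c = (\<lambda>J. if J = {} then sym_const A c else \<zero>\<^bsub>sym_alg A n\<^esub>)"

end

theory Submission
  imports Defs
begin

text \<open>
  Consider the polynomial ring \<open>R[f\<^sub>1, \<dots>, f\<^sub>n]\<close> and the exterior algebra over it on \<open>e\<^sub>1, \<dots>, e\<^sub>n\<close>.
  In polynomial degree \<open>s\<close>, the differential \<open>\<Sum> r\<^sub>j \<partial>/\<partial>e\<^sub>j\<close> gives a free resolution of
  \<open>I\<^sup>s/I\<^sup>s\<^sup>+\<^sup>1\<close>, with the augmentation \<open>f\<^sub>j \<mapsto> - r\<^sub>j\<close>; that this is well defined with the right
  kernel is the quasi-regularity of the sequence. Modulo \<open>I\<close> the differential vanishes, so
  \<open>Tor\<close> is the part of the Koszul complex over \<open>S\<close> in degree \<open>s\<close>.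
  The differentials \<open>\<Sum> r\<^sub>j \<partial>/\<partial>e\<^sub>j\<close> and \<open>\<Sum> f\<^sub>j \<partial>/\<partial>e\<^sub>j\<close> anticommute, and their sum,
  truncated to the polynomial degrees \<open>s\<close> and \<open>s + 1\<close>, is a complex over \<open>I\<^sup>s/I\<^sup>s\<^sup>+\<^sup>2\<close>: this is
  where the sign in the augmentation is needed. It is an extension of the resolution in degree \<open>s\<close> by
  that in degree \<open>s + 1\<close>, and the connecting homomorphism of such an extension is the off-diagonal
  component \<open>\<Sum> f\<^sub>j \<partial>/\<partial>e\<^sub>j\<close>. Any other short exact sequence of resolutions maps to
  this extension, since it splits in each degree.
  The resulting complex is exact by a contracting homotopy that needs no division by integers.
\<close>

section \<open>Modules and linear maps\<close>

text \<open>\<open>psi\<close> is given through \<open>inv_into\<close> on a tensor product,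
  \<open>tor_map\<close> and \<open>eta\<close> through an arbitrary lift, and the connecting
  homomorphism through \<open>THE\<close>, so none of them can be computed directly. All of them are
  handled through \<open>tor_koszul\<close>, which sends the class of a chain \<open>x\<close> to
  the reduction modulo \<open>I\<close> of the image of \<open>x\<close> in the polynomial
  resolution. It is injective, so linearity, uniqueness and exactness can be tested after applying
  it; \<open>psi_eq\<close> identifies it with \<open>psi\<close>. Since \<open>R/I\<close> is
  cyclic, every element of \<open>R/I \<otimes> M\<close> is \<open>1 \<otimes> x\<close>. Chains
  over \<open>S\<close> are therefore represented by chains over \<open>R\<close> whose boundary
  vanishes only after tensoring. Quasi-regularity is a diagram chase with the two anticommuting
  differentials: the regular sequence gives exactness of one, the contraction exactness of the
  other. Chain maps, homotopies and the off-diagonal component of the comparison are three instances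
  of one recursion, \<open>twisted_extension\<close>.\<close>

lemma lin_homI:
  assumes "\<And>x. x \<in> carrier M \<Longrightarrow> f x \<in> carrier N"
    and "\<And>x y. x \<in> carrier M \<Longrightarrow> y \<in> carrier M \<Longrightarrow> f (x \<oplus>\<^bsub>M\<^esub> y) = f x \<oplus>\<^bsub>N\<^esub> f y"
    and "\<And>a x. a \<in> carrier R \<Longrightarrow> x \<in> carrier M \<Longrightarrow> f (a \<odot>\<^bsub>M\<^esub> x) = a \<odot>\<^bsub>N\<^esub> f x"
  shows "f \<in> lin_hom R M N"
  using assms by (auto simp: lin_hom_def)

lemma lin_homD:
  assumes "f \<in> lin_hom R M N"
  shows "x \<in> carrier M \<Longrightarrow> f x \<in> carrier N"
    and "x \<in> carrier M \<Longrightarrow> y \<in> carrier M \<Longrightarrow> f (x \<oplus>\<^bsub>M\<^esub> y) = f x \<oplus>\<^bsub>N\<^esub> f y"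
    and "a \<in> carrier R \<Longrightarrow> x \<in> carrier M \<Longrightarrow> f (a \<odot>\<^bsub>M\<^esub> x) = a \<odot>\<^bsub>N\<^esub> f x"
  using assms by (auto simp: lin_hom_def)

lemma lin_hom_comp:
  assumes "f \<in> lin_hom R M N" "g \<in> lin_hom R N L"
  shows "(\<lambda>x. g (f x)) \<in> lin_hom R M L"
  using assms by (auto simp: lin_hom_def Pi_def)

lemma lin_hom_ident: "(\<lambda>x. x) \<in> lin_hom R M M"
  by (simp add: lin_hom_def)

lemma lin_hom_zero:
  assumes "module R M" "module R N" "f \<in> lin_hom R M N"
  shows "f \<zero>\<^bsub>M\<^esub> = \<zero>\<^bsub>N\<^esub>"
proof -
  interpret M: module R M by fact
  interpret N: module R N by fact
  have "f (\<zero>\<^bsub>R\<^esub> \<odot>\<^bsub>M\<^esub> \<zero>\<^bsub>M\<^esub>) = \<zero>\<^bsub>R\<^esub> \<odot>\<^bsub>N\<^esub> f \<zero>\<^bsub>M\<^esub>"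
    by (rule lin_homD(3)[OF assms(3)]) auto
  then show ?thesis using lin_homD(1)[OF assms(3) M.zero_closed] by simp
qed

lemma lin_hom_uminus:
  assumes "module R M" "module R N" "f \<in> lin_hom R M N" "x \<in> carrier M"
  shows "f (\<ominus>\<^bsub>M\<^esub> x) = \<ominus>\<^bsub>N\<^esub> f x"
proof -
  interpret M: module R M by fact
  interpret N: module R N by fact
  have "\<ominus>\<^bsub>M\<^esub> x = (\<ominus>\<^bsub>R\<^esub> \<one>\<^bsub>R\<^esub>) \<odot>\<^bsub>M\<^esub> x" using assms(4) by (simp add: M.smult_l_minus)
  then show ?thesis
    using assms(4) lin_homD[OF assms(3)] by (simp add: N.smult_l_minus)
qed

lemma lin_hom_minus:
  assumes "module R M" "module R N" "f \<in> lin_hom R M N" "x \<in> carrier M" "y \<in> carrier M"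
  shows "f (x \<ominus>\<^bsub>M\<^esub> y) = f x \<ominus>\<^bsub>N\<^esub> f y"
proof -
  interpret M: module R M by fact
  show ?thesis
    using assms lin_homD(2)[OF assms(3)] by (simp add: a_minus_def lin_hom_uminus)
qed

lemma lin_hom_finsum:
  assumes "module R M" "module R N" "f \<in> lin_hom R M N" "g \<in> A \<rightarrow> carrier M"
  shows "f (\<Oplus>\<^bsub>M\<^esub>i\<in>A. g i) = (\<Oplus>\<^bsub>N\<^esub>i\<in>A. f (g i))"
proof -
  interpret M: module R M by fact
  interpret N: module R N by fact
  show ?thesis using assms(4)
  proof (induction A rule: infinite_finite_induct)
    case (insert a A)
    then have "(\<lambda>i. f (g i)) \<in> insert a A \<rightarrow> carrier N"
      using lin_homD(1)[OF assms(3)] by auto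
    then show ?case using insert lin_homD[OF assms(3)] by (simp add: Pi_def)
  qed (simp_all add: lin_hom_zero[OF assms(1-3)])
qed

lemma lin_hom_plus:
  assumes "module R N" "f \<in> lin_hom R M N" "g \<in> lin_hom R M N" "module R M"
  shows "(\<lambda>x. f x \<oplus>\<^bsub>N\<^esub> g x) \<in> lin_hom R M N"
proof -
  interpret N: module R N by fact
  show ?thesis
    using lin_homD[OF assms(2)] lin_homD[OF assms(3)]
    by (intro lin_homI) (auto simp: N.smult_r_distr N.a_ac)
qed

lemma lin_hom_const_zero:
  assumes "module R N"
  shows "(\<lambda>x. \<zero>\<^bsub>N\<^esub>) \<in> lin_hom R M N"
proof -
  interpret N: module R N by fact
  show ?thesis by (auto intro: lin_homI)
qed

lemma lin_hom_neg:
  assumes "module R N" "f \<in> lin_hom R M N"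
  shows "(\<lambda>x. \<ominus>\<^bsub>N\<^esub> f x) \<in> lin_hom R M N"
proof -
  interpret N: module R N by fact
  show ?thesis
    using lin_homD[OF assms(2)]
    by (intro lin_homI) (auto simp: N.smult_r_minus N.minus_add)
qed

lemma lin_hom_diff:
  assumes "module R N" "f \<in> lin_hom R M N" "g \<in> lin_hom R M N" "module R M"
  shows "(\<lambda>x. f x \<ominus>\<^bsub>N\<^esub> g x) \<in> lin_hom R M N"
  unfolding a_minus_def by (intro lin_hom_plus lin_hom_neg assms)

lemma lin_hom_finsum_fun:
  assumes "module R M" "module R N" "finite A" "\<And>i. i \<in> A \<Longrightarrow> f i \<in> lin_hom R M N"
  shows "(\<lambda>x. \<Oplus>\<^bsub>N\<^esub>i\<in>A. f i x) \<in> lin_hom R M N"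
proof -
  interpret M: module R M by fact
  interpret N: module R N by fact
  have c: "f i x \<in> carrier N" if "i \<in> A" "x \<in> carrier M" for i x
    using assms(4) that lin_homD(1) by metis
  show ?thesis
  proof (rule lin_homI)
    fix x y assume xy: "x \<in> carrier M" "y \<in> carrier M"
    have "(\<Oplus>\<^bsub>N\<^esub>i\<in>A. f i (x \<oplus>\<^bsub>M\<^esub> y)) = (\<Oplus>\<^bsub>N\<^esub>i\<in>A. f i x \<oplus>\<^bsub>N\<^esub> f i y)"
      by (rule N.finsum_cong') (use xy c lin_homD(2)[OF assms(4)] in auto)
    also have "\<dots> = (\<Oplus>\<^bsub>N\<^esub>i\<in>A. f i x) \<oplus>\<^bsub>N\<^esub> (\<Oplus>\<^bsub>N\<^esub>i\<in>A. f i y)"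
      by (rule N.finsum_addf) (use xy c in auto)
    finally show "(\<Oplus>\<^bsub>N\<^esub>i\<in>A. f i (x \<oplus>\<^bsub>M\<^esub> y)) = (\<Oplus>\<^bsub>N\<^esub>i\<in>A. f i x) \<oplus>\<^bsub>N\<^esub> (\<Oplus>\<^bsub>N\<^esub>i\<in>A. f i y)" .
  next
    fix a x assume ax: "a \<in> carrier R" "x \<in> carrier M"
    have "(\<Oplus>\<^bsub>N\<^esub>i\<in>A. f i (a \<odot>\<^bsub>M\<^esub> x)) = (\<Oplus>\<^bsub>N\<^esub>i\<in>A. a \<odot>\<^bsub>N\<^esub> f i x)"
      by (rule N.finsum_cong') (use ax c lin_homD(3)[OF assms(4)] in auto)
    also have "\<dots> = a \<odot>\<^bsub>N\<^esub> (\<Oplus>\<^bsub>N\<^esub>i\<in>A. f i x)"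
      by (rule N.finsum_smult_ldistr[symmetric]) (use ax c assms(3) in auto)
    finally show "(\<Oplus>\<^bsub>N\<^esub>i\<in>A. f i (a \<odot>\<^bsub>M\<^esub> x)) = a \<odot>\<^bsub>N\<^esub> (\<Oplus>\<^bsub>N\<^esub>i\<in>A. f i x)" .
  qed (use c in auto)
qed

text \<open>The module axioms are inherited from \<open>R\<close> through a jointly injective family
  of coordinates compatible with the operations; free modules, exterior algebras and the bigraded
  components are all treated in this way. The additive inverse is taken to be
  \<open>(\<ominus> \<one>) \<odot> x\<close>, whose closure comes from that of scalar
  multiplication.\<close>

lemma coordinate_module:
  fixes R (structure) and M (structure)
  assumes "cring R"
    and inj: "\<And>x y. x \<in> carrier M \<Longrightarrow> y \<in> carrier M \<Longrightarrow> (\<And>i. ev i x = ev i y) \<Longrightarrow> x = y"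
    and ev: "\<And>i x. x \<in> carrier M \<Longrightarrow> ev i x \<in> carrier R"
    and zero: "\<zero>\<^bsub>M\<^esub> \<in> carrier M" "\<And>i. ev i \<zero>\<^bsub>M\<^esub> = \<zero>"
    and add: "\<And>x y. x \<in> carrier M \<Longrightarrow> y \<in> carrier M \<Longrightarrow> x \<oplus>\<^bsub>M\<^esub> y \<in> carrier M"
      "\<And>i x y. x \<in> carrier M \<Longrightarrow> y \<in> carrier M \<Longrightarrow> ev i (x \<oplus>\<^bsub>M\<^esub> y) = ev i x \<oplus> ev i y"
    and smult: "\<And>a x. a \<in> carrier R \<Longrightarrow> x \<in> carrier M \<Longrightarrow> a \<odot>\<^bsub>M\<^esub> x \<in> carrier M"
      "\<And>i a x. a \<in> carrier R \<Longrightarrow> x \<in> carrier M \<Longrightarrow> ev i (a \<odot>\<^bsub>M\<^esub> x) = a \<otimes> ev i x"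
  shows "module R M"
proof -
  interpret cring R by fact
  have grp: "abelian_group M"
  proof (rule abelian_groupI)
    fix x assume x: "x \<in> carrier M"
    show "\<exists>y\<in>carrier M. y \<oplus>\<^bsub>M\<^esub> x = \<zero>\<^bsub>M\<^esub>"
    proof (rule bexI[where x = "(\<ominus> \<one>) \<odot>\<^bsub>M\<^esub> x"])
      show "(\<ominus> \<one>) \<odot>\<^bsub>M\<^esub> x \<oplus>\<^bsub>M\<^esub> x = \<zero>\<^bsub>M\<^esub>"
        by (rule inj) (use x ev in \<open>simp_all add: zero add smult l_minus l_neg\<close>)
    qed (use x smult in auto)
  qed (auto intro!: inj simp: zero add ev a_ac)
  show ?thesis
    by (rule moduleI[OF assms(1) grp]) (auto intro!: inj simp: add smult ev l_distr r_distr m_assoc)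
qed

lemma self_module_simps [simp]:
  "carrier (self_module R) = carrier R" "\<zero>\<^bsub>self_module R\<^esub> = \<zero>\<^bsub>R\<^esub>"
  "x \<oplus>\<^bsub>self_module R\<^esub> y = x \<oplus>\<^bsub>R\<^esub> y" "a \<odot>\<^bsub>self_module R\<^esub> x = a \<otimes>\<^bsub>R\<^esub> x"
  by (simp_all add: self_module_def)

lemma finsum_self_module: "finsum (self_module R) = finsum R"
  by (rule ext)+ (simp add: finsum_def finprod_def self_module_def)

lemma self_module_module:
  assumes "cring R"
  shows "module R (self_module R)"
proof -
  interpret cring R by fact
  show ?thesis
    by (rule coordinate_module[OF assms, where ev = "\<lambda>_::unit. \<lambda>x. x"]) auto
qed

lemma ideal_submodule:
  assumes "cring R" "ideal J R" "J \<subseteq> H" "submodule H R (self_module R)"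
  shows "submodule J R ((self_module R)\<lparr>carrier := H\<rparr>)"
proof -
  interpret cring R by fact
  interpret J: ideal J R by fact
  interpret H: submodule H R "self_module R" by fact
  interpret M: module R "(self_module R)\<lparr>carrier := H\<rparr>"
    by (rule H.submodule_is_module[OF self_module_module[OF assms(1)]])
  \<comment> \<open>The additive inverse of a record is chosen inside its carrier, so shrinking the
    carrier changes the term. Multiplication by -1 pins it down through operations that stay the
    same.\<close>
  have inv: "\<ominus>\<^bsub>(self_module R)\<lparr>carrier := H\<rparr>\<^esub> a \<in> J" if "a \<in> J" for a
  proof -
    have "\<ominus>\<^bsub>(self_module R)\<lparr>carrier := H\<rparr>\<^esub> a = (\<ominus>\<^bsub>R\<^esub> \<one>\<^bsub>R\<^esub>) \<odot>\<^bsub>(self_module R)\<lparr>carrier := H\<rparr>\<^esub> a"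
      using that assms(3) M.smult_l_minus[of "\<one>\<^bsub>R\<^esub>" a] M.smult_one[of a] by (auto simp del: M.smult_one)
    then show ?thesis using that J.I_l_closed[of a "\<ominus>\<^bsub>R\<^esub> \<one>\<^bsub>R\<^esub>"] by simp
  qed
  show ?thesis
    by (rule M.submoduleI) (use inv assms(3) J.I_l_closed in auto)
qed

lemma restrict_scalars_simps [simp]:
  "carrier (restrict_scalars h M) = carrier M" "\<zero>\<^bsub>restrict_scalars h M\<^esub> = \<zero>\<^bsub>M\<^esub>"
  "x \<oplus>\<^bsub>restrict_scalars h M\<^esub> y = x \<oplus>\<^bsub>M\<^esub> y" "a \<odot>\<^bsub>restrict_scalars h M\<^esub> x = h a \<odot>\<^bsub>M\<^esub> x"
  by (simp_all add: restrict_scalars_def)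

lemma abelian_group_cong:
  assumes "abelian_group M" "carrier N = carrier M" "zero N = zero M" "add N = add M"
  shows "abelian_group N"
proof -
  interpret M: abelian_group M by fact
  show ?thesis
    by (rule abelian_groupI) (auto simp: assms(2-4) M.a_ac intro: M.l_neg)
qed

lemma restrict_scalars_module:
  assumes "cring R" "h \<in> ring_hom R S" "module S M"
  shows "module R (restrict_scalars h M)"
proof -
  interpret R: cring R by fact
  interpret M: module S M by fact
  show ?thesis
    by (rule moduleI[OF assms(1) abelian_group_cong[OF M.abelian_group_axioms]])
      (auto simp: restrict_scalars_def ring_hom_closed[OF assms(2)] ring_hom_add[OF assms(2)]
         ring_hom_mult[OF assms(2)] ring_hom_one[OF assms(2)]
         M.smult_l_distr M.smult_r_distr M.smult_assoc1)
qed

subsection \<open>Quotient modules\<close>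

lemma quot_module_simps [simp]:
  "\<zero>\<^bsub>quot_module M N\<^esub> = N" "X \<oplus>\<^bsub>quot_module M N\<^esub> Y = X <+>\<^bsub>M\<^esub> Y"
  by (simp_all add: quot_module_def)

lemma quot_module_carrier: "carrier (quot_module M N) = (\<lambda>x. N +>\<^bsub>M\<^esub> x) ` carrier M"
  by (auto simp: quot_module_def A_RCOSETS_def')

locale quotient = module R M + submodule N R M
  for R (structure) and M (structure) and N
begin

lemma abelian_subgroup: "abelian_subgroup N M"
  by (rule abelian_subgroupI3[OF additive_subgroupI[OF subgroup_axioms] M.abelian_group_axioms])

sublocale N: abelian_subgroup N M by (rule abelian_subgroup)

lemma coset_eq_iff:
  assumes "x \<in> carrier M" "y \<in> carrier M"
  shows "N +>\<^bsub>M\<^esub> x = N +>\<^bsub>M\<^esub> y \<longleftrightarrow> x \<ominus>\<^bsub>M\<^esub> y \<in> N"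
  unfolding a_minus_def using assms N.a_rcos_module[of y x]
  by (metis N.a_repr_independence' N.a_repr_independenceD)

lemma coset_eq_zero_iff:
  assumes "x \<in> carrier M"
  shows "N +>\<^bsub>M\<^esub> x = N \<longleftrightarrow> x \<in> N"
  using coset_eq_iff[OF assms M.zero_closed] assms N.a_rcos_const[OF N.zero_closed]
    M.minus_equality[of "\<zero>\<^bsub>M\<^esub>" "\<zero>\<^bsub>M\<^esub>"]
  by (simp add: a_minus_def)

lemma mem_coset_iff:
  assumes "x \<in> carrier M"
  shows "y \<in> N +>\<^bsub>M\<^esub> x \<longleftrightarrow> y \<in> carrier M \<and> N +>\<^bsub>M\<^esub> y = N +>\<^bsub>M\<^esub> x"
  using assms N.a_elemrcos_carrier N.a_rcos_self N.a_repr_independence' by metis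

lemma coset_self: "x \<in> carrier M \<Longrightarrow> x \<in> N +>\<^bsub>M\<^esub> x"
  by (rule N.a_rcos_self)

lemma quot_add:
  "x \<in> carrier M \<Longrightarrow> y \<in> carrier M \<Longrightarrow>
    (N +>\<^bsub>M\<^esub> x) \<oplus>\<^bsub>quot_module M N\<^esub> (N +>\<^bsub>M\<^esub> y) = N +>\<^bsub>M\<^esub> (x \<oplus>\<^bsub>M\<^esub> y)"
  by (simp add: N.a_rcos_sum)

text \<open>\<open>quot_module\<close> takes the union of the cosets of \<open>a \<odot> y\<close>
  over all representatives \<open>y\<close>. This is a single coset because all of these cosets
  coincide and the index set is not empty.\<close>

lemma quot_smult:
  assumes "a \<in> carrier R" "x \<in> carrier M"
  shows "a \<odot>\<^bsub>quot_module M N\<^esub> (N +>\<^bsub>M\<^esub> x) = N +>\<^bsub>M\<^esub> (a \<odot>\<^bsub>M\<^esub> x)"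
proof -
  have "N +>\<^bsub>M\<^esub> (a \<odot>\<^bsub>M\<^esub> y) = N +>\<^bsub>M\<^esub> (a \<odot>\<^bsub>M\<^esub> x)" if "y \<in> N +>\<^bsub>M\<^esub> x" for y
  proof -
    have y: "y \<in> carrier M" "y \<ominus>\<^bsub>M\<^esub> x \<in> N"
      using that assms(2) mem_coset_iff coset_eq_iff by auto
    have "a \<odot>\<^bsub>M\<^esub> y \<ominus>\<^bsub>M\<^esub> a \<odot>\<^bsub>M\<^esub> x = a \<odot>\<^bsub>M\<^esub> (y \<ominus>\<^bsub>M\<^esub> x)"
      using assms y by (simp add: a_minus_def smult_r_distr smult_r_minus)
    then show ?thesis using assms y coset_eq_iff[of "a \<odot>\<^bsub>M\<^esub> y" "a \<odot>\<^bsub>M\<^esub> x"] by simp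
  qed
  then have "(\<Union>y\<in>N +>\<^bsub>M\<^esub> x. N +>\<^bsub>M\<^esub> (a \<odot>\<^bsub>M\<^esub> y)) = (\<Union>y\<in>N +>\<^bsub>M\<^esub> x. N +>\<^bsub>M\<^esub> (a \<odot>\<^bsub>M\<^esub> x))"
    by (intro SUP_cong) auto
  moreover have "N +>\<^bsub>M\<^esub> x \<noteq> {}" using coset_self[OF assms(2)] by blast
  ultimately show ?thesis by (simp add: quot_module_def)
qed

lemma quot_closed: "x \<in> carrier M \<Longrightarrow> N +>\<^bsub>M\<^esub> x \<in> carrier (quot_module M N)"
  by (simp add: quot_module_carrier)

lemma quot_module_module: "module R (quot_module M N)"
proof (rule moduleI[OF R.is_cring])
  note q = quot_add[simplified] quot_smult
  have z: "N = N +>\<^bsub>M\<^esub> \<zero>\<^bsub>M\<^esub>" using N.a_rcos_const[OF N.zero_closed] by simp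
  show "abelian_group (quot_module M N)"
  proof (rule abelian_groupI)
    fix X assume "X \<in> carrier (quot_module M N)"
    then obtain x where x: "x \<in> carrier M" "X = N +>\<^bsub>M\<^esub> x" by (auto simp: quot_module_carrier)
    show "\<exists>Y\<in>carrier (quot_module M N). Y \<oplus>\<^bsub>quot_module M N\<^esub> X = \<zero>\<^bsub>quot_module M N\<^esub>"
      by (rule bexI[where x = "N +>\<^bsub>M\<^esub> (\<ominus>\<^bsub>M\<^esub> x)"])
        (use x z in \<open>auto simp: q quot_closed M.l_neg\<close>)
    show "\<zero>\<^bsub>quot_module M N\<^esub> \<oplus>\<^bsub>quot_module M N\<^esub> X = X"
      unfolding quot_module_simps by (subst z) (use x in \<open>simp add: q\<close>)
  next
    show "\<zero>\<^bsub>quot_module M N\<^esub> \<in> carrier (quot_module M N)"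
      using z quot_closed[OF M.zero_closed] by simp
  qed (auto simp: quot_module_carrier q M.a_ac)
qed (auto simp: quot_module_carrier quot_add[simplified] quot_smult smult_l_distr smult_r_distr smult_assoc1)

lemma quot_proj_lin: "(\<lambda>x. N +>\<^bsub>M\<^esub> x) \<in> lin_hom R M (quot_module M N)"
  by (intro lin_homI) (auto simp: quot_closed quot_add[simplified] quot_smult)

end

lemma quotientI: "module R M \<Longrightarrow> submodule N R M \<Longrightarrow> quotient R M N"
  by (simp add: quotient_def module_def submodule_def)

section \<open>Kernels, images and submodules\<close>

lemma lin_hom_kernel_submodule:
  assumes "module R M" "module R N" "f \<in> lin_hom R M N"
  shows "submodule (a_kernel M N f) R M"
proof -
  interpret M: module R M by fact
  interpret N: module R N by fact
  show ?thesis
    by (rule M.submoduleI)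
      (simp_all add: a_kernel_def' lin_homD[OF assms(3)] lin_hom_zero[OF assms] lin_hom_uminus[OF assms] subset_iff)
qed

lemma lin_hom_image_submodule:
  assumes "module R M" "module R N" "f \<in> lin_hom R M N"
  shows "submodule (f ` carrier M) R N"
proof -
  interpret M: module R M by fact
  interpret N: module R N by fact
  show ?thesis
  proof (rule N.submoduleI)
    show "\<zero>\<^bsub>N\<^esub> \<in> f ` carrier M" using lin_hom_zero[OF assms] M.zero_closed by (metis imageI)
    show "\<ominus>\<^bsub>N\<^esub> a \<in> f ` carrier M" if "a \<in> f ` carrier M" for a
      using that by (auto simp: lin_hom_uminus[OF assms, symmetric])
    show "a \<oplus>\<^bsub>N\<^esub> b \<in> f ` carrier M" if "a \<in> f ` carrier M" "b \<in> f ` carrier M" for a b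
      using that by (auto simp: lin_homD(2)[OF assms(3), symmetric])
    show "c \<odot>\<^bsub>N\<^esub> a \<in> f ` carrier M" if "c \<in> carrier R" "a \<in> f ` carrier M" for a c
      using that by (auto simp: lin_homD(3)[OF assms(3), symmetric])
  qed (auto intro: lin_homD(1)[OF assms(3)])
qed

lemma submodule_zero: "submodule H R M \<Longrightarrow> \<zero>\<^bsub>M\<^esub> \<in> H"
  using subgroup.one_closed[OF submodule.axioms(1)] by fastforce

lemma (in abelian_group) a_inv_zero: "\<ominus> \<zero> = \<zero>"
  using minus_equality[of \<zero> \<zero>] by simp

lemma (in abelian_group) minus_eq_zero_iff:
  assumes "x \<in> carrier G" "y \<in> carrier G"
  shows "x \<ominus> y = \<zero> \<longleftrightarrow> x = y"
proof
  assume "x \<ominus> y = \<zero>"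
  moreover have "x = (x \<ominus> y) \<oplus> y" using assms by (simp add: a_minus_def a_assoc l_neg)
  ultimately show "x = y" using assms by simp
qed (use assms in \<open>simp add: a_minus_def r_neg\<close>)

lemma submodule_restrict:
  assumes "module R M" "submodule H R M" "submodule N R M" "N \<subseteq> H"
  shows "submodule N R (M\<lparr>carrier := H\<rparr>)"
proof -
  interpret M: module R M by fact
  interpret H: submodule H R M by fact
  interpret H': module R "M\<lparr>carrier := H\<rparr>" by (rule H.submodule_is_module[OF assms(1)])
  have inv: "\<ominus>\<^bsub>M\<lparr>carrier := H\<rparr>\<^esub> a \<in> N" if "a \<in> N" for a
  proof -
    have "\<ominus>\<^bsub>M\<lparr>carrier := H\<rparr>\<^esub> a = (\<ominus>\<^bsub>R\<^esub> \<one>\<^bsub>R\<^esub>) \<odot>\<^bsub>M\<lparr>carrier := H\<rparr>\<^esub> a"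
      using that assms(4) H'.smult_l_minus[of "\<one>\<^bsub>R\<^esub>" a] H'.smult_one[of a] by (auto simp del: H'.smult_one)
    then show ?thesis using that M.submoduleE(4)[OF assms(3), of "\<ominus>\<^bsub>R\<^esub> \<one>\<^bsub>R\<^esub>" a] by simp
  qed
  show ?thesis
    by (rule H'.submoduleI) (use inv assms(4) M.submoduleE[OF assms(3)] subgroup.one_closed[OF submodule.axioms(1)[OF assms(3)]] in auto)
qed

subsection \<open>Free and projective modules\<close>

lemma free_module_simps [simp]:
  "\<zero>\<^bsub>free_module R X\<^esub> = (\<lambda>_. \<zero>\<^bsub>R\<^esub>)" "c \<oplus>\<^bsub>free_module R X\<^esub> d = (\<lambda>x. c x \<oplus>\<^bsub>R\<^esub> d x)"
  "a \<odot>\<^bsub>free_module R X\<^esub> c = (\<lambda>x. a \<otimes>\<^bsub>R\<^esub> c x)"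
  by (simp_all add: free_module_def)

lemma free_module_carrier:
  "c \<in> carrier (free_module R X) \<longleftrightarrow>
    (\<forall>x\<in>X. c x \<in> carrier R) \<and> (\<forall>x. x \<notin> X \<longrightarrow> c x = \<zero>\<^bsub>R\<^esub>) \<and> finite {x. c x \<noteq> \<zero>\<^bsub>R\<^esub>}"
  by (simp add: free_module_def)

text \<open>The linear extension of \<open>b\<close> to the free module on \<open>X\<close>, summed
  over the support so that the sum is finite. It has the shape of the body of
  \<open>tensor_lift\<close>, which thereby becomes a linear extension evaluated on a coset.\<close>

definition lin_ext :: "('a, 'm, 'd) module_scheme \<Rightarrow> ('a, 'c) ring_scheme \<Rightarrow> 'x set \<Rightarrow> ('x \<Rightarrow> 'm) \<Rightarrow> ('x \<Rightarrow> 'a) \<Rightarrow> 'm"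
  where "lin_ext L R X b c = (\<Oplus>\<^bsub>L\<^esub>z\<in>{z \<in> X. c z \<noteq> \<zero>\<^bsub>R\<^esub>}. c z \<odot>\<^bsub>L\<^esub> b z)"

context cring
begin

lemma free_module_value: "c \<in> carrier (free_module R X) \<Longrightarrow> c x \<in> carrier R"
  by (cases "x \<in> X") (auto simp: free_module_carrier)

lemma free_module_module: "module R (free_module R X)"
proof (rule coordinate_module[OF is_cring, where ev = "\<lambda>x c. c x"])
  fix c d assume c: "c \<in> carrier (free_module R X)" and d: "d \<in> carrier (free_module R X)"
  have "finite {x. c x \<oplus> d x \<noteq> \<zero>}"
    by (rule finite_subset[of _ "{x. c x \<noteq> \<zero>} \<union> {x. d x \<noteq> \<zero>}"])
      (auto simp: c[unfolded free_module_carrier] d[unfolded free_module_carrier])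
  then show "c \<oplus>\<^bsub>free_module R X\<^esub> d \<in> carrier (free_module R X)"
    using c d by (auto simp: free_module_carrier)
next
  fix a c assume a: "a \<in> carrier R" and c: "c \<in> carrier (free_module R X)"
  have "finite {x. a \<otimes> c x \<noteq> \<zero>}"
    by (rule finite_subset[of _ "{x. c x \<noteq> \<zero>}"]) (auto simp: a c[unfolded free_module_carrier])
  then show "a \<odot>\<^bsub>free_module R X\<^esub> c \<in> carrier (free_module R X)"
    using a c by (auto simp: free_module_carrier)
qed (auto simp: free_module_value, auto simp: free_module_carrier)

lemma free_gen_closed: "x \<in> X \<Longrightarrow> free_gen R x \<in> carrier (free_module R X)"
proof -
  have "{y. free_gen R x y \<noteq> \<zero>} \<subseteq> {x}" by (auto simp: free_gen_def)
  then have "finite {y. free_gen R x y \<noteq> \<zero>}" using finite_subset by blast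
  then show "x \<in> X \<Longrightarrow> free_gen R x \<in> carrier (free_module R X)"
    by (auto simp: free_module_carrier free_gen_def)
qed

text \<open>Induction over a finite set containing the support: the coefficient at one point is
  split off and set to zero in the remainder.\<close>

lemma free_module_induct:
  assumes c: "c \<in> carrier (free_module R X)"
    and zero: "P \<zero>\<^bsub>free_module R X\<^esub>"
    and gen: "\<And>a x. a \<in> carrier R \<Longrightarrow> x \<in> X \<Longrightarrow> P (a \<odot>\<^bsub>free_module R X\<^esub> free_gen R x)"
    and add: "\<And>c d. c \<in> carrier (free_module R X) \<Longrightarrow> d \<in> carrier (free_module R X) \<Longrightarrow> P c \<Longrightarrow> P d
      \<Longrightarrow> P (c \<oplus>\<^bsub>free_module R X\<^esub> d)"
  shows "P c"
proof -
  have "finite A \<Longrightarrow> c \<in> carrier (free_module R X) \<Longrightarrow> {x. c x \<noteq> \<zero>} \<subseteq> A \<Longrightarrow> P c" for A c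
  proof (induction A arbitrary: c rule: finite_induct)
    case empty
    then have "c = \<zero>\<^bsub>free_module R X\<^esub>" by (auto simp: fun_eq_iff)
    then show ?case using zero by simp
  next
    case (insert z A)
    show ?case
    proof (cases "z \<in> X")
      case False
      then have "c z = \<zero>" using insert.prems by (auto simp: free_module_carrier)
      then show ?thesis using insert by auto
    next
      case True
      let ?d = "c(z := \<zero>)"
      have "finite {x. ?d x \<noteq> \<zero>}"
      proof (rule finite_subset)
        show "{x. ?d x \<noteq> \<zero>} \<subseteq> {x. c x \<noteq> \<zero>}" by auto
        show "finite {x. c x \<noteq> \<zero>}" using insert.prems(1) unfolding free_module_carrier by blast
      qed
      then have d: "?d \<in> carrier (free_module R X)"
        using insert.prems(1) unfolding free_module_carrier fun_upd_apply by (simp split: if_split)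
      have cz: "c z \<in> carrier R" by (rule free_module_value[OF insert.prems(1)])
      have "c = (c z \<odot>\<^bsub>free_module R X\<^esub> free_gen R z) \<oplus>\<^bsub>free_module R X\<^esub> ?d"
        using free_module_value[OF insert.prems(1)] cz by (auto simp: fun_eq_iff free_gen_def)
      moreover have "P ?d" by (rule insert.IH[OF d]) (use insert.prems in auto)
      ultimately show ?thesis
        using add[OF module.smult_closed[OF free_module_module cz free_gen_closed[OF True]] d gen[OF cz True]] by metis
    qed
  qed
  then show ?thesis using c by (auto simp: free_module_carrier)
qed

lemma free_lin_hom_eqI:
  assumes "module R L" "f \<in> lin_hom R (free_module R X) L" "g \<in> lin_hom R (free_module R X) L"
    and "\<And>x. x \<in> X \<Longrightarrow> f (free_gen R x) = g (free_gen R x)" "c \<in> carrier (free_module R X)"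
  shows "f c = g c"
  using assms(5)
proof (rule free_module_induct)
  show "f \<zero>\<^bsub>free_module R X\<^esub> = g \<zero>\<^bsub>free_module R X\<^esub>"
    using lin_hom_zero[OF free_module_module assms(1)] assms(2,3) by metis
next
  fix a x assume a: "a \<in> carrier R" and x: "x \<in> X"
  show "f (a \<odot>\<^bsub>free_module R X\<^esub> free_gen R x) = g (a \<odot>\<^bsub>free_module R X\<^esub> free_gen R x)"
    unfolding lin_homD(3)[OF assms(2) a free_gen_closed[OF x]] lin_homD(3)[OF assms(3) a free_gen_closed[OF x]]
    using assms(4)[OF x] by simp
next
  fix c d assume cd: "c \<in> carrier (free_module R X)" "d \<in> carrier (free_module R X)" "f c = g c" "f d = g d"
  show "f (c \<oplus>\<^bsub>free_module R X\<^esub> d) = g (c \<oplus>\<^bsub>free_module R X\<^esub> d)"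
    unfolding lin_homD(2)[OF assms(2) cd(1,2)] lin_homD(2)[OF assms(3) cd(1,2)] cd(3,4) ..
qed

text \<open>Enlarging the index set lets the sums for \<open>c\<close>, \<open>d\<close> and
  \<open>c \<oplus> d\<close>, whose supports differ, be compared over one finite set.\<close>

lemma lin_ext_superset:
  assumes "module R L" "b \<in> X \<rightarrow> carrier L" "c \<in> carrier (free_module R X)"
    and "finite A" "A \<subseteq> X" "{x. c x \<noteq> \<zero>} \<subseteq> A"
  shows "lin_ext L R X b c = (\<Oplus>\<^bsub>L\<^esub>z\<in>A. c z \<odot>\<^bsub>L\<^esub> b z)"
proof -
  interpret L: module R L by fact
  show ?thesis unfolding lin_ext_def
    by (rule L.add.finprod_mono_neutral_cong_left)
      (use assms free_module_value[OF assms(3)] in \<open>auto simp: Pi_def\<close>)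
qed

lemma lin_ext_lin:
  assumes "module R L" "b \<in> X \<rightarrow> carrier L"
  shows "lin_ext L R X b \<in> lin_hom R (free_module R X) L"
proof -
  interpret L: module R L by fact
  interpret F: module R "free_module R X" by (rule free_module_module)
  have b: "x \<in> X \<Longrightarrow> b x \<in> carrier L" for x using assms(2) by auto
  note v = free_module_value
  show ?thesis
  proof (rule lin_homI)
    fix c assume c: "c \<in> carrier (free_module R X)"
    show "lin_ext L R X b c \<in> carrier L"
      unfolding lin_ext_def by (rule L.finsum_closed) (use b v[OF c] in auto)
    fix a assume a: "a \<in> carrier R"
    let ?A = "{z \<in> X. c z \<noteq> \<zero>}"
    have fin: "finite ?A" using c by (auto simp: free_module_carrier)
    have sub: "{x. c x \<noteq> \<zero>} \<subseteq> ?A" using c by (auto simp: free_module_carrier)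
    have "lin_ext L R X b (a \<odot>\<^bsub>free_module R X\<^esub> c) = (\<Oplus>\<^bsub>L\<^esub>z\<in>?A. (a \<odot>\<^bsub>free_module R X\<^esub> c) z \<odot>\<^bsub>L\<^esub> b z)"
    proof (rule lin_ext_superset[OF assms F.smult_closed[OF a c] fin])
      have "{x. (a \<odot>\<^bsub>free_module R X\<^esub> c) x \<noteq> \<zero>} \<subseteq> {x. c x \<noteq> \<zero>}" using a by auto
      then show "{x. (a \<odot>\<^bsub>free_module R X\<^esub> c) x \<noteq> \<zero>} \<subseteq> ?A" using sub by blast
    qed auto
    also have "\<dots> = (\<Oplus>\<^bsub>L\<^esub>z\<in>?A. a \<odot>\<^bsub>L\<^esub> (c z \<odot>\<^bsub>L\<^esub> b z))"
      by (rule L.finsum_cong') (use b v[OF c] a in \<open>auto simp: L.smult_assoc1\<close>)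
    also have "\<dots> = a \<odot>\<^bsub>L\<^esub> lin_ext L R X b c" unfolding lin_ext_def
      by (rule L.finsum_smult_ldistr[symmetric]) (use b v[OF c] a fin in auto)
    finally show "lin_ext L R X b (a \<odot>\<^bsub>free_module R X\<^esub> c) = a \<odot>\<^bsub>L\<^esub> lin_ext L R X b c" .
  next
    fix c d assume c: "c \<in> carrier (free_module R X)" and d: "d \<in> carrier (free_module R X)"
    let ?A = "{z \<in> X. c z \<noteq> \<zero>} \<union> {z \<in> X. d z \<noteq> \<zero>}"
    have fin: "finite ?A" using c d by (auto simp: free_module_carrier)
    have sub: "{x. c x \<noteq> \<zero>} \<subseteq> ?A" "{x. d x \<noteq> \<zero>} \<subseteq> ?A" using c d by (auto simp: free_module_carrier)
    have "lin_ext L R X b (c \<oplus>\<^bsub>free_module R X\<^esub> d) = (\<Oplus>\<^bsub>L\<^esub>z\<in>?A. (c \<oplus>\<^bsub>free_module R X\<^esub> d) z \<odot>\<^bsub>L\<^esub> b z)"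
    proof (rule lin_ext_superset[OF assms F.a_closed[OF c d] fin])
      show "{x. (c \<oplus>\<^bsub>free_module R X\<^esub> d) x \<noteq> \<zero>} \<subseteq> ?A" using sub by (auto, force+)
    qed auto
    also have "\<dots> = (\<Oplus>\<^bsub>L\<^esub>z\<in>?A. c z \<odot>\<^bsub>L\<^esub> b z \<oplus>\<^bsub>L\<^esub> d z \<odot>\<^bsub>L\<^esub> b z)"
      by (rule L.finsum_cong') (use b v[OF c] v[OF d] in \<open>auto simp: L.smult_l_distr\<close>)
    also have "\<dots> = (\<Oplus>\<^bsub>L\<^esub>z\<in>?A. c z \<odot>\<^bsub>L\<^esub> b z) \<oplus>\<^bsub>L\<^esub> (\<Oplus>\<^bsub>L\<^esub>z\<in>?A. d z \<odot>\<^bsub>L\<^esub> b z)"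
      by (rule L.finsum_addf) (use b v[OF c] v[OF d] in auto)
    also have "(\<Oplus>\<^bsub>L\<^esub>z\<in>?A. c z \<odot>\<^bsub>L\<^esub> b z) = lin_ext L R X b c"
      by (rule lin_ext_superset[OF assms c fin _ sub(1), symmetric]) auto
    also have "(\<Oplus>\<^bsub>L\<^esub>z\<in>?A. d z \<odot>\<^bsub>L\<^esub> b z) = lin_ext L R X b d"
      by (rule lin_ext_superset[OF assms d fin _ sub(2), symmetric]) auto
    finally show "lin_ext L R X b (c \<oplus>\<^bsub>free_module R X\<^esub> d) = lin_ext L R X b c \<oplus>\<^bsub>L\<^esub> lin_ext L R X b d" .
  qed
qed

lemma lin_ext_gen:
  assumes "module R L" "b \<in> X \<rightarrow> carrier L" "x \<in> X"
  shows "lin_ext L R X b (free_gen R x) = b x"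
proof -
  interpret L: module R L by fact
  have "lin_ext L R X b (free_gen R x) = (\<Oplus>\<^bsub>L\<^esub>z\<in>{x}. free_gen R x z \<odot>\<^bsub>L\<^esub> b z)"
    by (rule lin_ext_superset[OF assms(1,2) free_gen_closed[OF assms(3)]])
      (use assms(3) in \<open>auto simp: free_gen_def\<close>)
  also have "\<dots> = b x"
    using funcset_mem[OF assms(2,3)] by (simp add: free_gen_def)
  finally show ?thesis .
qed

text \<open>
  Here \<open>M\<close> and \<open>N\<close> have arbitrary element types: \<open>P\<close> is a direct summand of the free module on its
  carrier, which suffices for the lifting property.
\<close>

lemma projective_lift:
  assumes P: "projective R P" and M: "module R M" and N: "module R N"
    and g: "g \<in> lin_hom R M N" and f: "f \<in> lin_hom R P N" and im: "f ` carrier P \<subseteq> g ` carrier M"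
  obtains h where "h \<in> lin_hom R P M" "\<And>x. x \<in> carrier P \<Longrightarrow> g (h x) = f x"
proof -
  have mP: "module R P" using P by (simp add: projective_def)
  interpret P: module R P by fact
  let ?F = "free_module R (carrier P)"
  let ?e = "lin_ext P R (carrier P) (\<lambda>x. x)"
  note mF = free_module_module[of "carrier P"]
  have e: "?e \<in> lin_hom R ?F P" by (rule lin_ext_lin[OF mP]) auto
  have "?e ` carrier ?F = carrier P"
  proof
    show "carrier P \<subseteq> ?e ` carrier ?F"
    proof
      fix x assume x: "x \<in> carrier P"
      then have "?e (free_gen R x) = x" by (intro lin_ext_gen[OF mP]) auto
      then show "x \<in> ?e ` carrier ?F" using free_gen_closed[OF x] by (metis imageI)
    qed
  qed (use lin_homD(1)[OF e] in auto)
  then obtain s where s: "s \<in> lin_hom R P ?F" "\<And>x. x \<in> carrier P \<Longrightarrow> ?e (s x) = x"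
    using P[unfolded projective_def, THEN conjunct2, rule_format, of ?F P ?e "\<lambda>x. x"]
      mP mF e lin_hom_ident[of R P] by blast
  \<comment> \<open>Preimages of the values of \<open>f\<close> on all of \<open>carrier P\<close>,
    chosen without regard to linearity. They are extended linearly from the free module, and
    composition with the section \<open>s\<close> returns to \<open>P\<close>.\<close>
  obtain t where t: "\<And>x. x \<in> carrier P \<Longrightarrow> t x \<in> carrier M \<and> g (t x) = f x"
  proof -
    have "\<forall>x\<in>carrier P. \<exists>m\<in>carrier M. g m = f x"
    proof
      fix x assume "x \<in> carrier P"
      then have "f x \<in> g ` carrier M" using im by blast
      then show "\<exists>m\<in>carrier M. g m = f x" by auto
    qed
    then show thesis using that by (metis (no_types, lifting))
  qed
  let ?t = "lin_ext M R (carrier P) t"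
  have tl: "?t \<in> lin_hom R ?F M" by (rule lin_ext_lin[OF M]) (use t in auto)
  have eq: "g (?t c) = f (?e c)" if "c \<in> carrier ?F" for c
  proof (rule free_lin_hom_eqI[OF N lin_hom_comp[OF tl g] lin_hom_comp[OF e f] _ that])
    fix x assume x: "x \<in> carrier P"
    have "?t (free_gen R x) = t x" by (rule lin_ext_gen[OF M _ x]) (use t in auto)
    moreover have "?e (free_gen R x) = x" by (rule lin_ext_gen[OF mP _ x]) auto
    ultimately show "g (?t (free_gen R x)) = f (?e (free_gen R x))" using t[OF x] by simp
  qed
  show thesis
  proof (rule that[OF lin_hom_comp[OF s(1) tl]])
    fix x assume "x \<in> carrier P"
    then show "g (?t (s x)) = f x" using eq[of "s x"] s lin_homD(1)[OF s(1)] by simp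
  qed
qed

text \<open>Dual basis argument: with preimages \<open>t b\<close> of \<open>f (e b)\<close>, the
  lift is \<open>x \<mapsto> \<Sum> ev b x \<odot> t b\<close>, and \<open>expand\<close> shows that
  it lies over \<open>f\<close>.\<close>

lemma finite_basis_projective:
  fixes P :: "('a, 'm) module"
  assumes P: "module R P" and B: "finite B" and e: "\<And>b. b \<in> B \<Longrightarrow> e b \<in> carrier P"
    and ev: "\<And>b. b \<in> B \<Longrightarrow> ev b \<in> lin_hom R P (self_module R)"
    and expand: "\<And>x. x \<in> carrier P \<Longrightarrow> x = (\<Oplus>\<^bsub>P\<^esub>b\<in>B. ev b x \<odot>\<^bsub>P\<^esub> e b)"
  shows "projective R P"
  unfolding projective_def
proof (intro conjI P allI impI)
  fix M :: "('a, 'm \<Rightarrow> 'a) module" and N :: "('a, 'm) module" and g f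
  assume A: "module R M \<and> module R N \<and> g \<in> lin_hom R M N \<and> g ` carrier M = carrier N \<and> f \<in> lin_hom R P N"
  interpret P: module R P by fact
  interpret M: module R M using A by simp
  interpret N: module R N using A by simp
  have g: "g \<in> lin_hom R M N" and f: "f \<in> lin_hom R P N" and sur: "g ` carrier M = carrier N" using A by auto
  have "\<exists>m. m \<in> carrier M \<and> g m = f (e b)" if "b \<in> B" for b
    using sur lin_homD(1)[OF f e[OF that]] by (metis image_iff)
  then obtain t where t: "\<And>b. b \<in> B \<Longrightarrow> t b \<in> carrier M \<and> g (t b) = f (e b)" by metis
  have evc: "ev b x \<in> carrier R" if "b \<in> B" "x \<in> carrier P" for b x
    using lin_homD(1)[OF ev[OF that(1)] that(2)] by simp
  have lin: "(\<lambda>x. ev b x \<odot>\<^bsub>M\<^esub> t b) \<in> lin_hom R P M" if b: "b \<in> B" for b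
    using lin_homD[OF ev[OF b]] t[OF b]
    by (intro lin_homI) (auto simp: M.smult_l_distr M.smult_assoc1)
  show "\<exists>h\<in>lin_hom R P M. \<forall>x\<in>carrier P. g (h x) = f x"
  proof (intro bexI ballI)
    show "(\<lambda>x. \<Oplus>\<^bsub>M\<^esub>b\<in>B. ev b x \<odot>\<^bsub>M\<^esub> t b) \<in> lin_hom R P M"
      by (rule lin_hom_finsum_fun[OF P M.module_axioms B lin])
    fix x assume x: "x \<in> carrier P"
    have "g (\<Oplus>\<^bsub>M\<^esub>b\<in>B. ev b x \<odot>\<^bsub>M\<^esub> t b) = (\<Oplus>\<^bsub>N\<^esub>b\<in>B. g (ev b x \<odot>\<^bsub>M\<^esub> t b))"
      by (rule lin_hom_finsum[OF M.module_axioms N.module_axioms g]) (use evc x t in auto)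
    also have "\<dots> = (\<Oplus>\<^bsub>N\<^esub>b\<in>B. f (ev b x \<odot>\<^bsub>P\<^esub> e b))"
      by (rule N.finsum_cong')
        (use evc x t e lin_homD[OF f] in \<open>auto simp: lin_homD(3)[OF g] lin_homD(3)[OF f]\<close>)
    also have "\<dots> = f (\<Oplus>\<^bsub>P\<^esub>b\<in>B. ev b x \<odot>\<^bsub>P\<^esub> e b)"
      by (rule lin_hom_finsum[OF P N.module_axioms f, symmetric]) (use evc x e in auto)
    finally show "g (\<Oplus>\<^bsub>M\<^esub>b\<in>B. ev b x \<odot>\<^bsub>M\<^esub> t b) = f x" using expand[OF x] by simp
  qed
qed

end

subsection \<open>Tensor products\<close>

lemma span_module_submodule:
  assumes "module R M" "G \<subseteq> carrier M"
  shows "submodule (span_module R M G) R M"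
proof -
  interpret M: module R M by fact
  have top: "submodule (carrier M) R M" by (rule M.carrier_is_submodule)
  show ?thesis
  proof (rule M.submoduleI)
    show "span_module R M G \<subseteq> carrier M" using top assms(2) by (auto simp: span_module_def)
    show "\<zero>\<^bsub>M\<^esub> \<in> span_module R M G"
      using submodule_zero by (auto simp: span_module_def)
  qed (auto simp: span_module_def M.submoduleE(3-5))
qed

lemma span_module_mem: "x \<in> G \<Longrightarrow> x \<in> span_module R M G"
  by (auto simp: span_module_def)

lemma span_module_minimal: "submodule H R M \<Longrightarrow> G \<subseteq> H \<Longrightarrow> span_module R M G \<subseteq> H"
  by (auto simp: span_module_def)

definition bilinear_map ::
    "('a, 'c) ring_scheme \<Rightarrow> ('a, 'm, 'x) module_scheme \<Rightarrow> ('a, 'n, 'y) module_scheme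
      \<Rightarrow> ('a, 'l, 'z) module_scheme \<Rightarrow> ('m \<Rightarrow> 'n \<Rightarrow> 'l) \<Rightarrow> bool"
  where "bilinear_map R M N L b \<longleftrightarrow>
    (\<forall>y\<in>carrier N. (\<lambda>x. b x y) \<in> lin_hom R M L) \<and> (\<forall>x\<in>carrier M. b x \<in> lin_hom R N L)"

text \<open>Maps on cosets are defined throughout as \<open>the_elem\<close> of the image of the
  coset. This reduces their evaluation to constancy on the coset, that is, to
  well-definedness.\<close>

lemma the_elem_image_eq:
  assumes "x \<in> X" "\<And>y. y \<in> X \<Longrightarrow> f y = f x"
  shows "the_elem (f ` X) = f x"
proof -
  have "f ` X = {f x}"
  proof
    show "f ` X \<subseteq> {f x}" using assms(2) by blast
  qed (use assms(1) in blast)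
  then show ?thesis by simp
qed

locale tensor_product = M?: module R M + N: module R N
  for R :: "('a, 'c) ring_scheme" (structure) and M :: "('a, 'm) module" and N :: "('a, 'n) module"
begin

abbreviation F where "F \<equiv> free_module R (carrier M \<times> carrier N)"
abbreviation pt where "pt \<equiv> pure_tensor R M N"

lemma F_module: "module R F"
  by (rule R.free_module_module)

lemma rels_closed: "tensor_rels R M N \<subseteq> carrier F"
proof -
  interpret F: module R F by (rule F_module)
  have "z \<in> carrier M \<times> carrier N \<Longrightarrow> free_gen R z \<in> carrier F" for z by (rule R.free_gen_closed)
  then show ?thesis unfolding tensor_rels_def Let_def
    by (auto simp del: free_module_simps intro!: F.minus_closed F.a_closed F.smult_closed)
qed

sublocale T: quotient R F "tensor_null R M N"
  by (intro quotientI F_module) (simp add: tensor_null_def span_module_submodule[OF F_module rels_closed])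

lemma tensor_module: "module R (tensor R M N)"
  unfolding tensor_def by (rule T.quot_module_module)

lemma pure_tensor_closed:
  "x \<in> carrier M \<Longrightarrow> y \<in> carrier N \<Longrightarrow> pt x y \<in> carrier (tensor R M N)"
  unfolding tensor_def pure_tensor_def by (intro T.quot_closed R.free_gen_closed) simp

lemma bilinear_pure_tensor: "bilinear_map R M N (tensor R M N) pt"
proof -
  interpret F: module R F by (rule F_module)
  have g: "z \<in> carrier M \<times> carrier N \<Longrightarrow> free_gen R z \<in> carrier F" for z by (rule R.free_gen_closed)
  have rel: "c \<in> tensor_rels R M N \<Longrightarrow> c \<in> tensor_null R M N" for c
    by (simp add: tensor_null_def span_module_mem)
  have ml: "pt (x \<oplus>\<^bsub>M\<^esub> x') y = pt x y \<oplus>\<^bsub>tensor R M N\<^esub> pt x' y"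
    if "x \<in> carrier M" "x' \<in> carrier M" "y \<in> carrier N" for x x' y
  proof -
    have "free_gen R (x \<oplus>\<^bsub>M\<^esub> x', y) \<ominus>\<^bsub>F\<^esub> (free_gen R (x, y) \<oplus>\<^bsub>F\<^esub> free_gen R (x', y)) \<in> tensor_null R M N"
      by (rule rel) (use that in \<open>unfold tensor_rels_def Let_def, blast\<close>)
    then show ?thesis unfolding tensor_def pure_tensor_def
      by (subst T.quot_add) (use that g in \<open>auto simp: T.coset_eq_iff simp del: free_module_simps\<close>)
  qed
  have mr: "pt x (y \<oplus>\<^bsub>N\<^esub> y') = pt x y \<oplus>\<^bsub>tensor R M N\<^esub> pt x y'"
    if "x \<in> carrier M" "y \<in> carrier N" "y' \<in> carrier N" for x y y'
  proof -
    have "free_gen R (x, y \<oplus>\<^bsub>N\<^esub> y') \<ominus>\<^bsub>F\<^esub> (free_gen R (x, y) \<oplus>\<^bsub>F\<^esub> free_gen R (x, y')) \<in> tensor_null R M N"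
      by (rule rel) (use that in \<open>unfold tensor_rels_def Let_def, blast\<close>)
    then show ?thesis unfolding tensor_def pure_tensor_def
      by (subst T.quot_add) (use that g in \<open>auto simp: T.coset_eq_iff simp del: free_module_simps\<close>)
  qed
  have sl: "pt (a \<odot>\<^bsub>M\<^esub> x) y = a \<odot>\<^bsub>tensor R M N\<^esub> pt x y"
    if "a \<in> carrier R" "x \<in> carrier M" "y \<in> carrier N" for a x y
  proof -
    have "free_gen R (a \<odot>\<^bsub>M\<^esub> x, y) \<ominus>\<^bsub>F\<^esub> a \<odot>\<^bsub>F\<^esub> free_gen R (x, y) \<in> tensor_null R M N"
      by (rule rel) (use that in \<open>unfold tensor_rels_def Let_def, blast\<close>)
    then show ?thesis unfolding tensor_def pure_tensor_def
      by (subst T.quot_smult) (use that g in \<open>auto simp: T.coset_eq_iff simp del: free_module_simps\<close>)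
  qed
  have sr: "pt x (a \<odot>\<^bsub>N\<^esub> y) = a \<odot>\<^bsub>tensor R M N\<^esub> pt x y"
    if "a \<in> carrier R" "x \<in> carrier M" "y \<in> carrier N" for a x y
  proof -
    have "free_gen R (x, a \<odot>\<^bsub>N\<^esub> y) \<ominus>\<^bsub>F\<^esub> a \<odot>\<^bsub>F\<^esub> free_gen R (x, y) \<in> tensor_null R M N"
      by (rule rel) (use that in \<open>unfold tensor_rels_def Let_def, blast\<close>)
    then show ?thesis unfolding tensor_def pure_tensor_def
      by (subst T.quot_smult) (use that g in \<open>auto simp: T.coset_eq_iff simp del: free_module_simps\<close>)
  qed
  show ?thesis unfolding bilinear_map_def
    by (auto intro!: lin_homI simp: ml mr sl sr pure_tensor_closed)
qed

text \<open>By bilinearity a scalar multiple of a pure tensor is again pure, so sums of pure tensors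
  exhaust the tensor product and no case for scalars arises.\<close>

lemma tensor_induct [consumes 1, case_names pure add]:
  assumes "t \<in> carrier (tensor R M N)"
    and pure: "\<And>x y. x \<in> carrier M \<Longrightarrow> y \<in> carrier N \<Longrightarrow> P (pt x y)"
    and add: "\<And>t t'. t \<in> carrier (tensor R M N) \<Longrightarrow> t' \<in> carrier (tensor R M N) \<Longrightarrow> P t \<Longrightarrow> P t' \<Longrightarrow>
      P (t \<oplus>\<^bsub>tensor R M N\<^esub> t')"
  shows "P t"
proof -
  interpret TT: module R "tensor R M N" by (rule tensor_module)
  note bl = bilinear_pure_tensor[unfolded bilinear_map_def]
  note pl = lin_homD[OF bspec[OF conjunct1[OF bl]]]
  note proj = T.quot_proj_lin[folded tensor_def]
  have sm: "P (tensor_null R M N +>\<^bsub>F\<^esub> (a \<odot>\<^bsub>F\<^esub> free_gen R z))" if az: "a \<in> carrier R" "z \<in> carrier M \<times> carrier N" for a z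
  proof -
    obtain x y where z: "z = (x, y)" "x \<in> carrier M" "y \<in> carrier N" using az by (cases z) auto
    have "tensor_null R M N +>\<^bsub>F\<^esub> (a \<odot>\<^bsub>F\<^esub> free_gen R z) = a \<odot>\<^bsub>tensor R M N\<^esub> pt x y"
      unfolding tensor_def pure_tensor_def z(1)
      by (rule T.quot_smult[symmetric]) (use that z in \<open>auto intro: R.free_gen_closed\<close>)
    also have "\<dots> = pt (a \<odot>\<^bsub>M\<^esub> x) y" using pl(3) that z by metis
    finally show ?thesis using pure[of "a \<odot>\<^bsub>M\<^esub> x" y] that z by simp
  qed
  obtain c where c: "c \<in> carrier F" "t = tensor_null R M N +>\<^bsub>F\<^esub> c"
    using assms(1) by (auto simp: tensor_def quot_module_carrier)
  have "P (tensor_null R M N +>\<^bsub>F\<^esub> c)" using c(1)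
  proof (rule R.free_module_induct)
    have "pt \<zero>\<^bsub>M\<^esub> \<zero>\<^bsub>N\<^esub> = \<zero>\<^bsub>tensor R M N\<^esub>"
      using lin_hom_zero[OF M.module_axioms tensor_module bspec[OF conjunct1[OF bl] N.zero_closed]] .
    also have "\<dots> = tensor_null R M N +>\<^bsub>F\<^esub> \<zero>\<^bsub>F\<^esub>"
      using lin_hom_zero[OF F_module tensor_module proj] by simp
    finally show "P (tensor_null R M N +>\<^bsub>F\<^esub> \<zero>\<^bsub>F\<^esub>)"
      using pure[OF M.zero_closed N.zero_closed] by simp
  next
    fix c d assume cd: "c \<in> carrier F" "d \<in> carrier F"
      "P (tensor_null R M N +>\<^bsub>F\<^esub> c)" "P (tensor_null R M N +>\<^bsub>F\<^esub> d)"
    show "P (tensor_null R M N +>\<^bsub>F\<^esub> (c \<oplus>\<^bsub>F\<^esub> d))"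
      using add[OF lin_homD(1)[OF proj cd(1)] lin_homD(1)[OF proj cd(2)] cd(3,4)]
        lin_homD(2)[OF proj cd(1,2)] by metis
  qed (rule sm)
  then show ?thesis using c by simp
qed

context
  fixes L :: "('a, 'l) module" and b
  assumes L: "module R L" and b: "bilinear_map R M N L b"
begin

private lemma b_left: "y \<in> carrier N \<Longrightarrow> (\<lambda>x. b x y) \<in> lin_hom R M L"
  and b_right: "x \<in> carrier M \<Longrightarrow> b x \<in> lin_hom R N L"
  using b by (auto simp: bilinear_map_def)

private abbreviation "E \<equiv> lin_ext L R (carrier M \<times> carrier N) (\<lambda>z. b (fst z) (snd z))"

private lemma b_Pi: "(\<lambda>z. b (fst z) (snd z)) \<in> carrier M \<times> carrier N \<rightarrow> carrier L"
  using lin_homD(1)[OF b_right] by auto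

private lemma E_lin: "E \<in> lin_hom R F L"
  by (rule R.lin_ext_lin[OF L b_Pi])

private lemma E_gen: "x \<in> carrier M \<Longrightarrow> y \<in> carrier N \<Longrightarrow> E (free_gen R (x, y)) = b x y"
  by (subst R.lin_ext_gen[OF L b_Pi]) auto

private lemma E_null: "tensor_null R M N \<subseteq> a_kernel F L E"
  unfolding tensor_null_def
proof (rule span_module_minimal[OF lin_hom_kernel_submodule[OF F_module L E_lin]])
  interpret L: module R L by (rule L)
  interpret F: module R F by (rule F_module)
  note bl = lin_homD[OF b_left] and br = lin_homD[OF b_right]
  have g: "x \<in> carrier M \<Longrightarrow> y \<in> carrier N \<Longrightarrow> free_gen R (x, y) \<in> carrier F" for x y
    by (rule R.free_gen_closed) simp
  have [simp]: "E (c \<ominus>\<^bsub>F\<^esub> d) = \<zero>\<^bsub>L\<^esub>" if "c \<in> carrier F" "d \<in> carrier F" "E c = E d" for c d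
    using that lin_homD(1)[OF E_lin that(2)] lin_hom_minus[OF F_module L E_lin that(1,2)]
    by (simp add: L.r_neg a_minus_def)
  note [simp del] = free_module_simps
  show "tensor_rels R M N \<subseteq> a_kernel F L E"
    unfolding tensor_rels_def Let_def
    by (auto simp: a_kernel_def' g lin_homD(2,3)[OF E_lin] E_gen bl br)
qed

text \<open>The linear extension of a bilinear map kills the defining relations, hence all of
  \<open>tensor_null\<close> by minimality of the span. It is therefore constant on cosets, and
  \<open>the_elem\<close> returns its value.\<close>

lemma tensor_lift_coset:
  assumes "c \<in> carrier F"
  shows "tensor_lift R M N L b (tensor_null R M N +>\<^bsub>F\<^esub> c) = E c"
proof -
  interpret L: module R L by (rule L)
  have "E d = E c" if "d \<in> tensor_null R M N +>\<^bsub>F\<^esub> c" for d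
  proof -
    have d: "d \<in> carrier F" "d \<ominus>\<^bsub>F\<^esub> c \<in> tensor_null R M N"
      using that assms T.mem_coset_iff T.coset_eq_iff by auto
    then have "E d \<ominus>\<^bsub>L\<^esub> E c = \<zero>\<^bsub>L\<^esub>"
      using E_null lin_hom_minus[OF F_module L E_lin d(1) assms] by (auto simp: a_kernel_def')
    then show ?thesis using lin_homD(1)[OF E_lin] d assms by (simp add: L.minus_eq_zero_iff)
  qed
  then show ?thesis
    unfolding tensor_lift_def
    using the_elem_image_eq[OF T.coset_self[OF assms], of E] by (simp add: lin_ext_def[abs_def])
qed

lemma tensor_lift_lin: "tensor_lift R M N L b \<in> lin_hom R (tensor R M N) L"
proof -
  interpret F: module R F by (rule F_module)
  note [simp del] = free_module_simps
  show ?thesis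
    by (rule lin_homI)
      (auto simp: tensor_def quot_module_carrier tensor_lift_coset T.quot_add T.quot_smult
         lin_homD[OF E_lin] simp del: quot_module_simps)
qed

lemma tensor_lift_pure: "x \<in> carrier M \<Longrightarrow> y \<in> carrier N \<Longrightarrow> tensor_lift R M N L b (pt x y) = b x y"
  unfolding pure_tensor_def by (subst tensor_lift_coset) (auto simp: R.free_gen_closed E_gen)

end

end

lemma bilinear_map_comp:
  assumes "bilinear_map R M' N' L b" "f \<in> lin_hom R M M'" "g \<in> lin_hom R N N'"
  shows "bilinear_map R M N L (\<lambda>x y. b (f x) (g y))"
  using assms unfolding bilinear_map_def
  by (auto intro: lin_hom_comp[of f R M M' "\<lambda>x. b x _"] lin_hom_comp[of g R N N'] lin_homD(1))

context
  fixes R :: "('a, 'c) ring_scheme" and M :: "('a, 'm) module" and N :: "('a, 'n) module"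
    and M' :: "('a, 'k) module" and N' :: "('a, 'l) module" and f g
  assumes modules: "module R M" "module R N" "module R M'" "module R N'"
    and fg: "f \<in> lin_hom R M M'" "g \<in> lin_hom R N N'"
begin

interpretation A: tensor_product R M N by (simp add: tensor_product_def modules)
interpretation B: tensor_product R M' N' by (simp add: tensor_product_def modules)

lemma tensor_map_lin: "tensor_map R M N M' N' f g \<in> lin_hom R (tensor R M N) (tensor R M' N')"
  unfolding tensor_map_def
  by (rule A.tensor_lift_lin[OF B.tensor_module bilinear_map_comp[OF B.bilinear_pure_tensor fg]])

lemma tensor_map_pure:
  "x \<in> carrier M \<Longrightarrow> y \<in> carrier N \<Longrightarrow>
    tensor_map R M N M' N' f g (pure_tensor R M N x y) = pure_tensor R M' N' (f x) (g y)"
  unfolding tensor_map_def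
  by (rule A.tensor_lift_pure[OF B.tensor_module bilinear_map_comp[OF B.bilinear_pure_tensor fg]])

end

section \<open>Base change to a quotient ring\<close>

lemma coset_carrier_update [simp]:
  "N +>\<^bsub>M\<lparr>carrier := H\<rparr>\<^esub> x = N +>\<^bsub>M\<^esub> x" "N <+>\<^bsub>M\<lparr>carrier := H\<rparr>\<^esub> N' = N <+>\<^bsub>M\<^esub> N'"
  "N +>\<^bsub>self_module R\<^esub> y = N +>\<^bsub>R\<^esub> y" "N <+>\<^bsub>self_module R\<^esub> N' = N <+>\<^bsub>R\<^esub> N'"
  by (simp_all add: a_r_coset_def' set_add_def' self_module_def)

text \<open>The tensor \<open>1 \<otimes> x\<close>. As \<open>R/I\<close> is generated by the class
  of 1, every element of \<open>R/I \<otimes> M\<close> has this form, so computations over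
  \<open>R/I\<close> can be done with representatives in \<open>M\<close>.\<close>

definition one_tensor ::
    "('a, 'c) ring_scheme \<Rightarrow> 'a set \<Rightarrow> ('a, 'm) module \<Rightarrow> 'm \<Rightarrow> ('a, 'm) tens_el"
  where "one_tensor R I M x = pure_tensor R (quot_ring_module R I) M (I +>\<^bsub>R\<^esub> \<one>\<^bsub>R\<^esub>) x"

lemma over_quotient_simps [simp]:
  "carrier (over_quotient M) = carrier M" "\<zero>\<^bsub>over_quotient M\<^esub> = \<zero>\<^bsub>M\<^esub>"
  "x \<oplus>\<^bsub>over_quotient M\<^esub> y = x \<oplus>\<^bsub>M\<^esub> y"
  by (simp_all add: over_quotient_def)

lemma finsum_over_quotient: "finsum (over_quotient M) = finsum M"
  by (rule ext)+ (simp add: finsum_def finprod_def over_quotient_def)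

locale quotient_by_ideal = R?: cring R + ideal I R for R (structure) and I
begin

abbreviation S where "S \<equiv> R Quot I"
abbreviation B where "B \<equiv> quot_ring_module R I"

lemma S_cring: "cring S"
  by (rule quotient_is_cring) (rule R.is_cring)

lemma I_submodule: "submodule I R (self_module R)"
proof -
  have "(self_module R)\<lparr>carrier := carrier R\<rparr> = self_module R" by (simp add: self_module_def)
  then show ?thesis
    using ideal_submodule[OF R.is_cring ideal_axioms a_subset, unfolded self_module_def]
      module.carrier_is_submodule[OF self_module_module[OF R.is_cring]]
    by (simp add: self_module_def)
qed

sublocale BQ: quotient R "self_module R" I
  by (intro quotientI self_module_module R.is_cring I_submodule)

lemma B_module: "module R B"
  unfolding quot_ring_module_def by (rule BQ.quot_module_module)

lemma B_carrier: "carrier B = carrier S"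
  by (simp add: quot_ring_module_def quot_module_def FactRing_def A_RCOSETS_def')

lemma S_carrier: "carrier S = (\<lambda>x. I +>\<^bsub>R\<^esub> x) ` carrier R"
  by (auto simp: FactRing_def A_RCOSETS_def')

lemma S_simps:
  "\<zero>\<^bsub>S\<^esub> = I" "\<one>\<^bsub>S\<^esub> = I +>\<^bsub>R\<^esub> \<one>" "X \<oplus>\<^bsub>S\<^esub> Y = X <+>\<^bsub>R\<^esub> Y"
  by (simp_all add: FactRing_def)

lemma coset_closed: "x \<in> carrier R \<Longrightarrow> I +>\<^bsub>R\<^esub> x \<in> carrier S"
  by (simp add: S_carrier)

lemma coset_add: "x \<in> carrier R \<Longrightarrow> y \<in> carrier R \<Longrightarrow> (I +>\<^bsub>R\<^esub> x) \<oplus>\<^bsub>S\<^esub> (I +>\<^bsub>R\<^esub> y) = I +>\<^bsub>R\<^esub> (x \<oplus> y)"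
  by (simp add: S_simps a_rcos_sum)

lemma coset_mult: "x \<in> carrier R \<Longrightarrow> y \<in> carrier R \<Longrightarrow> (I +>\<^bsub>R\<^esub> x) \<otimes>\<^bsub>S\<^esub> (I +>\<^bsub>R\<^esub> y) = I +>\<^bsub>R\<^esub> (x \<otimes> y)"
  by (simp add: FactRing_def rcoset_mult_add)

lemma coset_zero_iff: "x \<in> carrier R \<Longrightarrow> I +>\<^bsub>R\<^esub> x = I \<longleftrightarrow> x \<in> I"
  using BQ.coset_eq_zero_iff by simp

lemma coset_eq_iff:
  assumes "x \<in> carrier R" "y \<in> carrier R"
  shows "I +>\<^bsub>R\<^esub> x = I +>\<^bsub>R\<^esub> y \<longleftrightarrow> x \<ominus> y \<in> I"
  using assms a_rcos_module[of y x] a_repr_independence' a_repr_independenceD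
  by (metis minus_eq)

lemma B_smult: "a \<in> carrier R \<Longrightarrow> x \<in> carrier R \<Longrightarrow> a \<odot>\<^bsub>B\<^esub> (I +>\<^bsub>R\<^esub> x) = I +>\<^bsub>R\<^esub> (a \<otimes> x)"
  using BQ.quot_smult by (simp add: quot_ring_module_def)

lemma over_quotient_smult:
  assumes "module R M" and ann: "\<And>a x. a \<in> I \<Longrightarrow> x \<in> carrier M \<Longrightarrow> a \<odot>\<^bsub>M\<^esub> x = \<zero>\<^bsub>M\<^esub>"
    and "a \<in> carrier R" "x \<in> carrier M"
  shows "(I +>\<^bsub>R\<^esub> a) \<odot>\<^bsub>over_quotient M\<^esub> x = a \<odot>\<^bsub>M\<^esub> x"
proof -
  interpret M: module R M by fact
  have "a' \<odot>\<^bsub>M\<^esub> x = a \<odot>\<^bsub>M\<^esub> x" if a': "a' \<in> I +>\<^bsub>R\<^esub> a" for a'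
  proof -
    obtain h where "h \<in> I" "a' = h \<oplus> a" using a' by (auto simp: a_r_coset_def')
    then show ?thesis using assms by (simp add: M.smult_l_distr)
  qed
  then have "the_elem ((\<lambda>a'. a' \<odot>\<^bsub>M\<^esub> x) ` (I +>\<^bsub>R\<^esub> a)) = a \<odot>\<^bsub>M\<^esub> x"
    by (rule the_elem_image_eq[OF a_rcos_self[OF assms(3)]])
  then show ?thesis by (simp add: over_quotient_def)
qed

lemma over_quotient_module:
  assumes "module R M" and ann: "\<And>a x. a \<in> I \<Longrightarrow> x \<in> carrier M \<Longrightarrow> a \<odot>\<^bsub>M\<^esub> x = \<zero>\<^bsub>M\<^esub>"
  shows "module S (over_quotient M)"
proof -
  interpret M: module R M by fact
  note sm = over_quotient_smult[OF assms]
  show ?thesis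
  proof (rule moduleI[OF S_cring])
    show "abelian_group (over_quotient M)"
      by (rule abelian_group_cong[OF M.abelian_group_axioms]) (auto simp: over_quotient_def)
  qed (auto simp: S_carrier coset_add coset_mult sm M.smult_l_distr M.smult_r_distr M.smult_assoc1
       S_simps(2) simp del: S_simps(3))
qed

lemma lin_hom_over_quotient:
  assumes "module R M" "\<And>a x. a \<in> I \<Longrightarrow> x \<in> carrier M \<Longrightarrow> a \<odot>\<^bsub>M\<^esub> x = \<zero>\<^bsub>M\<^esub>"
    and "\<And>x. x \<in> carrier M \<Longrightarrow> f x \<in> carrier N"
    and "\<And>x y. x \<in> carrier M \<Longrightarrow> y \<in> carrier M \<Longrightarrow> f (x \<oplus>\<^bsub>M\<^esub> y) = f x \<oplus>\<^bsub>N\<^esub> f y"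
    and "\<And>a x. a \<in> carrier R \<Longrightarrow> x \<in> carrier M \<Longrightarrow> f (a \<odot>\<^bsub>M\<^esub> x) = (I +>\<^bsub>R\<^esub> a) \<odot>\<^bsub>N\<^esub> f x"
  shows "f \<in> lin_hom S (over_quotient M) N"
proof (rule lin_homI)
  fix c x assume "c \<in> carrier S" and x: "x \<in> carrier (over_quotient M)"
  then obtain a where a: "a \<in> carrier R" "c = I +>\<^bsub>R\<^esub> a" by (auto simp: S_carrier)
  have "c \<odot>\<^bsub>over_quotient M\<^esub> x = a \<odot>\<^bsub>M\<^esub> x"
    unfolding a(2) using over_quotient_smult[OF assms(1,2) a(1)] x by simp
  then show "f (c \<odot>\<^bsub>over_quotient M\<^esub> x) = c \<odot>\<^bsub>N\<^esub> f x" using assms(5) a x by simp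
qed (use assms(3,4) in auto)

end

locale base_change = quotient_by_ideal R I + M: module R M
  for R :: "('a, 'c) ring_scheme" (structure) and I and M :: "('a, 'm) module"
begin

sublocale BM: tensor_product R B M
  by (simp add: tensor_product_def B_module M.module_axioms)

lemmas tensor_base_module = BM.tensor_module

lemma one_tensor_lin: "one_tensor R I M \<in> lin_hom R M (tensor R B M)"
  using BM.bilinear_pure_tensor coset_closed[OF R.one_closed]
  by (auto simp: bilinear_map_def one_tensor_def[abs_def] B_carrier)

lemma pure_tensor_eq_one_tensor:
  assumes "a \<in> carrier R" "x \<in> carrier M"
  shows "pure_tensor R B M (I +>\<^bsub>R\<^esub> a) x = one_tensor R I M (a \<odot>\<^bsub>M\<^esub> x)"
proof -
  note left = lin_homD(3)[OF bspec[OF conjunct1[OF BM.bilinear_pure_tensor[unfolded bilinear_map_def]] assms(2)]]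
  have one: "I +>\<^bsub>R\<^esub> \<one> \<in> carrier B" using coset_closed by (simp add: B_carrier)
  have "pure_tensor R B M (a \<odot>\<^bsub>B\<^esub> (I +>\<^bsub>R\<^esub> \<one>)) x = a \<odot>\<^bsub>tensor R B M\<^esub> one_tensor R I M x"
    unfolding one_tensor_def by (rule left[OF assms(1) one])
  then show ?thesis using assms lin_homD(3)[OF one_tensor_lin] by (simp add: B_smult)
qed

lemma one_tensor_surj:
  assumes "t \<in> carrier (tensor R B M)"
  obtains x where "x \<in> carrier M" "t = one_tensor R I M x"
proof -
  have "\<exists>x\<in>carrier M. t = one_tensor R I M x"
    using assms
  proof (induction rule: BM.tensor_induct)
    case (pure c x)
    then obtain a where "a \<in> carrier R" "c = I +>\<^bsub>R\<^esub> a" by (auto simp: B_carrier S_carrier)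
    then show ?case using pure_tensor_eq_one_tensor pure by blast
  next
    case (add t t')
    then show ?case using lin_homD(2)[OF one_tensor_lin] by (metis M.a_closed)
  qed
  then show thesis using that by blast
qed

lemma one_tensor_ideal:
  assumes "a \<in> I" "x \<in> carrier M"
  shows "one_tensor R I M (a \<odot>\<^bsub>M\<^esub> x) = \<zero>\<^bsub>tensor R B M\<^esub>"
proof -
  note left = bspec[OF conjunct1[OF BM.bilinear_pure_tensor[unfolded bilinear_map_def]] assms(2)]
  have "\<zero>\<^bsub>B\<^esub> = I +>\<^bsub>R\<^esub> a" using assms(1) a_rcos_const by (simp add: quot_ring_module_def)
  then show ?thesis
    using lin_hom_zero[OF B_module tensor_base_module left] pure_tensor_eq_one_tensor[of a x] assms by simp
qed

lemma one_tensor_coordinates_ideal: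
  assumes "\<And>b. b \<in> X \<Longrightarrow> e b \<in> carrier M" "\<And>b. b \<in> X \<Longrightarrow> c b \<in> I"
  shows "one_tensor R I M (\<Oplus>\<^bsub>M\<^esub>b\<in>X. c b \<odot>\<^bsub>M\<^esub> e b) = \<zero>\<^bsub>tensor R B M\<^esub>"
proof -
  interpret T: module R "tensor R B M" by (rule tensor_base_module)
  have "one_tensor R I M (\<Oplus>\<^bsub>M\<^esub>b\<in>X. c b \<odot>\<^bsub>M\<^esub> e b) = (\<Oplus>\<^bsub>tensor R B M\<^esub>b\<in>X. one_tensor R I M (c b \<odot>\<^bsub>M\<^esub> e b))"
    by (rule lin_hom_finsum[OF M.module_axioms tensor_base_module one_tensor_lin]) (use assms in auto)
  also have "\<dots> = (\<Oplus>\<^bsub>tensor R B M\<^esub>b\<in>X. \<zero>\<^bsub>tensor R B M\<^esub>)"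
    by (rule T.finsum_cong') (use assms one_tensor_ideal in auto)
  finally show ?thesis by simp
qed

end

section \<open>Base change of linear maps, and detection of zero tensors\<close>

context quotient_by_ideal
begin

lemma base_changeI: "module R M \<Longrightarrow> base_change R I M"
  by (simp add: base_change_def module_def quotient_by_ideal_axioms)

text \<open>The action map \<open>R/I \<otimes> R \<rightarrow> R/I\<close> sends
  \<open>1 \<otimes> a\<close> to the class of \<open>a\<close>. Through coordinate functionals,
  this case also detects the vanishing of tensors in the Koszul modules.\<close>

lemma one_tensor_self_module:
  assumes "a \<in> carrier R" "one_tensor R I (self_module R) a = \<zero>\<^bsub>tensor R B (self_module R)\<^esub>"
  shows "a \<in> I"
proof -
  interpret bc: base_change R I "self_module R" by (intro base_changeI self_module_module R.is_cring)
  let ?b = "\<lambda>c a. a \<odot>\<^bsub>B\<^esub> c"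
  note ms = module.smult_closed[OF B_module] module.smult_l_distr[OF B_module]
    module.smult_r_distr[OF B_module] module.smult_assoc1[OF B_module, symmetric]
  have bil: "bilinear_map R B (self_module R) B ?b"
    unfolding bilinear_map_def by (auto intro!: lin_homI simp: ms m_comm)
  have one: "I +>\<^bsub>R\<^esub> \<one> \<in> carrier B" using coset_closed by (simp add: B_carrier)
  let ?l = "tensor_lift R B (self_module R) B ?b"
  have "?l (one_tensor R I (self_module R) a) = a \<odot>\<^bsub>B\<^esub> (I +>\<^bsub>R\<^esub> \<one>)"
    unfolding one_tensor_def by (rule bc.BM.tensor_lift_pure[OF B_module bil one]) (use assms(1) in simp)
  also have "\<dots> = I +>\<^bsub>R\<^esub> a" using assms(1) by (simp add: B_smult)
  finally have "I +>\<^bsub>R\<^esub> a = \<zero>\<^bsub>B\<^esub>"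
    unfolding assms(2) using lin_hom_zero[OF bc.tensor_base_module B_module bc.BM.tensor_lift_lin[OF B_module bil]] by simp
  then show ?thesis using coset_zero_iff[OF assms(1)] by (simp add: quot_ring_module_def)
qed

context
  fixes M :: "('a, 'm) module" and N :: "('a, 'n) module" and f
  assumes M: "module R M" and N: "module R N" and f: "f \<in> lin_hom R M N"
begin

interpretation M: base_change R I M by (rule base_changeI[OF M])
interpretation N: base_change R I N by (rule base_changeI[OF N])

lemma base_change_map_lin: "tensor_map R B M B N (\<lambda>x. x) f \<in> lin_hom R (tensor R B M) (tensor R B N)"
  by (rule tensor_map_lin[OF B_module M B_module N lin_hom_ident f])

lemma base_change_map_one:
  "x \<in> carrier M \<Longrightarrow> tensor_map R B M B N (\<lambda>x. x) f (one_tensor R I M x) = one_tensor R I N (f x)"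
  unfolding one_tensor_def
  by (rule tensor_map_pure[OF B_module M B_module N lin_hom_ident f])
    (auto simp: B_carrier coset_closed)

lemma one_tensor_map_eq:
  assumes "x \<in> carrier M" "y \<in> carrier M" "one_tensor R I M x = one_tensor R I M y"
  shows "one_tensor R I N (f x) = one_tensor R I N (f y)"
  using assms base_change_map_one by metis

lemma one_tensor_map_zero:
  assumes "x \<in> carrier M" "one_tensor R I M x = \<zero>\<^bsub>tensor R B M\<^esub>"
  shows "one_tensor R I N (f x) = \<zero>\<^bsub>tensor R B N\<^esub>"
proof -
  have "one_tensor R I M \<zero>\<^bsub>M\<^esub> = \<zero>\<^bsub>tensor R B M\<^esub>" "one_tensor R I N (f \<zero>\<^bsub>M\<^esub>) = \<zero>\<^bsub>tensor R B N\<^esub>"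
    using lin_hom_zero[OF M M.tensor_base_module M.one_tensor_lin]
      lin_hom_zero[OF N N.tensor_base_module N.one_tensor_lin] lin_hom_zero[OF M N f] by simp_all
  then show ?thesis using one_tensor_map_eq[of x "\<zero>\<^bsub>M\<^esub>"] assms by simp
qed

end

end

section \<open>Complexes\<close>

locale complex = R?: cring R for R :: "('a, 'c) ring_scheme" (structure) +
  fixes C :: "('a, 'm, 'z) chain_complex_scheme"
  assumes obj: "\<And>k. module R (obj C k)"
    and diff: "\<And>k. diff C k \<in> lin_hom R (obj C k) (obj C (k - 1))"
    and diff_diff: "\<And>k x. x \<in> carrier (obj C k) \<Longrightarrow> diff C (k - 1) (diff C k x) = \<zero>\<^bsub>obj C (k - 1 - 1)\<^esub>"
begin

lemma diff_from: "diff C (k + 1) \<in> lin_hom R (obj C (k + 1)) (obj C k)"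
  using diff[of "k + 1"] by simp

lemma cycles_iff: "z \<in> cycles C k \<longleftrightarrow> z \<in> carrier (obj C k) \<and> diff C k z = \<zero>\<^bsub>obj C (k - 1)\<^esub>"
  by (simp add: cycles_def a_kernel_def')

lemma boundaries_cycles: "boundaries C k \<subseteq> cycles C k"
  using lin_homD(1)[OF diff_from] diff_diff[of _ "k + 1"] by (auto simp: boundaries_def cycles_iff)

abbreviation Z where "Z k \<equiv> (obj C k)\<lparr>carrier := cycles C k\<rparr>"

lemma homology_quotient: "quotient R (Z k) (boundaries C k)"
proof -
  have Z: "submodule (cycles C k) R (obj C k)"
    unfolding cycles_def by (rule lin_hom_kernel_submodule[OF obj obj diff])
  have "submodule (boundaries C k) R (obj C k)"
    unfolding boundaries_def by (rule lin_hom_image_submodule[OF obj obj diff_from])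
  then show ?thesis
    by (intro quotientI submodule.submodule_is_module[OF Z obj] submodule_restrict[OF obj Z] boundaries_cycles)
qed

lemma homology_module: "module R (homology C k)"
  unfolding homology_def by (rule quotient.quot_module_module[OF homology_quotient])

lemma homology_carrier: "carrier (homology C k) = homology_class C k ` cycles C k"
  by (simp add: homology_def quot_module_carrier homology_class_def)

lemma mem_homology_class:
  "z' \<in> homology_class C k z \<longleftrightarrow> (\<exists>b\<in>carrier (obj C (k + 1)). z' = diff C (k + 1) b \<oplus>\<^bsub>obj C k\<^esub> z)"
  by (auto simp: homology_class_def boundaries_def a_r_coset_def')

lemma homology_class_eq_iff:
  assumes "z \<in> cycles C k" "z' \<in> cycles C k"
  shows "homology_class C k z = homology_class C k z' \<longleftrightarrow>
    (\<exists>b\<in>carrier (obj C (k + 1)). z = diff C (k + 1) b \<oplus>\<^bsub>obj C k\<^esub> z')"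
  using quotient.mem_coset_iff[OF homology_quotient, of z' k z] assms
  by (simp add: homology_class_def flip: mem_homology_class)

lemma homology_class_self: "z \<in> cycles C k \<Longrightarrow> z \<in> homology_class C k z"
  using quotient.coset_self[OF homology_quotient, of z k] by (simp add: homology_class_def)

lemma homology_class_cycle: "z' \<in> homology_class C k z \<Longrightarrow> z \<in> cycles C k \<Longrightarrow>
    z' \<in> cycles C k \<and> homology_class C k z' = homology_class C k z"
  using quotient.mem_coset_iff[OF homology_quotient, of z k z'] by (simp add: homology_class_def)

lemma homology_class_lin: "homology_class C k \<in> lin_hom R (Z k) (homology C k)"
  using quotient.quot_proj_lin[OF homology_quotient, of k] by (simp add: homology_def homology_class_def[abs_def])

end

lemma homology_map_class:
  assumes "complex R C" "complex R D"
    and F: "F \<in> lin_hom R (obj C k) (obj D k)" "F ` boundaries C k \<subseteq> boundaries D k"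
    and z: "z \<in> cycles C k" "F z \<in> cycles D k"
  shows "homology_map D k F (homology_class C k z) = homology_class D k (F z)"
proof -
  interpret C: complex R C by fact
  interpret D: complex R D by fact
  have "homology_class D k (F z') = homology_class D k (F z)" if z': "z' \<in> homology_class C k z" for z'
  proof -
    obtain b where b: "b \<in> carrier (obj C (k + 1))" "z' = diff C (k + 1) b \<oplus>\<^bsub>obj C k\<^esub> z"
      using z' by (auto simp: C.mem_homology_class)
    have "F z' = F (diff C (k + 1) b) \<oplus>\<^bsub>obj D k\<^esub> F z"
      using b z(1) lin_homD(2)[OF F(1)] lin_homD(1)[OF C.diff_from b(1)] by (simp add: C.cycles_iff)
    moreover have "F (diff C (k + 1) b) \<in> boundaries D k"
      using F(2) b(1) by (auto simp: boundaries_def)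
    ultimately have "F z' \<in> homology_class D k (F z)" by (auto simp: D.mem_homology_class boundaries_def)
    then show ?thesis using D.homology_class_cycle z(2) by blast
  qed
  then show ?thesis
    unfolding homology_map_def by (rule the_elem_image_eq[OF C.homology_class_self[OF z(1)]])
qed

subsection \<open>The complex computing Tor\<close>

text \<open>A chain over \<open>R\<close> that represents a cycle over \<open>R/I\<close>:
  \<open>diff Q k x\<close> itself may be nonzero and dies only in the tensor product. All classes
  in \<open>Tor\<close> are reached by such chains.\<close>

definition tor_cycle ::
    "('a, 'c) ring_scheme \<Rightarrow> 'a set \<Rightarrow> ('a, 'm, 'z) chain_complex_scheme \<Rightarrow> int \<Rightarrow> 'm \<Rightarrow> bool"
  where "tor_cycle R I Q k x \<longleftrightarrow> x \<in> carrier (obj Q k) \<and>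
    one_tensor R I (obj Q (k - 1)) (diff Q k x) = \<zero>\<^bsub>tensor R (quot_ring_module R I) (obj Q (k - 1))\<^esub>"

definition tor_class ::
    "('a, 'c) ring_scheme \<Rightarrow> 'a set \<Rightarrow> ('a, 'm, 'z) chain_complex_scheme \<Rightarrow> int \<Rightarrow> 'm \<Rightarrow> ('a, 'm) tens_el set"
  where "tor_class R I Q k x = homology_class (tor_complex R I Q) k (one_tensor R I (obj Q k) x)"

lemma tor_complex_simps:
  "obj (tor_complex R I Q) k = tensor R (quot_ring_module R I) (obj Q k)"
  "diff (tor_complex R I Q) k = tensor_map R (quot_ring_module R I) (obj Q k)
     (quot_ring_module R I) (obj Q (k - 1)) (\<lambda>x. x) (diff Q k)"
  by (simp_all add: tor_complex_def tensor_complex_def)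

locale complex_base_change = quotient_by_ideal R I + complex R Q
  for R :: "('a, 'c) ring_scheme" (structure) and I and Q :: "('a, 'm, 'z) chain_complex_scheme"
begin

sublocale bc: base_change R I "obj Q k" for k
  by (rule base_changeI[OF obj])

abbreviation T where "T \<equiv> tor_complex R I Q"
abbreviation ot where "ot k \<equiv> one_tensor R I (obj Q k)"

lemma T_diff_ot:
  "x \<in> carrier (obj Q k) \<Longrightarrow> diff T k (ot k x) = ot (k - 1) (diff Q k x)"
  unfolding tor_complex_simps by (rule base_change_map_one[OF obj obj diff])

lemma ot_zero: "ot k \<zero>\<^bsub>obj Q k\<^esub> = \<zero>\<^bsub>tensor R B (obj Q k)\<^esub>"
  by (rule lin_hom_zero[OF obj bc.tensor_base_module bc.one_tensor_lin])

sublocale T: complex R T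
proof (intro complex.intro complex_axioms.intro R.is_cring)
  fix k
  show "module R (obj T k)" by (simp add: tor_complex_simps bc.tensor_base_module)
  show "diff T k \<in> lin_hom R (obj T k) (obj T (k - 1))"
    unfolding tor_complex_simps by (rule base_change_map_lin[OF obj obj diff])
next
  fix k x
  assume "x \<in> carrier (obj T k)"
  then obtain y where "y \<in> carrier (obj Q k)" "x = ot k y"
    using bc.one_tensor_surj by (auto simp: tor_complex_simps)
  then show "diff T (k - 1) (diff T k x) = \<zero>\<^bsub>obj T (k - 1 - 1)\<^esub>"
    using lin_homD(1)[OF diff] by (simp add: T_diff_ot diff_diff ot_zero) (simp add: tor_complex_simps)
qed

lemma ot_closed: "x \<in> carrier (obj Q k) \<Longrightarrow> ot k x \<in> carrier (obj T k)"
  using lin_homD(1)[OF bc.one_tensor_lin] by (simp add: tor_complex_simps)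

lemma ot_surj:
  assumes "t \<in> carrier (obj T k)"
  obtains x where "x \<in> carrier (obj Q k)" "t = ot k x"
  using assms bc.one_tensor_surj by (auto simp: tor_complex_simps)

lemma ot_add: "x \<in> carrier (obj Q k) \<Longrightarrow> y \<in> carrier (obj Q k) \<Longrightarrow>
    ot k (x \<oplus>\<^bsub>obj Q k\<^esub> y) = ot k x \<oplus>\<^bsub>obj T k\<^esub> ot k y"
  using lin_homD(2)[OF bc.one_tensor_lin] by (simp add: tor_complex_simps)

lemma tor_cycle_closed: "tor_cycle R I Q k x \<Longrightarrow> x \<in> carrier (obj Q k)"
  by (simp add: tor_cycle_def)

lemma tor_cycle_ot: "x \<in> carrier (obj Q k) \<Longrightarrow> tor_cycle R I Q k x \<longleftrightarrow> ot k x \<in> cycles T k"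
  by (simp add: tor_cycle_def T.cycles_iff ot_closed T_diff_ot) (simp add: tor_complex_simps)

lemma Tor_module: "module R (Tor R I Q k)"
  unfolding Tor_def by (rule T.homology_module)

lemma Tor_carrier: "carrier (Tor R I Q k) = tor_class R I Q k ` Collect (tor_cycle R I Q k)"
proof
  show "carrier (Tor R I Q k) \<subseteq> tor_class R I Q k ` Collect (tor_cycle R I Q k)"
  proof
    fix X assume "X \<in> carrier (Tor R I Q k)"
    then obtain t where t: "t \<in> cycles T k" "X = homology_class T k t"
      by (auto simp: Tor_def T.homology_carrier)
    then obtain x where x: "x \<in> carrier (obj Q k)" "t = ot k x" using ot_surj T.cycles_iff by metis
    then show "X \<in> tor_class R I Q k ` Collect (tor_cycle R I Q k)"
      using t by (auto simp: tor_class_def tor_cycle_ot)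
  qed
qed (auto simp: Tor_def T.homology_carrier tor_class_def tor_cycle_ot[OF tor_cycle_closed, symmetric])

lemma Tor_cases:
  assumes "X \<in> carrier (Tor R I Q k)"
  obtains x where "tor_cycle R I Q k x" "X = tor_class R I Q k x"
  using assms by (auto simp: Tor_carrier)

lemma tor_class_closed: "tor_cycle R I Q k x \<Longrightarrow> tor_class R I Q k x \<in> carrier (Tor R I Q k)"
  by (auto simp: Tor_carrier)

text \<open>Boundaries over \<open>R/I\<close> are the tensors
  \<open>1 \<otimes> diff Q (k + 1) w\<close>, because every chain of degree \<open>k + 1\<close>
  over \<open>R/I\<close> is some \<open>1 \<otimes> w\<close>. The equation is stated in the tensor
  product, as it may fail in \<open>obj Q k\<close>.\<close>

lemma tor_class_eq_iff:
  assumes "tor_cycle R I Q k x" "tor_cycle R I Q k y"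
  shows "tor_class R I Q k x = tor_class R I Q k y \<longleftrightarrow>
    (\<exists>w\<in>carrier (obj Q (k + 1)). ot k x = ot k (diff Q (k + 1) w \<oplus>\<^bsub>obj Q k\<^esub> y))"
proof -
  have xy: "x \<in> carrier (obj Q k)" "y \<in> carrier (obj Q k)" using assms tor_cycle_closed by auto
  have dw: "ot k (diff Q (k + 1) w \<oplus>\<^bsub>obj Q k\<^esub> y) = diff T (k + 1) (ot (k + 1) w) \<oplus>\<^bsub>obj T k\<^esub> ot k y"
    if "w \<in> carrier (obj Q (k + 1))" for w
    using that xy lin_homD(1)[OF diff_from that] T_diff_ot[of w "k + 1"] by (simp add: ot_add)
  have "tor_class R I Q k x = tor_class R I Q k y \<longleftrightarrow>
      (\<exists>t\<in>carrier (obj T (k + 1)). ot k x = diff T (k + 1) t \<oplus>\<^bsub>obj T k\<^esub> ot k y)"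
    unfolding tor_class_def using assms xy by (intro T.homology_class_eq_iff) (auto simp: tor_cycle_ot)
  also have "\<dots> \<longleftrightarrow> (\<exists>w\<in>carrier (obj Q (k + 1)). ot k x = ot k (diff Q (k + 1) w \<oplus>\<^bsub>obj Q k\<^esub> y))"
    using dw ot_closed ot_surj by metis
  finally show ?thesis .
qed

lemma tor_cycle_add:
  assumes "tor_cycle R I Q k x" "tor_cycle R I Q k y"
  shows "tor_cycle R I Q k (x \<oplus>\<^bsub>obj Q k\<^esub> y)"
    "tor_class R I Q k (x \<oplus>\<^bsub>obj Q k\<^esub> y) = tor_class R I Q k x \<oplus>\<^bsub>Tor R I Q k\<^esub> tor_class R I Q k y"
proof -
  interpret O: module R "obj Q k" by (rule obj)
  interpret Z: module R "T.Z k" using T.homology_quotient quotient_def by blast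
  have c: "x \<in> carrier (obj Q k)" "y \<in> carrier (obj Q k)" "ot k x \<in> cycles T k" "ot k y \<in> cycles T k"
    using assms tor_cycle_closed tor_cycle_ot by blast+
  then have s: "ot k (x \<oplus>\<^bsub>obj Q k\<^esub> y) = ot k x \<oplus>\<^bsub>T.Z k\<^esub> ot k y" by (simp add: ot_add)
  show "tor_cycle R I Q k (x \<oplus>\<^bsub>obj Q k\<^esub> y)"
    using c Z.a_closed[of "ot k x" "ot k y"] s by (simp add: tor_cycle_ot)
  show "tor_class R I Q k (x \<oplus>\<^bsub>obj Q k\<^esub> y) = tor_class R I Q k x \<oplus>\<^bsub>Tor R I Q k\<^esub> tor_class R I Q k y"
    unfolding tor_class_def Tor_def s by (rule lin_homD(2)[OF T.homology_class_lin]) (use c in auto)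
qed

lemma tor_cycle_smult:
  assumes "tor_cycle R I Q k x" "a \<in> carrier R"
  shows "tor_cycle R I Q k (a \<odot>\<^bsub>obj Q k\<^esub> x)"
    "tor_class R I Q k (a \<odot>\<^bsub>obj Q k\<^esub> x) = a \<odot>\<^bsub>Tor R I Q k\<^esub> tor_class R I Q k x"
proof -
  interpret O: module R "obj Q k" by (rule obj)
  interpret Z: module R "T.Z k" using T.homology_quotient quotient_def by blast
  have c: "x \<in> carrier (obj Q k)" "ot k x \<in> cycles T k"
    using assms tor_cycle_closed tor_cycle_ot by blast+
  then have s: "ot k (a \<odot>\<^bsub>obj Q k\<^esub> x) = a \<odot>\<^bsub>T.Z k\<^esub> ot k x"
    using lin_homD(3)[OF bc.one_tensor_lin] assms(2) by (simp add: tor_complex_simps)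
  show "tor_cycle R I Q k (a \<odot>\<^bsub>obj Q k\<^esub> x)"
    using c Z.smult_closed[of a "ot k x"] s assms(2) by (simp add: tor_cycle_ot)
  show "tor_class R I Q k (a \<odot>\<^bsub>obj Q k\<^esub> x) = a \<odot>\<^bsub>Tor R I Q k\<^esub> tor_class R I Q k x"
    unfolding tor_class_def Tor_def s by (rule lin_homD(3)[OF T.homology_class_lin]) (use c assms in auto)
qed

lemma tor_class_zero: "tor_class R I Q k \<zero>\<^bsub>obj Q k\<^esub> = \<zero>\<^bsub>Tor R I Q k\<^esub>"
proof -
  interpret Z: module R "T.Z k" using T.homology_quotient quotient_def by blast
  show ?thesis
    using lin_hom_zero[OF Z.module_axioms T.homology_module T.homology_class_lin]
    by (simp add: tor_class_def Tor_def ot_zero) (simp add: tor_complex_simps)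
qed

lemma Tor_ideal:
  assumes "a \<in> I" "X \<in> carrier (Tor R I Q k)"
  shows "a \<odot>\<^bsub>Tor R I Q k\<^esub> X = \<zero>\<^bsub>Tor R I Q k\<^esub>"
proof -
  interpret Tor: module R "Tor R I Q k" by (rule Tor_module)
  interpret O: module R "obj Q k" by (rule obj)
  obtain x where x: "tor_cycle R I Q k x" "X = tor_class R I Q k x" using assms(2) by (rule Tor_cases)
  have "ot k (a \<odot>\<^bsub>obj Q k\<^esub> x) = ot k \<zero>\<^bsub>obj Q k\<^esub>"
    using bc.one_tensor_ideal[OF assms(1) tor_cycle_closed[OF x(1)]] by (simp add: ot_zero)
  then have "tor_class R I Q k (a \<odot>\<^bsub>obj Q k\<^esub> x) = tor_class R I Q k \<zero>\<^bsub>obj Q k\<^esub>"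
    by (simp add: tor_class_def)
  then show ?thesis using tor_cycle_smult(2)[OF x(1)] assms(1) x(2) tor_class_zero by simp
qed

lemma TorS_module: "module S (TorS R I Q k)"
  unfolding TorS_def by (rule over_quotient_module[OF Tor_module Tor_ideal])

end

section \<open>Comparison of resolutions\<close>

text \<open>One recursion behind all maps constructed out of projective modules: solve
  \<open>d (g (k + 1)) = c k + g k D\<close> degree by degree. Assumption \<open>dc\<close> makes
  each right-hand side a cycle, since
  \<open>d (c (k + 1) + g (k + 1) D) = - c k D + (c k + g k D) D = 0\<close>; exactness and
  projectivity then give the next map. With \<open>c = 0\<close> the result is a chain map. With
  \<open>c\<close> the difference of two chain maps and \<open>D\<close> a negated differential it
  is a homotopy. With \<open>c\<close> minus the off-diagonal differential it is the map that
  computes the connecting homomorphism.\<close>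

lemma (in cring) twisted_extension:
  fixes P :: "nat \<Rightarrow> ('a, 'p) module" and Y :: "nat \<Rightarrow> ('a, 'y) module"
  assumes proj: "\<And>k. projective R (P k)" and Y: "\<And>k. module R (Y k)"
    and d: "\<And>k. d k \<in> lin_hom R (Y (Suc k)) (Y k)"
    and exact: "\<And>k y. y \<in> carrier (Y (Suc k)) \<Longrightarrow> d k y = \<zero>\<^bsub>Y k\<^esub> \<Longrightarrow> y \<in> d (Suc k) ` carrier (Y (Suc (Suc k)))"
    and D: "\<And>k. D k \<in> lin_hom R (P (Suc k)) (P k)"
    and DD: "\<And>k x. x \<in> carrier (P (Suc (Suc k))) \<Longrightarrow> D k (D (Suc k) x) = \<zero>\<^bsub>P k\<^esub>"
    and c: "\<And>k. c k \<in> lin_hom R (P (Suc k)) (Y k)"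
    and dc: "\<And>k x. x \<in> carrier (P (Suc (Suc k))) \<Longrightarrow> d k (c (Suc k) x) = \<ominus>\<^bsub>Y k\<^esub> c k (D (Suc k) x)"
    and g0: "start \<in> lin_hom R (P 0) (Y 0)"
    and base: "\<And>x. x \<in> carrier (P (Suc 0)) \<Longrightarrow> c 0 x \<oplus>\<^bsub>Y 0\<^esub> start (D 0 x) \<in> d 0 ` carrier (Y (Suc 0))"
  obtains g where "g 0 = start" "\<And>k. g k \<in> lin_hom R (P k) (Y k)"
    "\<And>k x. x \<in> carrier (P (Suc k)) \<Longrightarrow> d k (g (Suc k) x) = c k x \<oplus>\<^bsub>Y k\<^esub> g k (D k x)"
proof -
  have mP: "module R (P k)" for k using proj by (simp add: projective_def)
  \<comment> \<open>The invariant demands in advance that the next right-hand side lie in the image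
    of \<open>d\<close>, so that the step itself is a single lifting problem. The last conjunct
    fixes the initial map.\<close>
  let ?inv = "\<lambda>k g. g \<in> lin_hom R (P k) (Y k) \<and>
    (\<forall>x\<in>carrier (P (Suc k)). c k x \<oplus>\<^bsub>Y k\<^esub> g (D k x) \<in> d k ` carrier (Y (Suc k))) \<and> (k = 0 \<longrightarrow> g = start)"
  have "\<exists>g. \<forall>k. ?inv k (g k) \<and>
      (\<forall>x\<in>carrier (P (Suc k)). d k (g (Suc k) x) = c k x \<oplus>\<^bsub>Y k\<^esub> g k (D k x))"
  proof (rule dependent_nat_choice)
    show "\<exists>g. ?inv 0 g" using g0 base by blast
  next
    fix g k assume g: "?inv k g"
    interpret Y: module R "Y k" by (rule Y)
    interpret Y': module R "Y (Suc k)" by (rule Y)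
    have lin: "(\<lambda>x. c k x \<oplus>\<^bsub>Y k\<^esub> g (D k x)) \<in> lin_hom R (P (Suc k)) (Y k)"
      using g by (intro lin_hom_plus[OF Y c lin_hom_comp[OF D] mP]) auto
    obtain g' where g': "g' \<in> lin_hom R (P (Suc k)) (Y (Suc k))"
      and dg': "\<And>x. x \<in> carrier (P (Suc k)) \<Longrightarrow> d k (g' x) = c k x \<oplus>\<^bsub>Y k\<^esub> g (D k x)"
      by (rule projective_lift[OF proj Y Y d lin]) (use g in auto)
    have "c (Suc k) x \<oplus>\<^bsub>Y (Suc k)\<^esub> g' (D (Suc k) x) \<in> d (Suc k) ` carrier (Y (Suc (Suc k)))"
      if x: "x \<in> carrier (P (Suc (Suc k)))" for x
    proof (rule exact)
      note Dx = lin_homD(1)[OF D x]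
      note cl = lin_homD(1)[OF c x] lin_homD(1)[OF g' Dx] lin_homD(1)[OF c Dx]
      show "c (Suc k) x \<oplus>\<^bsub>Y (Suc k)\<^esub> g' (D (Suc k) x) \<in> carrier (Y (Suc k))" using cl by simp
      have "g (D k (D (Suc k) x)) = \<zero>\<^bsub>Y k\<^esub>"
        unfolding DD[OF x] by (rule lin_hom_zero[OF mP Y]) (use g in blast)
      then show "d k (c (Suc k) x \<oplus>\<^bsub>Y (Suc k)\<^esub> g' (D (Suc k) x)) = \<zero>\<^bsub>Y k\<^esub>"
        unfolding lin_homD(2)[OF d cl(1,2)] dc[OF x] dg'[OF Dx] using cl by (simp add: Y.l_neg)
    qed
    then show "\<exists>g'. ?inv (Suc k) g' \<and> (\<forall>x\<in>carrier (P (Suc k)). d k (g' x) = c k x \<oplus>\<^bsub>Y k\<^esub> g (D k x))"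
      using g' dg' by (intro exI[of _ g']) auto
  qed
  then show thesis using that by blast
qed

text \<open>Separates exactness from projectivity: comparison maps and homotopies ask for
  projectivity of the source and for exactness of the target.\<close>

definition exact_resolution ::
    "('a, 'c) ring_scheme \<Rightarrow> ('a, 'b) module \<Rightarrow> ('a, 'm, 'b) resolution \<Rightarrow> bool"
  where "exact_resolution R M Q \<longleftrightarrow>
    (\<forall>k. module R (obj Q k)) \<and>
    (\<forall>k<0. carrier (obj Q k) = {\<zero>\<^bsub>obj Q k\<^esub>}) \<and>
    (\<forall>k. diff Q k \<in> lin_hom R (obj Q k) (obj Q (k - 1))) \<and>
    (\<forall>k>0. cycles Q k = boundaries Q k) \<and>
    aug Q \<in> lin_hom R (obj Q 0) M \<and>
    aug Q ` carrier (obj Q 0) = carrier M \<and>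
    a_kernel (obj Q 0) M (aug Q) = boundaries Q 0"

lemma proj_resolution_iff:
  "proj_resolution R M Q \<longleftrightarrow> exact_resolution R M Q \<and> (\<forall>k. projective R (obj Q k))"
  by (auto simp: proj_resolution_def exact_resolution_def projective_def)

locale res = R?: cring R for R :: "('a, 'c) ring_scheme" (structure) +
  fixes M :: "('a, 'b) module" and Q :: "('a, 'm, 'b) resolution"
  assumes M: "module R M" and exact: "exact_resolution R M Q"
begin

lemma res_obj: "module R (obj Q k)"
  and neg: "k < 0 \<Longrightarrow> carrier (obj Q k) = {\<zero>\<^bsub>obj Q k\<^esub>}"
  and res_diff: "diff Q k \<in> lin_hom R (obj Q k) (obj Q (k - 1))"
  and cycles_boundaries: "k > 0 \<Longrightarrow> cycles Q k = boundaries Q k"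
  and aug: "aug Q \<in> lin_hom R (obj Q 0) M"
  and aug_surj: "aug Q ` carrier (obj Q 0) = carrier M"
  and aug_kernel: "a_kernel (obj Q 0) M (aug Q) = boundaries Q 0"
  using exact by (auto simp: exact_resolution_def)

lemma neg_eq: "k < 0 \<Longrightarrow> x \<in> carrier (obj Q k) \<Longrightarrow> x = \<zero>\<^bsub>obj Q k\<^esub>"
  using neg by auto

sublocale complex R Q
proof (intro complex.intro complex_axioms.intro R.is_cring res_obj res_diff)
  fix k x assume x: "x \<in> carrier (obj Q k)"
  \<comment> \<open>That the differential squares to zero is not a clause of the definition. Above
    degree 1 it follows from cycles being boundaries; otherwise the composite lands in negative
    degree, which is zero.\<close>
  show "diff Q (k - 1) (diff Q k x) = \<zero>\<^bsub>obj Q (k - 1 - 1)\<^esub>"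
  proof (cases "k > 1")
    case True
    have "diff Q k x \<in> boundaries Q (k - 1)" using x by (simp add: boundaries_def)
    then have "diff Q k x \<in> cycles Q (k - 1)" using cycles_boundaries[of "k - 1"] True by simp
    then show ?thesis by (simp add: cycles_def a_kernel_def')
  next
    case False
    then show ?thesis
      using neg_eq[of "k - 1 - 1"] lin_homD(1)[OF res_diff lin_homD(1)[OF res_diff x]] by simp
  qed
qed

lemma diff_Suc: "diff Q (int (Suc j)) \<in> lin_hom R (obj Q (int (Suc j))) (obj Q (int j))"
  using diff[of "int (Suc j)"] by simp

lemma diff_one: "diff Q 1 \<in> lin_hom R (obj Q 1) (obj Q 0)"
  using diff[of 1] by simp

lemma diff_diff_Suc: "x \<in> carrier (obj Q (int (Suc (Suc j)))) \<Longrightarrow>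
    diff Q (int (Suc j)) (diff Q (int (Suc (Suc j))) x) = \<zero>\<^bsub>obj Q (int j)\<^esub>"
  using diff_diff[of x "int (Suc (Suc j))"] by simp

lemma exact_Suc:
  assumes "y \<in> carrier (obj Q (int (Suc j)))" "diff Q (int (Suc j)) y = \<zero>\<^bsub>obj Q (int j)\<^esub>"
  shows "y \<in> diff Q (int (Suc (Suc j))) ` carrier (obj Q (int (Suc (Suc j))))"
proof -
  have "y \<in> cycles Q (int (Suc j))" using assms by (simp add: cycles_iff)
  then have "y \<in> boundaries Q (int (Suc j))" using cycles_boundaries[of "int (Suc j)"] by simp
  moreover have "int (Suc j) + 1 = int (Suc (Suc j))" by simp
  ultimately show ?thesis unfolding boundaries_def by metis
qed

lemma aug_exact:
  assumes "y \<in> carrier (obj Q 0)" "aug Q y = \<zero>\<^bsub>M\<^esub>"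
  shows "y \<in> diff Q 1 ` carrier (obj Q 1)"
proof -
  have "y \<in> boundaries Q 0" using assms by (simp flip: aug_kernel add: a_kernel_def')
  then show ?thesis by (simp add: boundaries_def)
qed

lemma aug_diff:
  assumes "x \<in> carrier (obj Q 1)"
  shows "aug Q (diff Q 1 x) = \<zero>\<^bsub>M\<^esub>"
proof -
  have "diff Q 1 x \<in> boundaries Q 0" using assms by (simp add: boundaries_def)
  then show ?thesis by (simp flip: aug_kernel add: a_kernel_def')
qed

end

lemma chain_liftD:
  assumes "chain_lift R P Q f F"
  shows "F k \<in> lin_hom R (obj P k) (obj Q k)"
    and "x \<in> carrier (obj P k) \<Longrightarrow> F (k - 1) (diff P k x) = diff Q k (F k x)"
    and "x \<in> carrier (obj P 0) \<Longrightarrow> aug Q (F 0 x) = f (aug P x)"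
  using assms by (auto simp: chain_lift_def)

lemma chain_liftD_Suc:
  assumes "chain_lift R P Q f F" "x \<in> carrier (obj P (int (Suc j)))"
  shows "diff Q (int (Suc j)) (F (int (Suc j)) x) = F (int j) (diff P (int (Suc j)) x)"
  using chain_liftD(2)[OF assms] by simp

lemma chain_lift_comp:
  assumes "chain_lift R P Q f F" "chain_lift R Q L g G" "res R M P"
  shows "chain_lift R P L (\<lambda>x. g (f x)) (\<lambda>k x. G k (F k x))"
proof -
  interpret P: res R M P by fact
  show ?thesis
    unfolding chain_lift_def
    using chain_liftD[OF assms(1)] chain_liftD[OF assms(2)] lin_homD(1)[OF chain_liftD(1)[OF assms(1)]]
      lin_hom_comp[OF chain_liftD(1)[OF assms(1)] chain_liftD(1)[OF assms(2)]] by simp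
qed

locale proj_res = res +
  assumes projective: "\<And>k. projective R (obj Q k)"

lemma proj_resI: "cring R \<Longrightarrow> module R M \<Longrightarrow> proj_resolution R M Q \<Longrightarrow> proj_res R M Q"
  by (simp add: proj_res_def proj_res_axioms_def res_def res_axioms_def proj_resolution_iff)

section \<open>Comparison maps and their homotopies\<close>

locale two_resolutions = P: proj_res R M P + Q: res R N Q
  for R :: "('a, 'c) ring_scheme" (structure) and M :: "('a, 'b) module" and P :: "('a, 'p, 'b) resolution"
    and N :: "('a, 'd) module" and Q :: "('a, 'q, 'd) resolution"
begin

text \<open>The recursion runs over the natural numbers whereas complexes are indexed by the
  integers, so the family is continued by zero. At the seam, in degree 0, both composites land in
  degree -1, where the complex vanishes.\<close>

lemma chain_map_from_nat:
  assumes g: "\<And>j. g j \<in> lin_hom R (obj P (int j)) (obj Q (int j))"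
    and dg: "\<And>j x. x \<in> carrier (obj P (int (Suc j))) \<Longrightarrow>
      diff Q (int (Suc j)) (g (Suc j) x) = g j (diff P (int (Suc j)) x)"
    and aug: "\<And>x. x \<in> carrier (obj P 0) \<Longrightarrow> aug Q (g 0 x) = f (aug P x)"
  shows "chain_lift R P Q f (\<lambda>k. if k < 0 then (\<lambda>_. \<zero>\<^bsub>obj Q k\<^esub>) else g (nat k))"
  unfolding chain_lift_def
proof (intro conjI allI ballI)
  fix k :: int
  show "(if k < 0 then (\<lambda>_. \<zero>\<^bsub>obj Q k\<^esub>) else g (nat k)) \<in> lin_hom R (obj P k) (obj Q k)"
    using g[of "nat k"] lin_hom_const_zero[OF Q.obj] by (cases "k < 0") simp_all
  fix x assume x: "x \<in> carrier (obj P k)"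
  consider "k < 0" | "k = 0" | j where "k = int (Suc j)"
    by (metis int_cases nonneg_int_cases not0_implies_Suc not_less of_nat_0)
  then show "(if k - 1 < 0 then (\<lambda>_. \<zero>\<^bsub>obj Q (k - 1)\<^esub>) else g (nat (k - 1))) (diff P k x) =
      diff Q k ((if k < 0 then (\<lambda>_. \<zero>\<^bsub>obj Q k\<^esub>) else g (nat k)) x)"
  proof cases
    case 1
    then show ?thesis using lin_hom_zero[OF Q.obj Q.obj Q.diff, of k] by simp
  next
    case 2
    then have "diff Q 0 (g 0 x) \<in> carrier (obj Q (- 1))"
      using lin_homD(1)[OF Q.diff lin_homD(1)[OF g[of 0]]] x by simp
    then show ?thesis using 2 Q.neg_eq[of "- 1"] by simp
  next
    case 3
    have "nat k = Suc j" "nat (k - 1) = j" using 3 by auto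
    then show ?thesis using dg[of x j] x 3 by simp
  qed
qed (use aug in simp)

lemma chain_lift_exists:
  assumes f: "f \<in> lin_hom R M N"
  shows "\<exists>F. chain_lift R P Q f F"
proof -
  obtain g0 where g0: "g0 \<in> lin_hom R (obj P 0) (obj Q 0)"
    "\<And>x. x \<in> carrier (obj P 0) \<Longrightarrow> aug Q (g0 x) = f (aug P x)"
    by (rule P.projective_lift[OF P.projective Q.obj Q.M Q.aug lin_hom_comp[OF P.aug f]])
      (use Q.aug_surj lin_homD(1)[OF f] lin_homD(1)[OF P.aug] in auto)
  obtain g where g: "g 0 = g0" "\<And>k. g k \<in> lin_hom R (obj P (int k)) (obj Q (int k))"
    "\<And>k x. x \<in> carrier (obj P (int (Suc k))) \<Longrightarrow>
      diff Q (int (Suc k)) (g (Suc k) x) = \<zero>\<^bsub>obj Q (int k)\<^esub> \<oplus>\<^bsub>obj Q (int k)\<^esub> g k (diff P (int (Suc k)) x)"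
  proof (rule P.twisted_extension[where P = "\<lambda>k. obj P (int k)" and Y = "\<lambda>k. obj Q (int k)"
        and d = "\<lambda>k. diff Q (int (Suc k))" and D = "\<lambda>k. diff P (int (Suc k))" and start = g0
        and c = "\<lambda>k x. \<zero>\<^bsub>obj Q (int k)\<^esub>"])
    fix k x
    interpret Qk: module R "obj Q (int k)" by (rule Q.obj)
    assume x: "x \<in> carrier (obj P (int (Suc (Suc k))))"
    show "diff Q (int (Suc k)) \<zero>\<^bsub>obj Q (int (Suc k))\<^esub> = \<ominus>\<^bsub>obj Q (int k)\<^esub> \<zero>\<^bsub>obj Q (int k)\<^esub>"
      using lin_hom_zero[OF Q.obj Q.obj Q.diff_Suc] by (simp add: Qk.a_inv_zero)
  next
    fix x assume x: "x \<in> carrier (obj P (int (Suc 0)))"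
    interpret Q0: module R "obj Q 0" by (rule Q.obj)
    have x': "x \<in> carrier (obj P 1)" using x by simp
    note dx = lin_homD(1)[OF P.diff_one x']
    have "aug Q (g0 (diff P 1 x)) = \<zero>\<^bsub>N\<^esub>"
      using g0(2)[OF dx] P.aug_diff[OF x'] lin_hom_zero[OF P.M Q.M f] by simp
    then show "\<zero>\<^bsub>obj Q (int 0)\<^esub> \<oplus>\<^bsub>obj Q (int 0)\<^esub> g0 (diff P (int (Suc 0)) x)
        \<in> diff Q (int (Suc 0)) ` carrier (obj Q (int (Suc 0)))"
      using Q.aug_exact[OF lin_homD(1)[OF g0(1) dx]] lin_homD(1)[OF g0(1) dx] by simp
  qed (use g0 P.projective Q.obj Q.diff_Suc P.diff_Suc P.diff_diff_Suc Q.exact_Suc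
        lin_hom_const_zero[OF Q.obj] in simp_all)
  have dg: "diff Q (int (Suc k)) (g (Suc k) x) = g k (diff P (int (Suc k)) x)"
    if x: "x \<in> carrier (obj P (int (Suc k)))" for k x
  proof -
    interpret Qk: module R "obj Q (int k)" by (rule Q.obj)
    show ?thesis using g(3)[OF x] lin_homD(1)[OF g(2) lin_homD(1)[OF P.diff_Suc x]] by simp
  qed
  have ag: "aug Q (g 0 x) = f (aug P x)" if "x \<in> carrier (obj P 0)" for x
    using g0(2)[OF that] g(1) by simp
  show ?thesis using chain_map_from_nat[OF g(2) dg ag] by blast
qed

text \<open>The relation to solve is \<open>d h = (F - G) - h d\<close>. This is
  \<open>twisted_extension\<close> with the target shifted by one degree, \<open>c\<close> the
  difference of the two chain maps and the differential of the source negated, which supplies the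
  sign of \<open>h d\<close>. Degree 0 is stated apart because the term \<open>h d\<close> is absent
  there.\<close>

lemma chain_lift_homotopy:
  assumes F: "chain_lift R P Q f F" and G: "chain_lift R P Q f G"
  obtains h where "\<And>j. h j \<in> lin_hom R (obj P (int j)) (obj Q (int (Suc j)))"
    "\<And>x. x \<in> carrier (obj P 0) \<Longrightarrow> F 0 x = diff Q 1 (h 0 x) \<oplus>\<^bsub>obj Q 0\<^esub> G 0 x"
    "\<And>j x. x \<in> carrier (obj P (int (Suc j))) \<Longrightarrow> F (int (Suc j)) x =
      diff Q (int (Suc (Suc j))) (h (Suc j) x) \<oplus>\<^bsub>obj Q (int (Suc j))\<^esub>
        (G (int (Suc j)) x \<oplus>\<^bsub>obj Q (int (Suc j))\<^esub> h j (diff P (int (Suc j)) x))"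
proof -
  let ?e = "\<lambda>k x. F k x \<ominus>\<^bsub>obj Q k\<^esub> G k x"
  have e: "?e k \<in> lin_hom R (obj P k) (obj Q k)" for k
    by (rule lin_hom_diff[OF Q.obj chain_liftD(1)[OF F] chain_liftD(1)[OF G] P.obj])
  have de: "diff Q (int (Suc j)) (?e (int (Suc j)) x) = ?e (int j) (diff P (int (Suc j)) x)"
    if x: "x \<in> carrier (obj P (int (Suc j)))" for j x
    using lin_hom_minus[OF Q.obj Q.obj Q.diff_Suc] lin_homD(1)[OF chain_liftD(1)[OF F] x]
      lin_homD(1)[OF chain_liftD(1)[OF G] x] chain_liftD_Suc[OF F x] chain_liftD_Suc[OF G x] by simp
  have ae: "aug Q (?e 0 x) = \<zero>\<^bsub>N\<^esub>" if x: "x \<in> carrier (obj P 0)" for x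
  proof -
    interpret N: module R N by (rule Q.M)
    have Fx: "F 0 x \<in> carrier (obj Q 0)" "G 0 x \<in> carrier (obj Q 0)"
      using lin_homD(1)[OF chain_liftD(1)[OF F] x] lin_homD(1)[OF chain_liftD(1)[OF G] x] by auto
    have "aug Q (G 0 x) \<in> carrier N" using lin_homD(1)[OF Q.aug] Fx by simp
    then show ?thesis
      using lin_hom_minus[OF Q.obj Q.M Q.aug Fx] chain_liftD(3)[OF F x] chain_liftD(3)[OF G x]
      by (simp add: a_minus_def N.r_neg)
  qed
  obtain h0 where h0: "h0 \<in> lin_hom R (obj P 0) (obj Q 1)"
    "\<And>x. x \<in> carrier (obj P 0) \<Longrightarrow> diff Q 1 (h0 x) = ?e 0 x"
    by (rule P.projective_lift[OF P.projective Q.obj Q.obj Q.diff_one e])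
      (use Q.aug_exact ae lin_homD(1)[OF e] in auto)
  let ?D = "\<lambda>k x. \<ominus>\<^bsub>obj P (int k)\<^esub> diff P (int (Suc k)) x"
  have D: "?D k \<in> lin_hom R (obj P (int (Suc k))) (obj P (int k))" for k
    by (rule lin_hom_neg[OF P.obj P.diff_Suc])
  obtain h where h: "h 0 = h0" "\<And>k. h k \<in> lin_hom R (obj P (int k)) (obj Q (int (Suc k)))"
    "\<And>k x. x \<in> carrier (obj P (int (Suc k))) \<Longrightarrow>
      diff Q (int (Suc (Suc k))) (h (Suc k) x) = ?e (int (Suc k)) x \<oplus>\<^bsub>obj Q (int (Suc k))\<^esub> h k (?D k x)"
  proof (rule P.twisted_extension[where P = "\<lambda>k. obj P (int k)" and Y = "\<lambda>k. obj Q (int (Suc k))"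
        and d = "\<lambda>k. diff Q (int (Suc (Suc k)))" and D = ?D and start = h0
        and c = "\<lambda>k. ?e (int (Suc k))"])
    fix k x assume x: "x \<in> carrier (obj P (int (Suc (Suc k))))"
    interpret Pk: module R "obj P (int k)" by (rule P.obj)
    note dx = lin_homD(1)[OF P.diff_Suc x]
    show "?D k (?D (Suc k) x) = \<zero>\<^bsub>obj P (int k)\<^esub>"
      using lin_hom_uminus[OF P.obj P.obj P.diff_Suc dx] P.diff_diff_Suc[OF x] by simp
    interpret Q1: module R "obj Q (int (Suc k))" by (rule Q.obj)
    have "?e (int (Suc k)) (?D (Suc k) x) = \<ominus>\<^bsub>obj Q (int (Suc k))\<^esub> ?e (int (Suc k)) (diff P (int (Suc (Suc k))) x)"
      by (rule lin_hom_uminus[OF P.obj Q.obj e dx])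
    then show "diff Q (int (Suc (Suc k))) (?e (int (Suc (Suc k))) x) =
        \<ominus>\<^bsub>obj Q (int (Suc k))\<^esub> ?e (int (Suc k)) (?D (Suc k) x)"
      using de[OF x] lin_homD(1)[OF e dx] by (simp del: of_nat_Suc)
  next
    fix x assume x0: "x \<in> carrier (obj P (int (Suc 0)))"
    then have x: "x \<in> carrier (obj P 1)" by simp
    note dx = lin_homD(1)[OF P.diff_one x]
    interpret Q1: module R "obj Q 1" by (rule Q.obj)
    interpret Q0: module R "obj Q 0" by (rule Q.obj)
    interpret P0: module R "obj P 0" by (rule P.obj)
    note dn = P0.a_inv_closed[OF dx]
    note h0x = lin_homD(1)[OF h0(1) dn]
    note ex = lin_homD(1)[OF e[of 1] x]
    have "diff Q 1 (?e 1 x \<oplus>\<^bsub>obj Q 1\<^esub> h0 (\<ominus>\<^bsub>obj P 0\<^esub> diff P 1 x)) =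
        ?e 0 (diff P 1 x) \<oplus>\<^bsub>obj Q 0\<^esub> ?e 0 (\<ominus>\<^bsub>obj P 0\<^esub> diff P 1 x)"
      using lin_homD(2)[OF Q.diff_one ex h0x] h0(2)[OF dn] de[OF x0] by simp
    also have "\<dots> = \<zero>\<^bsub>obj Q 0\<^esub>"
      using lin_hom_uminus[OF P.obj Q.obj e[of 0] dx] lin_homD(1)[OF e[of 0] dx] by (simp add: Q0.r_neg)
    finally show "?e (int (Suc 0)) x \<oplus>\<^bsub>obj Q (int (Suc 0))\<^esub> h0 (?D 0 x)
        \<in> diff Q (int (Suc (Suc 0))) ` carrier (obj Q (int (Suc (Suc 0))))"
      using Q.exact_Suc[of "?e 1 x \<oplus>\<^bsub>obj Q 1\<^esub> h0 (\<ominus>\<^bsub>obj P 0\<^esub> diff P 1 x)" 0] ex h0x by simp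
  next
    show "\<And>k. ?e (int (Suc k)) \<in> lin_hom R (obj P (int (Suc k))) (obj Q (int (Suc k)))" by (rule e)
  next
    show "h0 \<in> lin_hom R (obj P (int 0)) (obj Q (int (Suc 0)))" using h0(1) by simp
  qed (use P.projective Q.obj Q.diff_Suc D Q.exact_Suc in \<open>simp_all del: of_nat_Suc\<close>)
  show thesis
  proof (rule that[OF h(2)])
    fix x assume x: "x \<in> carrier (obj P 0)"
    interpret Q0: module R "obj Q 0" by (rule Q.obj)
    have "F 0 x \<in> carrier (obj Q 0)" "G 0 x \<in> carrier (obj Q 0)"
      using lin_homD(1)[OF chain_liftD(1)[OF F] x] lin_homD(1)[OF chain_liftD(1)[OF G] x] by auto
    then show "F 0 x = diff Q 1 (h 0 x) \<oplus>\<^bsub>obj Q 0\<^esub> G 0 x"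
      using h0(2)[OF x] by (simp add: h(1) a_minus_def Q0.a_assoc Q0.l_neg)
  next
    fix j x assume x: "x \<in> carrier (obj P (int (Suc j)))"
    interpret Q1: module R "obj Q (int (Suc j))" by (rule Q.obj)
    note dx = lin_homD(1)[OF P.diff_Suc x]
    have c: "F (int (Suc j)) x \<in> carrier (obj Q (int (Suc j)))" "G (int (Suc j)) x \<in> carrier (obj Q (int (Suc j)))"
      "h j (diff P (int (Suc j)) x) \<in> carrier (obj Q (int (Suc j)))"
      using lin_homD(1)[OF chain_liftD(1)[OF F] x] lin_homD(1)[OF chain_liftD(1)[OF G] x] lin_homD(1)[OF h(2) dx] by auto
    have "diff Q (int (Suc (Suc j))) (h (Suc j) x) =
        ?e (int (Suc j)) x \<oplus>\<^bsub>obj Q (int (Suc j))\<^esub> \<ominus>\<^bsub>obj Q (int (Suc j))\<^esub> h j (diff P (int (Suc j)) x)"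
      unfolding h(3)[OF x] lin_hom_uminus[OF P.obj Q.obj h(2) dx] ..
    also have "\<dots> \<oplus>\<^bsub>obj Q (int (Suc j))\<^esub> (G (int (Suc j)) x \<oplus>\<^bsub>obj Q (int (Suc j))\<^esub> h j (diff P (int (Suc j)) x)) = F (int (Suc j)) x"
      using c by (simp add: a_minus_def Q1.a_ac Q1.r_neg Q1.r_neg1 Q1.r_neg2 del: of_nat_Suc)
    finally show "F (int (Suc j)) x =
      diff Q (int (Suc (Suc j))) (h (Suc j) x) \<oplus>\<^bsub>obj Q (int (Suc j))\<^esub>
        (G (int (Suc j)) x \<oplus>\<^bsub>obj Q (int (Suc j))\<^esub> h j (diff P (int (Suc j)) x))" by simp
  qed
qed

end

section \<open>Maps induced on Tor\<close>

locale two_resolutions_base_change = two_resolutions + quotient_by_ideal R I for I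
begin

sublocale P: complex_base_change R I P
  by (simp add: complex_base_change_def quotient_by_ideal_axioms P.complex_axioms)

sublocale Q: complex_base_change R I Q
  by (simp add: complex_base_change_def quotient_by_ideal_axioms Q.complex_axioms)

lemma chain_lift_tor_cycle:
  assumes F: "chain_lift R P Q f F" and x: "tor_cycle R I P k x"
  shows "tor_cycle R I Q k (F k x)"
proof -
  note xc = P.tor_cycle_closed[OF x]
  have "one_tensor R I (obj Q (k - 1)) (F (k - 1) (diff P k x)) =
      \<zero>\<^bsub>tensor R B (obj Q (k - 1))\<^esub>"
    by (rule one_tensor_map_zero[OF P.obj Q.obj chain_liftD(1)[OF F] lin_homD(1)[OF P.diff xc]])
      (use x in \<open>simp add: tor_cycle_def\<close>)
  then show ?thesis
    using chain_liftD(2)[OF F xc] lin_homD(1)[OF chain_liftD(1)[OF F] xc] by (simp add: tor_cycle_def)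
qed

text \<open>In \<open>F - G = d h + h d\<close> the first term is a boundary. The second vanishes
  over \<open>R/I\<close>, because there \<open>h\<close> is applied to \<open>diff P k x\<close>,
  which is zero after tensoring.\<close>

lemma chain_lift_tor_class_eq:
  assumes F: "chain_lift R P Q f F" and G: "chain_lift R P Q f G" and x: "tor_cycle R I P k x"
  shows "tor_class R I Q k (F k x) = tor_class R I Q k (G k x)"
proof -
  note xc = P.tor_cycle_closed[OF x]
  note Fx = lin_homD(1)[OF chain_liftD(1)[OF F] xc] and Gx = lin_homD(1)[OF chain_liftD(1)[OF G] xc]
  obtain h where h: "\<And>j. h j \<in> lin_hom R (obj P (int j)) (obj Q (int (Suc j)))"
    "\<And>x. x \<in> carrier (obj P 0) \<Longrightarrow> F 0 x = diff Q 1 (h 0 x) \<oplus>\<^bsub>obj Q 0\<^esub> G 0 x"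
    "\<And>j x. x \<in> carrier (obj P (int (Suc j))) \<Longrightarrow> F (int (Suc j)) x =
      diff Q (int (Suc (Suc j))) (h (Suc j) x) \<oplus>\<^bsub>obj Q (int (Suc j))\<^esub>
        (G (int (Suc j)) x \<oplus>\<^bsub>obj Q (int (Suc j))\<^esub> h j (diff P (int (Suc j)) x))"
    by (rule chain_lift_homotopy[OF F G]) blast
  consider "k < 0" | "k = 0" | j where "k = int (Suc j)"
    by (metis int_cases nonneg_int_cases not0_implies_Suc not_less of_nat_0)
  then show ?thesis
  proof cases
    case 1
    then show ?thesis using Q.neg_eq[OF 1 Fx] Q.neg_eq[OF 1 Gx] by simp
  next
    case 2
    then show ?thesis
      unfolding Q.tor_class_eq_iff[OF chain_lift_tor_cycle[OF F x] chain_lift_tor_cycle[OF G x]]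
      using h(2)[of x] xc lin_homD(1)[OF h(1)[of 0]] by auto
  next
    case (3 j)
    let ?O = "obj Q (int (Suc j))"
    interpret O: module R ?O by (rule Q.obj)
    have xj: "x \<in> carrier (obj P (int (Suc j)))" using xc 3 by simp
    note dx = lin_homD(1)[OF P.diff_Suc xj]
    have hd: "one_tensor R I ?O (h j (diff P (int (Suc j)) x)) = \<zero>\<^bsub>tensor R B ?O\<^esub>"
      by (rule one_tensor_map_zero[OF P.obj Q.obj h(1) dx])
        (use x 3 in \<open>simp add: tor_cycle_def\<close>)
    have w: "h (Suc j) x \<in> carrier (obj Q (int (Suc (Suc j))))" using lin_homD(1)[OF h(1) xj] .
    have c: "diff Q (int (Suc (Suc j))) (h (Suc j) x) \<in> carrier ?O" "G (int (Suc j)) x \<in> carrier ?O"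
      "h j (diff P (int (Suc j)) x) \<in> carrier ?O"
      using lin_homD(1)[OF Q.diff_Suc w] Gx 3 lin_homD(1)[OF h(1) dx] by simp_all
    interpret TO: module R "tensor R B ?O" by (rule Q.bc.tensor_base_module)
    note ol = lin_homD[OF Q.bc.one_tensor_lin]
    have "one_tensor R I ?O (F (int (Suc j)) x) =
        one_tensor R I ?O (diff Q (int (Suc (Suc j))) (h (Suc j) x) \<oplus>\<^bsub>?O\<^esub> G (int (Suc j)) x)"
      unfolding h(3)[OF xj] using c hd ol(1)[OF c(2)] by (simp add: ol(2) del: of_nat_Suc)
    moreover have "k + 1 = int (Suc (Suc j))" using 3 by simp
    ultimately show ?thesis
      unfolding Q.tor_class_eq_iff[OF chain_lift_tor_cycle[OF F x] chain_lift_tor_cycle[OF G x]]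
      using w 3 by metis
  qed
qed

text \<open>\<open>tor_map\<close> is defined by means of an arbitrarily chosen lift. Homotopy
  invariance lets its values be computed with whichever lift is at hand.\<close>

lemma tor_map_class:
  assumes F: "chain_lift R P Q f F" and x: "tor_cycle R I P k x"
  shows "tor_map R I P Q f k (tor_class R I P k x) = tor_class R I Q k (F k x)"
proof -
  define G where "G = (SOME F. chain_lift R P Q f F)"
  have G: "chain_lift R P Q f G" unfolding G_def by (rule someI[of "chain_lift R P Q f", OF F])
  let ?t = "tor_chain_map R I P Q G k"
  have Gk: "G k \<in> lin_hom R (obj P k) (obj Q k)" by (rule chain_liftD(1)[OF G])
  have one: "?t (P.ot k y) = Q.ot k (G k y)" if "y \<in> carrier (obj P k)" for y
    unfolding tor_chain_map_def by (rule base_change_map_one[OF P.obj Q.obj Gk that])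
  have b: "?t ` boundaries P.T k \<subseteq> boundaries Q.T k"
  proof
    fix z assume "z \<in> ?t ` boundaries P.T k"
    then obtain t where t: "t \<in> carrier (obj P.T (k + 1))" "z = ?t (diff P.T (k + 1) t)"
      by (auto simp: boundaries_def)
    obtain w where w: "w \<in> carrier (obj P (k + 1))" "t = P.ot (k + 1) w" by (rule P.ot_surj[OF t(1)])
    have "z = Q.ot k (G k (diff P (k + 1) w))"
      using one[OF lin_homD(1)[OF P.diff_from w(1)]] P.T_diff_ot[OF w(1)] t w by simp
    also have "G k (diff P (k + 1) w) = diff Q (k + 1) (G (k + 1) w)"
      using chain_liftD(2)[OF G w(1)] by simp
    also have "Q.ot k \<dots> = diff Q.T (k + 1) (Q.ot (k + 1) (G (k + 1) w))"
      using Q.T_diff_ot[of "G (k + 1) w" "k + 1"] lin_homD(1)[OF chain_liftD(1)[OF G] w(1)] by simp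
    finally show "z \<in> boundaries Q.T k"
      using Q.ot_closed[OF lin_homD(1)[OF chain_liftD(1)[OF G] w(1)]] by (simp add: boundaries_def)
  qed
  have "tor_map R I P Q f k (tor_class R I P k x) = homology_map Q.T k ?t (homology_class P.T k (P.ot k x))"
    by (simp add: tor_map_def tor_class_def G_def)
  also have "\<dots> = homology_class Q.T k (?t (P.ot k x))"
  proof (rule homology_map_class[OF P.T.complex_axioms Q.T.complex_axioms _ b])
    show "?t \<in> lin_hom R (obj P.T k) (obj Q.T k)"
      unfolding tor_chain_map_def tor_complex_simps by (rule base_change_map_lin[OF P.obj Q.obj Gk])
    show "P.ot k x \<in> cycles P.T k" using x P.tor_cycle_ot P.tor_cycle_closed by blast
    show "?t (P.ot k x) \<in> cycles Q.T k"
      using one[OF P.tor_cycle_closed[OF x]] chain_lift_tor_cycle[OF G x] Q.tor_cycle_ot Q.tor_cycle_closed by metis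
  qed
  also have "\<dots> = tor_class R I Q k (G k x)"
    using one[OF P.tor_cycle_closed[OF x]] by (simp add: tor_class_def)
  also have "\<dots> = tor_class R I Q k (F k x)" by (rule chain_lift_tor_class_eq[OF G F x])
  finally show ?thesis .
qed

end

section \<open>Koszul complexes\<close>

lemma (in abelian_monoid) finsum_swap:
  assumes "finite A" "finite B" "\<And>i j. i \<in> A \<Longrightarrow> j \<in> B \<Longrightarrow> f i j \<in> carrier G"
  shows "(\<Oplus>i\<in>A. \<Oplus>j\<in>B. f i j) = (\<Oplus>j\<in>B. \<Oplus>i\<in>A. f i j)"
  using assms(1,3)
proof (induction A rule: finite_induct)
  case (insert a A)
  have "(\<Oplus>i\<in>insert a A. \<Oplus>j\<in>B. f i j) = (\<Oplus>j\<in>B. f a j) \<oplus> (\<Oplus>j\<in>B. \<Oplus>i\<in>A. f i j)"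
    using insert by (subst finsum_insert) (auto intro!: finsum_closed)
  also have "\<dots> = (\<Oplus>j\<in>B. f a j \<oplus> (\<Oplus>i\<in>A. f i j))"
    using insert.prems by (intro finsum_addf[symmetric]) (auto intro!: finsum_closed)
  also have "\<dots> = (\<Oplus>j\<in>B. \<Oplus>i\<in>insert a A. f i j)"
  proof (rule finsum_cong'[OF refl])
    fix j assume j: "j \<in> B"
    show "f a j \<oplus> (\<Oplus>i\<in>A. f i j) = (\<Oplus>i\<in>insert a A. f i j)"
      using insert j by (subst finsum_insert) auto
  qed (use insert.prems in \<open>auto intro!: finsum_closed\<close>)
  finally show ?case .
qed simp

lemma (in abelian_monoid) finsum_single:
  assumes "finite A" "i \<in> A" "t i \<in> carrier G" "\<And>j. j \<in> A \<Longrightarrow> j \<noteq> i \<Longrightarrow> t j = \<zero>"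
  shows "(\<Oplus>j\<in>A. t j) = t i"
proof -
  have "t j \<in> carrier G" if "j \<in> A" for j
    using assms(3,4) that by (cases "j = i") auto
  then have "(\<Oplus>j\<in>A. t j) = (\<Oplus>j\<in>{i}. t j)"
    by (intro add.finprod_mono_neutral_cong_right) (use assms in auto)
  then show ?thesis using assms(3) by simp
qed

text \<open>Induction that splits off the last row and the last column, whose entries cancel in
  pairs. The vanishing of the diagonal is a separate assumption, since antisymmetry alone gives only
  that twice a diagonal entry is zero.\<close>

lemma (in abelian_group) finsum_antisym:
  assumes "\<And>i j. i < (n::nat) \<Longrightarrow> j < n \<Longrightarrow> f i j \<in> carrier G"
    and "\<And>i j. i < n \<Longrightarrow> j < n \<Longrightarrow> f i j = \<ominus> f j i" "\<And>i. i < n \<Longrightarrow> f i i = \<zero>"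
  shows "(\<Oplus>i\<in>{..<n}. \<Oplus>j\<in>{..<n}. f i j) = \<zero>"
  using assms
proof (induction n)
  case 0
  show ?case by simp
next
  case (Suc n)
  have c: "i \<le> n \<Longrightarrow> j \<le> n \<Longrightarrow> f i j \<in> carrier G" for i j using Suc.prems(1) by (simp add: less_Suc_eq_le)
  have s: "(\<Oplus>j\<in>{..<Suc n}. f i j) = f i n \<oplus> (\<Oplus>j\<in>{..<n}. f i j)" if "i \<le> n" for i
    unfolding lessThan_Suc using c that by (subst finsum_insert) auto
  have cs: "(\<Oplus>j\<in>{..<n}. f i j) \<in> carrier G" if "i \<le> n" for i
    using c that by (intro finsum_closed) auto
  have "(\<Oplus>i\<in>{..<Suc n}. \<Oplus>j\<in>{..<Suc n}. f i j) =
      (\<Oplus>j\<in>{..<Suc n}. f n j) \<oplus> (\<Oplus>i\<in>{..<n}. \<Oplus>j\<in>{..<Suc n}. f i j)"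
    unfolding lessThan_Suc[of n] using c by (subst finsum_insert) (auto intro!: finsum_closed)
  also have "(\<Oplus>j\<in>{..<Suc n}. f n j) = (\<Oplus>j\<in>{..<n}. f n j)"
    using s[of n] Suc.prems(3)[of n] cs[of n] by simp
  also have "(\<Oplus>i\<in>{..<n}. \<Oplus>j\<in>{..<Suc n}. f i j) = (\<Oplus>i\<in>{..<n}. f i n \<oplus> (\<Oplus>j\<in>{..<n}. f i j))"
    by (rule finsum_cong') (use s c cs in auto)
  also have "\<dots> = (\<Oplus>i\<in>{..<n}. f i n) \<oplus> (\<Oplus>i\<in>{..<n}. \<Oplus>j\<in>{..<n}. f i j)"
    by (rule finsum_addf) (use c cs in auto)
  also have "(\<Oplus>i\<in>{..<n}. \<Oplus>j\<in>{..<n}. f i j) = \<zero>"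
  proof (rule Suc.IH)
    fix i j assume "i < n" "j < n"
    then show "f i j \<in> carrier G" "f i j = \<ominus> f j i"
      using Suc.prems(1)[of i j] Suc.prems(2)[of i j] less_SucI by metis+
  next
    fix i assume "i < n"
    then show "f i i = \<zero>" by (intro Suc.prems(3)) simp
  qed
  also have "(\<Oplus>j\<in>{..<n}. f n j) \<oplus> ((\<Oplus>i\<in>{..<n}. f i n) \<oplus> \<zero>) = (\<Oplus>j\<in>{..<n}. f n j \<oplus> f j n)"
    using c by (subst finsum_addf) (auto intro!: finsum_closed)
  also have "\<dots> = (\<Oplus>j\<in>{..<n}. \<zero>)"
  proof (rule finsum_cong'[OF refl])
    fix j assume j: "j \<in> {..<n}"
    have e: "f n j = \<ominus> f j n" by (rule Suc.prems(2)) (use j in auto)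
    show "f n j \<oplus> f j n = \<zero>" unfolding e by (rule l_neg[OF c]) (use j in auto)
  qed simp
  finally show ?case by simp
qed

lemma ext_alg_simps':
  "x \<in> carrier (ext_alg A n) \<longleftrightarrow> (\<forall>J. x J \<in> carrier A) \<and> (\<forall>J. \<not> J \<subseteq> {..<n} \<longrightarrow> x J = \<zero>\<^bsub>A\<^esub>)"
  "\<zero>\<^bsub>ext_alg A n\<^esub> = (\<lambda>J. \<zero>\<^bsub>A\<^esub>)"
  by (simp_all add: ext_alg_def)

lemma card_less_insert:
  assumes "finite J" "j \<notin> J"
  shows "card {l \<in> insert j J. l < (i::nat)} = card {l \<in> J. l < i} + (if j < i then 1 else 0)"
proof -
  have "{l \<in> insert j J. l < i} = (if j < i then insert j {l \<in> J. l < i} else {l \<in> J. l < i})" by auto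
  then show ?thesis using assms by simp
qed

context cring
begin

lemma ext_deg_carrier: "x \<in> ext_deg R n k \<Longrightarrow> x \<in> carrier (ext_alg R n)"
  by (simp add: ext_deg_def)

lemma ext_deg_iff:
  "x \<in> ext_deg R n k \<longleftrightarrow> (\<forall>J. x J \<in> carrier R) \<and> (\<forall>J. x J \<noteq> \<zero> \<longrightarrow> J \<subseteq> {..<n} \<and> int (card J) = k)"
  by (auto simp: ext_deg_def ext_alg_simps')

lemma ext_alg_module: "module R (ext_alg R n)"
  by (rule coordinate_module[OF is_cring, where ev = "\<lambda>J x. x J"])
    (auto simp: ext_alg_simps' ext_alg_simps)

text \<open>Both sides pick out the coefficient at \<open>insert i (insert j J)\<close>. The sign
  exponents differ by one, as only the larger of the two indices counts the other among the smaller
  elements.\<close>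

lemma ext_partial_anticomm:
  assumes x: "x \<in> carrier (ext_alg R n)"
  shows "ext_partial R n i (ext_partial R n j x) J = \<ominus> ext_partial R n j (ext_partial R n i x) J"
proof (cases "J \<subseteq> {..<n} \<and> i < n \<and> j < n \<and> i \<notin> J \<and> j \<notin> J \<and> i \<noteq> j")
  case False
  then show ?thesis by (auto simp: ext_partial_def a_inv_zero)
next
  case True
  then have fin: "finite J" using finite_subset by blast
  note [simp] = ext_alg_carrierD(1)[OF x]
  let ?s = "neg_one_pow R"
  have a: "ext_partial R n i (ext_partial R n j x) J =
      ?s (card {l \<in> J. l < i} + card {l \<in> insert i J. l < j}) \<otimes> x (insert i (insert j J))"
    using True by (auto simp: ext_partial_def m_assoc[symmetric] neg_one_pow_add insert_commute)
  have b: "ext_partial R n j (ext_partial R n i x) J =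
      ?s (card {l \<in> J. l < j} + card {l \<in> insert j J. l < i}) \<otimes> x (insert i (insert j J))"
    using True by (auto simp: ext_partial_def m_assoc[symmetric] neg_one_pow_add)
  show ?thesis
    using True card_less_insert[OF fin, of i j] card_less_insert[OF fin, of j i] unfolding a b
    by (cases "i < j") (auto simp: neg_one_pow_parity l_minus simp del: insert_iff)
qed

lemma ext_partial_twice: "ext_partial R n j (ext_partial R n j x) J = \<zero>"
  by (auto simp: ext_partial_def)

lemma ext_partial_finsum:
  assumes "finite T" "\<And>i. i \<in> T \<Longrightarrow> y i \<in> carrier (ext_alg R n)" "\<And>i. i \<in> T \<Longrightarrow> c i \<in> carrier R"
  shows "ext_partial R n j (\<lambda>K. \<Oplus>i\<in>T. c i \<otimes> y i K) J = (\<Oplus>i\<in>T. c i \<otimes> ext_partial R n j (y i) J)"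
proof (cases "J \<subseteq> {..<n} \<and> j < n \<and> j \<notin> J")
  case True
  have [simp]: "y i K \<in> carrier R" if "i \<in> T" for i K using ext_alg_carrierD(1)[OF assms(2)[OF that]] .
  have "neg_one_pow R (card {i \<in> J. i < j}) \<otimes> (\<Oplus>i\<in>T. c i \<otimes> y i (insert j J)) =
      (\<Oplus>i\<in>T. neg_one_pow R (card {i \<in> J. i < j}) \<otimes> (c i \<otimes> y i (insert j J)))"
    by (rule finsum_rdistr) (use assms in auto)
  also have "\<dots> = (\<Oplus>i\<in>T. c i \<otimes> ext_partial R n j (y i) J)"
    by (rule finsum_cong') (use True assms in \<open>auto simp: ext_partial_def m_lcomm\<close>)
  finally show ?thesis using True by (simp add: ext_partial_def)
next
  case False
  then have z: "ext_partial R n j w J = \<zero>" for w by (auto simp: ext_partial_def)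
  have "(\<Oplus>i\<in>T. c i \<otimes> ext_partial R n j (y i) J) = (\<Oplus>i\<in>T. \<zero>)"
    by (rule finsum_cong') (use z assms in auto)
  then show ?thesis using z by simp
qed

lemma koszul_diff_lin:
  assumes "\<And>j. j < n \<Longrightarrow> a j \<in> carrier R"
  shows "koszul_diff R n a \<in> lin_hom R (ext_alg R n) (ext_alg R n)"
  using koszul_diff_graded_derivation[OF is_cring, of n a] assms by (auto simp: graded_derivation_def)

lemma koszul_diff_deg:
  assumes "\<And>j. j < n \<Longrightarrow> a j \<in> carrier R" "x \<in> ext_deg R n k"
  shows "koszul_diff R n a x \<in> ext_deg R n (k - 1)"
  using koszul_diff_graded_derivation[OF is_cring, of n a] assms by (auto simp: graded_derivation_def)

lemma koszul_diff_square:
  assumes a: "\<And>j. j < n \<Longrightarrow> a j \<in> carrier R" and x: "x \<in> carrier (ext_alg R n)"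
  shows "koszul_diff R n a (koszul_diff R n a x) = (\<lambda>J. \<zero>)"
proof
  fix J
  note p = ext_partial_closed[OF x]
  note [simp] = ext_alg_carrierD(1)[OF ext_partial_closed[OF p]]
  let ?t = "\<lambda>j i. a j \<otimes> (a i \<otimes> ext_partial R n j (ext_partial R n i x) J)"
  have "koszul_diff R n a (koszul_diff R n a x) J =
      (\<Oplus>j\<in>{..<n}. a j \<otimes> (\<Oplus>i\<in>{..<n}. a i \<otimes> ext_partial R n j (ext_partial R n i x) J))"
  proof -
    have "ext_partial R n j (koszul_diff R n a x) J =
        (\<Oplus>i\<in>{..<n}. a i \<otimes> ext_partial R n j (ext_partial R n i x) J)" for j
      unfolding koszul_diff_def by (rule ext_partial_finsum) (use a p in auto)
    then show ?thesis by (simp add: koszul_diff_def[of R n a "koszul_diff R n a x"])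
  qed
  also have "\<dots> = (\<Oplus>j\<in>{..<n}. \<Oplus>i\<in>{..<n}. ?t j i)"
    by (rule finsum_cong') (use a in \<open>auto intro!: finsum_closed finsum_rdistr\<close>)
  also have "\<dots> = \<zero>"
  proof (rule finsum_antisym)
    show "?t i j = \<ominus> ?t j i" if "i < n" "j < n" for i j
      using that a ext_partial_anticomm[OF x, of i j J] by (simp add: r_minus m_lcomm)
  qed (use a in \<open>auto simp: ext_partial_twice\<close>)
  finally show "koszul_diff R n a (koszul_diff R n a x) J = \<zero>" .
qed

subsection \<open>Regular sequences\<close>

text \<open>Supplies explicit coefficients for an element of the ideal. They are used below as the
  coefficients of Koszul chains of degree 1.\<close>

lemma genideal_finite:
  assumes r: "\<And>j. j < (n::nat) \<Longrightarrow> r j \<in> carrier R" and "a \<in> genideal R (r ` {..<n})"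
  obtains c where "\<And>j. c j \<in> carrier R" "a = (\<Oplus>j\<in>{..<n}. c j \<otimes> r j)"
proof -
  define H where "H = {a. \<exists>c. (\<forall>j. c j \<in> carrier R) \<and> a = (\<Oplus>j\<in>{..<n}. c j \<otimes> r j)}"
  have Hc: "x \<in> carrier R" if "x \<in> H" for x using that r unfolding H_def by (auto intro!: finsum_closed)
  have add: "x \<oplus> y \<in> H" if xy: "x \<in> H" "y \<in> H" for x y
  proof -
    obtain c d where c: "\<forall>j. c j \<in> carrier R" "x = (\<Oplus>j\<in>{..<n}. c j \<otimes> r j)"
      and d: "\<forall>j. d j \<in> carrier R" "y = (\<Oplus>j\<in>{..<n}. d j \<otimes> r j)" using xy unfolding H_def by blast
    have "x \<oplus> y = (\<Oplus>j\<in>{..<n}. c j \<otimes> r j \<oplus> d j \<otimes> r j)"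
      unfolding c d by (rule finsum_addf[symmetric]) (use c d r in auto)
    also have "\<dots> = (\<Oplus>j\<in>{..<n}. (c j \<oplus> d j) \<otimes> r j)"
      by (rule finsum_cong') (use c d r in \<open>auto simp: l_distr\<close>)
    finally show ?thesis using c d unfolding H_def by (intro CollectI exI[of _ "\<lambda>j. c j \<oplus> d j"]) auto
  qed
  have mult: "b \<otimes> x \<in> H" if b: "b \<in> carrier R" and x: "x \<in> H" for b x
  proof -
    obtain c where c: "\<forall>j. c j \<in> carrier R" "x = (\<Oplus>j\<in>{..<n}. c j \<otimes> r j)" using x unfolding H_def by blast
    have "b \<otimes> x = (\<Oplus>j\<in>{..<n}. b \<otimes> (c j \<otimes> r j))"
      unfolding c by (rule finsum_rdistr) (use b c r in auto)
    also have "\<dots> = (\<Oplus>j\<in>{..<n}. (b \<otimes> c j) \<otimes> r j)"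
      by (rule finsum_cong') (use b c r in \<open>auto simp: m_assoc\<close>)
    finally show ?thesis using b c unfolding H_def by (intro CollectI exI[of _ "\<lambda>j. b \<otimes> c j"]) auto
  qed
  have zero: "\<zero> \<in> H"
  proof -
    have "(\<Oplus>j\<in>{..<n}. \<zero> \<otimes> r j) = (\<Oplus>j\<in>{..<n}. \<zero>)" by (rule finsum_cong') (use r in auto)
    then show ?thesis unfolding H_def by (intro CollectI exI[of _ "\<lambda>j. \<zero>"]) auto
  qed
  have neg: "\<ominus> x \<in> H" if "x \<in> H" for x
    using mult[OF _ that, of "\<ominus> \<one>"] Hc[OF that] by (simp add: l_minus)
  have "ideal H R"
  proof (rule idealI[OF ring_axioms])
    show "subgroup H (add_monoid R)"
      by (rule add.subgroupI) (use Hc add zero neg in auto)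
    fix a x assume a: "a \<in> H" "x \<in> carrier R"
    then show "x \<otimes> a \<in> H" by (rule mult[rotated])
    then show "a \<otimes> x \<in> H" using m_comm[OF Hc[OF a(1)] a(2)] by simp
  qed
  moreover have "r ` {..<n} \<subseteq> H"
  proof
    fix x assume "x \<in> r ` {..<n}"
    then obtain i where i: "i < n" "x = r i" by auto
    have "(\<Oplus>j\<in>{..<n}. (if j = i then \<one> else \<zero>) \<otimes> r j) = (if i = i then \<one> else \<zero>) \<otimes> r i"
      by (rule finsum_single) (use i r in auto)
    then show "x \<in> H" using i r unfolding H_def by (intro CollectI exI[of _ "\<lambda>j. if j = i then \<one> else \<zero>"]) auto
  qed
  ultimately have "genideal R (r ` {..<n}) \<subseteq> H" by (rule genideal_minimal)
  then show thesis using assms(2) that unfolding H_def by blast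
qed

lemma regular_seqD:
  assumes reg: "regular_seq R r n" and j: "j < n"
  shows "r j \<in> carrier R"
    and "c \<in> carrier R \<Longrightarrow> r j \<otimes> c \<in> genideal R (r ` {..<j}) \<Longrightarrow> c \<in> genideal R (r ` {..<j})"
proof -
  show rj: "r j \<in> carrier R" using reg j by (simp add: regular_seq_def)
  let ?J = "genideal R (r ` {..<j})"
  have "r ` {..<j} \<subseteq> carrier R" using reg j by (auto simp: regular_seq_def)
  then have "ideal ?J R" by (rule genideal_ideal)
  then interpret q: quotient_by_ideal R ?J by (simp add: quotient_by_ideal_def is_cring)
  assume c: "c \<in> carrier R" and "r j \<otimes> c \<in> ?J"
  then have "(?J +> r j) \<otimes>\<^bsub>R Quot ?J\<^esub> (?J +> c) = \<zero>\<^bsub>R Quot ?J\<^esub>"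
    using rj by (simp add: q.coset_mult q.coset_zero_iff q.S_simps)
  then have "?J +> c = \<zero>\<^bsub>R Quot ?J\<^esub>"
    using reg j q.coset_closed[OF c] by (simp add: regular_seq_def Let_def)
  then show "c \<in> ?J" using q.coset_zero_iff[OF c] by (simp add: q.S_simps)
qed

text \<open>Splitting off the last generator: the coefficients at sets containing \<open>n\<close>
  and at sets avoiding \<open>n\<close> give two elements of the exterior algebra on
  \<open>n\<close> generators. As \<open>n\<close> is the largest index, it does not enter the signs
  of the other partial derivatives, and \<open>\<partial>/\<partial>e_n\<close> carries the sign
  \<open>(-1)^card J\<close>. The complex for \<open>n + 1\<close> elements is thus, up to signs,
  the mapping cone of multiplication by \<open>r n\<close> on the complex for \<open>n\<close>
  elements.\<close>

lemma koszul_diff_Suc_new: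
  assumes r: "\<And>j. j < Suc n \<Longrightarrow> r j \<in> carrier R" and x: "x \<in> carrier (ext_alg R (Suc n))"
    and J: "J \<subseteq> {..<n}"
  shows "koszul_diff R (Suc n) r x (insert n J) = koszul_diff R n r (\<lambda>K. if K \<subseteq> {..<n} then x (insert n K) else \<zero>) J"
proof -
  note [simp] = ext_alg_carrierD(1)[OF x]
  have fin: "finite J" "n \<notin> J" using J finite_subset by auto
  have "koszul_diff R (Suc n) r x (insert n J) =
      r n \<otimes> ext_partial R (Suc n) n x (insert n J) \<oplus> (\<Oplus>j\<in>{..<n}. r j \<otimes> ext_partial R (Suc n) j x (insert n J))"
    unfolding koszul_diff_def lessThan_Suc
    by (subst finsum_insert) (use r ext_alg_carrierD(1)[OF ext_partial_closed[OF x]] in auto)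
  also have "r n \<otimes> ext_partial R (Suc n) n x (insert n J) = \<zero>"
    using r by (simp add: ext_partial_def)
  also have "(\<Oplus>j\<in>{..<n}. r j \<otimes> ext_partial R (Suc n) j x (insert n J)) =
      koszul_diff R n r (\<lambda>K. if K \<subseteq> {..<n} then x (insert n K) else \<zero>) J"
    unfolding koszul_diff_def
  proof (rule finsum_cong'[OF refl])
    fix j assume j: "j \<in> {..<n}"
    have s: "{i \<in> insert n J. i < j} = {i \<in> J. i < j}" using j by auto
    have sub: "insert n J \<subseteq> {..<Suc n}" "j < n" "j \<noteq> n" "insert j J \<subseteq> {..<n}" using j J by auto
    have "ext_partial R (Suc n) j x (insert n J) =
        ext_partial R n j (\<lambda>K. if K \<subseteq> {..<n} then x (insert n K) else \<zero>) J"
      unfolding ext_partial_def s using sub J by (cases "j \<in> J") (simp_all add: insert_commute)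
    then show "r j \<otimes> ext_partial R (Suc n) j x (insert n J) =
        r j \<otimes> ext_partial R n j (\<lambda>K. if K \<subseteq> {..<n} then x (insert n K) else \<zero>) J" by simp
  qed (use r in \<open>auto simp: ext_partial_def\<close>)
  finally show ?thesis using r x by (simp add: koszul_diff_def ext_partial_def)
qed

lemma koszul_diff_Suc_old:
  assumes r: "\<And>j. j < Suc n \<Longrightarrow> r j \<in> carrier R" and x: "x \<in> carrier (ext_alg R (Suc n))"
    and J: "J \<subseteq> {..<n}"
  shows "koszul_diff R (Suc n) r x J =
    neg_one_pow R (card J) \<otimes> (r n \<otimes> x (insert n J)) \<oplus> koszul_diff R n r (\<lambda>K. if K \<subseteq> {..<n} then x K else \<zero>) J"
proof -
  note [simp] = ext_alg_carrierD(1)[OF x]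
  have fin: "finite J" "n \<notin> J" using J finite_subset by auto
  have "koszul_diff R (Suc n) r x J =
      r n \<otimes> ext_partial R (Suc n) n x J \<oplus> (\<Oplus>j\<in>{..<n}. r j \<otimes> ext_partial R (Suc n) j x J)"
    unfolding koszul_diff_def lessThan_Suc
    by (subst finsum_insert) (use r ext_alg_carrierD(1)[OF ext_partial_closed[OF x]] in auto)
  also have "r n \<otimes> ext_partial R (Suc n) n x J = neg_one_pow R (card J) \<otimes> (r n \<otimes> x (insert n J))"
  proof -
    have "{i \<in> J. i < n} = J" using J by auto
    then show ?thesis using r[of n] fin J by (auto simp: ext_partial_def m_lcomm)
  qed
  also have "(\<Oplus>j\<in>{..<n}. r j \<otimes> ext_partial R (Suc n) j x J) =
      koszul_diff R n r (\<lambda>K. if K \<subseteq> {..<n} then x K else \<zero>) J"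
    unfolding koszul_diff_def
    by (rule finsum_cong') (use r J in \<open>auto simp: ext_partial_def\<close>)
  finally show ?thesis .
qed

text \<open>Induction along the mapping cone. A cycle has a part \<open>xn\<close> at the sets
  containing \<open>n\<close>, which is a cycle of the smaller complex, and a part \<open>xo\<close>
  whose boundary is \<open>r n\<close> times \<open>xn\<close> up to sign. A primitive
  \<open>yn\<close> of \<open>xn\<close> is found, and subtracting a multiple of \<open>yn\<close>
  turns \<open>xo\<close> into a cycle to which the induction hypothesis applies. The condition on
  \<open>r n\<close> enters in degree 1, where \<open>xn\<close> is a scalar: \<open>r n\<close>
  multiplies it into the ideal of the earlier elements, so it lies in this ideal and is a
  boundary.\<close>

theorem koszul_exact:
  assumes "regular_seq R r n" "x \<in> ext_deg R n (int (Suc k))" "koszul_diff R n r x = (\<lambda>J. \<zero>)"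
  shows "\<exists>y\<in>ext_deg R n (int (Suc (Suc k))). koszul_diff R n r y = x"
  using assms
proof (induction n arbitrary: x k)
  case 0
  have "x J = \<zero>" for J
  proof (rule ccontr)
    assume "x J \<noteq> \<zero>"
    then have "J \<subseteq> {}" "int (card J) = int (Suc k)" using 0(2) unfolding ext_deg_iff by auto
    then show False by simp
  qed
  then have "x = (\<lambda>J. \<zero>)" by auto
  then have "koszul_diff R 0 r x = x" by (simp add: koszul_diff_def)
  moreover have "x \<in> ext_deg R 0 (int (Suc (Suc k)))" using \<open>x = _\<close> by (simp add: ext_deg_iff)
  ultimately show ?case by blast
next
  case (Suc n)
  note reg = Suc.prems(1)
  have regn: "regular_seq R r n" using reg by (simp add: regular_seq_def)
  have r: "r j \<in> carrier R" if "j < Suc n" for j using regular_seqD(1)[OF reg that] .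
  have rn: "r j \<in> carrier R" if "j < n" for j using r that by simp
  have xc: "x \<in> carrier (ext_alg R (Suc n))" using Suc.prems(2) by (rule ext_deg_carrier)
  note xR = ext_alg_carrierD(1)[OF xc]
  have xdeg: "J \<subseteq> {..<Suc n} \<and> card J = Suc k" if "x J \<noteq> \<zero>" for J
    using Suc.prems(2) that by (auto simp: ext_deg_iff)
  interpret E: module R "ext_alg R n" by (rule ext_alg_module)
  note lin = koszul_diff_lin[of n r, OF rn]
  let ?s = "neg_one_pow R"
  define xo where "xo K = (if K \<subseteq> {..<n} then x K else \<zero>)" for K
  define xn where "xn K = (if K \<subseteq> {..<n} then x (insert n K) else \<zero>)" for K
  have xo: "xo \<in> ext_deg R n (int (Suc k))"
    using xR xdeg by (auto simp: ext_deg_iff xo_def)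
  have xn: "xn \<in> ext_deg R n (int k)"
  proof -
    have "int (card K) = int k" if "x (insert n K) \<noteq> \<zero>" "K \<subseteq> {..<n}" for K
    proof -
      have "finite K" "n \<notin> K" using that(2) finite_subset by auto
      then show ?thesis using xdeg[OF that(1)] by simp
    qed
    then show ?thesis using xR by (auto simp: ext_deg_iff xn_def)
  qed
  note xoc = ext_deg_carrier[OF xo] and xnc = ext_deg_carrier[OF xn]
  have dxn: "koszul_diff R n r xn = (\<lambda>J. \<zero>)"
  proof
    fix J show "koszul_diff R n r xn J = \<zero>"
    proof (cases "J \<subseteq> {..<n}")
      case True
      then show ?thesis
        using koszul_diff_Suc_new[of n r, OF r xc True] fun_cong[OF Suc.prems(3)] by (simp add: xn_def[abs_def])
    next
      case False
      then show ?thesis using ext_alg_carrierD(2)[OF lin_homD(1)[OF lin xnc]] by blast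
    qed
  qed
  have dxo: "?s (card J) \<otimes> (r n \<otimes> xn J) \<oplus> koszul_diff R n r xo J = \<zero>" if "J \<subseteq> {..<n}" for J
    using koszul_diff_Suc_old[of n r, OF r xc that] fun_cong[OF Suc.prems(3)] that
    by (simp add: xn_def xo_def[abs_def])
  obtain yn where yn: "yn \<in> ext_deg R n (int (Suc k))" "koszul_diff R n r yn = xn"
  proof (cases k)
    case (Suc k')
    then show thesis using Suc.IH[OF regn _ dxn, of k'] xn that by auto
  next
    case 0
    let ?c = "xn {}"
    have c: "?c \<in> carrier R" by (rule ext_alg_carrierD(1)[OF xnc])
    have xn0: "xn J = \<zero>" if "J \<noteq> {}" for J
    proof (rule ccontr)
      assume "xn J \<noteq> \<zero>"
      then have "J \<subseteq> {..<n}" "card J = 0" using xn 0 unfolding ext_deg_iff by auto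
      moreover from this have "finite J" using finite_subset by blast
      ultimately show False using that by simp
    qed
    have dxo0: "koszul_diff R n r xo {} = (\<Oplus>j\<in>{..<n}. r j \<otimes> xo {j})"
      unfolding koszul_diff_def
      by (rule finsum_cong')
        (use rn ext_alg_carrierD(1)[OF xoc] in \<open>auto simp: ext_partial_def neg_one_pow_def\<close>)
    have rsub: "r ` {..<n} \<subseteq> carrier R" using rn by auto
    interpret J: ideal "genideal R (r ` {..<n})" R by (rule genideal_ideal[OF rsub])
    have "koszul_diff R n r xo {} \<in> genideal R (r ` {..<n})"
    proof -
      have "(\<Oplus>j\<in>T. r j \<otimes> xo {j}) \<in> genideal R (r ` {..<n})" if "T \<subseteq> {..<n}" for T
      proof -
        have "finite T" using that finite_subset by blast
        then show ?thesis using that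
        proof (induction T rule: finite_induct)
          case (insert j T)
          have m: "r j \<otimes> xo {j} \<in> genideal R (r ` {..<n})" if "j < n" for j
            using genideal_self[OF rsub] that ext_alg_carrierD(1)[OF xoc] by (intro J.I_r_closed) auto
          then show ?case using insert rn ext_alg_carrierD(1)[OF xoc]
            by (subst finsum_insert) auto
        qed simp
      qed
      then show ?thesis using dxo0 by simp
    qed
    then have "\<ominus> koszul_diff R n r xo {} \<in> genideal R (r ` {..<n})" by simp
    moreover have "r n \<otimes> ?c = \<ominus> koszul_diff R n r xo {}"
    proof -
      have "r n \<otimes> ?c \<oplus> koszul_diff R n r xo {} = \<zero>"
        using dxo[of "{}"] c r[of n] by (simp add: neg_one_pow_def)
      then show ?thesis
        using c r[of n] ext_alg_carrierD(1)[OF lin_homD(1)[OF lin xoc]] by (simp add: minus_equality)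
    qed
    ultimately have mem: "?c \<in> genideal R (r ` {..<n})" using regular_seqD(2)[OF reg _ c, of n] by simp
    obtain b where b: "\<And>j. b j \<in> carrier R" "?c = (\<Oplus>j\<in>{..<n}. b j \<otimes> r j)"
      by (rule genideal_finite[of n r ?c, OF rn mem]) (assumption, rule that)
    define y where "y J = (if \<exists>j<n. J = {j} then b (the_elem J) else \<zero>)" for J
    have y: "y \<in> ext_deg R n (int (Suc 0))"
      using b(1) by (auto simp: ext_deg_iff y_def)
    have "koszul_diff R n r y J = xn J" for J
    proof (cases "J = {}")
      case True
      have "koszul_diff R n r y {} = (\<Oplus>j\<in>{..<n}. b j \<otimes> r j)"
        unfolding koszul_diff_def
        by (rule finsum_cong') (use b rn in \<open>auto simp: ext_partial_def y_def neg_one_pow_def m_comm\<close>)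
      then show ?thesis using True b by simp
    next
      case False
      have "koszul_diff R n r y \<in> ext_deg R n (int (Suc 0) - 1)" by (rule koszul_diff_deg[OF rn y])
      then have "koszul_diff R n r y J \<noteq> \<zero> \<longrightarrow> J \<subseteq> {..<n} \<and> card J = 0"
        unfolding ext_deg_iff by simp
      moreover have "finite J" if "J \<subseteq> {..<n}" using that finite_subset by blast
      ultimately have "koszul_diff R n r y J = \<zero>" using False by auto
      then show ?thesis using xn0[OF False] by simp
    qed
    then show thesis using that[of y] y 0 by auto
  qed
  note ync = ext_deg_carrier[OF yn(1)]
  \<comment> \<open>\<open>yn\<close> lives on sets of size \<open>Suc k\<close>, so this is the
    signed factor with which it enters the boundary of the new element. It also makes
    \<open>z\<close> a cycle, because on sets of size \<open>k\<close> the sign of the cone is the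
    opposite one.\<close>
  let ?a = "?s (Suc k) \<otimes> r n"
  have a: "?a \<in> carrier R" using r by simp
  define z where "z = xo \<ominus>\<^bsub>ext_alg R n\<^esub> ?a \<odot>\<^bsub>ext_alg R n\<^esub> yn"
  have zc: "z \<in> carrier (ext_alg R n)" unfolding z_def using xoc ync a by simp
  have zJ: "xo J = z J \<oplus> ?a \<otimes> yn J" for J
  proof -
    have "xo = z \<oplus>\<^bsub>ext_alg R n\<^esub> ?a \<odot>\<^bsub>ext_alg R n\<^esub> yn"
      unfolding z_def using xoc ync a by (simp add: a_minus_def E.a_assoc E.l_neg)
    then show ?thesis by (simp add: ext_alg_simps)
  qed
  have zdeg: "z \<in> ext_deg R n (int (Suc k))"
  proof -
    have "z J = \<zero>" if "xo J = \<zero>" "yn J = \<zero>" for J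
      using zJ[of J] that ext_alg_carrierD(1)[OF zc, of J] a by simp
    then have "J \<subseteq> {..<n} \<and> int (card J) = int (Suc k)" if "z J \<noteq> \<zero>" for J
      using that xo yn(1) unfolding ext_deg_iff by metis
    then show ?thesis using ext_alg_carrierD(1)[OF zc] by (simp add: ext_deg_iff)
  qed
  have "koszul_diff R n r z = (\<lambda>J. \<zero>)"
  proof
    fix J
    have xnR: "xn J \<in> carrier R" by (rule ext_alg_carrierD(1)[OF xnc])
    have dzR: "koszul_diff R n r z J \<in> carrier R" by (rule ext_alg_carrierD(1)[OF lin_homD(1)[OF lin zc]])
    have "xo = z \<oplus>\<^bsub>ext_alg R n\<^esub> ?a \<odot>\<^bsub>ext_alg R n\<^esub> yn" using zJ by (auto simp: ext_alg_simps)
    then have d: "koszul_diff R n r xo J = koszul_diff R n r z J \<oplus> ?a \<otimes> xn J"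
      using lin_homD(2)[OF lin zc E.smult_closed[OF a ync]] lin_homD(3)[OF lin a ync] yn(2)
      by (simp add: ext_alg_simps)
    show "koszul_diff R n r z J = \<zero>"
    proof (cases "J \<subseteq> {..<n} \<and> xn J \<noteq> \<zero>")
      case True
      then have "card J = k" using xn by (auto simp: ext_deg_iff)
      then have "?s k \<otimes> (r n \<otimes> xn J) \<oplus> (koszul_diff R n r z J \<oplus> ?a \<otimes> xn J) = \<zero>"
        using dxo[of J] True d by simp
      moreover have "?a \<otimes> xn J = \<ominus> (?s k \<otimes> (r n \<otimes> xn J))"
        using r[of n] xnR by (simp add: neg_one_pow_Suc l_minus m_assoc)
      ultimately show ?thesis
        using dzR r[of n] xnR by (simp add: a_lcomm r_neg)
    next
      case False
      show ?thesis
      proof (cases "J \<subseteq> {..<n}")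
        case True
        then have "xn J = \<zero>" using False by simp
        then show ?thesis using dxo[OF True] d dzR a r[of n] by simp
      next
        case False
        then show ?thesis using ext_alg_carrierD(2)[OF lin_homD(1)[OF lin zc]] by blast
      qed
    qed
  qed
  from Suc.IH[OF regn zdeg this] obtain yo where
    yo: "yo \<in> ext_deg R n (int (Suc (Suc k)))" "koszul_diff R n r yo = z" by blast
  note yoc = ext_deg_carrier[OF yo(1)]
  note yoR = ext_alg_carrierD(1)[OF yoc] and ynR = ext_alg_carrierD(1)[OF ync]
  define y where "y J = (if n \<in> J then yn (J - {n}) else yo J)" for J
  have ydeg: "y \<in> ext_deg R (Suc n) (int (Suc (Suc k)))"
  proof -
    have "J \<subseteq> {..<Suc n} \<and> int (card J) = int (Suc (Suc k))" if "y J \<noteq> \<zero>" for J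
    proof (cases "n \<in> J")
      case True
      then have "J - {n} \<subseteq> {..<n}" "card (J - {n}) = Suc k"
        using that yn(1) by (auto simp: y_def ext_deg_iff)
      moreover from this have "finite J" using finite_subset by (metis finite_Diff2 finite_insert finite.emptyI finite_lessThan)
      ultimately show ?thesis using True by (auto simp: card_Diff_singleton less_Suc_eq)
    next
      case False
      then have "J \<subseteq> {..<n} \<and> int (card J) = int (Suc (Suc k))"
        using that yo(1) by (simp add: y_def ext_deg_iff)
      then show ?thesis by auto
    qed
    then show ?thesis using yoR ynR by (simp add: ext_deg_iff y_def)
  qed
  note yc = ext_deg_carrier[OF ydeg]
  have yold: "(\<lambda>K. if K \<subseteq> {..<n} then y K else \<zero>) = yo"
    using ext_alg_carrierD(2)[OF yoc] by (auto simp: y_def fun_eq_iff)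
  have ynew: "(\<lambda>K. if K \<subseteq> {..<n} then y (insert n K) else \<zero>) = yn"
  proof
    fix K
    have "insert n K - {n} = K" if "K \<subseteq> {..<n}" using that by auto
    then show "(if K \<subseteq> {..<n} then y (insert n K) else \<zero>) = yn K"
      using ext_alg_carrierD(2)[OF ync] by (auto simp: y_def)
  qed
  have "koszul_diff R (Suc n) r y J = x J" for J
  proof -
    consider "\<not> J \<subseteq> {..<Suc n}" | "J \<subseteq> {..<n}" | K where "J = insert n K" "K \<subseteq> {..<n}"
    proof (cases "n \<in> J")
      case True
      then have "J = insert n (J - {n})" by auto
      moreover have "J - {n} \<subseteq> {..<n}" if "J \<subseteq> {..<Suc n}" using that by auto
      ultimately show ?thesis using that by blast
    next
      case False
      then have "J \<subseteq> {..<n}" if "J \<subseteq> {..<Suc n}" using that by (auto simp: less_Suc_eq)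
      then show ?thesis using that by blast
    qed
    then show ?thesis
    proof cases
      case 1
      have dyc: "koszul_diff R (Suc n) r y \<in> carrier (ext_alg R (Suc n))"
        by (rule lin_homD(1)[OF koszul_diff_lin[of "Suc n" r, OF r] yc])
      show ?thesis using ext_alg_carrierD(2)[OF dyc 1] ext_alg_carrierD(2)[OF xc 1] by simp
    next
      case 2
      have yi: "y (insert n J) = yn J" using fun_cong[OF ynew, of J] 2 by simp
      have "koszul_diff R (Suc n) r y J = ?s (card J) \<otimes> (r n \<otimes> yn J) \<oplus> z J"
        using koszul_diff_Suc_old[of n r y J, OF r yc 2] by (simp only: yold yo(2) yi)
      also have "?s (card J) \<otimes> (r n \<otimes> yn J) = ?a \<otimes> yn J"
      proof (cases "yn J = \<zero>")
        case False
        then have "card J = Suc k" using yn(1) by (auto simp: ext_deg_iff)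
        then show ?thesis using r[of n] ynR by (simp add: m_assoc)
      qed (use r[of n] in simp)
      also have "?a \<otimes> yn J \<oplus> z J = xo J"
        unfolding zJ by (rule a_comm) (use a ynR ext_alg_carrierD(1)[OF zc] in auto)
      also have "xo J = x J" using 2 by (simp add: xo_def)
      finally show ?thesis .
    next
      case 3
      have "koszul_diff R (Suc n) r y J = koszul_diff R n r yn K"
        using koszul_diff_Suc_new[of n r y K, OF r yc 3(2)] by (simp only: ynew 3(1))
      then show ?thesis using 3 yn(2) by (simp add: xn_def)
    qed
  qed
  then show ?case using ydeg by blast
qed

end

subsection \<open>Bigraded coordinates\<close>

text \<open>
  An element of the exterior algebra over the polynomial ring is a function of a set \<open>J\<close> and a
  monomial \<open>m\<close>. The functions below are the component of bidegree \<open>(s, k)\<close>, the differential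
  \<open>\<Sum> f\<^sub>j \<partial>/\<partial>e\<^sub>j\<close>, and the differential \<open>\<Sum> r\<^sub>j \<partial>/\<partial>e\<^sub>j\<close> with constant coefficients.
\<close>

definition bideg :: "('a, 'c) ring_scheme \<Rightarrow> nat \<Rightarrow> nat \<Rightarrow> int \<Rightarrow> (nat set \<Rightarrow> nat multiset \<Rightarrow> 'a) set"
  where "bideg A n s k = {x. \<forall>J m. x J m \<in> carrier A \<and>
    (x J m \<noteq> \<zero>\<^bsub>A\<^esub> \<longrightarrow> J \<subseteq> {..<n} \<and> int (card J) = k \<and> set_mset m \<subseteq> {..<n} \<and> size m = s)}"

definition sym_koszul ::
    "('a, 'c) ring_scheme \<Rightarrow> nat \<Rightarrow> (nat set \<Rightarrow> nat multiset \<Rightarrow> 'a) \<Rightarrow> nat set \<Rightarrow> nat multiset \<Rightarrow> 'a"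
  where "sym_koszul A n x = (\<lambda>J m. \<Oplus>\<^bsub>A\<^esub>j\<in>{..<n}.
    if j \<in># m then ext_partial A n j (\<lambda>K. x K (m - {#j#})) J else \<zero>\<^bsub>A\<^esub>)"

definition const_koszul ::
    "('a, 'c) ring_scheme \<Rightarrow> nat \<Rightarrow> (nat \<Rightarrow> 'a) \<Rightarrow> (nat set \<Rightarrow> nat multiset \<Rightarrow> 'a)
      \<Rightarrow> nat set \<Rightarrow> nat multiset \<Rightarrow> 'a"
  where "const_koszul A n r x = (\<lambda>J m. koszul_diff A n r (\<lambda>K. x K m) J)"

text \<open>
  A contracting homotopy that works over any ring of coefficients: where the largest variable that
  occurs in \<open>m e\<^sub>J\<close> occurs in \<open>m\<close> only, it is moved from \<open>m\<close> to \<open>J\<close>.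
\<close>

definition contraction ::
    "('a, 'c) ring_scheme \<Rightarrow> (nat set \<Rightarrow> nat multiset \<Rightarrow> 'a) \<Rightarrow> nat set \<Rightarrow> nat multiset \<Rightarrow> 'a"
  where "contraction A x = (\<lambda>J m. let i = Max (J \<union> set_mset m) in
    if i \<in> J then neg_one_pow A (card (J - {i})) \<otimes>\<^bsub>A\<^esub> x (J - {i}) (add_mset i m) else \<zero>\<^bsub>A\<^esub>)"

lemma finite_submultisets: "finite {b. b \<subseteq># (m :: 'x multiset)}"
proof (induction m)
  case (add x m)
  have "b \<in> {b. b \<subseteq># m} \<union> add_mset x ` {b. b \<subseteq># m}" if b: "b \<subseteq># add_mset x m" for b
  proof (cases "x \<in># b")
    case True
    then obtain b' where b': "b = add_mset x b'" by (metis mset_add)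
    then show ?thesis using b by simp
  next
    case False
    have "count b a \<le> count m a" for a
      using mset_subset_eq_count[OF b, of a] False by (cases "a = x") (auto simp: not_in_iff)
    then show ?thesis by (simp add: subseteq_mset_def)
  qed
  then have "{b. b \<subseteq># add_mset x m} \<subseteq> {b. b \<subseteq># m} \<union> add_mset x ` {b. b \<subseteq># m}" by blast
  then show ?case using add.IH finite_subset by blast
qed simp

lemma sym_alg_simps:
  "p \<oplus>\<^bsub>sym_alg A n\<^esub> q = (\<lambda>m. p m \<oplus>\<^bsub>A\<^esub> q m)" "\<zero>\<^bsub>sym_alg A n\<^esub> = (\<lambda>m. \<zero>\<^bsub>A\<^esub>)"
  "p \<in> carrier (sym_alg A n) \<longleftrightarrow> (\<forall>m. p m \<in> carrier A) \<and> finite {m. p m \<noteq> \<zero>\<^bsub>A\<^esub>} \<and>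
    (\<forall>m. p m \<noteq> \<zero>\<^bsub>A\<^esub> \<longrightarrow> set_mset m \<subseteq> {..<n})"
  by (simp_all add: sym_alg_def)

text \<open>In a fixed degree the support is automatically finite, since there are only finitely
  many monomials of size \<open>s\<close> in \<open>n\<close> variables.\<close>

lemma sym_deg_iff:
  "p \<in> sym_deg A n s \<longleftrightarrow> (\<forall>m. p m \<in> carrier A \<and> (p m \<noteq> \<zero>\<^bsub>A\<^esub> \<longrightarrow> set_mset m \<subseteq> {..<n} \<and> size m = s))"
proof -
  have "finite {m. p m \<noteq> \<zero>\<^bsub>A\<^esub>}" if "\<forall>m. p m \<noteq> \<zero>\<^bsub>A\<^esub> \<longrightarrow> set_mset m \<subseteq> {..<n} \<and> size m = s"
    by (rule finite_subset[OF _ finite_multisets_of_size[of "{..<n}" s]])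
      (use that in \<open>auto simp: multisets_of_size_def\<close>)
  then show ?thesis by (auto simp: sym_deg_def sym_alg_simps)
qed

lemma koszul_alg_simps:
  "carrier (koszul_alg A n) = carrier (ext_alg (sym_alg A n) n)"
  "\<zero>\<^bsub>koszul_alg A n\<^esub> = (\<lambda>J m. \<zero>\<^bsub>A\<^esub>)" "x \<oplus>\<^bsub>koszul_alg A n\<^esub> y = (\<lambda>J m. x J m \<oplus>\<^bsub>A\<^esub> y J m)"
  "a \<odot>\<^bsub>koszul_alg A n\<^esub> x = (\<lambda>J. sym_const A a \<otimes>\<^bsub>sym_alg A n\<^esub> x J)"
  by (simp_all add: koszul_alg_def ext_alg_simps ext_alg_simps' sym_alg_simps)

lemma koszul_comp_simps:
  "carrier (koszul_comp A n s k) = bideg A n s k"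
  "\<zero>\<^bsub>koszul_comp A n s k\<^esub> = (\<lambda>J m. \<zero>\<^bsub>A\<^esub>)" "x \<oplus>\<^bsub>koszul_comp A n s k\<^esub> y = (\<lambda>J m. x J m \<oplus>\<^bsub>A\<^esub> y J m)"
  "a \<odot>\<^bsub>koszul_comp A n s k\<^esub> x = (\<lambda>J. sym_const A a \<otimes>\<^bsub>sym_alg A n\<^esub> x J)"
proof -
  have "x \<in> ext_deg (sym_alg A n) n k \<and> (\<forall>J. x J \<in> sym_deg A n s) \<longleftrightarrow> x \<in> bideg A n s k" for x
  proof
    assume x: "x \<in> ext_deg (sym_alg A n) n k \<and> (\<forall>J. x J \<in> sym_deg A n s)"
    have "J \<subseteq> {..<n} \<and> int (card J) = k" if "x J m \<noteq> \<zero>\<^bsub>A\<^esub>" for J m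
    proof -
      have "x J \<noteq> \<zero>\<^bsub>sym_alg A n\<^esub>" using that by (auto simp: sym_alg_simps)
      then show ?thesis using x by (auto simp: ext_deg_def ext_alg_simps')
    qed
    then show "x \<in> bideg A n s k" using x unfolding sym_deg_iff bideg_def by blast
  next
    assume x: "x \<in> bideg A n s k"
    then have s: "x J \<in> sym_deg A n s" for J unfolding sym_deg_iff bideg_def by blast
    moreover have "J \<subseteq> {..<n} \<and> int (card J) = k" if nz: "x J \<noteq> \<zero>\<^bsub>sym_alg A n\<^esub>" for J
    proof -
      obtain m where "x J m \<noteq> \<zero>\<^bsub>A\<^esub>" using nz by (auto simp: sym_alg_simps)
      then show ?thesis using x by (auto simp: bideg_def)
    qed
    ultimately show "x \<in> ext_deg (sym_alg A n) n k \<and> (\<forall>J. x J \<in> sym_deg A n s)"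
      unfolding ext_deg_def ext_alg_simps' using s sym_deg_def by blast
  qed
  then show "carrier (koszul_comp A n s k) = bideg A n s k" by (auto simp: koszul_comp_def)
qed (simp_all add: koszul_comp_def koszul_alg_simps)

context cring
begin

lemma bidegD:
  assumes "x \<in> bideg R n s k"
  shows "x J m \<in> carrier R"
    and "x J m \<noteq> \<zero> \<Longrightarrow> J \<subseteq> {..<n} \<and> int (card J) = k \<and> set_mset m \<subseteq> {..<n} \<and> size m = s"
  using assms by (auto simp: bideg_def)

lemma bideg_slice: "x \<in> bideg R n s k \<Longrightarrow> (\<lambda>K. x K m) \<in> ext_deg R n k"
  by (auto simp: ext_deg_iff dest: bidegD)

lemma bideg_slice_carrier: "x \<in> bideg R n s k \<Longrightarrow> (\<lambda>K. x K m) \<in> carrier (ext_alg R n)"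
  by (rule ext_deg_carrier[OF bideg_slice])

lemma sym_mult_const:
  assumes "a \<in> carrier R" "\<And>m. p m \<in> carrier R"
  shows "(sym_const R a \<otimes>\<^bsub>sym_alg R n\<^esub> p) = (\<lambda>m. a \<otimes> p m)"
proof
  fix m
  have "(\<Oplus>b\<in>{b. b \<subseteq># m}. sym_const R a b \<otimes> p (m - b)) = sym_const R a {#} \<otimes> p (m - {#})"
    by (rule finsum_single[OF finite_submultisets]) (use assms in \<open>auto simp: sym_const_def\<close>)
  then show "(sym_const R a \<otimes>\<^bsub>sym_alg R n\<^esub> p) m = a \<otimes> p m"
    by (simp add: sym_alg_def sym_const_def)
qed

lemma sym_mult_const_right:
  assumes "a \<in> carrier R" "\<And>m. p m \<in> carrier R"
  shows "(p \<otimes>\<^bsub>sym_alg R n\<^esub> sym_const R a) = (\<lambda>m. p m \<otimes> a)"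
proof
  fix m
  have "(\<Oplus>b\<in>{b. b \<subseteq># m}. p b \<otimes> sym_const R a (m - b)) = p m \<otimes> sym_const R a (m - m)"
  proof (rule finsum_single[OF finite_submultisets])
    fix b assume "b \<in> {b. b \<subseteq># m}" "b \<noteq> m"
    then have "m - b \<noteq> {#}" by (metis Diff_eq_empty_iff_mset mem_Collect_eq subset_mset.antisym)
    then show "p b \<otimes> sym_const R a (m - b) = \<zero>" using assms by (simp add: sym_const_def)
  qed (use assms in \<open>auto simp: sym_const_def\<close>)
  then show "(p \<otimes>\<^bsub>sym_alg R n\<^esub> sym_const R a) m = p m \<otimes> a"
    by (simp add: sym_alg_def sym_const_def)
qed

lemma sym_mult_var:
  assumes "\<And>m. p m \<in> carrier R"
  shows "(sym_var R j \<otimes>\<^bsub>sym_alg R n\<^esub> p) = (\<lambda>m. if j \<in># m then p (m - {#j#}) else \<zero>)"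
proof
  fix m
  show "(sym_var R j \<otimes>\<^bsub>sym_alg R n\<^esub> p) m = (if j \<in># m then p (m - {#j#}) else \<zero>)"
  proof (cases "j \<in># m")
    case True
    have "(\<Oplus>b\<in>{b. b \<subseteq># m}. sym_var R j b \<otimes> p (m - b)) = sym_var R j {#j#} \<otimes> p (m - {#j#})"
      by (rule finsum_single[OF finite_submultisets]) (use assms True in \<open>auto simp: sym_var_def\<close>)
    then show ?thesis using True assms by (simp add: sym_alg_def sym_var_def)
  next
    case False
    have "(\<Oplus>b\<in>{b. b \<subseteq># m}. sym_var R j b \<otimes> p (m - b)) = (\<Oplus>b\<in>{b. b \<subseteq># m}. \<zero>)"
      by (rule finsum_cong') (use assms False in \<open>auto simp: sym_var_def\<close>)
    then show ?thesis using False by (simp add: sym_alg_def)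
  qed
qed

lemma sym_alg_abelian_group: "abelian_group (sym_alg R n)"
proof (rule abelian_groupI)
  fix p q assume p: "p \<in> carrier (sym_alg R n)" and q: "q \<in> carrier (sym_alg R n)"
  have "finite {m. p m \<oplus> q m \<noteq> \<zero>}"
  proof (rule finite_subset)
    show "{m. p m \<oplus> q m \<noteq> \<zero>} \<subseteq> {m. p m \<noteq> \<zero>} \<union> {m. q m \<noteq> \<zero>}" by auto
  qed (use p q in \<open>auto simp: sym_alg_simps\<close>)
  moreover have "set_mset m \<subseteq> {..<n}" if "p m \<oplus> q m \<noteq> \<zero>" for m
    using that p q by (cases "p m = \<zero>") (auto simp: sym_alg_simps)
  ultimately show "p \<oplus>\<^bsub>sym_alg R n\<^esub> q \<in> carrier (sym_alg R n)"
    using p q unfolding sym_alg_simps by blast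
next
  fix p assume p: "p \<in> carrier (sym_alg R n)"
  then have [simp]: "p m \<in> carrier R" for m by (simp add: sym_alg_simps)
  have "\<ominus> (p m) \<noteq> \<zero> \<longleftrightarrow> p m \<noteq> \<zero>" for m by (metis a_inv_zero minus_minus \<open>p m \<in> carrier R\<close>)
  then show "\<exists>q\<in>carrier (sym_alg R n). q \<oplus>\<^bsub>sym_alg R n\<^esub> p = \<zero>\<^bsub>sym_alg R n\<^esub>"
    by (intro bexI[of _ "\<lambda>m. \<ominus> p m"]) (use p in \<open>auto simp: sym_alg_simps l_neg\<close>)
qed (auto simp: sym_alg_simps a_ac)

lemma sym_const_closed: "a \<in> carrier R \<Longrightarrow> sym_const R a \<in> carrier (sym_alg R n)"
proof -
  have "finite {m. sym_const R a m \<noteq> \<zero>}"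
    by (rule finite_subset[of _ "{{#}}"]) (auto simp: sym_const_def)
  then show "a \<in> carrier R \<Longrightarrow> sym_const R a \<in> carrier (sym_alg R n)"
    by (auto simp: sym_alg_simps sym_const_def)
qed

text \<open>Signs in the polynomial ring are constant polynomials, so a partial derivative over the
  polynomial ring can be read monomial by monomial over \<open>R\<close>.\<close>

lemma sym_alg_neg_one_pow: "neg_one_pow (sym_alg R n) c = sym_const R (neg_one_pow R c)"
proof (induction c)
  case 0
  show ?case by (simp add: neg_one_pow_def sym_alg_def sym_const_def)
next
  case (Suc c)
  interpret A: abelian_group "sym_alg R n" by (rule sym_alg_abelian_group)
  have one: "\<one>\<^bsub>sym_alg R n\<^esub> = sym_const R \<one>" by (simp add: sym_alg_def sym_const_def)
  have "\<ominus>\<^bsub>sym_alg R n\<^esub> sym_const R \<one> = sym_const R (\<ominus> \<one>)"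
    by (rule A.minus_equality) (auto simp: sym_const_closed, auto simp: sym_alg_simps sym_const_def l_neg)
  then have "neg_one_pow (sym_alg R n) (Suc c) = neg_one_pow (sym_alg R n) c \<otimes>\<^bsub>sym_alg R n\<^esub> sym_const R (\<ominus> \<one>)"
    unfolding neg_one_pow_def one by (simp add: nat_pow_def)
  also have "\<dots> = sym_const R (neg_one_pow R c \<otimes> \<ominus> \<one>)"
    unfolding Suc by (subst sym_mult_const) (auto simp: sym_const_def)
  finally show ?case by (simp add: neg_one_pow_def)
qed

lemma finsum_sym_alg:
  assumes "\<And>j. j \<in> T \<Longrightarrow> p j \<in> carrier (sym_alg R n)"
  shows "(\<Oplus>\<^bsub>sym_alg R n\<^esub>j\<in>T. p j) m = (\<Oplus>j\<in>T. p j m)"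
proof -
  interpret A: abelian_group "sym_alg R n" by (rule sym_alg_abelian_group)
  show ?thesis using assms
  proof (induction T rule: infinite_finite_induct)
    case (insert x F)
    have "(\<Oplus>\<^bsub>sym_alg R n\<^esub>j\<in>insert x F. p j) = p x \<oplus>\<^bsub>sym_alg R n\<^esub> (\<Oplus>\<^bsub>sym_alg R n\<^esub>j\<in>F. p j)"
      using insert by (intro A.finsum_insert) auto
    moreover have "(\<Oplus>j\<in>insert x F. p j m) = p x m \<oplus> (\<Oplus>j\<in>F. p j m)"
      using insert by (intro finsum_insert) (auto simp: sym_alg_simps)
    moreover have "(\<Oplus>\<^bsub>sym_alg R n\<^esub>j\<in>F. p j) m = (\<Oplus>j\<in>F. p j m)"
      by (rule insert.IH) (use insert.prems in blast)
    ultimately show ?case by (simp add: sym_alg_simps)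
  qed (simp_all add: sym_alg_simps)
qed

lemma ext_partial_add:
  assumes "x \<in> carrier (ext_alg R n)" "y \<in> carrier (ext_alg R n)"
  shows "ext_partial R n j (\<lambda>K. x K \<oplus> y K) J = ext_partial R n j x J \<oplus> ext_partial R n j y J"
  using ext_alg_carrierD(1)[OF assms(1)] ext_alg_carrierD(1)[OF assms(2)]
  by (auto simp: ext_partial_def r_distr)

lemma ext_partial_smult:
  assumes "x \<in> carrier (ext_alg R n)" "a \<in> carrier R"
  shows "ext_partial R n j (\<lambda>K. a \<otimes> x K) J = a \<otimes> ext_partial R n j x J"
  using ext_alg_carrierD(1)[OF assms(1)] assms(2) by (auto simp: ext_partial_def m_lcomm)

lemma ext_partial_value: "x \<in> carrier (ext_alg R n) \<Longrightarrow> ext_partial R n j x J \<in> carrier R"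
  by (rule ext_alg_carrierD(1)[OF ext_partial_closed])

lemma ext_partial_zero: "ext_partial R n j (\<lambda>K. \<zero>) J = \<zero>"
  by (simp add: ext_partial_def)

lemma sym_koszul_bideg:
  assumes x: "x \<in> bideg R n s k"
  shows "sym_koszul R n x \<in> bideg R n (Suc s) (k - 1)"
proof -
  have "sym_koszul R n x J m \<in> carrier R" for J m
    unfolding sym_koszul_def using ext_partial_value[OF bideg_slice_carrier[OF x]]
    by (intro finsum_closed) auto
  moreover have "J \<subseteq> {..<n} \<and> int (card J) = k - 1 \<and> set_mset m \<subseteq> {..<n} \<and> size m = Suc s"
    if nz: "sym_koszul R n x J m \<noteq> \<zero>" for J m
  proof -
    have "\<exists>j<n. j \<in># m \<and> ext_partial R n j (\<lambda>K. x K (m - {#j#})) J \<noteq> \<zero>"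
    proof (rule ccontr)
      assume "\<not> ?thesis"
      then have "sym_koszul R n x J m = (\<Oplus>j\<in>{..<n}. \<zero>)"
        unfolding sym_koszul_def by (intro finsum_cong') auto
      then show False using nz by simp
    qed
    then obtain j where j: "j < n" "j \<in># m" and nz': "ext_partial R n j (\<lambda>K. x K (m - {#j#})) J \<noteq> \<zero>"
      by blast
    have j': "j \<notin> J" "J \<subseteq> {..<n}" "x (insert j J) (m - {#j#}) \<noteq> \<zero>"
      using nz' by (auto simp: ext_partial_def split: if_splits)
    note j = j j'
    from bidegD(2)[OF x j(5)]
    have b: "int (card (insert j J)) = k" "set_mset (m - {#j#}) \<subseteq> {..<n}" "size (m - {#j#}) = s" by auto
    have "finite J" using j(4) finite_subset by blast
    then have "int (card J) = k - 1" using b(1) j(3) by simp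
    moreover have "m = add_mset j (m - {#j#})" using j(2) by simp
    then have "set_mset m \<subseteq> {..<n} \<and> size m = Suc s"
      using b(2,3) j(1) by (metis insert_subset lessThan_iff set_mset_add_mset_insert size_add_mset)
    ultimately show ?thesis using j(4) by blast
  qed
  ultimately show ?thesis by (simp add: bideg_def)
qed

lemma const_koszul_bideg:
  assumes r: "\<And>j. j < n \<Longrightarrow> r j \<in> carrier R" and x: "x \<in> bideg R n s k"
  shows "const_koszul R n r x \<in> bideg R n s (k - 1)"
proof -
  have d: "koszul_diff R n r (\<lambda>K. x K m) \<in> ext_deg R n (k - 1)" for m
    by (rule koszul_diff_deg[OF r bideg_slice[OF x]])
  have "set_mset m \<subseteq> {..<n} \<and> size m = s" if "const_koszul R n r x J m \<noteq> \<zero>" for J m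
  proof (rule ccontr)
    assume "\<not> ?thesis"
    then have "x K m = \<zero>" for K using bidegD(2)[OF x, of K m] by blast
    then have "koszul_diff R n r (\<lambda>K. x K m) J = \<zero>"
      using r by (intro koszul_diff_zero) (simp_all add: ext_partial_zero)
    then show False using that by (simp add: const_koszul_def)
  qed
  then show ?thesis using d by (auto simp: bideg_def const_koszul_def ext_deg_iff)
qed

lemma contraction_bideg:
  assumes x: "x \<in> bideg R n (Suc s) k"
  shows "contraction R x \<in> bideg R n s (k + 1)"
proof -
  have "contraction R x J m \<in> carrier R" for J m
    using bidegD(1)[OF x] by (simp add: contraction_def Let_def)
  moreover have "J \<subseteq> {..<n} \<and> int (card J) = k + 1 \<and> set_mset m \<subseteq> {..<n} \<and> size m = s"
    if nz: "contraction R x J m \<noteq> \<zero>" for J m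
  proof -
    let ?i = "Max (J \<union> set_mset m)"
    have i: "?i \<in> J" "x (J - {?i}) (add_mset ?i m) \<noteq> \<zero>"
      using nz by (auto simp: contraction_def Let_def split: if_splits)
    from bidegD(2)[OF x i(2)]
    have b: "J - {?i} \<subseteq> {..<n}" "int (card (J - {?i})) = k" "set_mset (add_mset ?i m) \<subseteq> {..<n}"
      "size (add_mset ?i m) = Suc s" by auto
    then have "?i < n" by simp
    then have "J \<subseteq> {..<n}" using b(1) i(1) by auto
    moreover from this have "finite J" using finite_subset by blast
    then have "card J = Suc (card (J - {?i}))" using i(1) by (rule card.remove)
    ultimately show ?thesis using b by auto
  qed
  ultimately show ?thesis by (simp add: bideg_def)
qed

lemma neg_one_pow_square: "x \<in> carrier R \<Longrightarrow> neg_one_pow R c \<otimes> (neg_one_pow R c \<otimes> x) = x"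
  by (auto simp: neg_one_pow_parity l_minus)

text \<open>Let \<open>i\<close> be the largest index occurring in \<open>J\<close> or
  \<open>m\<close>. If \<open>i\<close> occurs in \<open>m\<close> only, the second term vanishes
  and of the first only the summand for \<open>i\<close> survives, with the square of a sign. If
  \<open>i\<close> lies in \<open>J\<close>, the first term has no summand for \<open>i\<close>; its
  other summands cancel against those of the second term, whose summand for \<open>i\<close> is
  \<open>x J m\<close>. The pair of an empty set and an empty monomial, which has no largest index,
  is excluded.\<close>

theorem contraction_homotopy:
  assumes x: "x \<in> bideg R n s k" and J: "J \<subseteq> {..<n}" "set_mset m \<subseteq> {..<n}" "J \<noteq> {} \<or> m \<noteq> {#}"
  shows "sym_koszul R n (contraction R x) J m \<oplus> contraction R (sym_koszul R n x) J m = x J m"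
proof -
  let ?s = "neg_one_pow R"
  let ?i = "Max (J \<union> set_mset m)"
  have fin: "finite J" using J finite_subset by blast
  note xR = bidegD(1)[OF x]
  have cR: "contraction R x K l \<in> carrier R" for K l
    using xR by (simp add: contraction_def Let_def)
  have ne: "finite (J \<union> set_mset m)" "J \<union> set_mset m \<noteq> {}" using fin J(3) by auto
  have mem: "?i \<in> J \<union> set_mset m" by (rule Max_in[OF ne])
  then have i: "?i < n" using J by auto
  have le: "j \<le> ?i" if "j \<in> J \<union> set_mset m" for j using ne(1) that by simp
  let ?g = "\<lambda>j. if j \<in># m then ext_partial R n j (\<lambda>K. contraction R x K (m - {#j#})) J else \<zero>"
  have g: "?g j = (if j \<in># m \<and> j \<notin> J then ?s (card {l \<in> J. l < j}) \<otimes> contraction R x (insert j J) (m - {#j#}) else \<zero>)"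
    if "j < n" for j using that J(1) by (auto simp: ext_partial_def)
  \<comment> \<open>Moving a variable from \<open>m\<close> to \<open>J\<close> leaves the union
    unchanged, so the contraction refers to the same largest index in all summands.\<close>
  have max_move: "Max (insert j J \<union> set_mset (m - {#j#})) = ?i" if "j \<in># m" for j
  proof -
    have "set_mset m = insert j (set_mset (m - {#j#}))" using that by (metis insert_DiffM set_mset_add_mset_insert)
    then show ?thesis by (simp add: insert_commute Un_commute)
  qed
  show ?thesis
  proof (cases "?i \<in> J")
    case False
    then have im: "?i \<in># m" using mem by simp
    have "(\<Oplus>j\<in>{..<n}. ?g j) = ?g ?i"
    proof (rule finsum_single)
      show "?g ?i \<in> carrier R" using g[OF i] cR by simp
      fix j assume j: "j \<in> {..<n}" "j \<noteq> ?i"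
      have "contraction R x (insert j J) (m - {#j#}) = \<zero>" if "j \<in># m"
        using max_move[OF that] False j(2) by (simp add: contraction_def Let_def)
      then show "?g j = \<zero>" using g[of j] j(1) by simp
    qed (use i in auto)
    also have "?g ?i = ?s (card J) \<otimes> (?s (card J) \<otimes> x J m)"
    proof -
      have "{l \<in> J. l < ?i} = J" using le False by (auto simp: less_le)
      moreover have "contraction R x (insert ?i J) (m - {#?i#}) = ?s (card J) \<otimes> x J m"
        unfolding contraction_def Let_def max_move[OF im] using False im by simp
      ultimately show ?thesis using g[OF i] im False by simp
    qed
    finally have "sym_koszul R n (contraction R x) J m = x J m"
      using xR by (simp add: sym_koszul_def neg_one_pow_square)
    moreover have "contraction R (sym_koszul R n x) J m = \<zero>"
      using False by (simp add: contraction_def Let_def)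
    ultimately show ?thesis using xR by simp
  next
    case True
    let ?J = "J - {?i}" and ?m = "add_mset ?i m"
    let ?h = "\<lambda>j. if j \<in># ?m then ext_partial R n j (\<lambda>K. x K (?m - {#j#})) ?J else \<zero>"
    have J': "?J \<subseteq> {..<n}" using J(1) by auto
    have h: "?h j = (if j \<in># ?m \<and> j \<notin> ?J then ?s (card {l \<in> ?J. l < j}) \<otimes> x (insert j ?J) (?m - {#j#}) else \<zero>)"
      if "j < n" for j using that J' by (auto simp: ext_partial_def)
    have hR: "?h j \<in> carrier R" if "j < n" for j using h[OF that] xR by simp
    have gR: "?g j \<in> carrier R" if "j < n" for j using g[OF that] cR by simp
    have cancel: "?g j \<oplus> ?s (card ?J) \<otimes> ?h j = \<zero>" if j: "j < n" "j \<noteq> ?i" for j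
    proof (cases "j \<in># m \<and> j \<notin> J")
      case F: False
      then have "?g j = \<zero>" "?h j = \<zero>" using g[OF j(1)] h[OF j(1)] j(2) by auto
      then show ?thesis by simp
    next
      case T: True
      have ji: "j < ?i" using le[of j] T j(2) by simp
      have sets: "{l \<in> J. l < j} = {l \<in> ?J. l < j}" "insert j J - {?i} = insert j ?J"
        "add_mset ?i (m - {#j#}) = ?m - {#j#}" using ji T j(2) by auto
      have cJ: "card (insert j ?J) = Suc (card ?J)" using T fin by simp
      let ?y = "x (insert j ?J) (?m - {#j#})" and ?c = "card {l \<in> ?J. l < j}"
      have "contraction R x (insert j J) (m - {#j#}) = ?s (card (insert j ?J)) \<otimes> ?y"
        unfolding contraction_def Let_def max_move[OF conjunct1[OF T]] sets using True by simp
      then have "?g j = ?s ?c \<otimes> (?s (Suc (card ?J)) \<otimes> ?y)"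
        using g[OF j(1)] T unfolding cJ sets(1) by simp
      moreover have "?h j = ?s ?c \<otimes> ?y" using h[OF j(1)] T by simp
      ultimately show ?thesis using xR[of "insert j ?J" "?m - {#j#}"]
        by (auto simp: neg_one_pow_parity l_minus r_minus l_neg r_neg)
    qed
    have fi: "?h ?i = ?s (card ?J) \<otimes> x J m"
    proof -
      have "{l \<in> ?J. l < ?i} = ?J" using le by (auto simp: less_le)
      moreover have "insert ?i ?J = J" using True by auto
      ultimately show ?thesis using h[OF i] by simp
    qed
    have "contraction R (sym_koszul R n x) J m = ?s (card ?J) \<otimes> (\<Oplus>j\<in>{..<n}. ?h j)"
      using True by (simp add: contraction_def Let_def sym_koszul_def)
    also have "\<dots> = (\<Oplus>j\<in>{..<n}. ?s (card ?J) \<otimes> ?h j)"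
      by (rule finsum_rdistr) (use hR in auto)
    finally have "sym_koszul R n (contraction R x) J m \<oplus> contraction R (sym_koszul R n x) J m =
        (\<Oplus>j\<in>{..<n}. ?g j) \<oplus> (\<Oplus>j\<in>{..<n}. ?s (card ?J) \<otimes> ?h j)" by (simp add: sym_koszul_def)
    also have "\<dots> = (\<Oplus>j\<in>{..<n}. ?g j \<oplus> ?s (card ?J) \<otimes> ?h j)"
      by (rule finsum_addf[symmetric]) (use gR hR in auto)
    also have "\<dots> = ?g ?i \<oplus> ?s (card ?J) \<otimes> ?h ?i"
    proof (rule finsum_single)
      show "?g ?i \<oplus> ?s (card ?J) \<otimes> ?h ?i \<in> carrier R"
        by (intro a_closed m_closed gR hR i neg_one_pow_closed)
    qed (use i cancel in simp_all)
    also have "?g ?i = \<zero>" using g[OF i] True by simp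
    finally show ?thesis using fi xR by (simp add: neg_one_pow_square)
  qed
qed

end

section \<open>Bases, and relations between the two differentials\<close>

definition monomials :: "nat \<Rightarrow> nat \<Rightarrow> nat multiset set"
  where "monomials n s = multisets_of_size {..<n} s"

lemma monomials_iff: "m \<in> monomials n s \<longleftrightarrow> set_mset m \<subseteq> {..<n} \<and> size m = s"
  by (simp add: monomials_def multisets_of_size_def)

lemma finite_monomials: "finite (monomials n s)"
  unfolding monomials_def by (rule finite_multisets_of_size) simp

definition koszul_basis :: "nat \<Rightarrow> nat \<Rightarrow> int \<Rightarrow> (nat set \<times> nat multiset) set"
  where "koszul_basis n s k = {J. J \<subseteq> {..<n} \<and> int (card J) = k} \<times> monomials n s"

definition koszul_gen :: "('a, 'c) ring_scheme \<Rightarrow> nat set \<times> nat multiset \<Rightarrow> nat set \<Rightarrow> nat multiset \<Rightarrow> 'a"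
  where "koszul_gen A b = (\<lambda>J m. if J = fst b \<and> m = snd b then \<one>\<^bsub>A\<^esub> else \<zero>\<^bsub>A\<^esub>)"

lemma finite_koszul_basis: "finite (koszul_basis n s k)"
  by (simp add: koszul_basis_def finite_monomials)

context cring
begin

lemma finsum_uminus:
  assumes "\<And>i. i \<in> A \<Longrightarrow> f i \<in> carrier R"
  shows "(\<Oplus>i\<in>A. \<ominus> f i) = \<ominus> (\<Oplus>i\<in>A. f i)"
  using assms
proof (induction A rule: infinite_finite_induct)
  case (insert a A)
  have IH: "(\<Oplus>i\<in>A. \<ominus> f i) = \<ominus> (\<Oplus>i\<in>A. f i)" by (rule insert.IH) (use insert.prems in blast)
  have "(\<Oplus>i\<in>insert a A. \<ominus> f i) = \<ominus> f a \<oplus> (\<Oplus>i\<in>A. \<ominus> f i)"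
    using insert by (intro finsum_insert) auto
  moreover have "(\<Oplus>i\<in>insert a A. f i) = f a \<oplus> (\<Oplus>i\<in>A. f i)"
    using insert by (intro finsum_insert) auto
  moreover have "(\<Oplus>i\<in>A. f i) \<in> carrier R" using insert.prems by (intro finsum_closed) auto
  ultimately show ?case using IH insert.prems by (simp add: minus_add)
qed (simp_all add: a_inv_zero)

lemma ext_partial_sym_koszul:
  assumes x: "x \<in> bideg R n s k"
  shows "ext_partial R n j (\<lambda>K. sym_koszul R n x K m) J =
    (\<Oplus>i\<in>{..<n}. if i \<in># m then ext_partial R n j (ext_partial R n i (\<lambda>K. x K (m - {#i#}))) J else \<zero>)"
proof -
  let ?c = "\<lambda>i. if i \<in># m then \<one> else \<zero>"
  let ?y = "\<lambda>i. ext_partial R n i (\<lambda>K. x K (m - {#i#}))"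
  have y: "?y i \<in> carrier (ext_alg R n)" for i by (rule ext_partial_closed[OF bideg_slice_carrier[OF x]])
  have "sym_koszul R n x K m = (\<Oplus>i\<in>{..<n}. ?c i \<otimes> ?y i K)" for K
    unfolding sym_koszul_def
    by (rule finsum_cong') (use ext_partial_value[OF bideg_slice_carrier[OF x]] in auto)
  then have "ext_partial R n j (\<lambda>K. sym_koszul R n x K m) J =
      ext_partial R n j (\<lambda>K. \<Oplus>i\<in>{..<n}. ?c i \<otimes> ?y i K) J" by simp
  also have "\<dots> = (\<Oplus>i\<in>{..<n}. ?c i \<otimes> ext_partial R n j (?y i) J)"
    by (rule ext_partial_finsum) (use y in auto)
  also have "\<dots> = (\<Oplus>i\<in>{..<n}. if i \<in># m then ext_partial R n j (?y i) J else \<zero>)"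
    by (rule finsum_cong') (use ext_partial_value[OF ext_partial_closed[OF bideg_slice_carrier[OF x]]] in auto)
  finally show ?thesis .
qed

text \<open>Removing two variables from \<open>m\<close> is symmetric in them, while the partial
  derivatives anticommute; the double sum is antisymmetric.\<close>

lemma sym_koszul_square:
  assumes x: "x \<in> bideg R n s k"
  shows "sym_koszul R n (sym_koszul R n x) = (\<lambda>J m. \<zero>)"
proof (intro ext)
  fix J m
  let ?p = "\<lambda>j i. ext_partial R n j (ext_partial R n i (\<lambda>K. x K (m - {#j#} - {#i#}))) J"
  let ?f = "\<lambda>j i. if j \<in># m \<and> i \<in># m - {#j#} then ?p j i else \<zero>"
  have pR: "?p j i \<in> carrier R" for i j
    by (rule ext_partial_value[OF ext_partial_closed[OF bideg_slice_carrier[OF x]]])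
  have "sym_koszul R n (sym_koszul R n x) J m = (\<Oplus>j\<in>{..<n}. \<Oplus>i\<in>{..<n}. ?f j i)"
    unfolding sym_koszul_def[of R n "sym_koszul R n x"]
  proof (rule finsum_cong'[OF refl])
    fix j
    show "(if j \<in># m then ext_partial R n j (\<lambda>K. sym_koszul R n x K (m - {#j#})) J else \<zero>) = (\<Oplus>i\<in>{..<n}. ?f j i)"
    proof (cases "j \<in># m")
      case True
      then show ?thesis using ext_partial_sym_koszul[OF x, of j "m - {#j#}" J] by simp
    qed simp
  qed (use pR in \<open>auto intro!: finsum_closed\<close>)
  also have "\<dots> = \<zero>"
  proof (rule finsum_antisym)
    fix i j
    have "(i \<in># m \<and> j \<in># m - {#i#}) = (j \<in># m \<and> i \<in># m - {#j#})"
      by (cases "i = j") (auto simp: in_diff_count)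
    moreover have "m - {#i#} - {#j#} = m - {#j#} - {#i#}" by (simp add: add_mset_commute)
    ultimately show "?f i j = \<ominus> ?f j i"
      using ext_partial_anticomm[OF bideg_slice_carrier[OF x], of i j "m - {#j#} - {#i#}" J]
      by (auto simp: a_inv_zero)
  qed (use pR in \<open>auto simp: ext_partial_twice\<close>)
  finally show "sym_koszul R n (sym_koszul R n x) J m = \<zero>" .
qed

text \<open>Multiplication by \<open>r i\<close> and by a variable commute, so the sign is that of
  exchanging \<open>\<partial>/\<partial>e_i\<close> and
  \<open>\<partial>/\<partial>e_j\<close>.\<close>

lemma const_sym_koszul:
  assumes r: "\<And>j. j < n \<Longrightarrow> r j \<in> carrier R" and x: "x \<in> bideg R n s k"
  shows "const_koszul R n r (sym_koszul R n x) = (\<lambda>J m. \<ominus> sym_koszul R n (const_koszul R n r x) J m)"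
proof (intro ext)
  fix J m
  let ?p = "\<lambda>i j. ext_partial R n i (ext_partial R n j (\<lambda>K. x K (m - {#j#}))) J"
  let ?g = "\<lambda>i j. r i \<otimes> (if j \<in># m then ?p i j else \<zero>)"
  have pR: "ext_partial R n i (ext_partial R n j (\<lambda>K. x K l)) J \<in> carrier R" for i j l
    by (rule ext_partial_value[OF ext_partial_closed[OF bideg_slice_carrier[OF x]]])
  have "const_koszul R n r (sym_koszul R n x) J m = (\<Oplus>i\<in>{..<n}. \<Oplus>j\<in>{..<n}. ?g i j)"
    unfolding const_koszul_def koszul_diff_def ext_partial_sym_koszul[OF x]
    by (rule finsum_cong') (use r pR in \<open>auto intro!: finsum_closed finsum_rdistr\<close>)
  also have "\<dots> = (\<Oplus>j\<in>{..<n}. \<Oplus>i\<in>{..<n}. ?g i j)"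
    by (rule finsum_swap) (use r pR in auto)
  also have "\<dots> = (\<Oplus>j\<in>{..<n}. \<ominus> (if j \<in># m then ext_partial R n j (\<lambda>K. const_koszul R n r x K (m - {#j#})) J else \<zero>))"
  proof (rule finsum_cong'[OF refl])
    fix j assume j: "j \<in> {..<n}"
    have "ext_partial R n j (\<lambda>K. const_koszul R n r x K l) J =
        (\<Oplus>i\<in>{..<n}. r i \<otimes> ext_partial R n j (ext_partial R n i (\<lambda>K. x K l)) J)" for l
      unfolding const_koszul_def koszul_diff_def
      by (rule ext_partial_finsum) (use r ext_partial_closed[OF bideg_slice_carrier[OF x]] in auto)
    then have a: "\<ominus> ext_partial R n j (\<lambda>K. const_koszul R n r x K l) J =
        (\<Oplus>i\<in>{..<n}. \<ominus> (r i \<otimes> ext_partial R n j (ext_partial R n i (\<lambda>K. x K l)) J))" for l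
      using r pR by (subst finsum_uminus) auto
    have b: "\<ominus> ext_partial R n j (\<lambda>K. const_koszul R n r x K l) J =
        (\<Oplus>i\<in>{..<n}. r i \<otimes> ext_partial R n i (ext_partial R n j (\<lambda>K. x K l)) J)" for l
      unfolding a
    proof (rule finsum_cong'[OF refl])
      fix i assume i: "i \<in> {..<n}"
      show "\<ominus> (r i \<otimes> ext_partial R n j (ext_partial R n i (\<lambda>K. x K l)) J) =
          r i \<otimes> ext_partial R n i (ext_partial R n j (\<lambda>K. x K l)) J"
        using ext_partial_anticomm[OF bideg_slice_carrier[OF x], of i j l J] i r pR
        by (simp add: r_minus)
    qed (use r pR in auto)
    show "(\<Oplus>i\<in>{..<n}. ?g i j) =
        \<ominus> (if j \<in># m then ext_partial R n j (\<lambda>K. const_koszul R n r x K (m - {#j#})) J else \<zero>)"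
    proof (cases "j \<in># m")
      case False
      have "(\<Oplus>i\<in>{..<n}. ?g i j) = (\<Oplus>i\<in>{..<n}. \<zero>)" by (rule finsum_cong') (use False r in auto)
      then show ?thesis using False by (simp add: a_inv_zero)
    qed (use b in simp)
  qed (use ext_partial_value[OF bideg_slice_carrier[OF const_koszul_bideg[OF r x]]] in \<open>auto intro!: a_inv_closed\<close>)
  also have "\<dots> = \<ominus> sym_koszul R n (const_koszul R n r x) J m"
    unfolding sym_koszul_def
    by (rule finsum_uminus) (use ext_partial_value[OF bideg_slice_carrier[OF const_koszul_bideg[OF r x]]] in auto)
  finally show "const_koszul R n r (sym_koszul R n x) J m = \<ominus> sym_koszul R n (const_koszul R n r x) J m" .
qed

lemma const_koszul_square:
  assumes r: "\<And>j. j < n \<Longrightarrow> r j \<in> carrier R" and x: "x \<in> bideg R n s k"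
  shows "const_koszul R n r (const_koszul R n r x) = (\<lambda>J m. \<zero>)"
  unfolding const_koszul_def using koszul_diff_square[of n r, OF r bideg_slice_carrier[OF x]] by simp

text \<open>The differential does not touch the monomial, so exactness of the Koszul complex applies
  to each monomial separately.\<close>

lemma const_koszul_exact:
  assumes reg: "regular_seq R r n" and x: "x \<in> bideg R n s (int (Suc k))"
    and dx: "const_koszul R n r x = (\<lambda>J m. \<zero>)"
  shows "\<exists>y\<in>bideg R n s (int (Suc (Suc k))). const_koszul R n r y = x"
proof -
  have r: "j < n \<Longrightarrow> r j \<in> carrier R" for j using regular_seqD(1)[OF reg] .
  have "\<exists>y\<in>ext_deg R n (int (Suc (Suc k))). koszul_diff R n r y = (\<lambda>K. x K m)" for m
  proof (rule koszul_exact[OF reg bideg_slice[OF x]])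
    show "koszul_diff R n r (\<lambda>K. x K m) = (\<lambda>J. \<zero>)"
      using fun_cong[OF fun_cong[OF dx], of _ m] by (auto simp: const_koszul_def)
  qed
  then obtain y where y: "\<And>m. y m \<in> ext_deg R n (int (Suc (Suc k)))" "\<And>m. koszul_diff R n r (y m) = (\<lambda>K. x K m)"
    by metis
  \<comment> \<open>The primitives chosen at monomials of the wrong degree or with extraneous
    variables are arbitrary; they are replaced by zero to stay in the bidegree.\<close>
  let ?y = "\<lambda>J m. if m \<in> monomials n s then y m J else \<zero>"
  have "?y \<in> bideg R n s (int (Suc (Suc k)))"
    using y(1) unfolding ext_deg_iff bideg_def monomials_iff by auto
  moreover have "const_koszul R n r ?y J m = x J m" for J m
  proof (cases "m \<in> monomials n s")
    case True
    then show ?thesis using fun_cong[OF y(2)[of m], of J] by (simp add: const_koszul_def)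
  next
    case False
    then have "x J m = \<zero>" using bidegD(2)[OF x, of J m] by (auto simp: monomials_iff)
    moreover have "koszul_diff R n r (\<lambda>K. \<zero>) J = \<zero>"
      using r by (intro koszul_diff_zero) (simp_all add: ext_partial_zero)
    ultimately show ?thesis using False by (simp add: const_koszul_def)
  qed
  ultimately show ?thesis by (intro bexI[of _ ?y]) auto
qed

text \<open>For a cycle the homotopy formula exhibits the contraction as a primitive. The
  exceptional empty monomial does not occur in positive polynomial degree.\<close>

lemma sym_koszul_exact:
  assumes x: "x \<in> bideg R n (Suc s) k" and dx: "sym_koszul R n x = (\<lambda>J m. \<zero>)"
  shows "contraction R x \<in> bideg R n s (k + 1)" "sym_koszul R n (contraction R x) = x"
proof -
  show c: "contraction R x \<in> bideg R n s (k + 1)" by (rule contraction_bideg[OF x])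
  show "sym_koszul R n (contraction R x) = x"
  proof (intro ext)
    fix J m
    show "sym_koszul R n (contraction R x) J m = x J m"
    proof (cases "J \<subseteq> {..<n} \<and> set_mset m \<subseteq> {..<n} \<and> m \<noteq> {#}")
      case True
      have "contraction R (\<lambda>J m. \<zero>) J m = \<zero>" by (simp add: contraction_def Let_def)
      then show ?thesis
        using contraction_homotopy[OF x, of J m] True bidegD(1)[OF sym_koszul_bideg[OF c], of J m] dx by simp
    next
      case False
      then have zero: "y J m = \<zero>" if "y \<in> bideg R n (Suc s) l" for y l
        using bidegD(2)[OF that, of J m] by (cases "y J m = \<zero>") auto
      have "x J m = \<zero>" by (rule zero[OF x])
      moreover have "sym_koszul R n (contraction R x) J m = \<zero>"
        by (rule zero[OF sym_koszul_bideg[OF c]])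
      ultimately show ?thesis by simp
    qed
  qed
qed

text \<open>In polynomial degree 0 the contraction of \<open>x\<close> vanishes, as it would need a
  variable to move. The homotopy formula then leaves \<open>x = 0\<close>, except at the empty set
  with the empty monomial, which \<open>k \<noteq> 0\<close> rules out.\<close>

lemma sym_koszul_inj_zero:
  assumes x: "x \<in> bideg R n 0 k" and dx: "sym_koszul R n x = (\<lambda>J m. \<zero>)" and k: "k \<noteq> 0"
  shows "x = (\<lambda>J m. \<zero>)"
proof (intro ext)
  fix J m
  show "x J m = \<zero>"
  proof (rule ccontr)
    assume nz: "x J m \<noteq> \<zero>"
    then have Jm: "J \<subseteq> {..<n}" "int (card J) = k" "set_mset m \<subseteq> {..<n}" using bidegD(2)[OF x, of J m] by auto
    then have "J \<noteq> {}" using k by auto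
    have c: "contraction R x = (\<lambda>J m. \<zero>)"
    proof -
      have "x K (add_mset i l) = \<zero>" for K i l using bidegD(2)[OF x, of K "add_mset i l"] by auto
      then show ?thesis by (simp add: contraction_def Let_def fun_eq_iff)
    qed
    have "sym_koszul R n (contraction R x) J m = \<zero>"
      unfolding c sym_koszul_def by (rule add.finprod_one_eqI) (simp add: ext_partial_zero)
    moreover have "contraction R (sym_koszul R n x) J m = \<zero>"
      unfolding dx by (simp add: contraction_def Let_def)
    ultimately show False using contraction_homotopy[OF x Jm(1,3)] \<open>J \<noteq> {}\<close> nz by simp
  qed
qed

subsection \<open>The modules of the bigraded Koszul complex\<close>

lemma koszul_comp_smult:
  "a \<in> carrier R \<Longrightarrow> x \<in> bideg R n s k \<Longrightarrow> a \<odot>\<^bsub>koszul_comp R n s k\<^esub> x = (\<lambda>J m. a \<otimes> x J m)"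
  unfolding koszul_comp_simps by (rule ext, rule sym_mult_const) (auto dest: bidegD)

lemma bideg_zero: "(\<lambda>J m. \<zero>) \<in> bideg R n s k"
  by (simp add: bideg_def)

lemma bideg_add:
  assumes x: "x \<in> bideg R n s k" and y: "y \<in> bideg R n s k"
  shows "(\<lambda>J m. x J m \<oplus> y J m) \<in> bideg R n s k"
proof -
  have "x J m \<noteq> \<zero> \<or> y J m \<noteq> \<zero>" if "x J m \<oplus> y J m \<noteq> \<zero>" for J m using that by auto
  then show ?thesis using bidegD[OF x] bidegD[OF y] by (simp add: bideg_def) metis
qed

lemma bideg_smult:
  assumes a: "a \<in> carrier R" and x: "x \<in> bideg R n s k"
  shows "(\<lambda>J m. a \<otimes> x J m) \<in> bideg R n s k"
proof -
  have "x J m \<noteq> \<zero>" if "a \<otimes> x J m \<noteq> \<zero>" for J m using that a by auto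
  then have "J \<subseteq> {..<n} \<and> int (card J) = k \<and> set_mset m \<subseteq> {..<n} \<and> size m = s"
    if "a \<otimes> x J m \<noteq> \<zero>" for J m using bidegD(2)[OF x] that by blast
  then show ?thesis using bidegD(1)[OF x] a by (simp add: bideg_def)
qed

lemma koszul_comp_module: "module R (koszul_comp R n s k)"
  by (rule coordinate_module[OF is_cring, where ev = "\<lambda>i x. x (fst i) (snd i)"])
    (auto simp: koszul_comp_simps(1-3) koszul_comp_smult bideg_zero bideg_add bideg_smult fun_eq_iff dest: bidegD)

text \<open>Read off from the coefficients in \<open>R\<close>, on which a constant polynomial acts
  by plain multiplication. This larger module is the target of the tensor lift inside
  \<open>psi\<close>.\<close>

lemma koszul_alg_module: "module R (koszul_alg R n)"
proof -
  interpret A: abelian_group "sym_alg R n" by (rule sym_alg_abelian_group)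
  have v: "x J m \<in> carrier R" if "x \<in> carrier (koszul_alg R n)" for x J m
    using that by (auto simp: koszul_alg_simps ext_alg_simps' sym_alg_simps)
  have sm: "a \<odot>\<^bsub>koszul_alg R n\<^esub> x = (\<lambda>J m. a \<otimes> x J m)" if "a \<in> carrier R" "x \<in> carrier (koszul_alg R n)" for a x
    unfolding koszul_alg_simps using sym_mult_const[OF that(1), of "x _" n] v[OF that(2)] by simp
  have smc: "a \<odot>\<^bsub>koszul_alg R n\<^esub> x \<in> carrier (koszul_alg R n)"
    if a: "a \<in> carrier R" and x: "x \<in> carrier (koszul_alg R n)" for a x
  proof -
    have nz: "x J m \<noteq> \<zero>" if "a \<otimes> x J m \<noteq> \<zero>" for J m using that a by auto
    have f: "finite {m. x J m \<noteq> \<zero>}" for J using x by (simp add: koszul_alg_simps ext_alg_simps' sym_alg_simps)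
    have "finite {m. a \<otimes> x J m \<noteq> \<zero>}" for J
      by (rule finite_subset[OF _ f[of J]]) (use nz in auto)
    moreover have "set_mset m \<subseteq> {..<n}" if "a \<otimes> x J m \<noteq> \<zero>" for J m
      using nz[OF that] x unfolding koszul_alg_simps(1) ext_alg_simps' sym_alg_simps by blast
    ultimately show ?thesis
      unfolding sm[OF a x] using x a by (simp add: koszul_alg_simps(1) ext_alg_simps' sym_alg_simps)
  qed
  have ad: "x \<oplus>\<^bsub>koszul_alg R n\<^esub> y \<in> carrier (koszul_alg R n)"
    if "x \<in> carrier (koszul_alg R n)" "y \<in> carrier (koszul_alg R n)" for x y
  proof -
    have "x J \<oplus>\<^bsub>sym_alg R n\<^esub> y J \<in> carrier (sym_alg R n)" for J
      using that by (auto simp: koszul_alg_simps(1) ext_alg_simps')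
    moreover have "x J \<oplus>\<^bsub>sym_alg R n\<^esub> y J = \<zero>\<^bsub>sym_alg R n\<^esub>" if "\<not> J \<subseteq> {..<n}" for J
      using that \<open>x \<in> _\<close> \<open>y \<in> _\<close> by (simp add: koszul_alg_simps(1) ext_alg_simps')
    ultimately show ?thesis by (simp add: koszul_alg_simps(1,3) ext_alg_simps' sym_alg_simps(1))
  qed
  have smc': "(\<lambda>J m. a \<otimes> x J m) \<in> carrier (koszul_alg R n)"
    if "a \<in> carrier R" "x \<in> carrier (koszul_alg R n)" for a x
    using smc[OF that] sm[OF that] by simp
  show ?thesis
  proof (rule coordinate_module[OF is_cring, where ev = "\<lambda>i x. x (fst i) (snd i)"])
    show "\<zero>\<^bsub>koszul_alg R n\<^esub> \<in> carrier (koszul_alg R n)"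
      by (simp add: koszul_alg_simps ext_alg_simps' sym_alg_simps)
  qed (auto simp: v sm smc' ad fun_eq_iff, auto simp: koszul_alg_simps(2,3))
qed

lemma bideg_koszul_alg: "x \<in> bideg R n s k \<Longrightarrow> x \<in> carrier (koszul_alg R n)"
  using koszul_comp_simps(1)[of R n s k] by (auto simp: koszul_comp_def koszul_alg_simps(1) ext_deg_def)

lemma sym_koszul_lin:
  "sym_koszul R n \<in> lin_hom R (koszul_comp R n s k) (koszul_comp R n (Suc s) (k - 1))"
proof (rule lin_homI, unfold koszul_comp_simps(1))
  fix x assume x: "x \<in> bideg R n s k"
  show "sym_koszul R n x \<in> bideg R n (Suc s) (k - 1)" by (rule sym_koszul_bideg[OF x])
  note sx = bideg_slice_carrier[OF x]
  {
    fix y assume y: "y \<in> bideg R n s k"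
    note sy = bideg_slice_carrier[OF y]
    have "sym_koszul R n (\<lambda>J m. x J m \<oplus> y J m) J m = sym_koszul R n x J m \<oplus> sym_koszul R n y J m" for J m
    proof -
      let ?t = "\<lambda>x j. if j \<in># m then ext_partial R n j (\<lambda>K. x K (m - {#j#})) J else \<zero>"
      have "sym_koszul R n (\<lambda>J m. x J m \<oplus> y J m) J m = (\<Oplus>j\<in>{..<n}. ?t x j \<oplus> ?t y j)"
        unfolding sym_koszul_def
        by (rule finsum_cong') (use ext_partial_value[OF sx] ext_partial_value[OF sy] in
            \<open>auto simp: ext_partial_add[OF sx sy]\<close>)
      also have "\<dots> = sym_koszul R n x J m \<oplus> sym_koszul R n y J m" unfolding sym_koszul_def
        by (rule finsum_addf) (use ext_partial_value[OF sx] ext_partial_value[OF sy] in auto)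
      finally show ?thesis .
    qed
    then show "sym_koszul R n (x \<oplus>\<^bsub>koszul_comp R n s k\<^esub> y) =
        sym_koszul R n x \<oplus>\<^bsub>koszul_comp R n (Suc s) (k - 1)\<^esub> sym_koszul R n y"
      by (simp add: koszul_comp_simps(3) fun_eq_iff)
  }
  fix a assume a: "a \<in> carrier R"
  have "sym_koszul R n (\<lambda>J m. a \<otimes> x J m) J m = a \<otimes> sym_koszul R n x J m" for J m
  proof -
    let ?t = "\<lambda>x j. if j \<in># m then ext_partial R n j (\<lambda>K. x K (m - {#j#})) J else \<zero>"
    have "sym_koszul R n (\<lambda>J m. a \<otimes> x J m) J m = (\<Oplus>j\<in>{..<n}. a \<otimes> ?t x j)"
      unfolding sym_koszul_def
      by (rule finsum_cong') (use a ext_partial_value[OF sx] in \<open>auto simp: ext_partial_smult[OF sx]\<close>)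
    also have "\<dots> = a \<otimes> sym_koszul R n x J m" unfolding sym_koszul_def
      by (rule finsum_rdistr[symmetric]) (use a ext_partial_value[OF sx] in auto)
    finally show ?thesis .
  qed
  then show "sym_koszul R n (a \<odot>\<^bsub>koszul_comp R n s k\<^esub> x) =
      a \<odot>\<^bsub>koszul_comp R n (Suc s) (k - 1)\<^esub> sym_koszul R n x"
    using a x sym_koszul_bideg[OF x] by (simp add: koszul_comp_smult fun_eq_iff)
qed

lemma const_koszul_lin:
  assumes r: "\<And>j. j < n \<Longrightarrow> r j \<in> carrier R"
  shows "const_koszul R n r \<in> lin_hom R (koszul_comp R n s k) (koszul_comp R n s (k - 1))"
proof (rule lin_homI, unfold koszul_comp_simps(1))
  note lin = koszul_diff_lin[of n r, OF r]
  fix x assume x: "x \<in> bideg R n s k"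
  show d: "const_koszul R n r x \<in> bideg R n s (k - 1)" by (rule const_koszul_bideg[OF r x])
  note sx = bideg_slice_carrier[OF x]
  show "const_koszul R n r (x \<oplus>\<^bsub>koszul_comp R n s k\<^esub> y) =
      const_koszul R n r x \<oplus>\<^bsub>koszul_comp R n s (k - 1)\<^esub> const_koszul R n r y" if y: "y \<in> bideg R n s k" for y
    using lin_homD(2)[OF lin sx bideg_slice_carrier[OF y]]
    by (simp add: koszul_comp_simps(3) const_koszul_def ext_alg_simps)
  show "const_koszul R n r (a \<odot>\<^bsub>koszul_comp R n s k\<^esub> x) =
      a \<odot>\<^bsub>koszul_comp R n s (k - 1)\<^esub> const_koszul R n r x" if a: "a \<in> carrier R" for a
    using lin_homD(3)[OF lin a sx] a x d
    by (simp add: koszul_comp_smult) (simp add: const_koszul_def ext_alg_simps)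
qed

lemma koszul_gen_closed: "b \<in> koszul_basis n s k \<Longrightarrow> koszul_gen R b \<in> bideg R n s k"
  by (auto simp: bideg_def koszul_gen_def koszul_basis_def monomials_iff)

lemma koszul_coordinate_lin:
  "(\<lambda>x. x J m) \<in> lin_hom R (koszul_comp R n s k) (self_module R)"
  by (rule lin_homI) (auto simp: koszul_comp_simps(1,3) koszul_comp_smult dest: bidegD)

lemma koszul_expand:
  assumes x: "x \<in> bideg R n s k"
  shows "x = (\<Oplus>\<^bsub>koszul_comp R n s k\<^esub>b\<in>koszul_basis n s k. x (fst b) (snd b) \<odot>\<^bsub>koszul_comp R n s k\<^esub> koszul_gen R b)"
proof (intro ext)
  fix J m
  interpret K: module R "koszul_comp R n s k" by (rule koszul_comp_module)
  note xR = bidegD(1)[OF x]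
  let ?t = "\<lambda>b. x (fst b) (snd b) \<odot>\<^bsub>koszul_comp R n s k\<^esub> koszul_gen R b"
  have t: "?t b \<in> carrier (koszul_comp R n s k)" if "b \<in> koszul_basis n s k" for b
    using koszul_gen_closed[OF that] xR by (intro K.smult_closed) (auto simp: koszul_comp_simps(1))
  have tv: "?t b J m = x (fst b) (snd b) \<otimes> koszul_gen R b J m" if "b \<in> koszul_basis n s k" for b
    using koszul_comp_smult[OF xR koszul_gen_closed[OF that]] by simp
  have "(\<Oplus>\<^bsub>koszul_comp R n s k\<^esub>b\<in>koszul_basis n s k. ?t b) J m = (\<Oplus>\<^bsub>self_module R\<^esub>b\<in>koszul_basis n s k. ?t b J m)"
    by (rule lin_hom_finsum[OF koszul_comp_module self_module_module[OF is_cring] koszul_coordinate_lin[of J m]]) (use t in auto)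
  also have "\<dots> = (\<Oplus>b\<in>koszul_basis n s k. x (fst b) (snd b) \<otimes> koszul_gen R b J m)"
    unfolding finsum_self_module by (rule finsum_cong') (use tv xR in \<open>auto simp: koszul_gen_def\<close>)
  also have "\<dots> = x J m"
  proof (cases "(J, m) \<in> koszul_basis n s k")
    case True
    have "(\<Oplus>b\<in>koszul_basis n s k. x (fst b) (snd b) \<otimes> koszul_gen R b J m) =
        x (fst (J, m)) (snd (J, m)) \<otimes> koszul_gen R (J, m) J m"
      by (rule finsum_single[OF finite_koszul_basis True]) (use xR in \<open>auto simp: koszul_gen_def\<close>)
    then show ?thesis using xR by (simp add: koszul_gen_def)
  next
    case False
    then have "x J m = \<zero>" using bidegD(2)[OF x, of J m] by (auto simp: koszul_basis_def monomials_iff)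
    moreover have "(\<Oplus>b\<in>koszul_basis n s k. x (fst b) (snd b) \<otimes> koszul_gen R b J m) = (\<Oplus>b\<in>koszul_basis n s k. \<zero>)"
      by (rule finsum_cong') (use False xR in \<open>auto simp: koszul_gen_def\<close>)
    ultimately show ?thesis by simp
  qed
  finally show "x J m = (\<Oplus>\<^bsub>koszul_comp R n s k\<^esub>b\<in>koszul_basis n s k. ?t b) J m" ..
qed

lemma koszul_comp_projective: "projective R (koszul_comp R n s k)"
  by (rule finite_basis_projective[OF koszul_comp_module finite_koszul_basis,
        where e = "koszul_gen R" and ev = "\<lambda>b x. x (fst b) (snd b)"])
    (use koszul_gen_closed koszul_coordinate_lin koszul_expand in \<open>simp_all add: koszul_comp_simps(1)\<close>)

lemma sym_koszul_negative: "x \<in> bideg R n s 0 \<Longrightarrow> sym_koszul R n x = (\<lambda>J m. \<zero>)"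
  using bidegD(2)[OF sym_koszul_bideg[of x n s 0]] by (fastforce simp: fun_eq_iff)

text \<open>Connects the differential of the theorem, whose sums and products are those of the
  polynomial ring, with the coordinate formula used everywhere else.\<close>

lemma koszul_diff_sym_alg:
  assumes x: "x \<in> bideg R n s k"
  shows "koszul_diff (sym_alg R n) n (sym_var R) x = sym_koszul R n x"
proof (intro ext)
  fix J m
  note xR = bidegD(1)[OF x]
  have p: "ext_partial (sym_alg R n) n j x J = (\<lambda>m. ext_partial R n j (\<lambda>K. x K m) J)" for j
  proof (cases "J \<subseteq> {..<n} \<and> j < n \<and> j \<notin> J")
    case True
    then show ?thesis using xR by (simp add: ext_partial_def sym_alg_neg_one_pow sym_mult_const)
  next
    case False
    then have "ext_partial (sym_alg R n) n j x J = \<zero>\<^bsub>sym_alg R n\<^esub>"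
      "\<And>m. ext_partial R n j (\<lambda>K. x K m) J = \<zero>" by (auto simp: ext_partial_def)
    then show ?thesis by (simp add: sym_alg_simps)
  qed
  have v: "sym_var R j \<otimes>\<^bsub>sym_alg R n\<^esub> ext_partial (sym_alg R n) n j x J =
      (\<lambda>m. if j \<in># m then ext_partial R n j (\<lambda>K. x K (m - {#j#})) J else \<zero>)" for j
    unfolding p by (rule sym_mult_var) (rule ext_partial_value[OF bideg_slice_carrier[OF x]])
  \<comment> \<open>A sum of polynomials may be evaluated at a monomial term by term once the
    summands lie in the carrier; membership in a fixed degree gives the finiteness of the
    support.\<close>
  have c: "sym_var R j \<otimes>\<^bsub>sym_alg R n\<^esub> ext_partial (sym_alg R n) n j x J \<in> carrier (sym_alg R n)" if j: "j < n" for j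
  proof -
    have "set_mset m \<subseteq> {..<n} \<and> size m = Suc s"
      if "j \<in># m" "ext_partial R n j (\<lambda>K. x K (m - {#j#})) J \<noteq> \<zero>" for m
    proof -
      have nz: "x (insert j J) (m - {#j#}) \<noteq> \<zero>" using that(2) by (auto simp: ext_partial_def split: if_splits)
      have b: "set_mset (m - {#j#}) \<subseteq> {..<n}" "size (m - {#j#}) = s" using bidegD(2)[OF x nz] by auto
      have "m = add_mset j (m - {#j#})" using that(1) by simp
      then show ?thesis
        using b j by (metis insert_subset lessThan_iff set_mset_add_mset_insert size_add_mset)
    qed
    then have "sym_var R j \<otimes>\<^bsub>sym_alg R n\<^esub> ext_partial (sym_alg R n) n j x J \<in> sym_deg R n (Suc s)"
      unfolding sym_deg_iff v using ext_partial_value[OF bideg_slice_carrier[OF x]] by auto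
    then show ?thesis by (simp add: sym_deg_def)
  qed
  show "koszul_diff (sym_alg R n) n (sym_var R) x J m = sym_koszul R n x J m"
    unfolding koszul_diff_def sym_koszul_def by (subst finsum_sym_alg) (use c in \<open>auto simp: v\<close>)
qed

end

section \<open>The resolution of the associated graded ring\<close>

text \<open>The sign is that of \<open>\<phi>\<close>, under which \<open>f\<^sub>j\<close> corresponds to the class of \<open>- r\<^sub>j\<close>.\<close>

definition mono_val :: "('a, 'c) ring_scheme \<Rightarrow> nat \<Rightarrow> (nat \<Rightarrow> 'a) \<Rightarrow> nat multiset \<Rightarrow> 'a"
  where "mono_val R n r m = (\<Otimes>\<^bsub>R\<^esub>j\<in>{..<n}. (\<ominus>\<^bsub>R\<^esub> r j) [^]\<^bsub>R\<^esub> count m j)"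

definition sym_eval :: "('a, 'c) ring_scheme \<Rightarrow> nat \<Rightarrow> (nat \<Rightarrow> 'a) \<Rightarrow> nat \<Rightarrow> (nat multiset \<Rightarrow> 'a) \<Rightarrow> 'a"
  where "sym_eval R n r s p = (\<Oplus>\<^bsub>R\<^esub>m\<in>monomials n s. p m \<otimes>\<^bsub>R\<^esub> mono_val R n r m)"

section \<open>Evaluation of forms at the sequence, and quasi-regularity\<close>

locale elements = R?: cring R for R :: "('a, 'c) ring_scheme" (structure) +
  fixes r :: "nat \<Rightarrow> 'a" and n :: nat
  assumes r: "\<And>j. j < n \<Longrightarrow> r j \<in> carrier R"
begin

lemma mono_val_closed: "mono_val R n r m \<in> carrier R"
  unfolding mono_val_def using r by (intro finprod_closed) auto

lemma mono_val_add_mset: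
  assumes i: "i < n"
  shows "mono_val R n r (add_mset i m) = mono_val R n r m \<otimes> \<ominus> r i"
proof -
  have "mono_val R n r (add_mset i m) =
      (\<Otimes>j\<in>{..<n}. (\<ominus> r j) [^] count m j \<otimes> (if i = j then \<ominus> r j else \<one>))"
    unfolding mono_val_def by (rule finprod_cong') (use r in auto)
  also have "\<dots> = mono_val R n r m \<otimes> (\<Otimes>j\<in>{..<n}. if i = j then \<ominus> r j else \<one>)"
    unfolding mono_val_def by (rule finprod_multf) (use r in auto)
  also have "(\<Otimes>j\<in>{..<n}. if i = j then \<ominus> r j else \<one>) = \<ominus> r i"
    by (rule finprod_singleton) (use i r in auto)
  finally show ?thesis .
qed

lemma mono_val_empty: "mono_val R n r {#} = \<one>"
  unfolding mono_val_def by (rule finprod_one_eqI) simp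

lemma sym_eval_closed: "(\<And>m. p m \<in> carrier R) \<Longrightarrow> sym_eval R n r s p \<in> carrier R"
  unfolding sym_eval_def by (intro finsum_closed) (auto simp: mono_val_closed)

lemma sym_eval_add:
  assumes "\<And>m. p m \<in> carrier R" "\<And>m. q m \<in> carrier R"
  shows "sym_eval R n r s (\<lambda>m. p m \<oplus> q m) = sym_eval R n r s p \<oplus> sym_eval R n r s q"
proof -
  have "sym_eval R n r s (\<lambda>m. p m \<oplus> q m) =
      (\<Oplus>m\<in>monomials n s. p m \<otimes> mono_val R n r m \<oplus> q m \<otimes> mono_val R n r m)"
    unfolding sym_eval_def by (rule finsum_cong') (use assms in \<open>auto simp: l_distr mono_val_closed\<close>)
  also have "\<dots> = sym_eval R n r s p \<oplus> sym_eval R n r s q"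
    unfolding sym_eval_def by (rule finsum_addf) (use assms in \<open>auto simp: mono_val_closed\<close>)
  finally show ?thesis .
qed

lemma sym_eval_smult:
  assumes "a \<in> carrier R" "\<And>m. p m \<in> carrier R"
  shows "sym_eval R n r s (\<lambda>m. a \<otimes> p m) = a \<otimes> sym_eval R n r s p"
proof -
  have "sym_eval R n r s (\<lambda>m. a \<otimes> p m) = (\<Oplus>m\<in>monomials n s. a \<otimes> (p m \<otimes> mono_val R n r m))"
    unfolding sym_eval_def by (rule finsum_cong') (use assms in \<open>auto simp: m_assoc mono_val_closed\<close>)
  also have "\<dots> = a \<otimes> sym_eval R n r s p"
    unfolding sym_eval_def
    by (rule finsum_rdistr[symmetric]) (use assms finite_monomials in \<open>auto simp: mono_val_closed\<close>)
  finally show ?thesis .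
qed

lemma sym_eval_uminus:
  assumes "\<And>m. p m \<in> carrier R"
  shows "sym_eval R n r s (\<lambda>m. \<ominus> p m) = \<ominus> sym_eval R n r s p"
  using sym_eval_smult[of "\<ominus> \<one>" p s] assms sym_eval_closed[of p s] by (simp add: l_minus)

lemma sym_eval_degree_zero: "(\<And>m. p m \<in> carrier R) \<Longrightarrow> sym_eval R n r 0 p = p {#}"
proof -
  have "monomials n 0 = {{#}}" by (simp add: monomials_def)
  then show "(\<And>m. p m \<in> carrier R) \<Longrightarrow> sym_eval R n r 0 p = p {#}"
    by (simp add: sym_eval_def mono_val_empty)
qed

lemma sym_koszul_degree_one:
  assumes g: "g \<in> bideg R n s 1"
  shows "sym_koszul R n g {} m = (\<Oplus>j\<in>{..<n}. if j \<in># m then g {j} (m - {#j#}) else \<zero>)"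
    and "const_koszul R n r g {} m = (\<Oplus>j\<in>{..<n}. r j \<otimes> g {j} m)"
  unfolding sym_koszul_def const_koszul_def koszul_diff_def
  using bidegD(1)[OF g] r
  by (auto intro!: finsum_cong' simp: ext_partial_def neg_one_pow_def)

text \<open>Modulo the elements \<open>f\<^sub>j + r\<^sub>j\<close>, the two differentials are opposite to each other.\<close>

lemma sym_eval_koszul:
  assumes g: "g \<in> bideg R n s 1"
  shows "sym_eval R n r (Suc s) (sym_koszul R n g {}) = \<ominus> sym_eval R n r s (const_koszul R n r g {})"
proof -
  note gR = bidegD(1)[OF g] and mR = mono_val_closed
  let ?h = "\<lambda>m j. (if j \<in># m then g {j} (m - {#j#}) else \<zero>) \<otimes> mono_val R n r m"
  let ?k = "\<lambda>m j. r j \<otimes> g {j} m \<otimes> mono_val R n r m"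
  have "sym_eval R n r (Suc s) (sym_koszul R n g {}) = (\<Oplus>m\<in>monomials n (Suc s). \<Oplus>j\<in>{..<n}. ?h m j)"
    unfolding sym_eval_def sym_koszul_degree_one[OF g]
    by (rule finsum_cong') (use gR mR in \<open>auto intro!: finsum_closed finsum_ldistr\<close>)
  also have "\<dots> = (\<Oplus>j\<in>{..<n}. \<Oplus>m\<in>monomials n (Suc s). ?h m j)"
    by (rule finsum_swap) (use gR mR finite_monomials in auto)
  also have "\<dots> = (\<Oplus>j\<in>{..<n}. \<Oplus>m\<in>monomials n s. \<ominus> ?k m j)"
  proof (rule finsum_cong'[OF refl])
    fix j assume "j \<in> {..<n}"
    then have j: "j < n" by simp
    have inj: "inj_on (add_mset j) (monomials n s)" by (simp add: inj_on_def)
    \<comment> \<open>Only monomials divisible by the variable \<open>j\<close> contribute. Dividing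
      by it reindexes the sum by the monomials of degree \<open>s\<close>, and
      \<open>mono_val\<close> releases the factor \<open>\<ominus> r j\<close>, the source of the
      sign.\<close>
    have "(\<Oplus>m\<in>monomials n (Suc s). ?h m j) = (\<Oplus>m\<in>add_mset j ` monomials n s. ?h m j)"
    proof (rule add.finprod_mono_neutral_cong_right[OF finite_monomials])
      show "add_mset j ` monomials n s \<subseteq> monomials n (Suc s)" using j by (auto simp: monomials_iff)
      fix m assume m: "m \<in> monomials n (Suc s) - add_mset j ` monomials n s"
      have "j \<notin># m"
      proof
        assume "j \<in># m"
        then obtain m' where m': "m = add_mset j m'" by (metis mset_add)
        then have "m' \<in> monomials n s" using m by (simp add: monomials_iff)
        then show False using m m' by blast
      qed
      then show "?h m j = \<zero>" using mR by simp
    qed (use gR mR in auto)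
    also have "\<dots> = (\<Oplus>m\<in>monomials n s. ?h (add_mset j m) j)"
      by (rule finsum_reindex[OF _ inj]) (use gR mR in auto)
    also have "\<dots> = (\<Oplus>m\<in>monomials n s. \<ominus> ?k m j)"
    proof (rule finsum_cong'[OF refl])
      fix m
      show "?h (add_mset j m) j = \<ominus> ?k m j"
        using mR[of m] gR[of "{j}" m] r[OF j] mono_val_add_mset[OF j, of m]
        by (simp add: l_minus r_minus m_ac)
    qed (use gR mR r j in auto)
    finally show "(\<Oplus>m\<in>monomials n (Suc s). ?h m j) = (\<Oplus>m\<in>monomials n s. \<ominus> ?k m j)" .
  qed (use gR mR r in \<open>auto intro!: finsum_closed\<close>)
  also have "\<dots> = (\<Oplus>m\<in>monomials n s. \<Oplus>j\<in>{..<n}. \<ominus> ?k m j)"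
    by (rule finsum_swap) (use gR mR r finite_monomials in auto)
  also have "\<dots> = (\<Oplus>m\<in>monomials n s. \<ominus> (const_koszul R n r g {} m \<otimes> mono_val R n r m))"
  proof (rule finsum_cong'[OF refl])
    fix m
    have "(\<Oplus>j\<in>{..<n}. \<ominus> ?k m j) = \<ominus> (\<Oplus>j\<in>{..<n}. ?k m j)"
      by (rule finsum_uminus) (use gR mR r in auto)
    also have "(\<Oplus>j\<in>{..<n}. ?k m j) = const_koszul R n r g {} m \<otimes> mono_val R n r m"
      unfolding sym_koszul_degree_one[OF g] by (rule finsum_ldistr[symmetric]) (use gR mR r in auto)
    finally show "(\<Oplus>j\<in>{..<n}. \<ominus> ?k m j) = \<ominus> (const_koszul R n r g {} m \<otimes> mono_val R n r m)" .
  qed (use bidegD(1)[OF const_koszul_bideg[OF r g]] mR in auto)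
  also have "\<dots> = \<ominus> sym_eval R n r s (const_koszul R n r g {})"
    unfolding sym_eval_def
    by (rule finsum_uminus) (use bidegD(1)[OF const_koszul_bideg[OF r g]] mR in auto)
  finally show ?thesis .
qed

text \<open>In exterior degree 0 everything is a cycle for \<open>sym_koszul\<close>, so the
  contraction is a section: it writes a form of positive degree as a combination of the
  variables.\<close>

lemma contraction_section:
  assumes x: "x \<in> bideg R n (Suc s) 0"
  shows "contraction R x \<in> bideg R n s 1" "sym_koszul R n (contraction R x) = x"
  using sym_koszul_exact[OF x sym_koszul_negative[OF x]] by simp_all

text \<open>The clause \<open>sym_koszul w = 0\<close> is what carries the induction on
  \<open>s\<close>. Write \<open>x\<close> as \<open>sym_koszul g\<close> with \<open>g\<close> its
  contraction. By \<open>sym_eval_koszul\<close> the form \<open>- const_koszul g\<close>, one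
  degree lower, has value zero as well, so it equals \<open>const_koszul w\<close> for some
  \<open>w\<close> with \<open>sym_koszul w = 0\<close>. Then \<open>g + w\<close> is a cycle for
  \<open>const_koszul\<close> that \<open>sym_koszul\<close> still sends to \<open>x\<close>. By
  exactness it is \<open>const_koszul h\<close>, and anticommutation shows that
  \<open>- sym_koszul h\<close> has boundary \<open>x\<close>; it is killed by
  \<open>sym_koszul\<close>, whose square is zero.\<close>

lemma quasi_regular:
  assumes reg: "regular_seq R r n" and "x \<in> bideg R n s 0" "sym_eval R n r s (x {}) = \<zero>"
  shows "\<exists>w\<in>bideg R n s 1. sym_koszul R n w = (\<lambda>J m. \<zero>) \<and> const_koszul R n r w = x"
  using assms(2,3)
proof (induction s arbitrary: x)
  case 0
  have "x J m = \<zero>" for J m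
  proof (rule ccontr)
    assume nz: "x J m \<noteq> \<zero>"
    then have "J \<subseteq> {..<n}" "card J = 0" "m = {#}" using bidegD(2)[OF 0(1) nz] by auto
    moreover from this have "J = {}" using finite_subset by (metis card_eq_0_iff finite_lessThan)
    moreover have "x {} {#} = \<zero>" using 0(2) sym_eval_degree_zero[of "x {}"] bidegD(1)[OF 0(1)] by simp
    ultimately show False using nz by simp
  qed
  then have x: "x = (\<lambda>J m. \<zero>)" by auto
  have "sym_koszul R n (\<lambda>J m. \<zero>) = (\<lambda>J m. \<zero>)"
    using lin_hom_zero[OF koszul_comp_module koszul_comp_module sym_koszul_lin] by (simp add: koszul_comp_simps(2))
  moreover have "const_koszul R n r (\<lambda>J m. \<zero>) = (\<lambda>J m. \<zero>)"
    using lin_hom_zero[OF koszul_comp_module koszul_comp_module const_koszul_lin[of n r, OF r]] by (simp add: koszul_comp_simps(2))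
  ultimately show ?case using x bideg_zero by blast
next
  case (Suc s)
  note cl = const_koszul_lin[of n r, OF r]
  let ?g = "contraction R x"
  note g = contraction_section[OF Suc.prems(1)]
  let ?x' = "\<lambda>J m. \<ominus> const_koszul R n r ?g J m"
  have dg: "const_koszul R n r ?g \<in> bideg R n s 0" using const_koszul_bideg[OF r g(1)] by simp
  have x': "?x' \<in> bideg R n s 0"
    using bideg_smult[OF _ dg, of "\<ominus> \<one>"] bidegD(1)[OF dg] by (simp add: l_minus)
  have "sym_eval R n r s (?x' {}) = \<ominus> sym_eval R n r s (const_koszul R n r ?g {})"
    by (rule sym_eval_uminus) (rule bidegD(1)[OF dg])
  then have "sym_eval R n r s (?x' {}) = \<zero>"
    using sym_eval_koszul[OF g(1)] g(2) Suc.prems(2) by simp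
  from Suc.IH[OF x' this] obtain w where
    w: "w \<in> bideg R n s 1" "sym_koszul R n w = (\<lambda>J m. \<zero>)" "const_koszul R n r w = ?x'" by blast
  let ?z = "\<lambda>J m. ?g J m \<oplus> w J m"
  have z: "?z \<in> bideg R n s (int (Suc 0))" using bideg_add[OF g(1) w(1)] by simp
  have "const_koszul R n r ?z = (\<lambda>J m. const_koszul R n r ?g J m \<oplus> ?x' J m)"
    using lin_homD(2)[OF cl, of ?g s 1 w] g(1) w by (simp add: koszul_comp_simps(1,3))
  then have "const_koszul R n r ?z = (\<lambda>J m. \<zero>)" using bidegD(1)[OF dg] by (simp add: r_neg)
  from const_koszul_exact[OF reg z this] obtain h where
    h: "h \<in> bideg R n s 2" "const_koszul R n r h = ?z" by auto
  have "sym_koszul R n ?z = (\<lambda>J m. sym_koszul R n ?g J m \<oplus> sym_koszul R n w J m)"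
    using lin_homD(2)[OF sym_koszul_lin, of ?g n s 1 w] g(1) w by (simp add: koszul_comp_simps(1,3))
  then have fz: "sym_koszul R n ?z = x" using g(2) w(2) bidegD(1)[OF Suc.prems(1)] by simp
  let ?v = "\<lambda>J m. \<ominus> sym_koszul R n h J m"
  have fh: "sym_koszul R n h \<in> bideg R n (Suc s) 1" using sym_koszul_bideg[OF h(1)] by simp
  have vm: "?v = (\<ominus> \<one>) \<odot>\<^bsub>koszul_comp R n (Suc s) 1\<^esub> sym_koszul R n h"
    using bidegD(1)[OF fh] by (simp add: koszul_comp_smult[OF _ fh] l_minus)
  have v: "?v \<in> bideg R n (Suc s) 1"
    using bideg_smult[OF _ fh, of "\<ominus> \<one>"] bidegD(1)[OF fh] by (simp add: l_minus)
  have ffh: "sym_koszul R n (sym_koszul R n h) = (\<lambda>J m. \<zero>)" by (rule sym_koszul_square[OF h(1)])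
  have "sym_koszul R n ?v = (\<ominus> \<one>) \<odot>\<^bsub>koszul_comp R n (Suc (Suc s)) (1 - 1)\<^esub> (\<lambda>J m. \<zero>)"
    unfolding vm using lin_homD(3)[OF sym_koszul_lin, of "\<ominus> \<one>" "sym_koszul R n h" n "Suc s" 1] fh ffh
    by (simp add: koszul_comp_simps(1))
  then have "sym_koszul R n ?v = (\<lambda>J m. \<zero>)" by (subst (asm) koszul_comp_smult) (auto simp: bideg_zero)
  moreover have "const_koszul R n r ?v = x"
  proof -
    have cfh: "const_koszul R n r (sym_koszul R n h) = (\<lambda>J m. \<ominus> x J m)"
      using const_sym_koszul[OF r h(1)] h(2) fz by simp
    have xm: "(\<lambda>J m. \<ominus> x J m) \<in> bideg R n (Suc s) 0"
      using const_koszul_bideg[of n r, OF r fh] cfh by simp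
    have "const_koszul R n r ?v = (\<ominus> \<one>) \<odot>\<^bsub>koszul_comp R n (Suc s) 0\<^esub> (\<lambda>J m. \<ominus> x J m)"
      unfolding vm using lin_homD(3)[OF cl, of "\<ominus> \<one>" "sym_koszul R n h" "Suc s" 1] fh cfh
      by (simp add: koszul_comp_simps(1))
    also have "\<dots> = x" using bidegD(1)[OF Suc.prems(1)] by (simp add: koszul_comp_smult[OF _ xm] l_minus)
    finally show ?thesis .
  qed
  ultimately show ?case using v by blast
qed

end

text \<open>One copy of the Koszul complex for each monomial of degree \<open>s\<close>. The
  differential keeps the copies apart; only the augmentation, which evaluates a form at the
  sequence, ties them together.\<close>

definition power_resolution ::
    "('a, 'c) ring_scheme \<Rightarrow> 'a set \<Rightarrow> (nat \<Rightarrow> 'a) \<Rightarrow> nat \<Rightarrow> nat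
      \<Rightarrow> ('a, nat set \<Rightarrow> nat multiset \<Rightarrow> 'a, 'a set) resolution"
  where "power_resolution R I r n s = \<lparr>
    obj = koszul_comp R n s,
    diff = (\<lambda>k. const_koszul R n r),
    aug = (\<lambda>x. ideal_pow R I (Suc s) +>\<^bsub>R\<^esub> sym_eval R n r s (x {}))\<rparr>"

lemma power_resolution_simps [simp]:
  "obj (power_resolution R I r n s) k = koszul_comp R n s k"
  "diff (power_resolution R I r n s) k = const_koszul R n r"
  "aug (power_resolution R I r n s) x = ideal_pow R I (Suc s) +>\<^bsub>R\<^esub> sym_eval R n r s (x {})"
  by (simp_all add: power_resolution_def)

section \<open>Powers of the ideal and their quotients\<close>

context quotient_by_ideal
begin

lemma ideal_pow_ideal: "ideal (ideal_pow R I s) R"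
  by (induction s) (simp_all add: oneideal ideal_prod_is_ideal[OF ideal_axioms])

lemma ideal_pow_Suc_subset: "ideal_pow R I (Suc s) \<subseteq> ideal_pow R I s"
  using ideal_prod_inter[OF ideal_axioms ideal_pow_ideal, of s] by simp

lemma ideal_pow_antimono: "s \<le> t \<Longrightarrow> ideal_pow R I t \<subseteq> ideal_pow R I s"
proof (induction t rule: dec_induct)
  case (step t)
  then show ?case using ideal_pow_Suc_subset by blast
qed simp

lemma ideal_pow_one: "ideal_pow R I (Suc 0) = I"
  by (simp add: ideal_prod_one[OF ideal_axioms])

lemma ideal_pow_mult: "a \<in> I \<Longrightarrow> x \<in> ideal_pow R I s \<Longrightarrow> a \<otimes> x \<in> ideal_pow R I (Suc s)"
  by (simp add: ideal_prod.prod)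

lemma quotient_by_pow: "quotient_by_ideal R (ideal_pow R I s)"
  by (simp add: quotient_by_ideal_def ideal_pow_ideal R.is_cring)

abbreviation pow_module where "pow_module s \<equiv> (self_module R)\<lparr>carrier := ideal_pow R I s\<rparr>"

lemma filt_quotient:
  assumes "s \<le> t"
  shows "quotient R (pow_module s) (ideal_pow R I t)"
proof -
  note sub = quotient_by_ideal.I_submodule[OF quotient_by_pow]
  show ?thesis
    by (intro quotientI submodule.submodule_is_module[OF sub self_module_module[OF R.is_cring]]
        ideal_submodule[OF R.is_cring ideal_pow_ideal ideal_pow_antimono[OF assms] sub])
qed

lemma filt_module: "s \<le> t \<Longrightarrow> module R (filt_quot R I s t)"
  unfolding filt_quot_def by (rule quotient.quot_module_module[OF filt_quotient])

lemma filt_carrier: "carrier (filt_quot R I s t) = (\<lambda>a. ideal_pow R I t +>\<^bsub>R\<^esub> a) ` ideal_pow R I s"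
  by (simp add: filt_quot_def quot_module_carrier)

lemma filt_proj_lin: "s \<le> t \<Longrightarrow> (\<lambda>a. ideal_pow R I t +>\<^bsub>R\<^esub> a) \<in> lin_hom R (pow_module s) (filt_quot R I s t)"
  using quotient.quot_proj_lin[OF filt_quotient, of s t] by (simp add: filt_quot_def)

lemma filt_zero: "\<zero>\<^bsub>filt_quot R I s t\<^esub> = ideal_pow R I t"
  by (simp add: filt_quot_def)

lemma filt_zero_iff:
  assumes "a \<in> ideal_pow R I s"
  shows "ideal_pow R I t +>\<^bsub>R\<^esub> a = ideal_pow R I t \<longleftrightarrow> a \<in> ideal_pow R I t"
  using quotient_by_ideal.coset_zero_iff[OF quotient_by_pow] ideal.Icarr[OF ideal_pow_ideal assms] .

lemma gr_module: "module R (gr R I s)"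
  unfolding gr_def by (rule filt_module) simp

lemma gr_ideal:
  assumes "a \<in> I" "x \<in> carrier (gr R I s)"
  shows "a \<odot>\<^bsub>gr R I s\<^esub> x = \<zero>\<^bsub>gr R I s\<^esub>"
proof -
  obtain b where b: "b \<in> ideal_pow R I s" "x = ideal_pow R I (Suc s) +>\<^bsub>R\<^esub> b"
    using assms(2) by (auto simp: gr_def filt_carrier)
  have ab: "a \<otimes> b \<in> ideal_pow R I (Suc s)" by (rule ideal_pow_mult[OF assms(1) b(1)])
  have "a \<odot>\<^bsub>gr R I s\<^esub> x = ideal_pow R I (Suc s) +>\<^bsub>R\<^esub> (a \<otimes> b)"
    unfolding gr_def b(2) using lin_homD(3)[OF filt_proj_lin, of s "Suc s" a b] b assms(1) by simp
  then show ?thesis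
    using ab filt_zero_iff[of "a \<otimes> b" "Suc s" "Suc s"] by (simp add: gr_def filt_zero)
qed

lemma grS_module: "module S (grS R I s)"
  unfolding grS_def by (rule over_quotient_module[OF gr_module gr_ideal])

end

section \<open>Exactness of the resolutions of the graded pieces\<close>

locale koszul_setting = quotient_by_ideal R I + elements R r n
  for R :: "('a, 'c) ring_scheme" (structure) and I and r :: "nat \<Rightarrow> 'a" and n +
  assumes regular: "regular_seq R r n" and I_def: "I = genideal R (r ` {..<n})"
begin

lemma r_mem: "j < n \<Longrightarrow> r j \<in> I"
  unfolding I_def using genideal_self[of "r ` {..<n}"] r by auto

lemma mono_val_mem: "set_mset m \<subseteq> {..<n} \<Longrightarrow> mono_val R n r m \<in> ideal_pow R I (size m)"
proof (induction m)
  case empty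
  show ?case by (simp add: mono_val_empty)
next
  case (add j m)
  then have j: "j < n" and m: "mono_val R n r m \<in> ideal_pow R I (size m)" by auto
  have "\<ominus> r j \<otimes> mono_val R n r m \<in> ideal_pow R I (Suc (size m))"
    by (rule ideal_pow_mult) (use r_mem[OF j] m in auto)
  then show ?case using mono_val_add_mset[OF j, of m] mono_val_closed[of m] r[OF j] by (simp add: m_comm)
qed

lemma sym_eval_mem:
  assumes "\<And>m. p m \<in> carrier R"
  shows "sym_eval R n r s p \<in> ideal_pow R I s"
proof -
  interpret J: ideal "ideal_pow R I s" R by (rule ideal_pow_ideal)
  have "(\<Oplus>m\<in>A. p m \<otimes> mono_val R n r m) \<in> ideal_pow R I s" if "finite A" "A \<subseteq> monomials n s" for A
    using that
  proof (induction A rule: finite_induct)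
    case (insert m A)
    have "mono_val R n r m \<in> ideal_pow R I s" using mono_val_mem[of m] insert.prems by (auto simp: monomials_iff)
    then have "p m \<otimes> mono_val R n r m \<in> ideal_pow R I s" using J.I_l_closed assms by simp
    then show ?case using insert assms mono_val_closed by (subst finsum_insert) auto
  qed simp
  then show ?thesis unfolding sym_eval_def using finite_monomials by blast
qed

lemma sym_eval_coefficients_ideal:
  assumes "\<And>m. p m \<in> I"
  shows "sym_eval R n r s p \<in> ideal_pow R I (Suc s)"
proof -
  interpret J: ideal "ideal_pow R I (Suc s)" R by (rule ideal_pow_ideal)
  have "(\<Oplus>m\<in>A. p m \<otimes> mono_val R n r m) \<in> ideal_pow R I (Suc s)" if "finite A" "A \<subseteq> monomials n s" for A
    using that
  proof (induction A rule: finite_induct)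
    case (insert m A)
    have "mono_val R n r m \<in> ideal_pow R I s" using mono_val_mem[of m] insert.prems by (auto simp: monomials_iff)
    then have "p m \<otimes> mono_val R n r m \<in> ideal_pow R I (Suc s)" by (rule ideal_pow_mult[OF assms])
    moreover have "(\<lambda>m. p m \<otimes> mono_val R n r m) \<in> insert m A \<rightarrow> carrier R"
      using assms mono_val_closed by auto
    ultimately show ?case using insert by (subst finsum_insert) (auto simp del: ideal_pow.simps)
  qed (simp del: ideal_pow.simps)
  then show ?thesis unfolding sym_eval_def using finite_monomials by blast
qed

lemma sym_eval_lin: "(\<lambda>x. sym_eval R n r s (x {})) \<in> lin_hom R (koszul_comp R n s 0) (pow_module s)"
  by (rule lin_homI)
    (auto simp: koszul_comp_simps(1,3) koszul_comp_smult sym_eval_mem sym_eval_add sym_eval_smult bidegD(1))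

text \<open>For a product \<open>i \<otimes> j\<close>, with
  \<open>i = \<Sum> c l \<otimes> r l\<close> and \<open>j\<close> the value of a form
  \<open>x\<close>, take \<open>g = - \<Sum> c l x e_l\<close>. Then
  \<open>const_koszul g = - i x\<close>, and \<open>sym_eval_koszul\<close> turns this into the
  value \<open>i \<otimes> j\<close> for the form \<open>sym_koszul g\<close>, without any explicit
  multiplication of monomials.\<close>

lemma sym_eval_surj:
  assumes "a \<in> ideal_pow R I s"
  shows "\<exists>x\<in>bideg R n s 0. sym_eval R n r s (x {}) = a"
  using assms
proof (induction s arbitrary: a)
  case 0
  then have a: "a \<in> carrier R" by simp
  let ?x = "\<lambda>J m. if J = {} \<and> m = {#} then a else \<zero>"
  have "?x \<in> bideg R n 0 0" using a by (auto simp: bideg_def)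
  moreover have "sym_eval R n r 0 (?x {}) = a" using sym_eval_degree_zero[of "?x {}"] a by simp
  ultimately show ?case by (intro bexI[of _ ?x]) simp_all
next
  case (Suc s)
  from Suc.prems have "a \<in> I \<cdot>\<^bsub>R\<^esub> ideal_pow R I s" by simp
  then show ?case
  proof (induction rule: ideal_prod.induct)
    case (prod i j)
    obtain x where x: "x \<in> bideg R n s 0" "sym_eval R n r s (x {}) = j" using Suc.IH[OF prod(2)] by blast
    note xR = bidegD(1)[OF x(1)]
    have mem: "i \<in> genideal R (r ` {..<n})" using prod(1) I_def by simp
    obtain c where c: "\<And>l. c l \<in> carrier R" "i = (\<Oplus>l\<in>{..<n}. c l \<otimes> r l)"
      by (rule genideal_finite[of n r i, OF r mem]) (assumption, rule that)
    have i: "i \<in> carrier R" using prod(1) by (rule Icarr)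
    let ?g = "\<lambda>J m. if \<exists>l<n. J = {l} then \<ominus> (c (the_elem J) \<otimes> x {} m) else \<zero>"
    have g: "?g \<in> bideg R n s 1"
    proof -
      have "set_mset m \<subseteq> {..<n} \<and> size m = s" if "\<ominus> (b \<otimes> x {} m) \<noteq> \<zero>" "b \<in> carrier R" for b m
      proof -
        have "x {} m \<noteq> \<zero>" using that by (auto simp: a_inv_zero)
        then show ?thesis using bidegD(2)[OF x(1)] by blast
      qed
      then show ?thesis using c(1) xR by (auto simp: bideg_def)
    qed
    have "const_koszul R n r ?g {} m = \<ominus> (i \<otimes> x {} m)" for m
    proof -
      have "const_koszul R n r ?g {} m = (\<Oplus>l\<in>{..<n}. \<ominus> (c l \<otimes> r l \<otimes> x {} m))"
        unfolding sym_koszul_degree_one(2)[OF g]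
        by (rule finsum_cong') (use c(1) xR r in \<open>auto simp: r_minus m_ac\<close>)
      also have "\<dots> = \<ominus> (\<Oplus>l\<in>{..<n}. c l \<otimes> r l \<otimes> x {} m)"
        by (rule finsum_uminus) (use c(1) xR r in auto)
      also have "(\<Oplus>l\<in>{..<n}. c l \<otimes> r l \<otimes> x {} m) = i \<otimes> x {} m"
        unfolding c(2) by (rule finsum_ldistr[symmetric]) (use c(1) xR r in auto)
      finally show ?thesis .
    qed
    then have "const_koszul R n r ?g {} = (\<lambda>m. \<ominus> (i \<otimes> x {} m))" by (rule ext)
    then have "sym_eval R n r s (const_koszul R n r ?g {}) = \<ominus> (i \<otimes> j)"
      using sym_eval_uminus[of "\<lambda>m. i \<otimes> x {} m" s] sym_eval_smult[of i "x {}" s] i xR x(2) by simp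
    moreover have "j \<in> carrier R" using prod(2) ideal.Icarr[OF ideal_pow_ideal] by blast
    ultimately have "sym_eval R n r (Suc s) (sym_koszul R n ?g {}) = i \<otimes> j"
      using sym_eval_koszul[OF g] i by simp
    moreover have "sym_koszul R n ?g \<in> bideg R n (Suc s) 0" using sym_koszul_bideg[OF g] by simp
    ultimately show ?case by blast
  next
    case (sum a b)
    then obtain x y where xy: "x \<in> bideg R n (Suc s) 0" "sym_eval R n r (Suc s) (x {}) = a"
      "y \<in> bideg R n (Suc s) 0" "sym_eval R n r (Suc s) (y {}) = b" by blast
    have "sym_eval R n r (Suc s) (\<lambda>m. x {} m \<oplus> y {} m) = a \<oplus> b"
      using sym_eval_add[of "x {}" "y {}" "Suc s"] bidegD(1)[OF xy(1)] bidegD(1)[OF xy(3)] xy by simp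
    then show ?case using bideg_add[OF xy(1,3)] by (intro bexI) auto
  qed
qed

text \<open>The value of \<open>x\<close> is also the value of a form of degree
  \<open>s + 1\<close>, which is \<open>sym_koszul g\<close> for its contraction \<open>g\<close>.
  Hence \<open>x + const_koszul g\<close> has value zero and is a boundary by
  \<open>quasi_regular\<close>, and so is \<open>x\<close>.\<close>

lemma kernel_boundary:
  assumes x: "x \<in> bideg R n s 0" and mem: "sym_eval R n r s (x {}) \<in> ideal_pow R I (Suc s)"
  shows "\<exists>w\<in>bideg R n s 1. const_koszul R n r w = x"
proof -
  note cl = const_koszul_lin[of n r, OF r]
  obtain y where y: "y \<in> bideg R n (Suc s) 0" "sym_eval R n r (Suc s) (y {}) = sym_eval R n r s (x {})"
    using sym_eval_surj[OF mem] by blast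
  let ?g = "contraction R y"
  note g = contraction_section[OF y(1)]
  have dg: "const_koszul R n r ?g \<in> bideg R n s 0" using const_koszul_bideg[OF r g(1)] by simp
  let ?z = "\<lambda>J m. x J m \<oplus> const_koszul R n r ?g J m"
  have z: "?z \<in> bideg R n s 0" by (rule bideg_add[OF x dg])
  have e: "sym_eval R n r s (x {}) = \<ominus> sym_eval R n r s (const_koszul R n r ?g {})"
    using sym_eval_koszul[OF g(1)] g(2) y(2) by simp
  have "sym_eval R n r s (?z {}) = \<zero>"
    using sym_eval_add[of "x {}" "const_koszul R n r ?g {}" s] bidegD(1)[OF x] bidegD(1)[OF dg] e
      sym_eval_closed[of "const_koszul R n r ?g {}" s] by (simp add: l_neg)
  from quasi_regular[OF regular z this] obtain w where
    w: "w \<in> bideg R n s 1" "const_koszul R n r w = ?z" by blast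
  interpret K: module R "koszul_comp R n s 1" by (rule koszul_comp_module)
  interpret K0: module R "koszul_comp R n s 0" by (rule koszul_comp_module)
  have wg: "w \<in> carrier (koszul_comp R n s 1)" "?g \<in> carrier (koszul_comp R n s 1)"
    using w g by (simp_all add: koszul_comp_simps(1))
  have "const_koszul R n r (w \<ominus>\<^bsub>koszul_comp R n s 1\<^esub> ?g) = ?z \<ominus>\<^bsub>koszul_comp R n s 0\<^esub> const_koszul R n r ?g"
    using lin_hom_minus[OF koszul_comp_module koszul_comp_module cl wg] w(2) by simp
  also have "\<dots> = x"
  proof -
    have c: "x \<in> carrier (koszul_comp R n s 0)" "const_koszul R n r ?g \<in> carrier (koszul_comp R n s 0)"
      using x dg by (simp_all add: koszul_comp_simps(1))
    have "?z = x \<oplus>\<^bsub>koszul_comp R n s 0\<^esub> const_koszul R n r ?g" by (simp add: koszul_comp_simps(3))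
    then show ?thesis using c by (simp add: a_minus_def K0.a_assoc K0.r_neg)
  qed
  finally show ?thesis using K.minus_closed[OF wg] by (auto simp: koszul_comp_simps(1))
qed

lemma boundary_coefficients:
  assumes x: "x \<in> bideg R n s k"
  shows "const_koszul R n r x J m \<in> I"
proof -
  have t: "r j \<otimes> ext_partial R n j (\<lambda>K. x K m) J \<in> I" if "j < n" for j
    by (rule I_r_closed[OF r_mem[OF that] ext_partial_value[OF bideg_slice_carrier[OF x]]])
  have "(\<Oplus>j\<in>A. r j \<otimes> ext_partial R n j (\<lambda>K. x K m) J) \<in> I" if "finite A" "A \<subseteq> {..<n}" for A
    using that
  proof (induction A rule: finite_induct)
    case (insert j A)
    have "(\<lambda>j. r j \<otimes> ext_partial R n j (\<lambda>K. x K m) J) \<in> insert j A \<rightarrow> carrier R"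
      using insert.prems t Icarr by auto
    then show ?case using insert t by (subst finsum_insert) auto
  qed simp
  then show ?thesis by (simp add: const_koszul_def koszul_diff_def)
qed

lemma bideg_negative: "k < 0 \<Longrightarrow> bideg R n s k = {\<lambda>J m. \<zero>}"
  using bideg_zero by (auto simp: bideg_def fun_eq_iff)

lemma aug_lin: "aug (power_resolution R I r n s) \<in> lin_hom R (koszul_comp R n s 0) (gr R I s)"
proof -
  have "aug (power_resolution R I r n s) = (\<lambda>x. ideal_pow R I (Suc s) +>\<^bsub>R\<^esub> sym_eval R n r s (x {}))" by auto
  then show ?thesis
    using lin_hom_comp[OF sym_eval_lin filt_proj_lin, of s "Suc s"] by (simp add: gr_def del: ideal_pow.simps)
qed

theorem power_resolution: "proj_resolution R (gr R I s) (power_resolution R I r n s)"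
proof -
  let ?P = "power_resolution R I r n s"
  note cl = const_koszul_lin[of n r, OF r]
  have "exact_resolution R (gr R I s) ?P"
    unfolding exact_resolution_def
  proof (intro conjI allI impI)
    fix k :: int assume "k > 0"
    then obtain j where k: "k = int (Suc j)" by (metis zero_less_imp_eq_int gr0_implies_Suc)
    show "cycles ?P k = boundaries ?P k"
    proof
      show "cycles ?P k \<subseteq> boundaries ?P k"
      proof
        fix x assume "x \<in> cycles ?P k"
        then have x: "x \<in> bideg R n s (int (Suc j))" "const_koszul R n r x = (\<lambda>J m. \<zero>)"
          using k by (simp_all add: cycles_def a_kernel_def' koszul_comp_simps(1,2))
        obtain y where "y \<in> bideg R n s (int (Suc (Suc j)))" "const_koszul R n r y = x"
          using const_koszul_exact[OF regular x] by blast
        moreover have "int (Suc (Suc j)) = k + 1" using k by simp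
        ultimately show "x \<in> boundaries ?P k" by (auto simp: boundaries_def koszul_comp_simps(1))
      qed
      show "boundaries ?P k \<subseteq> cycles ?P k"
      proof
        fix x assume "x \<in> boundaries ?P k"
        then obtain y where y: "y \<in> bideg R n s (k + 1)" "x = const_koszul R n r y"
          by (auto simp: boundaries_def koszul_comp_simps(1))
        have "const_koszul R n r y \<in> bideg R n s k" using const_koszul_bideg[OF r y(1)] by simp
        then show "x \<in> cycles ?P k"
          using y(2) const_koszul_square[OF r y(1)] by (simp add: cycles_def a_kernel_def' koszul_comp_simps(1,2))
      qed
    qed
  next
    show "aug ?P \<in> lin_hom R (obj ?P 0) (gr R I s)" using aug_lin by simp
    show "aug ?P ` carrier (obj ?P 0) = carrier (gr R I s)"
    proof
      show "aug ?P ` carrier (obj ?P 0) \<subseteq> carrier (gr R I s)" using lin_homD(1)[OF aug_lin] by auto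
      show "carrier (gr R I s) \<subseteq> aug ?P ` carrier (obj ?P 0)"
      proof
        fix X assume "X \<in> carrier (gr R I s)"
        then obtain a where a: "a \<in> ideal_pow R I s" "X = ideal_pow R I (Suc s) +>\<^bsub>R\<^esub> a"
          by (auto simp: gr_def filt_carrier)
        obtain x where "x \<in> bideg R n s 0" "sym_eval R n r s (x {}) = a" using sym_eval_surj[OF a(1)] by blast
        then show "X \<in> aug ?P ` carrier (obj ?P 0)"
          unfolding a(2) by (intro image_eqI[of _ _ x]) (simp_all add: koszul_comp_simps(1))
      qed
    qed
    have iff: "aug ?P x = \<zero>\<^bsub>gr R I s\<^esub> \<longleftrightarrow> sym_eval R n r s (x {}) \<in> ideal_pow R I (Suc s)"
      if "x \<in> bideg R n s 0" for x
      using filt_zero_iff[OF sym_eval_mem[of "x {}" s], of "Suc s"] bidegD(1)[OF that]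
      by (simp add: gr_def filt_zero del: ideal_pow.simps)
    show "a_kernel (obj ?P 0) (gr R I s) (aug ?P) = boundaries ?P 0"
    proof
      show "a_kernel (obj ?P 0) (gr R I s) (aug ?P) \<subseteq> boundaries ?P 0"
        using iff kernel_boundary by (auto simp: a_kernel_def' boundaries_def koszul_comp_simps(1) image_iff
            simp del: ideal_pow.simps power_resolution_simps(3)) metis
      show "boundaries ?P 0 \<subseteq> a_kernel (obj ?P 0) (gr R I s) (aug ?P)"
      proof
        fix x assume "x \<in> boundaries ?P 0"
        then obtain y where y: "y \<in> bideg R n s 1" "x = const_koszul R n r y"
          by (auto simp: boundaries_def koszul_comp_simps(1))
        have x: "x \<in> bideg R n s 0" using const_koszul_bideg[OF r y(1)] y(2) by simp
        have "sym_eval R n r s (x {}) \<in> ideal_pow R I (Suc s)"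
          by (rule sym_eval_coefficients_ideal) (use y boundary_coefficients in auto)
        then show "x \<in> a_kernel (obj ?P 0) (gr R I s) (aug ?P)"
          using x iff[OF x] by (simp add: a_kernel_def' koszul_comp_simps(1) del: ideal_pow.simps power_resolution_simps(3))
      qed
    qed
  qed (use koszul_comp_module cl in \<open>simp_all add: koszul_comp_simps(1,2) bideg_negative\<close>)
  then show ?thesis by (simp add: proj_resolution_iff koszul_comp_projective)
qed

lemma power_res: "proj_res R (gr R I s) (power_resolution R I r n s)"
  by (rule proj_resI[OF R.is_cring gr_module power_resolution])

end

section \<open>Comparison with the Koszul complex over the polynomial ring\<close>

definition reduce ::
    "('a, 'c) ring_scheme \<Rightarrow> 'a set \<Rightarrow> (nat set \<Rightarrow> nat multiset \<Rightarrow> 'a) \<Rightarrow> nat set \<Rightarrow> nat multiset \<Rightarrow> 'a set"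
  where "reduce R I x = (\<lambda>J m. I +>\<^bsub>R\<^esub> x J m)"

text \<open>For maps whose definition by choice does not show their linearity: it can be checked
  after composing with an injective linear map, usually \<open>tor_koszul\<close>.\<close>

lemma lin_hom_transfer:
  assumes N: "module R N" and L: "module R L" and h: "h \<in> lin_hom R N L" and inj: "inj_on h (carrier N)"
    and g: "\<And>x. x \<in> carrier M \<Longrightarrow> g x \<in> carrier N" and hg: "(\<lambda>x. h (g x)) \<in> lin_hom R M L" and M: "module R M"
  shows "g \<in> lin_hom R M N"
proof -
  interpret M: module R M by fact
  interpret N: module R N by fact
  show ?thesis
  proof (rule lin_homI)
    fix x y assume xy: "x \<in> carrier M" "y \<in> carrier M"
    have "h (g (x \<oplus>\<^bsub>M\<^esub> y)) = h (g x \<oplus>\<^bsub>N\<^esub> g y)"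
      using lin_homD(2)[OF hg xy] lin_homD(2)[OF h g[OF xy(1)] g[OF xy(2)]] by simp
    then show "g (x \<oplus>\<^bsub>M\<^esub> y) = g x \<oplus>\<^bsub>N\<^esub> g y"
      by (rule inj_onD[OF inj]) (use g xy in auto)
  next
    fix a x assume ax: "a \<in> carrier R" "x \<in> carrier M"
    have "h (g (a \<odot>\<^bsub>M\<^esub> x)) = h (a \<odot>\<^bsub>N\<^esub> g x)"
      using lin_homD(3)[OF hg ax] lin_homD(3)[OF h ax(1) g[OF ax(2)]] by simp
    then show "g (a \<odot>\<^bsub>M\<^esub> x) = a \<odot>\<^bsub>N\<^esub> g x"
      by (rule inj_onD[OF inj]) (use g ax in auto)
  qed (rule g)
qed

context quotient_by_ideal
begin

lemma two_resolutions_base_changeI: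
  "proj_res R M P \<Longrightarrow> res R N Q \<Longrightarrow> two_resolutions_base_change R M P N Q I"
  by (simp add: two_resolutions_base_change_def two_resolutions_def quotient_by_ideal_axioms)

lemma coset_ring_hom: "ring_hom_cring R S (\<lambda>x. I +>\<^bsub>R\<^esub> x)"
  using rcos_ring_hom_cring[OF R.is_cring] by simp

lemma coset_neg_one_pow: "I +>\<^bsub>R\<^esub> neg_one_pow R c = neg_one_pow S c"
proof -
  interpret h: ring_hom_cring R S "\<lambda>x. I +>\<^bsub>R\<^esub> x" by (rule coset_ring_hom)
  have one: "I +>\<^bsub>R\<^esub> \<one> = \<one>\<^bsub>S\<^esub>" by (rule h.hom_one)
  have "I +>\<^bsub>R\<^esub> \<ominus> \<one> = \<ominus>\<^bsub>S\<^esub> (I +>\<^bsub>R\<^esub> \<one>)" by (rule h.hom_a_inv) (rule R.one_closed)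
  then show ?thesis
    unfolding neg_one_pow_parity h.S.neg_one_pow_parity one by (cases "even c") (simp_all only: if_True if_False one)
qed

lemma reduce_bideg:
  assumes "x \<in> bideg R n s k"
  shows "reduce R I x \<in> bideg S n s k"
proof -
  have z: "I +>\<^bsub>R\<^esub> \<zero> = \<zero>\<^bsub>S\<^esub>" using coset_zero_iff[of \<zero>] by (simp add: S_simps(1))
  have "x J m \<noteq> \<zero>" if nz: "I +>\<^bsub>R\<^esub> x J m \<noteq> \<zero>\<^bsub>S\<^esub>" for J m
  proof
    assume "x J m = \<zero>"
    then show False using nz unfolding z[symmetric] by simp
  qed
  then have "J \<subseteq> {..<n} \<and> int (card J) = k \<and> set_mset m \<subseteq> {..<n} \<and> size m = s"
    if "I +>\<^bsub>R\<^esub> x J m \<noteq> \<zero>\<^bsub>S\<^esub>" for J m using bidegD(2)[OF assms] that by blast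
  then show ?thesis
    using coset_closed[OF bidegD(1)[OF assms]] by (simp add: bideg_def reduce_def)
qed

lemma reduce_surj:
  assumes y: "y \<in> bideg S n s k"
  obtains x where "x \<in> bideg R n s k" "y = reduce R I x"
proof -
  interpret S: cring S by (rule S_cring)
  have "\<exists>a\<in>carrier R. y J m = I +>\<^bsub>R\<^esub> a" for J m
    using S.bidegD(1)[OF y, of J m] by (auto simp: S_carrier)
  then obtain x where x: "\<And>J m. x J m \<in> carrier R" "\<And>J m. y J m = I +>\<^bsub>R\<^esub> x J m" by metis
  \<comment> \<open>Taking the representative 0 wherever the class is zero keeps the support, and
    hence the bidegree, unchanged.\<close>
  let ?x = "\<lambda>J m. if y J m = I then \<zero> else x J m"
  have "?x \<in> bideg R n s k"
    using x(1) S.bidegD(2)[OF y] by (auto simp: bideg_def S_simps)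
  moreover have "y = reduce R I ?x"
    using x coset_zero_iff[of \<zero>] by (auto simp: reduce_def fun_eq_iff)
  ultimately show thesis by (rule that)
qed

lemma reduce_eq_iff:
  assumes "x \<in> bideg R n s k" "y \<in> bideg R n s' k'"
  shows "reduce R I x = reduce R I y \<longleftrightarrow> (\<forall>J m. x J m \<ominus> y J m \<in> I)"
  using bidegD(1)[OF assms(1)] bidegD(1)[OF assms(2)]
  by (auto simp: reduce_def fun_eq_iff coset_eq_iff)

lemma reduce_add_ideal:
  assumes "x \<in> bideg R n s k" "\<And>J m. y J m \<in> I"
  shows "reduce R I (\<lambda>J m. y J m \<oplus> x J m) = reduce R I x"
proof (intro ext)
  fix J m
  have "y J m \<oplus> x J m \<ominus> x J m = y J m"
    using bidegD(1)[OF assms(1), of J m] assms(2)[of J m] Icarr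
    by (simp add: minus_eq a_assoc r_neg)
  then show "reduce R I (\<lambda>J m. y J m \<oplus> x J m) J m = reduce R I x J m"
    unfolding reduce_def using bidegD(1)[OF assms(1), of J m] assms(2)[of J m] Icarr
    by (subst coset_eq_iff) auto
qed

lemma reduce_add:
  assumes "x \<in> bideg R n s k" "y \<in> bideg R n s k"
  shows "reduce R I (x \<oplus>\<^bsub>koszul_comp R n s k\<^esub> y) = reduce R I x \<oplus>\<^bsub>koszul_comp S n s k\<^esub> reduce R I y"
  using bidegD(1)[OF assms(1)] bidegD(1)[OF assms(2)]
  by (simp add: koszul_comp_simps(3) reduce_def coset_add)

lemma reduce_smult:
  assumes a: "a \<in> carrier R" and x: "x \<in> bideg R n s k"
  shows "reduce R I (a \<odot>\<^bsub>koszul_comp R n s k\<^esub> x) = (I +>\<^bsub>R\<^esub> a) \<odot>\<^bsub>koszul_comp S n s k\<^esub> reduce R I x"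
proof -
  interpret S: cring S by (rule S_cring)
  show ?thesis
    unfolding koszul_comp_smult[OF assms] S.koszul_comp_smult[OF coset_closed[OF a] reduce_bideg[OF x]]
    using bidegD(1)[OF x] a by (simp add: reduce_def coset_mult)
qed

lemma reduce_sym_koszul:
  assumes x: "x \<in> bideg R n s k"
  shows "reduce R I (sym_koszul R n x) = sym_koszul S n (reduce R I x)"
proof (intro ext)
  fix J m
  interpret h: ring_hom_cring R S "\<lambda>x. I +>\<^bsub>R\<^esub> x" by (rule coset_ring_hom)
  note xR = bidegD(1)[OF x]
  have z: "I +>\<^bsub>R\<^esub> \<zero> = \<zero>\<^bsub>S\<^esub>" by (rule h.hom_zero)
  have p: "I +>\<^bsub>R\<^esub> ext_partial R n j (\<lambda>K. x K l) J = ext_partial S n j (\<lambda>K. I +>\<^bsub>R\<^esub> x K l) J" for j l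
    using xR by (simp add: ext_partial_def z coset_mult[symmetric] coset_neg_one_pow)
  let ?t = "\<lambda>j. if j \<in># m then ext_partial R n j (\<lambda>K. x K (m - {#j#})) J else \<zero>"
  have t: "?t \<in> {..<n} \<rightarrow> carrier R" using ext_partial_value[OF bideg_slice_carrier[OF x]] by auto
  have "I +>\<^bsub>R\<^esub> (\<Oplus>j\<in>{..<n}. ?t j) = (\<Oplus>\<^bsub>S\<^esub>j\<in>{..<n}. I +>\<^bsub>R\<^esub> ?t j)"
    using h.hom_finsum[OF t] by (simp add: comp_def)
  also have "\<dots> = (\<Oplus>\<^bsub>S\<^esub>j\<in>{..<n}. if j \<in># m then ext_partial S n j (\<lambda>K. I +>\<^bsub>R\<^esub> x K (m - {#j#})) J else \<zero>\<^bsub>S\<^esub>)"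
  proof (rule h.S.finsum_cong'[OF refl])
    fix j
    show "I +>\<^bsub>R\<^esub> ?t j = (if j \<in># m then ext_partial S n j (\<lambda>K. I +>\<^bsub>R\<^esub> x K (m - {#j#})) J else \<zero>\<^bsub>S\<^esub>)"
      by (simp add: p z)
    show "(\<lambda>j. if j \<in># m then ext_partial S n j (\<lambda>K. I +>\<^bsub>R\<^esub> x K (m - {#j#})) J else \<zero>\<^bsub>S\<^esub>) \<in> {..<n} \<rightarrow> carrier S"
      using coset_closed[OF ext_partial_value[OF bideg_slice_carrier[OF x]]] by (auto simp: p[symmetric])
  qed
  finally show "reduce R I (sym_koszul R n x) J m = sym_koszul S n (reduce R I x) J m"
    by (simp add: reduce_def sym_koszul_def)
qed

text \<open>Identifies \<open>R/I \<otimes>\<close> the Koszul module with its reduction. A tensor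
  that vanishes has all its coordinates in \<open>I\<close>, by applying the coordinate functionals
  and \<open>one_tensor_self_module\<close>; conversely an element with coordinates in
  \<open>I\<close> is expanded in the basis.\<close>

lemma one_tensor_koszul_eq_iff:
  assumes x: "x \<in> bideg R n s k" and y: "y \<in> bideg R n s k"
  shows "one_tensor R I (koszul_comp R n s k) x = one_tensor R I (koszul_comp R n s k) y \<longleftrightarrow>
    reduce R I x = reduce R I y"
proof -
  let ?K = "koszul_comp R n s k"
  interpret K: base_change R I ?K by (rule base_changeI[OF koszul_comp_module])
  interpret TK: module R "tensor R B ?K" by (rule K.tensor_base_module)
  have xy: "x \<in> carrier ?K" "y \<in> carrier ?K" using x y by (simp_all add: koszul_comp_simps(1))
  have cls: "one_tensor R I ?K x \<in> carrier (tensor R B ?K)" "one_tensor R I ?K y \<in> carrier (tensor R B ?K)"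
    using lin_homD(1)[OF K.one_tensor_lin] xy by auto
  have d: "x \<ominus>\<^bsub>?K\<^esub> y \<in> bideg R n s k"
    using K.M.minus_closed[OF xy] by (simp add: koszul_comp_simps(1))
  have dJ: "(x \<ominus>\<^bsub>?K\<^esub> y) J m = x J m \<ominus> y J m" for J m
  proof -
    have "x = (x \<ominus>\<^bsub>?K\<^esub> y) \<oplus>\<^bsub>?K\<^esub> y" using xy by (simp add: a_minus_def K.M.a_assoc K.M.l_neg)
    then have "x J m = (x \<ominus>\<^bsub>?K\<^esub> y) J m \<oplus> y J m" by (metis koszul_comp_simps(3))
    then show ?thesis
      using bidegD(1)[OF d, of J m] bidegD(1)[OF y, of J m] by (simp add: minus_eq a_assoc r_neg)
  qed
  have "one_tensor R I ?K x = one_tensor R I ?K y \<longleftrightarrow> one_tensor R I ?K (x \<ominus>\<^bsub>?K\<^esub> y) = \<zero>\<^bsub>tensor R B ?K\<^esub>"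
    using lin_hom_minus[OF koszul_comp_module K.tensor_base_module K.one_tensor_lin xy] cls
    by (simp add: TK.minus_eq_zero_iff)
  also have "\<dots> \<longleftrightarrow> (\<forall>J m. (x \<ominus>\<^bsub>?K\<^esub> y) J m \<in> I)"
  proof
    assume a: "one_tensor R I ?K (x \<ominus>\<^bsub>?K\<^esub> y) = \<zero>\<^bsub>tensor R B ?K\<^esub>"
    show "\<forall>J m. (x \<ominus>\<^bsub>?K\<^esub> y) J m \<in> I"
    proof (intro allI)
      fix J m
      have "one_tensor R I (self_module R) ((x \<ominus>\<^bsub>?K\<^esub> y) J m) = \<zero>\<^bsub>tensor R B (self_module R)\<^esub>"
        by (rule one_tensor_map_zero[OF koszul_comp_module self_module_module[OF R.is_cring] koszul_coordinate_lin _ a])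
          (use d in \<open>simp add: koszul_comp_simps(1)\<close>)
      then show "(x \<ominus>\<^bsub>?K\<^esub> y) J m \<in> I" using one_tensor_self_module bidegD(1)[OF d] by blast
    qed
  next
    assume a: "\<forall>J m. (x \<ominus>\<^bsub>?K\<^esub> y) J m \<in> I"
    show "one_tensor R I ?K (x \<ominus>\<^bsub>?K\<^esub> y) = \<zero>\<^bsub>tensor R B ?K\<^esub>"
      by (subst koszul_expand[OF d], rule K.one_tensor_coordinates_ideal)
        (use a koszul_gen_closed in \<open>auto simp: koszul_comp_simps(1)\<close>)
  qed
  also have "\<dots> \<longleftrightarrow> reduce R I x = reduce R I y"
    unfolding reduce_eq_iff[OF x y] dJ ..
  finally show ?thesis .
qed

end

section \<open>Tor computed from the power resolution\<close>

context koszul_setting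
begin

abbreviation K where "K \<equiv> power_resolution R I r n"

lemma K_res: "res R (gr R I s) (K s)"
  using power_res by (simp add: proj_res_def)

sublocale Kc: complex_base_change R I "K s" for s
proof -
  interpret res R "gr R I s" "K s" by (rule K_res)
  show "complex_base_change R I (K s)"
    by (simp add: complex_base_change_def quotient_by_ideal_axioms complex_axioms)
qed

lemma K_tor_cycle: "tor_cycle R I (K s) k x \<longleftrightarrow> x \<in> bideg R n s k"
proof
  assume x: "x \<in> bideg R n s k"
  note dx = const_koszul_bideg[of n r, OF r x]
  have "reduce R I (const_koszul R n r x) = reduce R I (\<lambda>J m. \<zero>)"
    unfolding reduce_def using boundary_coefficients[OF x] by (simp add: a_rcos_const)
  then have "one_tensor R I (koszul_comp R n s (k - 1)) (const_koszul R n r x) =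
      one_tensor R I (koszul_comp R n s (k - 1)) (\<lambda>J m. \<zero>)"
    using one_tensor_koszul_eq_iff[OF dx bideg_zero] by simp
  then show "tor_cycle R I (K s) k x"
    using x Kc.ot_zero[of s "k - 1"] by (simp add: tor_cycle_def koszul_comp_simps(1,2))
qed (auto simp: tor_cycle_def koszul_comp_simps(1))

lemma K_class_eq_iff:
  assumes x: "x \<in> bideg R n s k" and y: "y \<in> bideg R n s k"
  shows "tor_class R I (K s) k x = tor_class R I (K s) k y \<longleftrightarrow> reduce R I x = reduce R I y"
proof -
  have "one_tensor R I (koszul_comp R n s k) x =
      one_tensor R I (koszul_comp R n s k) (const_koszul R n r w \<oplus>\<^bsub>koszul_comp R n s k\<^esub> y) \<longleftrightarrow>
      reduce R I x = reduce R I y" if w: "w \<in> bideg R n s (k + 1)" for w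
  proof -
    have dw: "const_koszul R n r w \<in> bideg R n s k" using const_koszul_bideg[of n r, OF r w] by simp
    have "reduce R I (const_koszul R n r w \<oplus>\<^bsub>koszul_comp R n s k\<^esub> y) = reduce R I y"
      unfolding koszul_comp_simps(3) by (rule reduce_add_ideal[OF y boundary_coefficients[OF w]])
    moreover have "const_koszul R n r w \<oplus>\<^bsub>koszul_comp R n s k\<^esub> y \<in> bideg R n s k"
      unfolding koszul_comp_simps(3) by (rule bideg_add[OF dw y])
    ultimately show ?thesis using one_tensor_koszul_eq_iff[OF x] by simp
  qed
  moreover have "bideg R n s (k + 1) \<noteq> {}" using bideg_zero by blast
  ultimately show ?thesis
    using Kc.tor_class_eq_iff[of s k x y] x y by (auto simp: K_tor_cycle koszul_comp_simps(1))
qed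

end

lemma chain_lift_ident: "chain_lift R L L (\<lambda>X. X) (\<lambda>k x. x)"
  by (simp add: chain_lift_def lin_hom_ident)

section \<open>Comparison with an arbitrary family of resolutions\<close>

locale koszul_tor = koszul_setting R I r n
  for R :: "('a, 'c) ring_scheme" (structure) and I and r :: "nat \<Rightarrow> 'a" and n +
  fixes Q :: "nat \<Rightarrow> ('a, 'q, 'a set) resolution"
  assumes Q: "\<And>s. proj_resolution R (gr R I s) (Q s)"
begin

lemma Q_res: "proj_res R (gr R I s) (Q s)"
  by (rule proj_resI[OF R.is_cring gr_module Q])

lemma Q_res': "res R (gr R I s) (Q s)"
  using Q_res by (simp add: proj_res_def)

sublocale Qc: complex_base_change R I "Q s" for s
proof -
  interpret res R "gr R I s" "Q s" by (rule Q_res')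
  show "complex_base_change R I (Q s)"
    by (simp add: complex_base_change_def quotient_by_ideal_axioms complex_axioms)
qed

lemma QK: "two_resolutions_base_change R (gr R I s) (Q s) (gr R I s') (K s') I"
  by (rule two_resolutions_base_changeI[OF Q_res K_res])

lemma KQ: "two_resolutions_base_change R (gr R I s) (K s) (gr R I s') (Q s') I"
  by (rule two_resolutions_base_changeI[OF power_res Q_res'])

text \<open>Homotopic maps give equal classes, and in the power resolution classes are reductions.
  This is the form in which uniqueness of lifts is used from here on.\<close>

lemma lift_reduce_eq:
  assumes F: "chain_lift R (Q s) (K s') f F" and G: "chain_lift R (Q s) (K s') f G"
    and x: "tor_cycle R I (Q s) k x"
  shows "reduce R I (F k x) = reduce R I (G k x)"
proof -
  interpret QK: two_resolutions_base_change R "gr R I s" "Q s" "gr R I s'" "K s'" I by (rule QK)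
  show ?thesis
    using QK.chain_lift_tor_class_eq[OF F G x] QK.chain_lift_tor_cycle[OF F x] QK.chain_lift_tor_cycle[OF G x]
    by (simp add: K_tor_cycle K_class_eq_iff)
qed

definition compare :: "nat \<Rightarrow> int \<Rightarrow> 'q \<Rightarrow> nat set \<Rightarrow> nat multiset \<Rightarrow> 'a"
  where "compare s = (SOME F. chain_lift R (Q s) (K s) (\<lambda>X. X) F)"

lemma compare_lift: "chain_lift R (Q s) (K s) (\<lambda>X. X) (compare s)"
proof -
  interpret QK: two_resolutions_base_change R "gr R I s" "Q s" "gr R I s" "K s" I by (rule QK)
  obtain F where "chain_lift R (Q s) (K s) (\<lambda>X. X) F" using QK.chain_lift_exists[OF lin_hom_ident] by blast
  then show ?thesis unfolding compare_def by (rule someI[of "chain_lift R (Q s) (K s) (\<lambda>X. X)"])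
qed

text \<open>The working form of \<open>psi\<close>, shown equal to it in \<open>psi_eq\<close>. Any
  representative of the class may be used, and by \<open>tor_koszul_class\<close> any lift of the
  identity may take the place of \<open>compare\<close>.\<close>

definition tor_koszul :: "nat \<Rightarrow> int \<Rightarrow> ('a, 'q) tens_el set \<Rightarrow> nat set \<Rightarrow> nat multiset \<Rightarrow> 'a set"
  where "tor_koszul s k t = the_elem ((\<lambda>x. reduce R I (compare s k x)) `
    {x. tor_cycle R I (Q s) k x \<and> tor_class R I (Q s) k x = t})"

lemma compare_bideg: "tor_cycle R I (Q s) k x \<Longrightarrow> compare s k x \<in> bideg R n s k"
  using lin_homD(1)[OF chain_liftD(1)[OF compare_lift]] Qc.tor_cycle_closed by (simp add: koszul_comp_simps(1))

lemma tor_koszul_compare: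
  assumes x: "tor_cycle R I (Q s) k x"
  shows "tor_koszul s k (tor_class R I (Q s) k x) = reduce R I (compare s k x)"
  unfolding tor_koszul_def
proof (rule the_elem_image_eq)
  interpret QK: two_resolutions_base_change R "gr R I s" "Q s" "gr R I s" "K s" I by (rule QK)
  fix y assume "y \<in> {y. tor_cycle R I (Q s) k y \<and> tor_class R I (Q s) k y = tor_class R I (Q s) k x}"
  then have y: "tor_cycle R I (Q s) k y" "tor_class R I (Q s) k y = tor_class R I (Q s) k x" by auto
  have "tor_class R I (K s) k (compare s k y) = tor_class R I (K s) k (compare s k x)"
    using QK.tor_map_class[OF compare_lift y(1)] QK.tor_map_class[OF compare_lift x] y(2) by simp
  then show "reduce R I (compare s k y) = reduce R I (compare s k x)"
    using K_class_eq_iff compare_bideg x y(1) by simp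
qed (use x in simp)

lemma tor_koszul_class:
  assumes F: "chain_lift R (Q s) (K s) (\<lambda>X. X) F" and x: "tor_cycle R I (Q s) k x"
  shows "tor_koszul s k (tor_class R I (Q s) k x) = reduce R I (F k x)"
  using tor_koszul_compare[OF x] lift_reduce_eq[OF compare_lift F x] by simp

lemma tor_koszul_lin: "tor_koszul s k \<in> lin_hom S (TorS R I (Q s) k) (koszul_comp S n s k)"
  unfolding TorS_def
proof (rule lin_hom_over_quotient[OF Qc.Tor_module Qc.Tor_ideal])
  note cl = lin_homD[OF chain_liftD(1)[OF compare_lift]]
  fix t assume "t \<in> carrier (Tor R I (Q s) k)"
  then obtain x where x: "tor_cycle R I (Q s) k x" "t = tor_class R I (Q s) k x" by (rule Qc.Tor_cases)
  show "tor_koszul s k t \<in> carrier (koszul_comp S n s k)"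
    unfolding x(2) tor_koszul_compare[OF x(1)] koszul_comp_simps(1)
    by (rule reduce_bideg[OF compare_bideg[OF x(1)]])
  show "tor_koszul s k (a \<odot>\<^bsub>Tor R I (Q s) k\<^esub> t) = (I +>\<^bsub>R\<^esub> a) \<odot>\<^bsub>koszul_comp S n s k\<^esub> tor_koszul s k t"
    if a: "a \<in> carrier R" for a
    unfolding x(2) Qc.tor_cycle_smult(2)[OF x(1) a, symmetric] tor_koszul_compare[OF x(1)]
      tor_koszul_compare[OF Qc.tor_cycle_smult(1)[OF x(1) a]]
    using cl(3)[OF a Qc.tor_cycle_closed[OF x(1)]] reduce_smult[OF a compare_bideg[OF x(1)]] by simp
  fix t' assume "t' \<in> carrier (Tor R I (Q s) k)"
  then obtain y where y: "tor_cycle R I (Q s) k y" "t' = tor_class R I (Q s) k y" by (rule Qc.Tor_cases)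
  show "tor_koszul s k (t \<oplus>\<^bsub>Tor R I (Q s) k\<^esub> t') = tor_koszul s k t \<oplus>\<^bsub>koszul_comp S n s k\<^esub> tor_koszul s k t'"
    unfolding x(2) y(2) Qc.tor_cycle_add(2)[OF x(1) y(1), symmetric] tor_koszul_compare[OF x(1)]
      tor_koszul_compare[OF y(1)] tor_koszul_compare[OF Qc.tor_cycle_add(1)[OF x(1) y(1)]]
    using cl(2)[OF Qc.tor_cycle_closed[OF x(1)] Qc.tor_cycle_closed[OF y(1)]]
      reduce_add[OF compare_bideg[OF x(1)] compare_bideg[OF y(1)]] by simp
qed

text \<open>A lift \<open>G\<close> of the identity in the opposite direction is inverse to
  \<open>compare\<close> up to homotopy, since both composites lift the identity, and homotopies
  disappear on classes. In the power resolution the classes are exactly the elements of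
  \<open>bideg S n s k\<close>, through \<open>K_class_eq_iff\<close> and
  \<open>reduce_surj\<close>.\<close>

lemma tor_koszul_bij: "bij_betw (tor_koszul s k) (carrier (Tor R I (Q s) k)) (bideg S n s k)"
proof -
  interpret QK: two_resolutions_base_change R "gr R I s" "Q s" "gr R I s" "K s" I by (rule QK)
  interpret KQ: two_resolutions_base_change R "gr R I s" "K s" "gr R I s" "Q s" I by (rule KQ)
  interpret QQ: two_resolutions_base_change R "gr R I s" "Q s" "gr R I s" "Q s" I
    by (rule two_resolutions_base_changeI[OF Q_res Q_res'])
  interpret KK: two_resolutions_base_change R "gr R I s" "K s" "gr R I s" "K s" I
    by (rule two_resolutions_base_changeI[OF power_res K_res])
  obtain G where G: "chain_lift R (K s) (Q s) (\<lambda>X. X) G" using KQ.chain_lift_exists[OF lin_hom_ident] by blast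
  note ident = chain_lift_ident
  have "inj_on (tor_koszul s k) (carrier (Tor R I (Q s) k))"
  proof (rule inj_onI)
    fix t t' assume tt: "t \<in> carrier (Tor R I (Q s) k)" "t' \<in> carrier (Tor R I (Q s) k)"
      and eq: "tor_koszul s k t = tor_koszul s k t'"
    obtain x where x: "tor_cycle R I (Q s) k x" "t = tor_class R I (Q s) k x" using tt(1) by (rule Qc.Tor_cases)
    obtain y where y: "tor_cycle R I (Q s) k y" "t' = tor_class R I (Q s) k y" using tt(2) by (rule Qc.Tor_cases)
    have GF: "tor_class R I (Q s) k (G k (compare s k z)) = tor_class R I (Q s) k z" if "tor_cycle R I (Q s) k z" for z
      by (rule QQ.chain_lift_tor_class_eq[OF chain_lift_comp[OF compare_lift G Q_res'] ident that])
    have "tor_class R I (K s) k (compare s k x) = tor_class R I (K s) k (compare s k y)"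
      using eq tor_koszul_compare[OF x(1)] tor_koszul_compare[OF y(1)] x y K_class_eq_iff compare_bideg by simp
    moreover have "tor_map R I (K s) (Q s) (\<lambda>X. X) k (tor_class R I (K s) k (compare s k z)) = tor_class R I (Q s) k z"
      if "tor_cycle R I (Q s) k z" for z
      using KQ.tor_map_class[OF G, of k "compare s k z"] compare_bideg[OF that] GF[OF that] by (simp add: K_tor_cycle)
    ultimately show "t = t'" using x y by metis
  qed
  moreover have "tor_koszul s k ` carrier (Tor R I (Q s) k) = bideg S n s k"
  proof (intro equalityI subsetI)
    fix y assume "y \<in> tor_koszul s k ` carrier (Tor R I (Q s) k)"
    then show "y \<in> bideg S n s k" using lin_homD(1)[OF tor_koszul_lin] by (auto simp: TorS_def koszul_comp_simps(1))
  next
    fix y assume "y \<in> bideg S n s k"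
    then obtain z where z: "z \<in> bideg R n s k" "y = reduce R I z" by (rule reduce_surj)
    have zc: "tor_cycle R I (K s) k z" using z(1) by (simp add: K_tor_cycle)
    have Gz: "tor_cycle R I (Q s) k (G k z)" by (rule KQ.chain_lift_tor_cycle[OF G zc])
    have "tor_class R I (K s) k (compare s k (G k z)) = tor_class R I (K s) k z"
      by (rule KK.chain_lift_tor_class_eq[OF chain_lift_comp[OF G compare_lift K_res] ident zc])
    then have "tor_koszul s k (tor_class R I (Q s) k (G k z)) = y"
      using tor_koszul_compare[OF Gz] K_class_eq_iff compare_bideg[OF Gz] z by simp
    then show "y \<in> tor_koszul s k ` carrier (Tor R I (Q s) k)" using Qc.tor_class_closed[OF Gz] by blast
  qed
  ultimately show ?thesis by (simp add: bij_betw_def)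
qed

lemma tor_koszul_inj: "inj_on (tor_koszul s k) (carrier (TorS R I (Q s) k))"
  using tor_koszul_bij by (simp add: bij_betw_def TorS_def)

lemma tor_koszul_closed: "t \<in> carrier (Tor R I (Q s) k) \<Longrightarrow> tor_koszul s k t \<in> bideg S n s k"
  using tor_koszul_bij by (auto simp: bij_betw_def)

end

section \<open>The connecting homomorphism\<close>

text \<open>For a section \<open>q\<close> of \<open>g\<close>, the element
  \<open>y - q (g y)\<close> lies in the kernel of \<open>g\<close>, and \<open>p y\<close> is its
  preimage under \<open>f\<close>; linearity of \<open>p\<close> is inherited from that of
  \<open>f \<circ> p\<close>. Linear splittings survive the tensor product, which is how injectivity
  and lifting over \<open>R/I\<close> are obtained below.\<close>

lemma split_exact:
  assumes cr: "cring R" and L: "module R L" and M: "module R M" and N: "module R N" and proj: "projective R N"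
    and f: "f \<in> lin_hom R L M" and g: "g \<in> lin_hom R M N"
    and inj: "inj_on f (carrier L)" and ex: "f ` carrier L = a_kernel M N g" and sur: "g ` carrier M = carrier N"
  obtains p q where "p \<in> lin_hom R M L" "q \<in> lin_hom R N M"
    "\<And>x. x \<in> carrier L \<Longrightarrow> p (f x) = x" "\<And>y. y \<in> carrier M \<Longrightarrow> y = f (p y) \<oplus>\<^bsub>M\<^esub> q (g y)"
proof -
  interpret cring R by fact
  interpret L: module R L by fact
  interpret M: module R M by fact
  interpret N: module R N by fact
  obtain q where q: "q \<in> lin_hom R N M" "\<And>z. z \<in> carrier N \<Longrightarrow> g (q z) = z"
    by (rule projective_lift[OF proj M N g lin_hom_ident]) (use sur in auto)
  let ?e = "\<lambda>y. y \<ominus>\<^bsub>M\<^esub> q (g y)"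
  have el: "?e \<in> lin_hom R M M"
    by (rule lin_hom_diff[OF M lin_hom_ident lin_hom_comp[OF g q(1)] M])
  have "?e y \<in> f ` carrier L" if y: "y \<in> carrier M" for y
  proof -
    have gy: "g y \<in> carrier N" using lin_homD(1)[OF g y] .
    have qy: "q (g y) \<in> carrier M" using lin_homD(1)[OF q(1) gy] .
    have "g (?e y) = \<zero>\<^bsub>N\<^esub>" using lin_hom_minus[OF M N g y qy] q(2)[OF gy] gy by (simp add: a_minus_def N.r_neg)
    then show ?thesis using lin_homD(1)[OF el y] by (simp add: ex a_kernel_def')
  qed
  then have "\<forall>y\<in>carrier M. \<exists>x. x \<in> carrier L \<and> f x = ?e y" by (metis (no_types, lifting) image_iff)
  then obtain p where p: "\<And>y. y \<in> carrier M \<Longrightarrow> p y \<in> carrier L" "\<And>y. y \<in> carrier M \<Longrightarrow> f (p y) = ?e y"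
    by metis
  have fp: "(\<lambda>y. f (p y)) \<in> lin_hom R M M" using el p(2) by (auto simp: lin_hom_def)
  have pl: "p \<in> lin_hom R M L" by (rule lin_hom_transfer[OF L M f inj p(1) fp M])
  show thesis
  proof (rule that[OF pl q(1)])
    fix x assume x: "x \<in> carrier L"
    have fx: "f x \<in> carrier M" using lin_homD(1)[OF f x] .
    have "f x \<in> a_kernel M N g" using ex x by blast
    then have "g (f x) = \<zero>\<^bsub>N\<^esub>" by (simp add: a_kernel_def')
    then have "f (p (f x)) = f x"
      using p(2)[OF fx] lin_hom_zero[OF N M q(1)] fx by (simp add: a_minus_def M.a_inv_zero)
    then show "p (f x) = x" by (rule inj_onD[OF inj _ p(1)[OF fx] x])
  next
    fix y assume y: "y \<in> carrier M"
    have "q (g y) \<in> carrier M" using lin_homD(1)[OF q(1) lin_homD(1)[OF g y]] .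
    then show "y = f (p y) \<oplus>\<^bsub>M\<^esub> q (g y)" using p(2)[OF y] y by (simp add: a_minus_def M.a_assoc M.l_neg)
  qed
qed

lemma (in cring) koszul_comp_uminus:
  assumes x: "x \<in> bideg R n s k"
  shows "\<ominus>\<^bsub>koszul_comp R n s k\<^esub> x = (\<lambda>J m. \<ominus> x J m)"
proof -
  have "\<ominus>\<^bsub>koszul_comp R n s k\<^esub> x = (\<ominus> \<one>) \<odot>\<^bsub>koszul_comp R n s k\<^esub> x"
    using module.smult_l_minus[OF koszul_comp_module, of \<one> x] module.smult_one[OF koszul_comp_module, of x] x
    by (simp add: koszul_comp_simps(1))
  then show ?thesis using bidegD(1)[OF x] by (simp add: koszul_comp_smult[OF _ x] l_minus)
qed

section \<open>Short exact sequences of resolutions and their comparison\<close>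

locale koszul_connecting = koszul_tor R I r n Q
  for R :: "('a, 'c) ring_scheme" (structure) and I and r :: "nat \<Rightarrow> 'a" and n
    and Q :: "nat \<Rightarrow> ('a, 'q, 'a set) resolution" +
  fixes P :: "nat \<Rightarrow> ('a, 'p, 'a set) resolution" and u v
  assumes P: "\<And>s. proj_resolution R (filt_quot R I s (Suc (Suc s))) (P s)"
    and ses: "\<And>s. ses_of_resolutions R gr_incl (gr_proj R I s) (Q (Suc s)) (P s) (Q s) (u s) (v s)"
begin

lemma P_module: "module R (filt_quot R I s (Suc (Suc s)))"
  by (rule filt_module) simp

lemma P_res: "proj_res R (filt_quot R I s (Suc (Suc s))) (P s)"
  by (rule proj_resI[OF R.is_cring P_module P])

sublocale Pc: complex_base_change R I "P s" for s
proof -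
  interpret proj_res R "filt_quot R I s (Suc (Suc s))" "P s" by (rule P_res)
  show "complex_base_change R I (P s)"
    by (simp add: complex_base_change_def quotient_by_ideal_axioms complex_axioms)
qed

lemma u_lift: "chain_lift R (Q (Suc s)) (P s) gr_incl (u s)"
  and v_lift: "chain_lift R (P s) (Q s) (gr_proj R I s) (v s)"
  and u_inj: "inj_on (u s k) (carrier (obj (Q (Suc s)) k))"
  and u_image: "u s k ` carrier (obj (Q (Suc s)) k) = a_kernel (obj (P s) k) (obj (Q s) k) (v s k)"
  and v_surj: "v s k ` carrier (obj (P s) k) = carrier (obj (Q s) k)"
  using ses[of s] by (auto simp: ses_of_resolutions_def)

lemma u_lin: "u s k \<in> lin_hom R (obj (Q (Suc s)) k) (obj (P s) k)"
  and v_lin: "v s k \<in> lin_hom R (obj (P s) k) (obj (Q s) k)"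
  by (rule chain_liftD(1)[OF u_lift], rule chain_liftD(1)[OF v_lift])

lemma v_u: "x \<in> carrier (obj (Q (Suc s)) k) \<Longrightarrow> v s k (u s k x) = \<zero>\<^bsub>obj (Q s) k\<^esub>"
  using u_image[of s k] by (auto simp: a_kernel_def')

lemma gr_proj_coset:
  assumes a: "a \<in> carrier R"
  shows "gr_proj R I s (ideal_pow R I (Suc (Suc s)) +>\<^bsub>R\<^esub> a) = ideal_pow R I (Suc s) +>\<^bsub>R\<^esub> a"
proof -
  interpret J: ideal "ideal_pow R I (Suc s)" R by (rule ideal_pow_ideal)
  interpret J': ideal "ideal_pow R I (Suc (Suc s))" R by (rule ideal_pow_ideal)
  have "x \<oplus> (y \<oplus> a) \<in> ideal_pow R I (Suc s) +>\<^bsub>R\<^esub> a"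
    if x: "x \<in> ideal_pow R I (Suc s)" and y: "y \<in> ideal_pow R I (Suc (Suc s))" for x y
  proof -
    have y': "y \<in> ideal_pow R I (Suc s)" using y ideal_pow_Suc_subset[of "Suc s"] by blast
    have "x \<oplus> (y \<oplus> a) = (x \<oplus> y) \<oplus> a" using J.Icarr[OF x] J.Icarr[OF y'] a by (simp add: a_assoc)
    moreover have "x \<oplus> y \<in> ideal_pow R I (Suc s)" using x y' by (rule J.a_closed)
    ultimately show ?thesis by (auto simp: a_r_coset_def')
  qed
  moreover have "x \<oplus> a \<in> gr_proj R I s (ideal_pow R I (Suc (Suc s)) +>\<^bsub>R\<^esub> a)"
    if x: "x \<in> ideal_pow R I (Suc s)" for x
  proof -
    have "x \<oplus> a = x \<oplus> (\<zero> \<oplus> a)" using a by simp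
    moreover have "\<zero> \<in> ideal_pow R I (Suc (Suc s))" by (rule J'.zero_closed)
    ultimately show ?thesis using x unfolding gr_proj_def set_add_def' a_r_coset_def' by blast
  qed
  ultimately show ?thesis by (auto simp: gr_proj_def set_add_def' a_r_coset_def')
qed

text \<open>
  The chain map \<open>x \<mapsto> (compare (v x), \<Gamma> x)\<close> takes \<open>P s\<close> to the truncation of the Koszul complex of
  \<open>r\<^sub>j + f\<^sub>j\<close> to polynomials of degrees \<open>s\<close> and \<open>s + 1\<close>, which resolves \<open>I\<^sup>s/I\<^sup>s\<^sup>+\<^sup>2\<close>.
  Its differential has the component \<open>sym_koszul\<close> from degree \<open>s\<close> to degree \<open>s + 1\<close>.
\<close>

lemma connecting_lift:
  obtains \<Gamma> where "\<And>k. \<Gamma> k \<in> lin_hom R (obj (P s) k) (koszul_comp R n (Suc s) k)"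
    "chain_lift R (Q (Suc s)) (K (Suc s)) (\<lambda>X. X) (\<lambda>k x. \<Gamma> k (u s k x))"
    "\<And>k x. x \<in> carrier (obj (P s) k) \<Longrightarrow>
      reduce R I (\<Gamma> (k - 1) (diff (P s) k x)) = reduce R I (sym_koszul R n (compare s k (v s k x)))"
proof -
  interpret P: proj_res R "filt_quot R I s (Suc (Suc s))" "P s" by (rule P_res)
  interpret K': res R "gr R I (Suc s)" "K (Suc s)" by (rule K_res)
  let ?F = "filt_quot R I s (Suc (Suc s))"
  let ?I1 = "ideal_pow R I (Suc s)" and ?I2 = "ideal_pow R I (Suc (Suc s))"
  let ?\<alpha> = "compare s"
  let ?w = "\<lambda>k x. ?\<alpha> k (v s k x)"
  note [simp del] = ideal_pow.simps of_nat_Suc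
  interpret F: module R ?F by (rule P_module)
  note cl = const_koszul_lin[of n r, OF r]
  have wl: "?w k \<in> lin_hom R (obj (P s) k) (koszul_comp R n s k)" for k
    using lin_hom_comp[OF v_lin chain_liftD(1)[OF compare_lift]] by simp
  have wb: "?w k x \<in> bideg R n s k" if "x \<in> carrier (obj (P s) k)" for k x
    using lin_homD(1)[OF wl that] by (simp add: koszul_comp_simps(1))
  have wd: "const_koszul R n r (?w (int (Suc j)) x) = ?w (int j) (diff (P s) (int (Suc j)) x)"
    if x: "x \<in> carrier (obj (P s) (int (Suc j)))" for j x
    using chain_liftD_Suc[OF compare_lift lin_homD(1)[OF v_lin x]] chain_liftD_Suc[OF v_lift x] by simp
  have wu: "?w k (u s k x) = (\<lambda>J m. \<zero>)" if x: "x \<in> carrier (obj (Q (Suc s)) k)" for k x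
    using v_u[OF x] lin_hom_zero[OF Qc.obj koszul_comp_module, of "?\<alpha> k" s k n s k] chain_liftD(1)[OF compare_lift, of s k]
    by (simp add: koszul_comp_simps(2))
  have zero_sym: "sym_koszul R n (\<lambda>J m. \<zero>) = (\<lambda>J m. \<zero>)"
    using lin_hom_zero[OF koszul_comp_module koszul_comp_module sym_koszul_lin] by (simp add: koszul_comp_simps(2))
  \<comment> \<open>the augmentations of the two summands, with values in \<open>I\<^sup>s/I\<^sup>s\<^sup>+\<^sup>2\<close>\<close>
  let ?a0 = "\<lambda>x. ?I2 +>\<^bsub>R\<^esub> sym_eval R n r s (x {})"
  let ?a1 = "\<lambda>x. ?I2 +>\<^bsub>R\<^esub> sym_eval R n r (Suc s) (x {})"
  have a0: "?a0 \<in> lin_hom R (koszul_comp R n s 0) ?F"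
    using lin_hom_comp[OF sym_eval_lin filt_proj_lin, of s "Suc (Suc s)"] by simp
  have a1: "?a1 \<in> lin_hom R (koszul_comp R n (Suc s) 0) ?F"
  proof -
    have inc: "(\<lambda>a. a) \<in> lin_hom R (pow_module (Suc s)) (pow_module s)"
      using ideal_pow_Suc_subset[of s] by (auto intro!: lin_homI)
    show ?thesis
      using lin_hom_comp[OF lin_hom_comp[OF sym_eval_lin[of "Suc s"] inc] filt_proj_lin[of s "Suc (Suc s)"]] by simp
  qed
  \<comment> \<open>What the component in polynomial degree \<open>s\<close> leaves of the
    augmentation of \<open>P s\<close>. Both terms have the same image in
    \<open>I^s/I^(s+1)\<close>, so the difference lies in \<open>I^(s+1)/I^(s+2)\<close> and is the
    value of a form of degree \<open>s + 1\<close>.\<close>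
  let ?f = "\<lambda>x. aug (P s) x \<ominus>\<^bsub>?F\<^esub> ?a0 (?w 0 x)"
  have f: "?f \<in> lin_hom R (obj (P s) 0) ?F"
    by (rule lin_hom_diff[OF P_module P.aug lin_hom_comp[OF wl[of 0] a0] Pc.obj])
  have im: "?f x \<in> ?a1 ` carrier (koszul_comp R n (Suc s) 0)" if x: "x \<in> carrier (obj (P s) 0)" for x
  proof -
    have fx: "?f x \<in> carrier ?F" using lin_homD(1)[OF f x] .
    have ax: "aug (P s) x \<in> carrier ?F" using lin_homD(1)[OF P.aug x] .
    have a0x: "?a0 (?w 0 x) \<in> carrier ?F" using lin_homD(1)[OF a0 lin_homD(1)[OF wl x]] .
    obtain b where b: "b \<in> ideal_pow R I s" "?f x = ?I2 +>\<^bsub>R\<^esub> b" using fx by (auto simp: filt_carrier)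
    have bR: "b \<in> carrier R" using ideal.Icarr[OF ideal_pow_ideal b(1)] .
    let ?e = "sym_eval R n r s (?w 0 x {})"
    have e: "?e \<in> ideal_pow R I s" "?e \<in> carrier R"
      using sym_eval_mem sym_eval_closed bidegD(1)[OF wb[OF x]] by auto
    have "aug (P s) x = ?f x \<oplus>\<^bsub>?F\<^esub> ?a0 (?w 0 x)" using ax a0x by (simp add: a_minus_def F.a_assoc F.l_neg)
    also have "\<dots> = ?I2 +>\<^bsub>R\<^esub> (b \<oplus> ?e)"
      unfolding b(2) using lin_homD(2)[OF filt_proj_lin[of s "Suc (Suc s)"], of b ?e] b(1) e(1) by simp
    finally have "gr_proj R I s (aug (P s) x) = ?I1 +>\<^bsub>R\<^esub> (b \<oplus> ?e)" using gr_proj_coset bR e(2) by simp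
    moreover have "gr_proj R I s (aug (P s) x) = ?I1 +>\<^bsub>R\<^esub> ?e"
      using chain_liftD(3)[OF v_lift x] chain_liftD(3)[OF compare_lift lin_homD(1)[OF v_lin x]] by simp
    ultimately have "(b \<oplus> ?e) \<ominus> ?e \<in> ?I1"
      using quotient_by_ideal.coset_eq_iff[OF quotient_by_pow, of "b \<oplus> ?e" ?e "Suc s"] bR e(2) by simp
    moreover have "(b \<oplus> ?e) \<ominus> ?e = b" using bR e(2) by (simp add: a_minus_def R.a_assoc R.r_neg)
    ultimately obtain z where "z \<in> bideg R n (Suc s) 0" "sym_eval R n r (Suc s) (z {}) = b"
      using sym_eval_surj[of b "Suc s"] by auto
    then show ?thesis using b(2) by (auto simp: koszul_comp_simps(1))
  qed
  obtain \<gamma>0 where \<gamma>0: "\<gamma>0 \<in> lin_hom R (obj (P s) 0) (koszul_comp R n (Suc s) 0)"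
    "\<And>x. x \<in> carrier (obj (P s) 0) \<Longrightarrow> ?a1 (\<gamma>0 x) = ?f x"
    by (rule projective_lift[OF P.projective koszul_comp_module P_module a1 f]) (use im in blast)+
  \<comment> \<open>With this choice the recursion reads
    \<open>const_koszul \<gamma> + sym_koszul w = \<gamma> d\<close>, with \<open>w\<close> standing
    for \<open>?w\<close>. This is the component in polynomial degree \<open>s + 1\<close> of the
    condition on a chain map into the twisted complex.\<close>
  let ?c = "\<lambda>k x. \<ominus>\<^bsub>koszul_comp R n (Suc s) (int k)\<^esub> sym_koszul R n (?w (int (Suc k)) x)"
  have sl: "sym_koszul R n \<in> lin_hom R (koszul_comp R n s (int (Suc k))) (koszul_comp R n (Suc s) (int k))" for k
    using sym_koszul_lin[of n s "int (Suc k)"] by (simp add: of_nat_Suc)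
  have dl: "const_koszul R n r \<in> lin_hom R (koszul_comp R n t (int (Suc k))) (koszul_comp R n t (int k))" for k t
    using cl[of t "int (Suc k)"] by (simp add: of_nat_Suc)
  have c: "?c k \<in> lin_hom R (obj (P s) (int (Suc k))) (koszul_comp R n (Suc s) (int k))" for k
    by (rule lin_hom_neg[OF koszul_comp_module lin_hom_comp[OF wl sl]])
  obtain \<gamma> where \<gamma>: "\<gamma> 0 = \<gamma>0" "\<And>k. \<gamma> k \<in> lin_hom R (obj (P s) (int k)) (koszul_comp R n (Suc s) (int k))"
    "\<And>k x. x \<in> carrier (obj (P s) (int (Suc k))) \<Longrightarrow>
      const_koszul R n r (\<gamma> (Suc k) x) = ?c k x \<oplus>\<^bsub>koszul_comp R n (Suc s) (int k)\<^esub> \<gamma> k (diff (P s) (int (Suc k)) x)"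
  proof (rule twisted_extension[where P = "\<lambda>k. obj (P s) (int k)" and Y = "\<lambda>k. koszul_comp R n (Suc s) (int k)"
        and d = "\<lambda>k. const_koszul R n r" and D = "\<lambda>k. diff (P s) (int (Suc k))" and start = \<gamma>0 and c = ?c])
    fix k y assume "y \<in> carrier (koszul_comp R n (Suc s) (int (Suc k)))"
      "const_koszul R n r y = \<zero>\<^bsub>koszul_comp R n (Suc s) (int k)\<^esub>"
    then show "y \<in> const_koszul R n r ` carrier (koszul_comp R n (Suc s) (int (Suc (Suc k))))"
      using K'.exact_Suc[of y k] by simp
  next
    fix k x assume x: "x \<in> carrier (obj (P s) (int (Suc (Suc k))))"
    note dx = lin_homD(1)[OF P.diff_Suc x]
    have w: "?w (int (Suc (Suc k))) x \<in> bideg R n s (int (Suc (Suc k)))" by (rule wb[OF x])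
    have sw: "sym_koszul R n (?w (int (Suc (Suc k))) x) \<in> carrier (koszul_comp R n (Suc s) (int (Suc k)))"
      using lin_homD(1)[OF sl] w by (simp add: koszul_comp_simps(1))
    have scw: "sym_koszul R n (const_koszul R n r (?w (int (Suc (Suc k))) x)) \<in> bideg R n (Suc s) (int k)"
      using lin_homD(1)[OF sl lin_homD(1)[OF dl], of "?w (int (Suc (Suc k))) x" k] w by (simp add: koszul_comp_simps(1))
    have "const_koszul R n r (?c (Suc k) x) =
        \<ominus>\<^bsub>koszul_comp R n (Suc s) (int k)\<^esub> const_koszul R n r (sym_koszul R n (?w (int (Suc (Suc k))) x))"
      by (rule lin_hom_uminus[OF koszul_comp_module koszul_comp_module dl sw])
    also have "const_koszul R n r (sym_koszul R n (?w (int (Suc (Suc k))) x)) =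
        \<ominus>\<^bsub>koszul_comp R n (Suc s) (int k)\<^esub> sym_koszul R n (const_koszul R n r (?w (int (Suc (Suc k))) x))"
      unfolding koszul_comp_uminus[OF scw] by (rule const_sym_koszul[OF r w])
    also have "const_koszul R n r (?w (int (Suc (Suc k))) x) = ?w (int (Suc k)) (diff (P s) (int (Suc (Suc k))) x)"
      by (rule wd[OF x])
    finally show "const_koszul R n r (?c (Suc k) x) =
        \<ominus>\<^bsub>koszul_comp R n (Suc s) (int k)\<^esub> ?c k (diff (P s) (int (Suc (Suc k))) x)" .
  next
    fix x assume x0: "x \<in> carrier (obj (P s) (int (Suc 0)))"
    then have x: "x \<in> carrier (obj (P s) 1)" by (simp add: of_nat_Suc)
    note dx = lin_homD(1)[OF P.diff_one x]
    have w: "?w 1 x \<in> bideg R n s 1" by (rule wb[OF x])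
    have sw: "sym_koszul R n (?w 1 x) \<in> carrier (koszul_comp R n (Suc s) 0)"
      using sym_koszul_bideg[OF w] by (simp add: koszul_comp_simps(1))
    have cw: "const_koszul R n r (?w 1 x) \<in> carrier (koszul_comp R n s 0)"
      using const_koszul_bideg[of n r, OF r w] by (simp add: koszul_comp_simps(1))
    interpret K0: module R "koszul_comp R n (Suc s) 0" by (rule koszul_comp_module)
    \<comment> \<open>The two summands of the base case have opposite values under
      \<open>?a1\<close>: the minus signs in \<open>?c\<close> and in \<open>sym_eval_koszul\<close>
      cancel and give \<open>?X\<close>, whereas \<open>?f\<close> contributes the negative of
      \<open>?X\<close>. Their sum is in the kernel of the augmentation of \<open>K (Suc s)\<close>,
      hence a boundary.\<close>
    let ?E = "sym_eval R n r s (const_koszul R n r (?w 1 x) {})"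
    let ?X = "?I2 +>\<^bsub>R\<^esub> ?E"
    have E: "?E \<in> ideal_pow R I s" "?E \<in> carrier R"
      using sym_eval_mem sym_eval_closed bidegD(1)[OF const_koszul_bideg[of n r, OF r w]] by auto
    have X: "?X \<in> carrier ?F" using E(1) by (auto simp: filt_carrier)
    have nE: "\<ominus> ?E \<in> ideal_pow R I s" using additive_subgroup.a_inv_closed[OF ideal.axioms(1)[OF ideal_pow_ideal] E(1)] .
    have nX: "?I2 +>\<^bsub>R\<^esub> \<ominus> ?E = \<ominus>\<^bsub>?F\<^esub> ?X"
    proof (rule F.minus_equality[symmetric])
      show "(?I2 +>\<^bsub>R\<^esub> \<ominus> ?E) \<oplus>\<^bsub>?F\<^esub> ?X = \<zero>\<^bsub>?F\<^esub>"
        using lin_homD(2)[OF filt_proj_lin[of s "Suc (Suc s)"], of "\<ominus> ?E" ?E] E nE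
          filt_zero_iff[of \<zero> "Suc (Suc s)" "Suc (Suc s)"] ideal.axioms(1)[OF ideal_pow_ideal]
        by (simp add: R.l_neg filt_zero additive_subgroup.zero_closed)
    qed (use X nE in \<open>auto simp: filt_carrier\<close>)
    have c0: "?c 0 x = \<ominus>\<^bsub>koszul_comp R n (Suc s) 0\<^esub> sym_koszul R n (?w 1 x)" by (simp add: of_nat_Suc)
    have "?a1 (?c 0 x) = \<ominus>\<^bsub>?F\<^esub> ?a1 (sym_koszul R n (?w 1 x))"
      unfolding c0 by (rule lin_hom_uminus[OF koszul_comp_module P_module a1 sw])
    also have "\<dots> = ?X" unfolding sym_eval_koszul[OF w] nX using X by simp
    finally have ac: "?a1 (?c 0 x) = ?X" .
    have "aug (P s) (diff (P s) 1 x) = \<zero>\<^bsub>?F\<^esub>" by (rule P.aug_diff[OF x])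
    moreover have "?w 0 (diff (P s) 1 x) = const_koszul R n r (?w 1 x)" using wd[OF x0] by (simp add: of_nat_Suc)
    ultimately have ag: "?a1 (\<gamma>0 (diff (P s) 1 x)) = \<ominus>\<^bsub>?F\<^esub> ?X"
      using \<gamma>0(2)[OF dx] X by (simp add: a_minus_def)
    have ccl: "?c 0 x \<in> carrier (koszul_comp R n (Suc s) 0)" unfolding c0 using sw by simp
    have gcl: "\<gamma>0 (diff (P s) 1 x) \<in> carrier (koszul_comp R n (Suc s) 0)" using lin_homD(1)[OF \<gamma>0(1) dx] .
    let ?y = "?c 0 x \<oplus>\<^bsub>koszul_comp R n (Suc s) 0\<^esub> \<gamma>0 (diff (P s) 1 x)"
    have ycl: "?y \<in> carrier (koszul_comp R n (Suc s) 0)" using ccl gcl by (rule K0.a_closed)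
    have "?a1 ?y = \<zero>\<^bsub>?F\<^esub>" unfolding lin_homD(2)[OF a1 ccl gcl] ac ag using X by (rule F.r_neg)
    then have "aug (K (Suc s)) ?y = \<zero>\<^bsub>gr R I (Suc s)\<^esub>" by (simp add: gr_def filt_zero)
    then have "?y \<in> const_koszul R n r ` carrier (koszul_comp R n (Suc s) 1)"
      using K'.aug_exact[of ?y] ycl by simp
    then show "?c 0 x \<oplus>\<^bsub>koszul_comp R n (Suc s) (int 0)\<^esub> \<gamma>0 (diff (P s) (int (Suc 0)) x)
        \<in> const_koszul R n r ` carrier (koszul_comp R n (Suc s) (int (Suc 0)))" by (simp add: of_nat_Suc)
  next
    show "\<And>k. ?c k \<in> lin_hom R (obj (P s) (int (Suc k))) (koszul_comp R n (Suc s) (int k))" by (rule c)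
  next
    show "\<gamma>0 \<in> lin_hom R (obj (P s) (int 0)) (koszul_comp R n (Suc s) (int 0))" using \<gamma>0(1) by simp
  qed (use P.projective koszul_comp_module dl P.diff_Suc P.diff_diff_Suc in simp_all)
  define \<Gamma> where "\<Gamma> k = (if k < 0 then (\<lambda>_ _ _. \<zero>) else \<gamma> (nat k))" for k :: int
  have \<Gamma>l: "\<Gamma> k \<in> lin_hom R (obj (P s) k) (koszul_comp R n (Suc s) k)" for k
  proof (cases "k < 0")
    case True
    have "(\<lambda>_. \<zero>\<^bsub>koszul_comp R n (Suc s) k\<^esub>) \<in> lin_hom R (obj (P s) k) (koszul_comp R n (Suc s) k)"
      by (rule lin_hom_const_zero[OF koszul_comp_module])
    then show ?thesis using True by (simp add: \<Gamma>_def koszul_comp_simps(2))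
  next
    case False
    then show ?thesis using \<gamma>(2)[of "nat k"] by (simp add: \<Gamma>_def)
  qed
  interpret QK: two_resolutions_base_change R "gr R I (Suc s)" "Q (Suc s)" "gr R I (Suc s)" "K (Suc s)" I by (rule QK)
  \<comment> \<open>On the image of \<open>u\<close> the component \<open>?w\<close> vanishes
    because \<open>v\<close> kills \<open>u\<close>. The off-diagonal term and \<open>?a0\<close>
    then drop out, so that \<open>\<gamma>\<close> composed with \<open>u\<close> is a chain map
    over the identity.\<close>
  have "chain_lift R (Q (Suc s)) (K (Suc s)) (\<lambda>X. X)
      (\<lambda>k. if k < 0 then (\<lambda>_. \<zero>\<^bsub>obj (K (Suc s)) k\<^esub>) else (\<lambda>x. \<gamma> (nat k) (u s (int (nat k)) x)))"
  proof (rule QK.chain_map_from_nat)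
    fix j
    show "(\<lambda>x. \<gamma> j (u s (int j) x)) \<in> lin_hom R (obj (Q (Suc s)) (int j)) (obj (K (Suc s)) (int j))"
      using lin_hom_comp[OF u_lin \<gamma>(2)] by simp
  next
    fix j x assume x: "x \<in> carrier (obj (Q (Suc s)) (int (Suc j)))"
    interpret Kj: module R "koszul_comp R n (Suc s) (int j)" by (rule koszul_comp_module)
    note ux = lin_homD(1)[OF u_lin x]
    have "?c j (u s (int (Suc j)) x) = \<zero>\<^bsub>koszul_comp R n (Suc s) (int j)\<^esub>"
      unfolding wu[OF x] zero_sym using Kj.a_inv_zero by (simp add: koszul_comp_simps(2))
    moreover have "\<gamma> j (diff (P s) (int (Suc j)) (u s (int (Suc j)) x)) \<in> carrier (koszul_comp R n (Suc s) (int j))"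
      using lin_homD(1)[OF \<gamma>(2) lin_homD(1)[OF P.diff_Suc ux]] .
    ultimately show "diff (K (Suc s)) (int (Suc j)) (\<gamma> (Suc j) (u s (int (Suc j)) x)) =
        \<gamma> j (u s (int j) (diff (Q (Suc s)) (int (Suc j)) x))"
      using \<gamma>(3)[OF ux] chain_liftD_Suc[OF u_lift x] by simp
  next
    fix x assume x: "x \<in> carrier (obj (Q (Suc s)) 0)"
    have "?a0 (\<lambda>J m. \<zero>) = \<zero>\<^bsub>?F\<^esub>"
      using lin_hom_zero[OF koszul_comp_module P_module a0] by (simp add: koszul_comp_simps(2))
    then have "?a1 (\<gamma>0 (u s 0 x)) = aug (P s) (u s 0 x) \<ominus>\<^bsub>?F\<^esub> \<zero>\<^bsub>?F\<^esub>"
      using \<gamma>0(2)[OF lin_homD(1)[OF u_lin x]] wu[OF x] by simp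
    also have "\<dots> = aug (P s) (u s 0 x)"
      using lin_homD(1)[OF P.aug lin_homD(1)[OF u_lin x]] by (simp add: a_minus_def F.a_inv_zero)
    also have "\<dots> = aug (Q (Suc s)) x" using chain_liftD(3)[OF u_lift x] by (simp add: gr_incl_def)
    finally show "aug (K (Suc s)) (\<gamma> 0 (u s (int 0) x)) = aug (Q (Suc s)) x" by (simp add: \<gamma>(1))
  qed
  moreover have "(if k < 0 then (\<lambda>_. \<zero>\<^bsub>obj (K (Suc s)) k\<^esub>) else (\<lambda>x. \<gamma> (nat k) (u s (int (nat k)) x))) =
      (\<lambda>x. \<Gamma> k (u s k x))" for k
    by (simp add: \<Gamma>_def koszul_comp_simps(2))
  ultimately have lift: "chain_lift R (Q (Suc s)) (K (Suc s)) (\<lambda>X. X) (\<lambda>k x. \<Gamma> k (u s k x))" by simp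
  \<comment> \<open>Modulo \<open>I\<close> the term \<open>const_koszul \<gamma>\<close> disappears
    from the recursion, which leaves this equation. For \<open>k \<le> 0\<close> both sides are
    zero, being in negative exterior degree.\<close>
  have "reduce R I (\<Gamma> (k - 1) (diff (P s) k x)) = reduce R I (sym_koszul R n (?w k x))"
    if x: "x \<in> carrier (obj (P s) k)" for k x
  proof (cases "k > 0")
    case False
    then have "\<Gamma> (k - 1) (diff (P s) k x) = (\<lambda>J m. \<zero>)" by (simp add: \<Gamma>_def)
    moreover have "sym_koszul R n (?w k x) = (\<lambda>J m. \<zero>)"
      using sym_koszul_bideg[OF wb[OF x]] bideg_negative[of "k - 1" "Suc s"] False by auto
    ultimately show ?thesis by simp
  next
    case True
    then obtain j where j: "k = int (Suc j)" by (metis zero_less_imp_eq_int gr0_implies_Suc)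
    have xj: "x \<in> carrier (obj (P s) (int (Suc j)))" using x j by simp
    let ?s = "sym_koszul R n (?w (int (Suc j)) x)" and ?g = "\<gamma> j (diff (P s) (int (Suc j)) x)"
    have sb: "?s \<in> bideg R n (Suc s) (int j)"
      using lin_homD(1)[OF sl] wb[OF xj] by (simp add: koszul_comp_simps(1))
    have gb: "?g \<in> bideg R n (Suc s) (int j)"
      using lin_homD(1)[OF \<gamma>(2) lin_homD(1)[OF P.diff_Suc xj]] by (simp add: koszul_comp_simps(1))
    have d: "const_koszul R n r (\<gamma> (Suc j) x) = (\<lambda>J m. \<ominus> ?s J m \<oplus> ?g J m)"
      using \<gamma>(3)[OF xj] by (simp add: koszul_comp_simps(3) koszul_comp_uminus[OF sb])
    have "?g J m = const_koszul R n r (\<gamma> (Suc j) x) J m \<oplus> ?s J m" for J m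
    proof -
      have "(\<ominus> a \<oplus> b) \<oplus> a = b" if "a \<in> carrier R" "b \<in> carrier R" for a b
        using that R.a_comm[of "\<ominus> a" b] by (simp add: R.a_assoc R.l_neg)
      then show ?thesis unfolding d using bidegD(1)[OF sb, of J m] bidegD(1)[OF gb, of J m] by simp
    qed
    then have e: "?g = (\<lambda>J m. const_koszul R n r (\<gamma> (Suc j) x) J m \<oplus> ?s J m)" by blast
    have gs: "\<gamma> (Suc j) x \<in> bideg R n (Suc s) (int (Suc j))"
      using lin_homD(1)[OF \<gamma>(2) xj] by (simp add: koszul_comp_simps(1))
    have "reduce R I ?g = reduce R I (\<lambda>J m. const_koszul R n r (\<gamma> (Suc j) x) J m \<oplus> ?s J m)"
      using e by (rule arg_cong)
    also have "\<dots> = reduce R I ?s" by (rule reduce_add_ideal[OF sb boundary_coefficients[OF gs]])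
    finally have "reduce R I ?g = reduce R I ?s" .
    moreover have "\<Gamma> (k - 1) = \<gamma> j" using j by (simp add: \<Gamma>_def of_nat_Suc)
    ultimately show ?thesis using j by simp
  qed
  then show thesis using that[of \<Gamma>] \<Gamma>l lift by blast
qed

end

section \<open>Values and exactness of the connecting homomorphism\<close>

context koszul_connecting
begin

abbreviation connecting where
  "connecting s \<equiv> tor_connecting R I (Q (Suc s)) (P s) (Q s) (u s) (v s)"

lemma tor_chain_map_u: "x \<in> carrier (obj (Q (Suc s)) k) \<Longrightarrow>
    tor_chain_map R I (Q (Suc s)) (P s) (u s) k (one_tensor R I (obj (Q (Suc s)) k) x) =
    one_tensor R I (obj (P s) k) (u s k x)"
  unfolding tor_chain_map_def by (rule base_change_map_one[OF Qc.obj Pc.obj u_lin])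

lemma tor_chain_map_v: "x \<in> carrier (obj (P s) k) \<Longrightarrow>
    tor_chain_map R I (P s) (Q s) (v s) k (one_tensor R I (obj (P s) k) x) =
    one_tensor R I (obj (Q s) k) (v s k x)"
  unfolding tor_chain_map_def by (rule base_change_map_one[OF Pc.obj Qc.obj v_lin])

lemma uv_split:
  obtains p q where "p \<in> lin_hom R (obj (P s) k) (obj (Q (Suc s)) k)" "q \<in> lin_hom R (obj (Q s) k) (obj (P s) k)"
    "\<And>x. x \<in> carrier (obj (Q (Suc s)) k) \<Longrightarrow> p (u s k x) = x"
    "\<And>y. y \<in> carrier (obj (P s) k) \<Longrightarrow> y = u s k (p y) \<oplus>\<^bsub>obj (P s) k\<^esub> q (v s k y)"
proof -
  interpret Qs: proj_res R "gr R I s" "Q s" by (rule Q_res)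
  show thesis
    by (rule split_exact[OF R.is_cring Qc.obj Pc.obj Qc.obj Qs.projective u_lin v_lin u_inj u_image v_surj])
      (rule that)
qed

text \<open>The retraction \<open>p\<close>, available because \<open>Q s\<close> is projective in
  each degree, keeps \<open>u\<close> injective after tensoring.\<close>

lemma one_tensor_u_inj:
  assumes x: "x \<in> carrier (obj (Q (Suc s)) k)"
    and z: "one_tensor R I (obj (P s) k) (u s k x) = \<zero>\<^bsub>tensor R B (obj (P s) k)\<^esub>"
  shows "one_tensor R I (obj (Q (Suc s)) k) x = \<zero>\<^bsub>tensor R B (obj (Q (Suc s)) k)\<^esub>"
proof -
  obtain p q where p: "p \<in> lin_hom R (obj (P s) k) (obj (Q (Suc s)) k)"
    "\<And>x. x \<in> carrier (obj (Q (Suc s)) k) \<Longrightarrow> p (u s k x) = x"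
    by (rule uv_split[where s = s and k = k]) blast
  show ?thesis
    using one_tensor_map_zero[OF Pc.obj Qc.obj p(1) lin_homD(1)[OF u_lin x] z] p(2)[OF x] by simp
qed

text \<open>Over \<open>R/I\<close> the map \<open>u\<close> sends the boundary of \<open>x\<close>
  to that of \<open>diff (P s) k y\<close>, which is zero, and \<open>u\<close> is injective
  there.\<close>

lemma connecting_cycle:
  assumes y: "y \<in> carrier (obj (P s) k)" and x: "x \<in> carrier (obj (Q (Suc s)) (k - 1))"
    and e: "one_tensor R I (obj (P s) (k - 1)) (u s (k - 1) x) =
      one_tensor R I (obj (P s) (k - 1)) (diff (P s) k y)"
  shows "tor_cycle R I (Q (Suc s)) (k - 1) x"
proof -
  have dx: "diff (Q (Suc s)) (k - 1) x \<in> carrier (obj (Q (Suc s)) (k - 1 - 1))"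
    using lin_homD(1)[OF Qc.diff x] .
  have "one_tensor R I (obj (P s) (k - 1 - 1)) (diff (P s) (k - 1) (u s (k - 1) x)) =
      one_tensor R I (obj (P s) (k - 1 - 1)) (diff (P s) (k - 1) (diff (P s) k y))"
    by (rule one_tensor_map_eq[OF Pc.obj Pc.obj Pc.diff lin_homD(1)[OF u_lin x] lin_homD(1)[OF Pc.diff y] e])
  also have "\<dots> = \<zero>\<^bsub>tensor R B (obj (P s) (k - 1 - 1))\<^esub>"
    unfolding Pc.diff_diff[OF y] by (rule Pc.ot_zero)
  finally have "one_tensor R I (obj (P s) (k - 1 - 1)) (u s (k - 1 - 1) (diff (Q (Suc s)) (k - 1) x)) =
      \<zero>\<^bsub>tensor R B (obj (P s) (k - 1 - 1))\<^esub>"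
    unfolding chain_liftD(2)[OF u_lift x] .
  from one_tensor_u_inj[OF dx this] show ?thesis using x unfolding tor_cycle_def by blast
qed

text \<open>Apply \<open>\<Gamma>\<close> to the relation between \<open>u x\<close> and
  \<open>d y\<close> over \<open>R/I\<close>. On the left \<open>\<Gamma> u\<close> is a lift of the
  identity and computes \<open>tor_koszul\<close> of the class of \<open>x\<close>; on the right
  \<open>\<Gamma> d\<close> reduces to \<open>sym_koszul\<close> of \<open>compare (v y)\<close>.
  The choices of \<open>y\<close> and \<open>x\<close> are arbitrary.\<close>

lemma connecting_value:
  assumes y: "y \<in> carrier (obj (P s) k)" and x: "x \<in> carrier (obj (Q (Suc s)) (k - 1))"
    and e: "one_tensor R I (obj (P s) (k - 1)) (u s (k - 1) x) =
      one_tensor R I (obj (P s) (k - 1)) (diff (P s) k y)"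
    and c: "tor_cycle R I (Q s) k (v s k y)"
  shows "tor_koszul (Suc s) (k - 1) (tor_class R I (Q (Suc s)) (k - 1) x) =
    sym_koszul S n (tor_koszul s k (tor_class R I (Q s) k (v s k y)))"
proof -
  obtain \<Gamma> where g: "\<And>k. \<Gamma> k \<in> lin_hom R (obj (P s) k) (koszul_comp R n (Suc s) k)"
    "chain_lift R (Q (Suc s)) (K (Suc s)) (\<lambda>X. X) (\<lambda>k x. \<Gamma> k (u s k x))"
    "\<And>k x. x \<in> carrier (obj (P s) k) \<Longrightarrow>
      reduce R I (\<Gamma> (k - 1) (diff (P s) k x)) = reduce R I (sym_koszul R n (compare s k (v s k x)))"
    using connecting_lift by blast
  have ux: "u s (k - 1) x \<in> carrier (obj (P s) (k - 1))" using lin_homD(1)[OF u_lin x] .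
  have dy: "diff (P s) k y \<in> carrier (obj (P s) (k - 1))" using lin_homD(1)[OF Pc.diff y] .
  have b: "\<Gamma> (k - 1) z \<in> bideg R n (Suc s) (k - 1)" if "z \<in> carrier (obj (P s) (k - 1))" for z
    using lin_homD(1)[OF g(1) that] by (simp add: koszul_comp_simps(1))
  have "tor_koszul (Suc s) (k - 1) (tor_class R I (Q (Suc s)) (k - 1) x) = reduce R I (\<Gamma> (k - 1) (u s (k - 1) x))"
    by (rule tor_koszul_class[OF g(2) connecting_cycle[OF y x e]])
  also have "\<dots> = reduce R I (\<Gamma> (k - 1) (diff (P s) k y))"
    using one_tensor_map_eq[OF Pc.obj koszul_comp_module g(1) ux dy e]
    unfolding one_tensor_koszul_eq_iff[OF b[OF ux] b[OF dy]] .
  also have "\<dots> = reduce R I (sym_koszul R n (compare s k (v s k y)))" by (rule g(3)[OF y])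
  also have "\<dots> = sym_koszul S n (reduce R I (compare s k (v s k y)))"
    by (rule reduce_sym_koszul[OF compare_bideg[OF c]])
  finally show ?thesis unfolding tor_koszul_compare[OF c] .
qed

text \<open>All admissible values \<open>Y\<close> have the same image under the injective map
  \<open>tor_koszul\<close>, which gives the uniqueness behind \<open>THE\<close> without comparing
  two choices of lifts. Existence comes from the splitting in each degree.\<close>

lemma connecting_properties:
  assumes t: "t \<in> carrier (Tor R I (Q s) k)"
  shows "connecting s k t \<in> carrier (Tor R I (Q (Suc s)) (k - 1))"
    and "tor_koszul (Suc s) (k - 1) (connecting s k t) = sym_koszul S n (tor_koszul s k t)"
proof -
  let ?R = "\<lambda>z w y Y. z \<in> t \<and> w \<in> carrier (obj (tor_complex R I (P s)) k) \<and>
    y \<in> carrier (obj (tor_complex R I (Q (Suc s))) (k - 1)) \<and>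
    tor_chain_map R I (P s) (Q s) (v s) k w = z \<and>
    tor_chain_map R I (Q (Suc s)) (P s) (u s) (k - 1) y = diff (tor_complex R I (P s)) k w \<and>
    Y = homology_class (tor_complex R I (Q (Suc s))) (k - 1) y"
  have val: "Y \<in> carrier (Tor R I (Q (Suc s)) (k - 1)) \<and>
      tor_koszul (Suc s) (k - 1) Y = sym_koszul S n (tor_koszul s k t)" if R: "?R z w y Y" for z w y Y
  proof -
    obtain b where b: "b \<in> carrier (obj (P s) k)" "w = one_tensor R I (obj (P s) k) b"
      using Pc.ot_surj R by blast
    obtain a where a: "a \<in> carrier (obj (Q (Suc s)) (k - 1))" "y = one_tensor R I (obj (Q (Suc s)) (k - 1)) a"
      using Qc.ot_surj R by blast
    have e: "one_tensor R I (obj (P s) (k - 1)) (u s (k - 1) a) =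
        one_tensor R I (obj (P s) (k - 1)) (diff (P s) k b)"
      using R Pc.T_diff_ot[OF b(1)] tor_chain_map_u[OF a(1)] a(2) b(2) by simp
    obtain x0 where x0: "tor_cycle R I (Q s) k x0" "t = tor_class R I (Q s) k x0" using t by (rule Qc.Tor_cases)
    have vb: "v s k b \<in> carrier (obj (Q s) k)" using lin_homD(1)[OF v_lin b(1)] .
    have z: "z = one_tensor R I (obj (Q s) k) (v s k b)" using R b tor_chain_map_v[OF b(1)] by simp
    have x0c: "one_tensor R I (obj (Q s) k) x0 \<in> cycles (tor_complex R I (Q s)) k"
      using x0(1) Qc.tor_cycle_ot Qc.tor_cycle_closed by blast
    have "z \<in> homology_class (tor_complex R I (Q s)) k (one_tensor R I (obj (Q s) k) x0)"
      using R x0(2) by (simp add: tor_class_def)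
    from Qc.T.homology_class_cycle[OF this x0c]
    have zc: "z \<in> cycles (tor_complex R I (Q s)) k" "homology_class (tor_complex R I (Q s)) k z = t"
      using x0(2) by (auto simp: tor_class_def)
    have c: "tor_cycle R I (Q s) k (v s k b)" using zc(1) Qc.tor_cycle_ot[OF vb] z by simp
    have tc: "tor_class R I (Q s) k (v s k b) = t" using zc(2) z by (simp add: tor_class_def)
    have Y: "Y = tor_class R I (Q (Suc s)) (k - 1) a" using R a(2) by (simp add: tor_class_def)
    show ?thesis
      unfolding Y using connecting_value[OF b(1) a(1) e c] tc
        Qc.tor_class_closed[OF connecting_cycle[OF b(1) a(1) e]] by simp
  qed
  have "\<exists>z w y Y. ?R z w y Y"
  proof -
    obtain x where x: "tor_cycle R I (Q s) k x" "t = tor_class R I (Q s) k x" using t by (rule Qc.Tor_cases)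
    note xc = Qc.tor_cycle_closed[OF x(1)]
    obtain b where b: "b \<in> carrier (obj (P s) k)" "v s k b = x" using v_surj[of s k] xc by (metis image_iff)
    have db: "diff (P s) k b \<in> carrier (obj (P s) (k - 1))" using lin_homD(1)[OF Pc.diff b(1)] .
    obtain p q where p: "p \<in> lin_hom R (obj (P s) (k - 1)) (obj (Q (Suc s)) (k - 1))"
      and q: "q \<in> lin_hom R (obj (Q s) (k - 1)) (obj (P s) (k - 1))"
      and pq: "\<And>y. y \<in> carrier (obj (P s) (k - 1)) \<Longrightarrow>
        y = u s (k - 1) (p y) \<oplus>\<^bsub>obj (P s) (k - 1)\<^esub> q (v s (k - 1) y)"
      by (rule uv_split[where s = s and k = "k - 1"]) blast
    \<comment> \<open>The splitting writes \<open>d b\<close> as \<open>u ?a\<close> plus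
      \<open>q (v (d b))\<close>. Here \<open>v (d b)\<close> is the boundary of \<open>x\<close>,
      which vanishes over \<open>R/I\<close> because \<open>x\<close> represents a cycle, so
      \<open>?a\<close> is the required lift after tensoring.\<close>
    let ?a = "p (diff (P s) k b)"
    have a: "?a \<in> carrier (obj (Q (Suc s)) (k - 1))" using lin_homD(1)[OF p db] .
    have vd: "v s (k - 1) (diff (P s) k b) = diff (Q s) k x"
      using chain_liftD(2)[OF v_lift b(1)] b(2) by simp
    have dx: "diff (Q s) k x \<in> carrier (obj (Q s) (k - 1))" using lin_homD(1)[OF Qc.diff xc] .
    have "one_tensor R I (obj (P s) (k - 1)) (q (diff (Q s) k x)) = \<zero>\<^bsub>tensor R B (obj (P s) (k - 1))\<^esub>"
      by (rule one_tensor_map_zero[OF Qc.obj Pc.obj q dx]) (use x(1) in \<open>simp add: tor_cycle_def\<close>)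
    moreover have "one_tensor R I (obj (P s) (k - 1)) (diff (P s) k b) =
        one_tensor R I (obj (P s) (k - 1)) (u s (k - 1) ?a) \<oplus>\<^bsub>obj (tor_complex R I (P s)) (k - 1)\<^esub>
        one_tensor R I (obj (P s) (k - 1)) (q (diff (Q s) k x))"
      using pq[OF db] Pc.ot_add[OF lin_homD(1)[OF u_lin a] lin_homD(1)[OF q dx]] vd by simp
    ultimately have e: "one_tensor R I (obj (P s) (k - 1)) (diff (P s) k b) =
        one_tensor R I (obj (P s) (k - 1)) (u s (k - 1) ?a)"
    proof -
      interpret TP: module R "obj (tor_complex R I (P s)) (k - 1)" by (rule Pc.T.obj)
      assume "one_tensor R I (obj (P s) (k - 1)) (q (diff (Q s) k x)) = \<zero>\<^bsub>tensor R B (obj (P s) (k - 1))\<^esub>"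
        and "one_tensor R I (obj (P s) (k - 1)) (diff (P s) k b) =
          one_tensor R I (obj (P s) (k - 1)) (u s (k - 1) ?a) \<oplus>\<^bsub>obj (tor_complex R I (P s)) (k - 1)\<^esub>
          one_tensor R I (obj (P s) (k - 1)) (q (diff (Q s) k x))"
      then show ?thesis
        using Pc.ot_closed[OF lin_homD(1)[OF u_lin a]] TP.r_zero by (simp add: tor_complex_simps)
    qed
    let ?w = "one_tensor R I (obj (P s) k) b" and ?y = "one_tensor R I (obj (Q (Suc s)) (k - 1)) ?a"
    have "?R (one_tensor R I (obj (Q s) k) x) ?w ?y (homology_class (tor_complex R I (Q (Suc s))) (k - 1) ?y)"
    proof (intro conjI refl)
      show "one_tensor R I (obj (Q s) k) x \<in> t"
        unfolding x(2) tor_class_def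
        by (rule Qc.T.homology_class_self) (use x(1) xc Qc.tor_cycle_ot in blast)
      show "?w \<in> carrier (obj (tor_complex R I (P s)) k)" by (rule Pc.ot_closed[OF b(1)])
      show "?y \<in> carrier (obj (tor_complex R I (Q (Suc s))) (k - 1))" by (rule Qc.ot_closed[OF a])
      show "tor_chain_map R I (P s) (Q s) (v s) k ?w = one_tensor R I (obj (Q s) k) x"
        using tor_chain_map_v[OF b(1)] b(2) by simp
      show "tor_chain_map R I (Q (Suc s)) (P s) (u s) (k - 1) ?y = diff (tor_complex R I (P s)) k ?w"
        using tor_chain_map_u[OF a] Pc.T_diff_ot[OF b(1)] e by simp
    qed
    then show ?thesis by blast
  qed
  then obtain z w y Y where R: "?R z w y Y" by blast
  have "connecting s k t = Y"
    unfolding tor_connecting_def connecting_hom_def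
  proof (rule the_equality)
    show "\<exists>z\<in>t. \<exists>w\<in>carrier (obj (tor_complex R I (P s)) k). \<exists>y\<in>carrier (obj (tor_complex R I (Q (Suc s))) (k - 1)).
        tor_chain_map R I (P s) (Q s) (v s) k w = z \<and>
        tor_chain_map R I (Q (Suc s)) (P s) (u s) (k - 1) y = diff (tor_complex R I (P s)) k w \<and>
        Y = homology_class (tor_complex R I (Q (Suc s))) (k - 1) y"
      using R by blast
  next
    fix Y' assume "\<exists>z\<in>t. \<exists>w\<in>carrier (obj (tor_complex R I (P s)) k). \<exists>y\<in>carrier (obj (tor_complex R I (Q (Suc s))) (k - 1)).
        tor_chain_map R I (P s) (Q s) (v s) k w = z \<and>
        tor_chain_map R I (Q (Suc s)) (P s) (u s) (k - 1) y = diff (tor_complex R I (P s)) k w \<and>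
        Y' = homology_class (tor_complex R I (Q (Suc s))) (k - 1) y"
    then obtain z' w' y' where R': "?R z' w' y' Y'" by blast
    have "tor_koszul (Suc s) (k - 1) Y' = tor_koszul (Suc s) (k - 1) Y"
      using val[OF R] val[OF R'] by simp
    then show "Y' = Y"
      by (rule inj_onD[OF bij_betw_imp_inj_on[OF tor_koszul_bij]]) (use val[OF R] val[OF R'] in auto)
  qed
  then show "connecting s k t \<in> carrier (Tor R I (Q (Suc s)) (k - 1))"
    and "tor_koszul (Suc s) (k - 1) (connecting s k t) = sym_koszul S n (tor_koszul s k t)"
    using val[OF R] by simp_all
qed

lemma connecting_lin: "connecting s k \<in> lin_hom S (TorS R I (Q s) k) (TorS R I (Q (Suc s)) (k - 1))"
proof (rule lin_hom_transfer[OF Qc.TorS_module cring.koszul_comp_module[OF S_cring] tor_koszul_lin tor_koszul_inj])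
  fix t assume "t \<in> carrier (TorS R I (Q s) k)"
  then show "connecting s k t \<in> carrier (TorS R I (Q (Suc s)) (k - 1))"
    using connecting_properties(1) by (simp add: TorS_def)
next
  have l: "(\<lambda>t. sym_koszul S n (tor_koszul s k t)) \<in> lin_hom S (TorS R I (Q s) k) (koszul_comp S n (Suc s) (k - 1))"
    by (rule lin_hom_comp[OF tor_koszul_lin cring.sym_koszul_lin[OF S_cring]])
  interpret T: module S "TorS R I (Q s) k" by (rule Qc.TorS_module)
  have e: "tor_koszul (Suc s) (k - 1) (connecting s k t) = sym_koszul S n (tor_koszul s k t)"
    if "t \<in> carrier (TorS R I (Q s) k)" for t
    using connecting_properties(2) that by (simp add: TorS_def)
  show "(\<lambda>t. tor_koszul (Suc s) (k - 1) (connecting s k t)) \<in>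
      lin_hom S (TorS R I (Q s) k) (koszul_comp S n (Suc s) (k - 1))"
    by (rule lin_homI) (simp_all add: e lin_homD[OF l])
qed (rule Qc.TorS_module)

lemma connecting_zero_iff:
  assumes t: "t \<in> carrier (Tor R I (Q s) k)"
  shows "connecting s k t = \<zero>\<^bsub>Tor R I (Q (Suc s)) (k - 1)\<^esub> \<longleftrightarrow>
    sym_koszul S n (tor_koszul s k t) = (\<lambda>J m. \<zero>\<^bsub>S\<^esub>)"
proof -
  have z: "tor_koszul s' k' \<zero>\<^bsub>Tor R I (Q s') k'\<^esub> = (\<lambda>J m. \<zero>\<^bsub>S\<^esub>)" for s' k'
    using lin_hom_zero[OF Qc.TorS_module cring.koszul_comp_module[OF S_cring] tor_koszul_lin, of s' k']
    by (simp add: TorS_def koszul_comp_simps(2))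
  interpret T: module R "Tor R I (Q (Suc s)) (k - 1)" by (rule Qc.Tor_module)
  have "connecting s k t = \<zero>\<^bsub>Tor R I (Q (Suc s)) (k - 1)\<^esub> \<longleftrightarrow>
      tor_koszul (Suc s) (k - 1) (connecting s k t) = tor_koszul (Suc s) (k - 1) \<zero>\<^bsub>Tor R I (Q (Suc s)) (k - 1)\<^esub>"
    by (rule inj_on_eq_iff[OF bij_betw_imp_inj_on[OF tor_koszul_bij], symmetric])
      (rule connecting_properties(1)[OF t], rule T.zero_closed)
  then show ?thesis unfolding connecting_properties(2)[OF t] z .
qed

lemma tor_koszul_zero_iff:
  assumes t: "t \<in> carrier (Tor R I (Q s) k)"
  shows "tor_koszul s k t = (\<lambda>J m. \<zero>\<^bsub>S\<^esub>) \<longleftrightarrow> t = \<zero>\<^bsub>Tor R I (Q s) k\<^esub>"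
proof -
  have z: "tor_koszul s k \<zero>\<^bsub>Tor R I (Q s) k\<^esub> = (\<lambda>J m. \<zero>\<^bsub>S\<^esub>)"
    using lin_hom_zero[OF Qc.TorS_module cring.koszul_comp_module[OF S_cring] tor_koszul_lin, of s k]
    by (simp add: TorS_def koszul_comp_simps(2))
  interpret T: module R "Tor R I (Q s) k" by (rule Qc.Tor_module)
  have "t = \<zero>\<^bsub>Tor R I (Q s) k\<^esub> \<longleftrightarrow> tor_koszul s k t = tor_koszul s k \<zero>\<^bsub>Tor R I (Q s) k\<^esub>"
    by (rule inj_on_eq_iff[OF bij_betw_imp_inj_on[OF tor_koszul_bij], symmetric])
      (rule t, rule T.zero_closed)
  then show ?thesis unfolding z by blast
qed

text \<open>The bijections \<open>tor_koszul\<close> turn the connecting maps into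
  \<open>sym_koszul\<close>, so exactness is that of the Koszul complex over \<open>S\<close>; the
  contraction there provides the preimage.\<close>

lemma connecting_kernel_Suc:
  "a_kernel (Tor R I (Q (Suc s)) k) (Tor R I (Q (Suc (Suc s))) (k - 1)) (connecting (Suc s) k) =
    connecting s (k + 1) ` carrier (Tor R I (Q s) (k + 1))"
proof
  interpret S: cring S by (rule S_cring)
  show "connecting s (k + 1) ` carrier (Tor R I (Q s) (k + 1)) \<subseteq>
      a_kernel (Tor R I (Q (Suc s)) k) (Tor R I (Q (Suc (Suc s))) (k - 1)) (connecting (Suc s) k)"
  proof
    fix y assume "y \<in> connecting s (k + 1) ` carrier (Tor R I (Q s) (k + 1))"
    then obtain t where t: "t \<in> carrier (Tor R I (Q s) (k + 1))" "y = connecting s (k + 1) t" by blast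
    have y: "y \<in> carrier (Tor R I (Q (Suc s)) k)" "tor_koszul (Suc s) k y = sym_koszul S n (tor_koszul s (k + 1) t)"
      using connecting_properties[OF t(1)] t(2) by simp_all
    have "sym_koszul S n (tor_koszul (Suc s) k y) = (\<lambda>J m. \<zero>\<^bsub>S\<^esub>)"
      unfolding y(2) by (rule S.sym_koszul_square[OF tor_koszul_closed[OF t(1)]])
    then show "y \<in> a_kernel (Tor R I (Q (Suc s)) k) (Tor R I (Q (Suc (Suc s))) (k - 1)) (connecting (Suc s) k)"
      using y(1) connecting_zero_iff[OF y(1)] by (simp add: a_kernel_def')
  qed
  show "a_kernel (Tor R I (Q (Suc s)) k) (Tor R I (Q (Suc (Suc s))) (k - 1)) (connecting (Suc s) k) \<subseteq>
      connecting s (k + 1) ` carrier (Tor R I (Q s) (k + 1))"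
  proof
    fix y assume "y \<in> a_kernel (Tor R I (Q (Suc s)) k) (Tor R I (Q (Suc (Suc s))) (k - 1)) (connecting (Suc s) k)"
    then have y: "y \<in> carrier (Tor R I (Q (Suc s)) k)" "sym_koszul S n (tor_koszul (Suc s) k y) = (\<lambda>J m. \<zero>\<^bsub>S\<^esub>)"
      using connecting_zero_iff[of y "Suc s" k] by (auto simp: a_kernel_def')
    note c = S.sym_koszul_exact[OF tor_koszul_closed[OF y(1)] y(2)]
    have "contraction S (tor_koszul (Suc s) k y) \<in> tor_koszul s (k + 1) ` carrier (Tor R I (Q s) (k + 1))"
      unfolding bij_betw_imp_surj_on[OF tor_koszul_bij] by (rule c(1))
    then obtain t where t': "contraction S (tor_koszul (Suc s) k y) = tor_koszul s (k + 1) t"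
      "t \<in> carrier (Tor R I (Q s) (k + 1))" by (rule imageE)
    note t = t'(2) t'(1)[symmetric]
    have d: "connecting s (k + 1) t \<in> carrier (Tor R I (Q (Suc s)) k)"
      "tor_koszul (Suc s) k (connecting s (k + 1) t) = tor_koszul (Suc s) k y"
      using connecting_properties[OF t(1)] t(2) c(2) by simp_all
    have "connecting s (k + 1) t = y"
      by (rule inj_onD[OF bij_betw_imp_inj_on[OF tor_koszul_bij] d(2) d(1) y(1)])
    then show "y \<in> connecting s (k + 1) ` carrier (Tor R I (Q s) (k + 1))" using t(1) by blast
  qed
qed

text \<open>In polynomial degree 0 the differential \<open>sym_koszul\<close> is injective away from
  exterior degree 0; that degree is the image of \<open>eta\<close> and is treated in
  \<open>connecting_kernel_eta\<close>.\<close>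

lemma connecting_kernel_zero:
  assumes k: "k \<noteq> 0"
  shows "a_kernel (Tor R I (Q 0) k) (Tor R I (Q (Suc 0)) (k - 1)) (connecting 0 k) = {\<zero>\<^bsub>Tor R I (Q 0) k\<^esub>}"
proof -
  interpret S: cring S by (rule S_cring)
  interpret T: module R "Tor R I (Q 0) k" by (rule Qc.Tor_module)
  have "t = \<zero>\<^bsub>Tor R I (Q 0) k\<^esub>" if t: "t \<in> carrier (Tor R I (Q 0) k)" "connecting 0 k t = \<zero>\<^bsub>Tor R I (Q (Suc 0)) (k - 1)\<^esub>" for t
    using S.sym_koszul_inj_zero[OF tor_koszul_closed[OF t(1)] _ k] connecting_zero_iff[OF t(1)]
      tor_koszul_zero_iff[OF t(1)] t(2) by simp
  moreover have "connecting 0 k \<zero>\<^bsub>Tor R I (Q 0) k\<^esub> = \<zero>\<^bsub>Tor R I (Q (Suc 0)) (k - 1)\<^esub>"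
    using lin_hom_zero[OF Qc.TorS_module Qc.TorS_module connecting_lin, of 0 k] by (simp add: TorS_def)
  ultimately show ?thesis by (auto simp: a_kernel_def')
qed

end

section \<open>The isomorphism \<open>\<psi>\<close>\<close>

text \<open>Embeds the exterior algebra as polynomial degree 0. This gives a chain map from the
  Koszul complex to \<open>K 0\<close> over the identity, which lets the factor
  \<open>tor_to_ext\<close> of \<open>psi\<close> be compared with
  \<open>tor_koszul 0\<close>.\<close>

definition degree_zero :: "('a, 'c) ring_scheme \<Rightarrow> (nat set \<Rightarrow> 'a) \<Rightarrow> nat set \<Rightarrow> nat multiset \<Rightarrow> 'a"
  where "degree_zero R z = (\<lambda>J m. if m = {#} then z J else \<zero>\<^bsub>R\<^esub>)"

lemma koszul_resolution_simps [simp]: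
  "obj (koszul_resolution R I r n) k = (ext_alg R n)\<lparr>carrier := ext_deg R n k\<rparr>"
  "diff (koszul_resolution R I r n) k = koszul_diff R n r"
  "aug (koszul_resolution R I r n) x = I +>\<^bsub>R\<^esub> x {}"
  by (simp_all add: koszul_resolution_def)

lemma (in cring) degree_zero_bideg: "z \<in> ext_deg R n k \<Longrightarrow> degree_zero R z \<in> bideg R n 0 k"
  by (auto simp: ext_deg_iff bideg_def degree_zero_def)

section \<open>The Koszul complex as a resolution of R/I\<close>

context koszul_setting
begin

lemma ext_deg_module: "module R ((ext_alg R n)\<lparr>carrier := ext_deg R n k\<rparr>)"
proof -
  have a: "(\<lambda>J. x J \<oplus> y J) \<in> ext_deg R n k" if x: "x \<in> ext_deg R n k" and y: "y \<in> ext_deg R n k" for x y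
  proof -
    have "x J \<noteq> \<zero> \<or> y J \<noteq> \<zero>" if "x J \<oplus> y J \<noteq> \<zero>" for J using that by auto
    then show ?thesis using x y unfolding ext_deg_iff by (metis R.a_closed)
  qed
  have s: "(\<lambda>J. a \<otimes> x J) \<in> ext_deg R n k" if "a \<in> carrier R" "x \<in> ext_deg R n k" for a x
  proof -
    have "x J \<noteq> \<zero>" if "a \<otimes> x J \<noteq> \<zero>" for J using that \<open>a \<in> carrier R\<close> by auto
    then show ?thesis using that unfolding ext_deg_iff by (metis R.m_closed)
  qed
  show ?thesis
    by (rule coordinate_module[OF R.is_cring, where ev = "\<lambda>J x. x J"])
      (auto simp: ext_alg_simps ext_alg_simps'(2) a s, auto simp: ext_deg_iff)
qed

lemma const_koszul_degree_zero: "const_koszul R n r (degree_zero R z) = degree_zero R (koszul_diff R n r z)"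
proof (intro ext)
  fix J m
  have "koszul_diff R n r (\<lambda>K. \<zero>) J = \<zero>"
    using r by (intro koszul_diff_zero) (simp_all add: ext_partial_zero)
  then show "const_koszul R n r (degree_zero R z) J m = degree_zero R (koszul_diff R n r z) J m"
    by (simp add: const_koszul_def degree_zero_def)
qed

lemma sym_eval_degree_zero': "z \<in> ext_deg R n k \<Longrightarrow> sym_eval R n r 0 (degree_zero R z {}) = z {}"
  by (subst sym_eval_degree_zero) (auto simp: degree_zero_def ext_deg_iff)

text \<open>In positive degrees this is \<open>koszul_exact\<close>. At the augmentation, an element
  with constant term in \<open>I\<close> is a boundary by the case \<open>s = 0\<close> of
  \<open>kernel_boundary\<close>, read off at the empty monomial.\<close>

lemma koszul_res: "res R (gr R I 0) (koszul_resolution R I r n)"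
proof -
  let ?K = "koszul_resolution R I r n"
  let ?E = "\<lambda>k. (ext_alg R n)\<lparr>carrier := ext_deg R n k\<rparr>"
  note [simp] = ideal_pow_one and [simp del] = ideal_pow.simps(2)
  have dl: "koszul_diff R n r \<in> lin_hom R (?E k) (?E (k - 1))" for k
    using koszul_diff_deg[of n r, OF r] lin_homD[OF koszul_diff_lin[of n r, OF r]] ext_deg_carrier
    by (intro lin_homI) auto
  have inc: "(\<lambda>x. x {}) \<in> lin_hom R (?E 0) (pow_module 0)"
    by (rule lin_homI) (auto simp: ext_alg_simps ext_deg_iff)
  have al: "aug ?K \<in> lin_hom R (?E 0) (gr R I 0)"
  proof -
    have "aug ?K = (\<lambda>x. I +>\<^bsub>R\<^esub> x {})" by auto
    then show ?thesis using lin_hom_comp[OF inc filt_proj_lin, of "Suc 0"] by (simp add: gr_def)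
  qed
  have iff: "aug ?K x = \<zero>\<^bsub>gr R I 0\<^esub> \<longleftrightarrow> x {} \<in> I" if "x \<in> ext_deg R n 0" for x
    using coset_zero_iff[of "x {}"] that by (simp add: gr_def filt_zero ext_deg_iff)
  have "exact_resolution R (gr R I 0) ?K"
    unfolding exact_resolution_def
  proof (intro conjI allI impI)
    fix k :: int assume "k < 0"
    then show "carrier (obj ?K k) = {\<zero>\<^bsub>obj ?K k\<^esub>}" by (auto simp: ext_deg_iff ext_alg_simps'(2))
  next
    fix k :: int assume "k > 0"
    then obtain j where k: "k = int (Suc j)" by (metis zero_less_imp_eq_int gr0_implies_Suc)
    show "cycles ?K k = boundaries ?K k"
    proof
      show "cycles ?K k \<subseteq> boundaries ?K k"
      proof
        fix x assume "x \<in> cycles ?K k"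
        then have x: "x \<in> ext_deg R n (int (Suc j))" "koszul_diff R n r x = (\<lambda>J. \<zero>)"
          using k by (simp_all add: cycles_def a_kernel_def' ext_alg_simps'(2))
        obtain y where "y \<in> ext_deg R n (int (Suc (Suc j)))" "koszul_diff R n r y = x"
          using koszul_exact[OF regular x] by blast
        moreover have "int (Suc (Suc j)) = k + 1" using k by simp
        ultimately show "x \<in> boundaries ?K k" by (auto simp: boundaries_def)
      qed
      show "boundaries ?K k \<subseteq> cycles ?K k"
      proof
        fix x assume "x \<in> boundaries ?K k"
        then obtain y where y: "y \<in> ext_deg R n (k + 1)" "x = koszul_diff R n r y"
          by (auto simp: boundaries_def)
        have "koszul_diff R n r y \<in> ext_deg R n k" using koszul_diff_deg[of n r, OF r y(1)] by simp
        then show "x \<in> cycles ?K k"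
          using y(2) koszul_diff_square[of n r, OF r ext_deg_carrier[OF y(1)]]
          by (simp add: cycles_def a_kernel_def' ext_alg_simps'(2))
      qed
    qed
  next
    show "aug ?K \<in> lin_hom R (obj ?K 0) (gr R I 0)" using al by simp
    show "aug ?K ` carrier (obj ?K 0) = carrier (gr R I 0)"
    proof
      show "aug ?K ` carrier (obj ?K 0) \<subseteq> carrier (gr R I 0)" using lin_homD(1)[OF al] by auto
      show "carrier (gr R I 0) \<subseteq> aug ?K ` carrier (obj ?K 0)"
      proof
        fix X assume "X \<in> carrier (gr R I 0)"
        then obtain a where a: "a \<in> carrier R" "X = I +>\<^bsub>R\<^esub> a" by (auto simp: gr_def filt_carrier)
        then show "X \<in> aug ?K ` carrier (obj ?K 0)"
          by (intro image_eqI[of _ _ "\<lambda>J. if J = {} then a else \<zero>"]) (auto simp: ext_deg_iff)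
      qed
    qed
    show "a_kernel (obj ?K 0) (gr R I 0) (aug ?K) = boundaries ?K 0"
    proof
      show "a_kernel (obj ?K 0) (gr R I 0) (aug ?K) \<subseteq> boundaries ?K 0"
      proof
        fix x assume "x \<in> a_kernel (obj ?K 0) (gr R I 0) (aug ?K)"
        then have x: "x \<in> ext_deg R n 0" "x {} \<in> I" using iff[of x] by (auto simp: a_kernel_def')
        have "sym_eval R n r 0 (degree_zero R x {}) \<in> ideal_pow R I (Suc 0)"
          using sym_eval_degree_zero'[OF x(1)] x(2) by simp
        from kernel_boundary[OF degree_zero_bideg[OF x(1)] this] obtain w where
          w: "w \<in> bideg R n 0 1" "const_koszul R n r w = degree_zero R x" by blast
        have "koszul_diff R n r (\<lambda>K. w K {#}) = x"
          using fun_cong[OF fun_cong[OF w(2)], of _ "{#}"] by (auto simp: const_koszul_def degree_zero_def)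
        then show "x \<in> boundaries ?K 0" using bideg_slice[OF w(1), of "{#}"] by (auto simp: boundaries_def)
      qed
      show "boundaries ?K 0 \<subseteq> a_kernel (obj ?K 0) (gr R I 0) (aug ?K)"
      proof
        fix x assume "x \<in> boundaries ?K 0"
        then obtain y where y: "y \<in> ext_deg R n 1" "x = koszul_diff R n r y" by (auto simp: boundaries_def)
        have x: "x \<in> ext_deg R n 0" using koszul_diff_deg[of n r, OF r y(1)] y(2) by simp
        have "const_koszul R n r (degree_zero R y) {} {#} \<in> I"
          by (rule boundary_coefficients[OF degree_zero_bideg[OF y(1)]])
        then have "x {} \<in> I" unfolding const_koszul_degree_zero by (simp add: degree_zero_def y(2))
        then show "x \<in> a_kernel (obj ?K 0) (gr R I 0) (aug ?K)" using x iff[OF x] by (simp add: a_kernel_def')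
      qed
    qed
  qed (use ext_deg_module dl in simp_all)
  then show ?thesis by (simp add: res_def res_axioms_def R.is_cring gr_module)
qed

lemma degree_zero_lift: "chain_lift R (koszul_resolution R I r n) (K 0) (\<lambda>X. X) (\<lambda>k. degree_zero R)"
  unfolding chain_lift_def
proof (intro conjI allI ballI)
  fix k
  show "degree_zero R \<in> lin_hom R (obj (koszul_resolution R I r n) k) (obj (K 0) k)"
  proof (rule lin_homI)
    fix x assume "x \<in> carrier (obj (koszul_resolution R I r n) k)"
    then have x: "x \<in> ext_deg R n k" by simp
    show "degree_zero R x \<in> carrier (obj (K 0) k)"
      using degree_zero_bideg[OF x] by (simp add: koszul_comp_simps(1))
    show "degree_zero R (a \<odot>\<^bsub>obj (koszul_resolution R I r n) k\<^esub> x) = a \<odot>\<^bsub>obj (K 0) k\<^esub> degree_zero R x"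
      if a: "a \<in> carrier R" for a
      using koszul_comp_smult[OF a degree_zero_bideg[OF x]] a
      by (auto simp: degree_zero_def ext_alg_simps fun_eq_iff)
  qed (simp add: degree_zero_def ext_alg_simps koszul_comp_simps(3) fun_eq_iff)
qed (auto simp: const_koszul_degree_zero sym_eval_degree_zero' ideal_pow_one simp del: ideal_pow.simps(2))

end

section \<open>The two factors of the isomorphism in coordinates\<close>

context koszul_tor
begin

text \<open>Both sides are computed with one lift \<open>F\<close> to the Koszul complex, followed
  on the right by \<open>degree_zero\<close>. On the left the homology class is a set of tensors
  that differ by boundaries; these have coefficients in \<open>I\<close>, so reduction is constant
  on the class and \<open>the_elem\<close> returns it.\<close>

lemma tor_to_ext_eq:
  assumes t: "t \<in> carrier (Tor R I (Q 0) k)"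
  shows "(\<lambda>J. sym_const S (tor_to_ext R I r n (Q 0) k t J)) = tor_koszul 0 k t"
proof -
  let ?KK = "koszul_resolution R I r n"
  let ?O = "\<lambda>k. (ext_alg R n)\<lparr>carrier := ext_deg R n k\<rparr>"
  let ?E = "ext_alg S n"
  let ?L = "restrict_scalars (\<lambda>a. I +>\<^bsub>R\<^esub> a) ?E"
  let ?red = "\<lambda>x J. I +>\<^bsub>R\<^esub> (x J :: 'a)"
  let ?b = "\<lambda>c x. c \<odot>\<^bsub>?E\<^esub> ?red x"
  interpret Sc: cring S by (rule S_cring)
  interpret QKK: two_resolutions_base_change R "gr R I 0" "Q 0" "gr R I 0" ?KK I
    by (rule two_resolutions_base_changeI[OF Q_res koszul_res])
  obtain F where F: "chain_lift R (Q 0) ?KK (\<lambda>X. X) F" using QKK.chain_lift_exists[OF lin_hom_ident] by blast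
  obtain x where x: "tor_cycle R I (Q 0) k x" "t = tor_class R I (Q 0) k x" using t by (rule Qc.Tor_cases)
  have Fx: "F k x \<in> ext_deg R n k"
    using lin_homD(1)[OF chain_liftD(1)[OF F] Qc.tor_cycle_closed[OF x(1)]] by simp
  have mL: "module R ?L"
    by (rule restrict_scalars_module[OF R.is_cring rcos_ring_hom Sc.ext_alg_module])
  have E: "module S ?E" by (rule Sc.ext_alg_module)
  have red: "?red y \<in> carrier ?E" if y: "y \<in> ext_deg R n k'" for y k'
  proof -
    have "I +>\<^bsub>R\<^esub> \<zero> = I" using coset_zero_iff[of \<zero>] by simp
    moreover have "y J \<in> carrier R" "\<not> J \<subseteq> {..<n} \<Longrightarrow> y J = \<zero>" for J
      using ext_alg_carrierD[OF ext_deg_carrier[OF y]] by auto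
    ultimately show ?thesis using coset_closed by (simp add: ext_alg_simps' S_simps(1))
  qed
  have red_lin: "?red \<in> lin_hom R (?O k) ?L"
  proof (rule lin_homI)
    fix y z assume "y \<in> carrier (?O k)" "z \<in> carrier (?O k)"
    then have "y \<in> ext_deg R n k" "z \<in> ext_deg R n k" by auto
    then have "y J \<in> carrier R" "z J \<in> carrier R" for J by (auto simp: ext_deg_iff)
    then show "?red (y \<oplus>\<^bsub>?O k\<^esub> z) = ?red y \<oplus>\<^bsub>?L\<^esub> ?red z"
      by (simp add: ext_alg_simps coset_add)
  next
    fix a y assume a: "a \<in> carrier R" and "y \<in> carrier (?O k)"
    then have "y J \<in> carrier R" for J by (auto simp: ext_deg_iff)
    then show "?red (a \<odot>\<^bsub>?O k\<^esub> y) = a \<odot>\<^bsub>?L\<^esub> ?red y"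
      using a by (simp add: ext_alg_simps coset_mult)
  qed (use red in auto)
  have bil: "bilinear_map R B (?O k) ?L ?b"
    unfolding bilinear_map_def
  proof (intro conjI ballI)
    fix y assume "y \<in> carrier (?O k)"
    then have yE: "?red y \<in> carrier ?E" using red by auto
    show "(\<lambda>c. ?b c y) \<in> lin_hom R B ?L"
    proof (rule lin_homI)
      fix c d assume "c \<in> carrier B" "d \<in> carrier B"
      then obtain a b where ab: "a \<in> carrier R" "b \<in> carrier R" "c = I +>\<^bsub>R\<^esub> a" "d = I +>\<^bsub>R\<^esub> b"
        by (auto simp: B_carrier S_carrier)
      have "c \<oplus>\<^bsub>B\<^esub> d = c \<oplus>\<^bsub>S\<^esub> d" by (simp add: quot_ring_module_def S_simps(3))
      then show "?b (c \<oplus>\<^bsub>B\<^esub> d) y = ?b c y \<oplus>\<^bsub>?L\<^esub> ?b d y"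
        using module.smult_l_distr[OF E _ _ yE, of c d] ab coset_closed by simp
    next
      fix e c assume e: "e \<in> carrier R" and "c \<in> carrier B"
      then obtain a where a: "a \<in> carrier R" "c = I +>\<^bsub>R\<^esub> a" by (auto simp: B_carrier S_carrier)
      have "e \<odot>\<^bsub>B\<^esub> c = (I +>\<^bsub>R\<^esub> e) \<otimes>\<^bsub>S\<^esub> c" using e a by (simp add: B_smult coset_mult)
      then show "?b (e \<odot>\<^bsub>B\<^esub> c) y = e \<odot>\<^bsub>?L\<^esub> ?b c y"
        using module.smult_assoc1[OF E coset_closed[OF e] _ yE, of c] a coset_closed by simp
    qed (use module.smult_closed[OF E _ yE] in \<open>simp add: B_carrier\<close>)
  next
    fix c assume "c \<in> carrier B"
    then have c: "c \<in> carrier S" by (simp add: B_carrier)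
    show "?b c \<in> lin_hom R (?O k) ?L"
    proof (rule lin_homI)
      fix y z assume y: "y \<in> carrier (?O k)" and z: "z \<in> carrier (?O k)"
      show "?b c (y \<oplus>\<^bsub>?O k\<^esub> z) = ?b c y \<oplus>\<^bsub>?L\<^esub> ?b c z"
        using lin_homD(2)[OF red_lin y z] module.smult_r_distr[OF E c] lin_homD(1)[OF red_lin y] lin_homD(1)[OF red_lin z]
        by simp
    next
      fix a y assume a: "a \<in> carrier R" and y: "y \<in> carrier (?O k)"
      have yE: "?red y \<in> carrier ?E" using lin_homD(1)[OF red_lin y] by simp
      have "?b c (a \<odot>\<^bsub>?O k\<^esub> y) = c \<odot>\<^bsub>?E\<^esub> ((I +>\<^bsub>R\<^esub> a) \<odot>\<^bsub>?E\<^esub> ?red y)"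
        using lin_homD(3)[OF red_lin a y] by simp
      also have "\<dots> = (I +>\<^bsub>R\<^esub> a) \<odot>\<^bsub>?E\<^esub> (c \<odot>\<^bsub>?E\<^esub> ?red y)"
        using module.smult_assoc1[OF E c coset_closed[OF a] yE] module.smult_assoc1[OF E coset_closed[OF a] c yE]
          Sc.m_comm[OF c coset_closed[OF a]] by simp
      finally show "?b c (a \<odot>\<^bsub>?O k\<^esub> y) = a \<odot>\<^bsub>?L\<^esub> ?b c y" by simp
    qed (use module.smult_closed[OF E c] lin_homD(1)[OF red_lin] in simp)
  qed
  interpret BO: base_change R I "?O k" by (rule base_changeI[OF ext_deg_module])
  let ?l = "tensor_lift R B (?O k) ?L ?b"
  have l: "?l \<in> lin_hom R (tensor R B (?O k)) ?L" by (rule BO.BM.tensor_lift_lin[OF mL bil])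
  have l_one: "?l (one_tensor R I (?O k) y) = ?red y" if y: "y \<in> ext_deg R n k" for y
  proof -
    have "?l (one_tensor R I (?O k) y) = ?b (I +>\<^bsub>R\<^esub> \<one>) y"
      unfolding one_tensor_def
      by (rule BO.BM.tensor_lift_pure[OF mL bil]) (use y coset_closed in \<open>simp_all add: B_carrier\<close>)
    also have "\<dots> = \<one>\<^bsub>S\<^esub> \<odot>\<^bsub>?E\<^esub> ?red y" by (simp add: S_simps(2))
    finally show ?thesis using module.smult_one[OF E red[OF y]] by simp
  qed
  have tm: "tor_map R I (Q 0) ?KK (\<lambda>X. X) k t = tor_class R I ?KK k (F k x)"
    unfolding x(2) by (rule QKK.tor_map_class[OF F x(1)])
  have "the_elem (?l ` tor_class R I ?KK k (F k x)) = ?l (one_tensor R I (?O k) (F k x))"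
  proof (rule the_elem_image_eq)
    have c: "one_tensor R I (?O k) (F k x) \<in> cycles (tor_complex R I ?KK) k"
      using QKK.chain_lift_tor_cycle[OF F x(1)] QKK.Q.tor_cycle_ot[of "F k x" k] Fx by simp
    show "one_tensor R I (?O k) (F k x) \<in> tor_class R I ?KK k (F k x)"
      using QKK.Q.T.homology_class_self[OF c] by (simp add: tor_class_def)
    fix z assume "z \<in> tor_class R I ?KK k (F k x)"
    then obtain b where b: "b \<in> carrier (obj (tor_complex R I ?KK) (k + 1))"
      "z = diff (tor_complex R I ?KK) (k + 1) b \<oplus>\<^bsub>obj (tor_complex R I ?KK) k\<^esub> one_tensor R I (?O k) (F k x)"
      by (auto simp: tor_class_def QKK.Q.T.mem_homology_class)
    obtain w where w: "w \<in> ext_deg R n (k + 1)" "b = one_tensor R I (?O (k + 1)) w"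
      using QKK.Q.ot_surj[OF b(1)] by auto
    have dw: "koszul_diff R n r w \<in> ext_deg R n k" using koszul_diff_deg[of n r, OF r w(1)] by simp
    have "diff (tor_complex R I ?KK) (k + 1) b = one_tensor R I (?O k) (koszul_diff R n r w)"
      using QKK.Q.T_diff_ot[of w "k + 1"] w by simp
    then have z: "z = one_tensor R I (?O k) (koszul_diff R n r w \<oplus>\<^bsub>?O k\<^esub> F k x)"
      using b(2) QKK.Q.ot_add[of "koszul_diff R n r w" k "F k x"] dw Fx by simp
    have s: "koszul_diff R n r w \<oplus>\<^bsub>?O k\<^esub> F k x \<in> ext_deg R n k"
      using abelian_monoid.a_closed[OF abelian_group.axioms(1)[OF module.axioms(2)[OF ext_deg_module]], of _ k] dw Fx by simp
    have i: "koszul_diff R n r w J \<in> I" for J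
      using boundary_coefficients[OF degree_zero_bideg[OF w(1)], of J "{#}"]
      unfolding const_koszul_degree_zero by (simp add: degree_zero_def)
    have "?red (koszul_diff R n r w \<oplus>\<^bsub>?O k\<^esub> F k x) J = ?red (F k x) J" for J
    proof -
      have c: "koszul_diff R n r w J \<in> carrier R" "F k x J \<in> carrier R"
        using Icarr[OF i] Fx by (auto simp: ext_deg_iff)
      have "(koszul_diff R n r w J \<oplus> F k x J) \<ominus> F k x J = koszul_diff R n r w J"
        using c by (simp add: a_minus_def R.a_assoc R.r_neg)
      then show ?thesis using coset_eq_iff[of "koszul_diff R n r w J \<oplus> F k x J" "F k x J"] c i
        by (simp add: ext_alg_simps)
    qed
    then show "?l z = ?l (one_tensor R I (?O k) (F k x))" unfolding z l_one[OF s] l_one[OF Fx] by blast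
  qed
  then have te: "tor_to_ext R I r n (Q 0) k t = ?red (F k x)"
    unfolding tor_to_ext_def Let_def tm using l_one[OF Fx] by simp
  have "tor_koszul 0 k t = reduce R I (degree_zero R (F k x))"
    unfolding x(2)
    by (rule tor_koszul_class[OF chain_lift_comp[OF F degree_zero_lift Q_res'] x(1)])
  also have "\<dots> = (\<lambda>J. sym_const S (tor_to_ext R I r n (Q 0) k t J))"
    unfolding te using coset_zero_iff[of \<zero>]
    by (simp add: reduce_def degree_zero_def sym_const_def fun_eq_iff S_simps(1))
  finally show ?thesis ..
qed

text \<open>\<open>gr_to_sym\<close> is an inverse picked by \<open>inv_into\<close>, so it can be
  evaluated once \<open>sym_to_gr\<close> is known to be injective. Two forms over \<open>S\<close>
  lift to forms over \<open>R\<close>; if their values agree modulo \<open>I^(s+1)\<close>, the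
  lifts differ by a boundary according to \<open>kernel_boundary\<close>, and boundaries have
  coefficients in \<open>I\<close>.\<close>

lemma gr_to_sym_aug:
  assumes x: "x \<in> bideg R n s 0"
  shows "gr_to_sym R I r n s (aug (K s) x) = reduce R I x {}"
proof -
  let ?f = "sym_to_gr R I r n s"
  interpret G: module R "gr R I s" by (rule gr_module)
  note [simp del] = ideal_pow.simps
  have val: "?f (reduce R I y {}) = aug (K s) y" if y: "y \<in> bideg R n s 0" for y
  proof -
    note yR = bidegD(1)[OF y]
    let ?g = "\<lambda>m. reduce R I y {} m \<odot>\<^bsub>grS R I s\<^esub> (ideal_pow R I (Suc s) +>\<^bsub>R\<^esub> mono_val R n r m)"
    have mm: "ideal_pow R I (Suc s) +>\<^bsub>R\<^esub> mono_val R n r m \<in> carrier (gr R I s)" "mono_val R n r m \<in> ideal_pow R I s"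
      if "m \<in> monomials n s" for m
      using mono_val_mem[of m] that by (auto simp: gr_def filt_carrier monomials_iff)
    note pl = filt_proj_lin[of s "Suc s"]
    have sm: "?g m = y {} m \<odot>\<^bsub>gr R I s\<^esub> (ideal_pow R I (Suc s) +>\<^bsub>R\<^esub> mono_val R n r m)" if m: "m \<in> monomials n s" for m
      using over_quotient_smult[OF gr_module gr_ideal yR[of "{}" m] mm(1)[OF m]] by (simp add: reduce_def grS_def)
    have g: "?g m = ideal_pow R I (Suc s) +>\<^bsub>R\<^esub> (y {} m \<otimes> mono_val R n r m)" if m: "m \<in> monomials n s" for m
      unfolding sm[OF m] using lin_homD(3)[OF pl yR[of "{}" m], of "mono_val R n r m"] mm(2)[OF m] by (simp add: gr_def)
    have gc: "?g m \<in> carrier (gr R I s)" if m: "m \<in> monomials n s" for m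
      unfolding sm[OF m] using yR mm(1)[OF m] by simp
    have sub: "{m. reduce R I y {} m \<noteq> \<zero>\<^bsub>S\<^esub>} \<subseteq> monomials n s"
    proof
      fix m assume "m \<in> {m. reduce R I y {} m \<noteq> \<zero>\<^bsub>S\<^esub>}"
      then have "reduce R I y {} m \<noteq> \<zero>\<^bsub>S\<^esub>" by (rule CollectD)
      from cring.bidegD(2)[OF S_cring reduce_bideg[OF y] this] show "m \<in> monomials n s"
        by (simp add: monomials_iff)
    qed
    have "?f (reduce R I y {}) = (\<Oplus>\<^bsub>gr R I s\<^esub>m\<in>{m. reduce R I y {} m \<noteq> \<zero>\<^bsub>S\<^esub>}. ?g m)"
      unfolding sym_to_gr_def mono_val_def[symmetric] by (simp add: grS_def finsum_over_quotient)
    \<comment> \<open>\<open>sym_to_gr\<close> sums over the support of the reduced form,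
      \<open>sym_eval\<close> over all monomials of degree \<open>s\<close>. The terms added have
      coefficients in \<open>I\<close>, which annihilates \<open>gr R I s\<close>.\<close>
    also have "\<dots> = (\<Oplus>\<^bsub>gr R I s\<^esub>m\<in>monomials n s. ?g m)"
    proof (rule G.add.finprod_mono_neutral_cong_left[OF finite_monomials sub])
      fix m assume m: "m \<in> monomials n s - {m. reduce R I y {} m \<noteq> \<zero>\<^bsub>S\<^esub>}"
      then have "reduce R I y {} m = I" by (simp add: S_simps(1))
      then have yI: "y {} m \<in> I" using coset_zero_iff[OF yR] by (simp add: reduce_def)
      have m': "m \<in> monomials n s" using m by simp
      show "?g m = \<zero>\<^bsub>gr R I s\<^esub>" unfolding sm[OF m'] by (rule gr_ideal[OF yI mm(1)[OF m']])
    qed (use gc in auto)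
    also have "\<dots> = (\<Oplus>\<^bsub>gr R I s\<^esub>m\<in>monomials n s. ideal_pow R I (Suc s) +>\<^bsub>R\<^esub> (y {} m \<otimes> mono_val R n r m))"
      by (rule G.finsum_cong') (use g gc in auto)
    also have "\<dots> = ideal_pow R I (Suc s) +>\<^bsub>R\<^esub> sym_eval R n r s (y {})"
    proof -
      have mod: "module R (pow_module s)" using filt_quotient[of s s] quotient_def by blast
      have c: "y {} m \<otimes> mono_val R n r m \<in> ideal_pow R I s" if "m \<in> monomials n s" for m
        using ideal.I_l_closed[OF ideal_pow_ideal mm(2)[OF that] yR] .
      have fs: "(\<Oplus>\<^bsub>pow_module s\<^esub>m\<in>monomials n s. y {} m \<otimes> mono_val R n r m) = sym_eval R n r s (y {})"
      proof -
        have inc: "(\<lambda>a. a) \<in> lin_hom R (pow_module s) (self_module R)"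
          using ideal.Icarr[OF ideal_pow_ideal[of s]] by (intro lin_homI) auto
        show ?thesis
          using lin_hom_finsum[OF mod self_module_module[OF R.is_cring] inc, of "\<lambda>m. y {} m \<otimes> mono_val R n r m" "monomials n s"] c
          by (simp add: finsum_self_module sym_eval_def)
      qed
      show ?thesis
        using lin_hom_finsum[OF mod gr_module, of "\<lambda>a. ideal_pow R I (Suc s) +>\<^bsub>R\<^esub> a" s "\<lambda>m. y {} m \<otimes> mono_val R n r m" "monomials n s"]
          pl c fs by (simp add: gr_def)
    qed
    finally show ?thesis by simp
  qed
  have inj: "inj_on ?f (sym_deg S n s)"
  proof (rule inj_onI)
    fix p q assume pq: "p \<in> sym_deg S n s" "q \<in> sym_deg S n s" "?f p = ?f q"
    have lift: "\<exists>x\<in>bideg R n s 0. p = reduce R I x {}" if p: "p \<in> sym_deg S n s" for p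
    proof -
      have "(\<lambda>J m. if J = {} then p m else \<zero>\<^bsub>S\<^esub>) \<in> bideg S n s 0"
        using p cring.cring_simprules(2)[OF S_cring] by (auto simp: bideg_def sym_deg_iff)
      then obtain x where "x \<in> bideg R n s 0" "(\<lambda>J m. if J = {} then p m else \<zero>\<^bsub>S\<^esub>) = reduce R I x"
        by (rule reduce_surj)
      then show ?thesis by (intro bexI[of _ x]) (auto dest: fun_cong[of _ _ "{}"])
    qed
    obtain x where x: "x \<in> bideg R n s 0" "p = reduce R I x {}" using lift[OF pq(1)] by blast
    obtain y where y: "y \<in> bideg R n s 0" "q = reduce R I y {}" using lift[OF pq(2)] by blast
    let ?C = "koszul_comp R n s 0"
    interpret C: module R ?C by (rule koszul_comp_module)
    have xy: "x \<in> carrier ?C" "y \<in> carrier ?C" using x y by (simp_all add: koszul_comp_simps(1))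
    have d: "x \<ominus>\<^bsub>?C\<^esub> y \<in> bideg R n s 0" using C.minus_closed[OF xy] by (simp add: koszul_comp_simps(1))
    have "aug (K s) x = aug (K s) y" using pq(3) val x y by simp
    then have "aug (K s) (x \<ominus>\<^bsub>?C\<^esub> y) = \<zero>\<^bsub>gr R I s\<^esub>"
      using lin_hom_minus[OF koszul_comp_module gr_module aug_lin xy] lin_homD(1)[OF aug_lin xy(2)]
      by (simp add: a_minus_def G.r_neg del: power_resolution_simps(3))
    then have "sym_eval R n r s ((x \<ominus>\<^bsub>?C\<^esub> y) {}) \<in> ideal_pow R I (Suc s)"
      using filt_zero_iff[OF sym_eval_mem[of "(x \<ominus>\<^bsub>?C\<^esub> y) {}" s], of "Suc s"] bidegD(1)[OF d]
      by (simp add: gr_def filt_zero)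
    then obtain w where w: "w \<in> bideg R n s 1" "const_koszul R n r w = x \<ominus>\<^bsub>?C\<^esub> y"
      using kernel_boundary[OF d] by blast
    have "x = (x \<ominus>\<^bsub>?C\<^esub> y) \<oplus>\<^bsub>?C\<^esub> y" using xy by (simp add: a_minus_def C.a_assoc C.l_neg)
    then have "x = (\<lambda>J m. const_koszul R n r w J m \<oplus> y J m)" unfolding w(2)[symmetric] koszul_comp_simps(3) .
    then have "reduce R I x = reduce R I y"
      using reduce_add_ideal[OF y(1) boundary_coefficients[OF w(1)]] by simp
    then show "p = q" using x y by simp
  qed
  have "reduce R I x {} \<in> sym_deg S n s"
    unfolding sym_deg_iff using cring.bidegD[OF S_cring reduce_bideg[OF x]] by blast
  then show ?thesis
    unfolding gr_to_sym_def val[OF x, symmetric] by (rule inv_into_f_f[OF inj])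
qed

end

section \<open>Products of graded pieces with Tor\<close>

context koszul_tor
begin

lemma gr_cases:
  assumes "X \<in> carrier (gr R I s)"
  obtains x where "x \<in> bideg R n s 0" "X = aug (K s) x"
proof -
  have "aug (K s) ` carrier (obj (K s) 0) = carrier (gr R I s)" by (rule res.aug_surj[OF K_res])
  then show thesis using assms that by (auto simp: koszul_comp_simps(1))
qed

text \<open>The product of a form and an element of the exterior algebra over \<open>S\<close>, in
  coordinates. The second factor has polynomial degree 0, so that only its coefficients at
  \<open>{#}\<close> matter.\<close>

definition sym_tor_product :: "nat \<Rightarrow> int \<Rightarrow> 'a set \<Rightarrow> ('a, 'q) tens_el set \<Rightarrow> nat set \<Rightarrow> nat multiset \<Rightarrow> 'a set"
  where "sym_tor_product s k X t = (\<lambda>J m. gr_to_sym R I r n s X m \<otimes>\<^bsub>S\<^esub> tor_koszul 0 k t J {#})"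

lemma gr_to_sym_closed: "X \<in> carrier (gr R I s) \<Longrightarrow> gr_to_sym R I r n s X m \<in> carrier S"
  using gr_cases[of X s] gr_to_sym_aug coset_closed[OF bidegD(1)] by (metis reduce_def)

lemma tor_koszul_value: "t \<in> carrier (Tor R I (Q s) k) \<Longrightarrow> tor_koszul s k t J m \<in> carrier S"
  by (rule cring.bidegD(1)[OF S_cring tor_koszul_closed])

lemma sym_tor_product_eq:
  assumes X: "X \<in> carrier (gr R I s)" and t: "t \<in> carrier (Tor R I (Q 0) k)"
  shows "gr_to_sym R I r n s X \<odot>\<^bsub>ext_alg (sym_alg S n) n\<^esub> (\<lambda>J. sym_const S (tor_to_ext R I r n (Q 0) k t J)) =
    sym_tor_product s k X t"
proof (rule ext)
  fix J
  interpret S: cring S by (rule S_cring)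
  have e: "sym_const S (tor_to_ext R I r n (Q 0) k t J) = tor_koszul 0 k t J"
    using fun_cong[OF tor_to_ext_eq[OF t], of J] by (simp add: sym_const_def)
  have c: "tor_to_ext R I r n (Q 0) k t J = tor_koszul 0 k t J {#}"
    by (simp add: e[symmetric]) (simp add: sym_const_def)
  show "(gr_to_sym R I r n s X \<odot>\<^bsub>ext_alg (sym_alg S n) n\<^esub> (\<lambda>J. sym_const S (tor_to_ext R I r n (Q 0) k t J))) J =
      sym_tor_product s k X t J"
    unfolding ext_alg_simps c sym_tor_product_def
    by (rule S.sym_mult_const_right[OF tor_koszul_value[OF t] gr_to_sym_closed[OF X]])
qed

text \<open>Multiplication by a form \<open>p\<close> with value \<open>X\<close> is a chain map
  from \<open>K 0\<close> to \<open>K s\<close> over multiplication by \<open>X\<close>, because the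
  differential does not act on the variables. Preceded by \<open>compare\<close> it gives one lift
  from \<open>Q 0\<close> to \<open>K s\<close>; a lift to \<open>Q s\<close> followed by
  \<open>compare\<close> gives another, and the two agree after reduction.\<close>

lemma tor_map_mult:
  assumes X: "X \<in> carrier (gr R I s)" and t: "t \<in> carrier (Tor R I (Q 0) k)"
  shows "tor_map R I (Q 0) (Q s) (\<lambda>c. c \<odot>\<^bsub>grS R I s\<^esub> X) k t \<in> carrier (Tor R I (Q s) k)"
    and "tor_koszul s k (tor_map R I (Q 0) (Q s) (\<lambda>c. c \<odot>\<^bsub>grS R I s\<^esub> X) k t) = sym_tor_product s k X t"
proof -
  let ?f = "\<lambda>c. c \<odot>\<^bsub>grS R I s\<^esub> X"
  note [simp del] = ideal_pow.simps(2)
  interpret G: module R "gr R I s" by (rule gr_module)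
  have fa: "?f (I +>\<^bsub>R\<^esub> a) = a \<odot>\<^bsub>gr R I s\<^esub> X" if "a \<in> carrier R" for a
    unfolding grS_def by (rule over_quotient_smult[OF gr_module gr_ideal that X])
  have h: "(\<lambda>a. I +>\<^bsub>R\<^esub> a) \<in> lin_hom R (pow_module 0) (gr R I 0)"
    using filt_proj_lin[of 0 "Suc 0"] by (simp add: gr_def ideal_pow_one)
  have g0: "c \<in> carrier (gr R I 0) \<Longrightarrow> \<exists>a\<in>carrier R. c = I +>\<^bsub>R\<^esub> a" for c
    by (auto simp: gr_def filt_carrier ideal_pow_one)
  have f: "?f \<in> lin_hom R (gr R I 0) (gr R I s)"
  proof (rule lin_homI)
    fix c assume "c \<in> carrier (gr R I 0)"
    then obtain a where a: "a \<in> carrier R" "c = I +>\<^bsub>R\<^esub> a" using g0 by blast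
    show "?f c \<in> carrier (gr R I s)" unfolding a(2) fa[OF a(1)] using a(1) X by simp
    show "?f (e \<odot>\<^bsub>gr R I 0\<^esub> c) = e \<odot>\<^bsub>gr R I s\<^esub> ?f c" if e: "e \<in> carrier R" for e
    proof -
      have "e \<odot>\<^bsub>gr R I 0\<^esub> c = I +>\<^bsub>R\<^esub> (e \<otimes> a)" using lin_homD(3)[OF h e, of a] a by simp
      then show ?thesis using fa a e X by (simp add: G.smult_assoc1)
    qed
    fix d assume "d \<in> carrier (gr R I 0)"
    then obtain b where b: "b \<in> carrier R" "d = I +>\<^bsub>R\<^esub> b" using g0 by blast
    have "c \<oplus>\<^bsub>gr R I 0\<^esub> d = I +>\<^bsub>R\<^esub> (a \<oplus> b)" using lin_homD(2)[OF h, of a b] a b by simp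
    then show "?f (c \<oplus>\<^bsub>gr R I 0\<^esub> d) = ?f c \<oplus>\<^bsub>gr R I s\<^esub> ?f d" using fa a b X by (simp add: G.smult_l_distr)
  qed
  interpret QQ: two_resolutions_base_change R "gr R I 0" "Q 0" "gr R I s" "Q s" I
    by (rule two_resolutions_base_changeI[OF Q_res Q_res'])
  obtain F where F: "chain_lift R (Q 0) (Q s) ?f F" using QQ.chain_lift_exists[OF f] by blast
  obtain q where q: "tor_cycle R I (Q 0) k q" "t = tor_class R I (Q 0) k q" using t by (rule Qc.Tor_cases)
  have tm: "tor_map R I (Q 0) (Q s) ?f k t = tor_class R I (Q s) k (F k q)"
    unfolding q(2) by (rule QQ.tor_map_class[OF F q(1)])
  note Fq = QQ.chain_lift_tor_cycle[OF F q(1)]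
  show "tor_map R I (Q 0) (Q s) ?f k t \<in> carrier (Tor R I (Q s) k)"
    unfolding tm by (rule Qc.tor_class_closed[OF Fq])
  obtain p where p: "p \<in> bideg R n s 0" "X = aug (K s) p" using X by (rule gr_cases)
  note pR = bidegD(1)[OF p(1)]
  let ?mu = "\<lambda>z J m. p {} m \<otimes> z J {#}"
  have mub: "?mu z \<in> bideg R n s k'" if z: "z \<in> bideg R n 0 k'" for z k'
  proof -
    have "p {} m \<noteq> \<zero> \<and> z J {#} \<noteq> \<zero>" if "p {} m \<otimes> z J {#} \<noteq> \<zero>" for J m
      using that pR bidegD(1)[OF z] by auto
    then have "J \<subseteq> {..<n} \<and> int (card J) = k' \<and> set_mset m \<subseteq> {..<n} \<and> size m = s" if "p {} m \<otimes> z J {#} \<noteq> \<zero>" for J m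
      using bidegD(2)[OF z, of J "{#}"] bidegD(2)[OF p(1), of "{}" m] that by blast
    then show ?thesis using pR bidegD(1)[OF z] by (simp add: bideg_def)
  qed
  have mu: "chain_lift R (K 0) (K s) ?f (\<lambda>k. ?mu)"
    unfolding chain_lift_def
  proof (intro conjI allI ballI)
    fix k' show "?mu \<in> lin_hom R (obj (K 0) k') (obj (K s) k')"
    proof (rule lin_homI)
      fix z assume "z \<in> carrier (obj (K 0) k')"
      then have z: "z \<in> bideg R n 0 k'" by (simp add: koszul_comp_simps(1))
      show "?mu z \<in> carrier (obj (K s) k')" using mub[OF z] by (simp add: koszul_comp_simps(1))
      show "?mu (a \<odot>\<^bsub>obj (K 0) k'\<^esub> z) = a \<odot>\<^bsub>obj (K s) k'\<^esub> ?mu z" if a: "a \<in> carrier R" for a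
        using a pR bidegD(1)[OF z] koszul_comp_smult[OF a z] koszul_comp_smult[OF a mub[OF z]]
        by (simp add: fun_eq_iff m_lcomm)
      fix z' assume "z' \<in> carrier (obj (K 0) k')"
      then have z': "z' \<in> bideg R n 0 k'" by (simp add: koszul_comp_simps(1))
      show "?mu (z \<oplus>\<^bsub>obj (K 0) k'\<^esub> z') = ?mu z \<oplus>\<^bsub>obj (K s) k'\<^esub> ?mu z'"
        using pR bidegD(1)[OF z] bidegD(1)[OF z'] by (simp add: koszul_comp_simps(3) r_distr)
    qed
    fix z assume "z \<in> carrier (obj (K 0) k')"
    then have z: "z \<in> bideg R n 0 k'" by (simp add: koszul_comp_simps(1))
    show "?mu (diff (K 0) k' z) = diff (K s) k' (?mu z)"
    proof (intro ext)
      fix J m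
      have "koszul_diff R n r (p {} m \<odot>\<^bsub>ext_alg R n\<^esub> (\<lambda>K. z K {#})) = p {} m \<odot>\<^bsub>ext_alg R n\<^esub> koszul_diff R n r (\<lambda>K. z K {#})"
        by (rule lin_homD(3)[OF koszul_diff_lin[of n r, OF r] pR bideg_slice_carrier[OF z]])
      then show "?mu (diff (K 0) k' z) J m = diff (K s) k' (?mu z) J m"
        by (simp add: const_koszul_def ext_alg_simps)
    qed
  next
    fix z assume "z \<in> carrier (obj (K 0) 0)"
    then have z: "z \<in> bideg R n 0 0" by (simp add: koszul_comp_simps(1))
    let ?a = "z {} {#}"
    have a: "?a \<in> carrier R" using bidegD(1)[OF z] .
    have "aug (K s) (?mu z) = ideal_pow R I (Suc s) +>\<^bsub>R\<^esub> (?a \<otimes> sym_eval R n r s (p {}))"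
      using sym_eval_smult[OF a, of "p {}" s] pR a by (simp add: m_comm)
    also have "\<dots> = ?a \<odot>\<^bsub>gr R I s\<^esub> X"
      using lin_homD(3)[OF filt_proj_lin[of s "Suc s"] a, of "sym_eval R n r s (p {})"] sym_eval_mem[of "p {}" s] pR p(2)
      by (simp add: gr_def)
    also have "\<dots> = ?f (aug (K 0) z)"
      using fa[OF a] sym_eval_degree_zero[of "z {}"] bidegD(1)[OF z] by (simp add: ideal_pow_one)
    finally show "aug (K s) (?mu z) = ?f (aug (K 0) z)" .
  qed
  have l1: "chain_lift R (Q 0) (K s) ?f (\<lambda>k x. compare s k (F k x))"
    by (rule chain_lift_comp[OF F compare_lift Q_res'])
  have l2: "chain_lift R (Q 0) (K s) ?f (\<lambda>k x. ?mu (compare 0 k x))"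
    by (rule chain_lift_comp[OF compare_lift mu Q_res'])
  have "tor_koszul s k (tor_map R I (Q 0) (Q s) ?f k t) = reduce R I (compare s k (F k q))"
    unfolding tm by (rule tor_koszul_compare[OF Fq])
  also have "\<dots> = reduce R I (?mu (compare 0 k q))" by (rule lift_reduce_eq[OF l1 l2 q(1)])
  also have "\<dots> = sym_tor_product s k X t"
    unfolding sym_tor_product_def p(2) gr_to_sym_aug[OF p(1)] q(2) tor_koszul_compare[OF q(1)]
    using pR bidegD(1)[OF compare_bideg[OF q(1)]] by (simp add: reduce_def coset_mult)
  finally show "tor_koszul s k (tor_map R I (Q 0) (Q s) ?f k t) = sym_tor_product s k X t" .
qed

lemma gr_to_sym_add:
  assumes X: "X \<in> carrier (gr R I s)" and Y: "Y \<in> carrier (gr R I s)"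
  shows "gr_to_sym R I r n s (X \<oplus>\<^bsub>gr R I s\<^esub> Y) m = gr_to_sym R I r n s X m \<oplus>\<^bsub>S\<^esub> gr_to_sym R I r n s Y m"
proof -
  obtain x where x: "x \<in> bideg R n s 0" "X = aug (K s) x" using X by (rule gr_cases)
  obtain y where y: "y \<in> bideg R n s 0" "Y = aug (K s) y" using Y by (rule gr_cases)
  have xy: "(\<lambda>J m. x J m \<oplus> y J m) \<in> bideg R n s 0" by (rule bideg_add[OF x(1) y(1)])
  have "X \<oplus>\<^bsub>gr R I s\<^esub> Y = aug (K s) (\<lambda>J m. x J m \<oplus> y J m)"
    using lin_homD(2)[OF aug_lin, of x s y] x y by (simp add: koszul_comp_simps(1,3) del: power_resolution_simps(3) ideal_pow.simps)
  then show ?thesis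
    unfolding x(2) y(2) using gr_to_sym_aug[OF xy] gr_to_sym_aug[OF x(1)] gr_to_sym_aug[OF y(1)]
      coset_add[OF bidegD(1)[OF x(1)] bidegD(1)[OF y(1)], of "{}" m "{}" m]
    by (simp add: reduce_def del: power_resolution_simps(3))
qed

lemma gr_to_sym_smult:
  assumes c: "c \<in> carrier S" and X: "X \<in> carrier (gr R I s)"
  shows "gr_to_sym R I r n s (c \<odot>\<^bsub>grS R I s\<^esub> X) m = c \<otimes>\<^bsub>S\<^esub> gr_to_sym R I r n s X m"
proof -
  obtain x where x: "x \<in> bideg R n s 0" "X = aug (K s) x" using X by (rule gr_cases)
  obtain a where a: "a \<in> carrier R" "c = I +>\<^bsub>R\<^esub> a" using c by (auto simp: S_carrier)
  have ax: "(\<lambda>J m. a \<otimes> x J m) \<in> bideg R n s 0" by (rule bideg_smult[OF a(1) x(1)])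
  have "c \<odot>\<^bsub>grS R I s\<^esub> X = a \<odot>\<^bsub>gr R I s\<^esub> X"
    unfolding a(2) grS_def by (rule over_quotient_smult[OF gr_module gr_ideal a(1) X])
  also have "\<dots> = aug (K s) (\<lambda>J m. a \<otimes> x J m)"
    using lin_homD(3)[OF aug_lin a(1), of x s] x koszul_comp_smult[OF a(1) x(1)]
    by (simp add: koszul_comp_simps(1) del: power_resolution_simps(3) ideal_pow.simps)
  finally show ?thesis
    using gr_to_sym_aug[OF ax] gr_to_sym_aug[OF x(1)] x(2) a
      coset_mult[OF a(1) bidegD(1)[OF x(1)], of "{}" m]
    by (simp add: reduce_def del: power_resolution_simps(3))
qed

lemma sym_tor_product_bilinear:
  "bilinear_map S (grS R I s) (TorS R I (Q 0) k) (koszul_comp S n s k) (sym_tor_product s k)"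
proof -
  interpret S: cring S by (rule S_cring)
  have cl: "sym_tor_product s k X t \<in> bideg S n s k" if "X \<in> carrier (gr R I s)" "t \<in> carrier (Tor R I (Q 0) k)" for X t
    using tor_koszul_closed[OF tor_map_mult(1)[OF that]] tor_map_mult(2)[OF that] by simp
  note tl = lin_homD[OF tor_koszul_lin[of 0 k], unfolded TorS_def over_quotient_simps koszul_comp_simps(1,3)]
  have ts: "tor_koszul 0 k (c \<odot>\<^bsub>TorS R I (Q 0) k\<^esub> t) = (\<lambda>J m. c \<otimes>\<^bsub>S\<^esub> tor_koszul 0 k t J m)"
    if "c \<in> carrier S" "t \<in> carrier (Tor R I (Q 0) k)" for c t
    using lin_homD(3)[OF tor_koszul_lin[of 0 k] that(1), of t] that S.koszul_comp_smult[OF that(1) tor_koszul_closed[OF that(2)]]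
    by (simp add: TorS_def)
  show ?thesis
    unfolding bilinear_map_def
  proof (intro conjI ballI)
    fix t assume "t \<in> carrier (TorS R I (Q 0) k)"
    then have t: "t \<in> carrier (Tor R I (Q 0) k)" by (simp add: TorS_def)
    note tR = tor_koszul_value[OF t]
    show "(\<lambda>X. sym_tor_product s k X t) \<in> lin_hom S (grS R I s) (koszul_comp S n s k)"
    proof (rule lin_homI)
      fix X assume "X \<in> carrier (grS R I s)"
      then have X: "X \<in> carrier (gr R I s)" by (simp add: grS_def)
      note XR = gr_to_sym_closed[OF X]
      show "sym_tor_product s k X t \<in> carrier (koszul_comp S n s k)"
        using cl[OF X t] by (simp add: koszul_comp_simps(1))
      show "sym_tor_product s k (c \<odot>\<^bsub>grS R I s\<^esub> X) t = c \<odot>\<^bsub>koszul_comp S n s k\<^esub> sym_tor_product s k X t"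
        if c: "c \<in> carrier S" for c
        unfolding S.koszul_comp_smult[OF c cl[OF X t]]
        using gr_to_sym_smult[OF c X] S.m_assoc[OF c XR tR] by (simp add: sym_tor_product_def)
      fix Y assume "Y \<in> carrier (grS R I s)"
      then have Y: "Y \<in> carrier (gr R I s)" by (simp add: grS_def)
      show "sym_tor_product s k (X \<oplus>\<^bsub>grS R I s\<^esub> Y) t =
          sym_tor_product s k X t \<oplus>\<^bsub>koszul_comp S n s k\<^esub> sym_tor_product s k Y t"
        using gr_to_sym_add[OF X Y] S.l_distr[OF XR gr_to_sym_closed[OF Y] tR]
        by (simp add: sym_tor_product_def koszul_comp_simps(3) grS_def)
    qed
  next
    fix X assume "X \<in> carrier (grS R I s)"
    then have X: "X \<in> carrier (gr R I s)" by (simp add: grS_def)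
    note XR = gr_to_sym_closed[OF X]
    show "sym_tor_product s k X \<in> lin_hom S (TorS R I (Q 0) k) (koszul_comp S n s k)"
    proof (rule lin_homI)
      fix t assume "t \<in> carrier (TorS R I (Q 0) k)"
      then have t: "t \<in> carrier (Tor R I (Q 0) k)" by (simp add: TorS_def)
      note tR = tor_koszul_value[OF t]
      show "sym_tor_product s k X t \<in> carrier (koszul_comp S n s k)"
        using cl[OF X t] by (simp add: koszul_comp_simps(1))
      show "sym_tor_product s k X (c \<odot>\<^bsub>TorS R I (Q 0) k\<^esub> t) = c \<odot>\<^bsub>koszul_comp S n s k\<^esub> sym_tor_product s k X t"
        if c: "c \<in> carrier S" for c
        unfolding S.koszul_comp_smult[OF c cl[OF X t]]
        using ts[OF c t] S.m_lcomm[OF XR c tR] by (simp add: sym_tor_product_def)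
      fix t' assume "t' \<in> carrier (TorS R I (Q 0) k)"
      then have t': "t' \<in> carrier (Tor R I (Q 0) k)" by (simp add: TorS_def)
      show "sym_tor_product s k X (t \<oplus>\<^bsub>TorS R I (Q 0) k\<^esub> t') =
          sym_tor_product s k X t \<oplus>\<^bsub>koszul_comp S n s k\<^esub> sym_tor_product s k X t'"
        using tl(2)[OF t t'] S.r_distr[OF tR tor_koszul_value[OF t'] XR]
        by (simp add: sym_tor_product_def koszul_comp_simps(3) TorS_def)
    qed
  qed
qed

lemma koszul_comp_alg_lin:
  "f \<in> lin_hom S M (koszul_comp S n s k) \<Longrightarrow> f \<in> lin_hom S M (koszul_alg S n)"
  using cring.bideg_koszul_alg[OF S_cring, of _ n s k]
  unfolding lin_hom_def koszul_comp_simps koszul_alg_simps(2-4) Pi_iff mem_Collect_eq by blast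

text \<open>On a pure tensor, the lift inside \<open>psi\<close> and \<open>tor_koszul\<close> of
  its image under \<open>gr_tor_mult\<close> are the same product, by \<open>tor_map_mult\<close>
  and \<open>sym_tor_product_eq\<close>; by additivity they agree on all tensors. Surjectivity of
  \<open>gr_tor_mult\<close> makes the map chosen by \<open>inv_into\<close> a right inverse, so
  that the equality applies to \<open>t\<close>.\<close>

theorem psi_eq:
  assumes t: "t \<in> carrier (Tor R I (Q s) k)"
  shows "psi R I r n Q s k t = tor_koszul s k t"
proof -
  interpret S: cring S by (rule S_cring)
  let ?G = "grS R I s" and ?T0 = "TorS R I (Q 0) k" and ?Ts = "TorS R I (Q s) k"
  let ?C = "koszul_comp S n s k" and ?A = "koszul_alg S n"
  let ?m = "\<lambda>X t. tor_map R I (Q 0) (Q s) (\<lambda>c. c \<odot>\<^bsub>?G\<^esub> X) k t"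
  let ?b = "\<lambda>X t'. gr_to_sym R I r n s X \<odot>\<^bsub>ext_alg (sym_alg S n) n\<^esub>
    (\<lambda>J. sym_const S (tor_to_ext R I r n (Q 0) k t' J))"
  have cG: "carrier ?G = carrier (gr R I s)" by (simp add: grS_def)
  have cT: "carrier (TorS R I (Q s') k) = carrier (Tor R I (Q s') k)" for s' by (simp add: TorS_def)
  interpret TP: tensor_product S ?G ?T0
    by (simp add: tensor_product_def grS_module Qc.TorS_module)
  note bil = sym_tor_product_bilinear[of s k, unfolded bilinear_map_def]
  have mC: "module S ?C" by (rule S.koszul_comp_module)
  have mA: "module S ?A" by (rule S.koszul_alg_module)
  have pe: "tor_koszul s k (?m X t') = sym_tor_product s k X t'" "?m X t' \<in> carrier ?Ts"
    if "X \<in> carrier ?G" "t' \<in> carrier ?T0" for X t'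
    using tor_map_mult that by (simp_all add: cG cT)
  have mb: "bilinear_map S ?G ?T0 ?Ts ?m"
    unfolding bilinear_map_def
  proof (intro conjI ballI)
    fix t' assume t': "t' \<in> carrier ?T0"
    have "(\<lambda>X. tor_koszul s k (?m X t')) \<in> lin_hom S ?G ?C"
      using lin_homD[OF bspec[OF conjunct1[OF bil] t']] pe(1)[OF _ t']
        module.smult_closed[OF grS_module] abelian_monoid.a_closed[OF abelian_group.axioms(1)[OF module.axioms(2)[OF grS_module]]]
      by (intro lin_homI) auto
    then show "(\<lambda>X. ?m X t') \<in> lin_hom S ?G ?Ts"
      by (intro lin_hom_transfer[OF Qc.TorS_module mC tor_koszul_lin tor_koszul_inj _ _ grS_module])
        (use pe(2) t' in auto)
  next
    fix X assume X: "X \<in> carrier ?G"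
    have "(\<lambda>t. tor_koszul s k (?m X t)) \<in> lin_hom S ?T0 ?C"
      using lin_homD[OF bspec[OF conjunct2[OF bil] X]] pe(1)[OF X]
        module.smult_closed[OF Qc.TorS_module] abelian_monoid.a_closed[OF abelian_group.axioms(1)[OF module.axioms(2)[OF Qc.TorS_module]]]
      by (intro lin_homI) auto
    then show "?m X \<in> lin_hom S ?T0 ?Ts"
      by (intro lin_hom_transfer[OF Qc.TorS_module mC tor_koszul_lin tor_koszul_inj _ _ Qc.TorS_module])
        (use pe(2) X in auto)
  qed
  have bb: "bilinear_map S ?G ?T0 ?A ?b"
  proof -
    have be: "?b X t' = sym_tor_product s k X t'" if "X \<in> carrier ?G" "t' \<in> carrier ?T0" for X t'
      using sym_tor_product_eq that by (simp add: cG cT)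
    show ?thesis
      unfolding bilinear_map_def
    proof (intro conjI ballI)
      fix t' assume t': "t' \<in> carrier ?T0"
      show "(\<lambda>X. ?b X t') \<in> lin_hom S ?G ?A"
        using lin_homD[OF koszul_comp_alg_lin[OF bspec[OF conjunct1[OF bil] t']]] be[OF _ t']
          module.smult_closed[OF grS_module] abelian_monoid.a_closed[OF abelian_group.axioms(1)[OF module.axioms(2)[OF grS_module]]]
        by (intro lin_homI) auto
    next
      fix X assume X: "X \<in> carrier ?G"
      show "?b X \<in> lin_hom S ?T0 ?A"
        using lin_homD[OF koszul_comp_alg_lin[OF bspec[OF conjunct2[OF bil] X]]] be[OF X]
          module.smult_closed[OF Qc.TorS_module] abelian_monoid.a_closed[OF abelian_group.axioms(1)[OF module.axioms(2)[OF Qc.TorS_module]]]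
        by (intro lin_homI) auto
    qed
  qed
  let ?GT = "tensor S ?G ?T0"
  let ?gm = "gr_tor_mult R I Q s k"
  have gm: "?gm \<in> lin_hom S ?GT ?Ts"
    unfolding gr_tor_mult_def by (rule TP.tensor_lift_lin[OF Qc.TorS_module mb])
  have gm_pure: "?gm (pure_tensor S ?G ?T0 X t') = ?m X t'" if "X \<in> carrier ?G" "t' \<in> carrier ?T0" for X t'
    unfolding gr_tor_mult_def by (rule TP.tensor_lift_pure[OF Qc.TorS_module mb that])
  let ?l = "tensor_lift S ?G ?T0 ?A ?b"
  have l: "?l \<in> lin_hom S ?GT ?A" by (rule TP.tensor_lift_lin[OF mA bb])
  have tg: "(\<lambda>w. tor_koszul s k (?gm w)) \<in> lin_hom S ?GT ?C" by (rule lin_hom_comp[OF gm tor_koszul_lin])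
  have eq: "?l w = tor_koszul s k (?gm w)" if "w \<in> carrier ?GT" for w
    using that
  proof (induction rule: TP.tensor_induct)
    case (pure X t')
    have "?l (pure_tensor S ?G ?T0 X t') = ?b X t'" by (rule TP.tensor_lift_pure[OF mA bb pure])
    then show ?case
      using gm_pure[OF pure] pe(1)[OF pure] sym_tor_product_eq[of X s t' k] pure by (simp add: cG cT)
  next
    case (add w w')
    then show ?case
      using lin_homD(2)[OF l add(1,2)] lin_homD(2)[OF koszul_comp_alg_lin[OF tg] add(1,2)] by simp
  qed
  \<comment> \<open>As \<open>tor_koszul\<close> is injective, it suffices to reach its values,
    which are combinations of basis elements \<open>(J, m)\<close>. Each of these is a product of
    the monomial \<open>m\<close>, realised by a class in \<open>gr R I s\<close>, with
    \<open>e_J\<close>, realised by a class in \<open>Tor\<close> of \<open>Q 0\<close>.\<close>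
  have "t \<in> ?gm ` carrier ?GT"
  proof -
    let ?B = "koszul_basis n s k"
    have "\<exists>w\<in>carrier ?GT. tor_koszul s k (?gm w) = koszul_gen S b" if b: "b \<in> ?B" for b
    proof -
      obtain J m where Jm: "b = (J, m)" "(J, m) \<in> koszul_basis n s k" using b by (cases b) auto
      have J: "(J, {#}) \<in> koszul_basis n 0 k" and m: "({}, m) \<in> koszul_basis n s 0"
        using Jm(2) by (auto simp: koszul_basis_def monomials_iff)
      have "koszul_gen S (J, {#}) \<in> tor_koszul 0 k ` carrier (Tor R I (Q 0) k)"
        unfolding bij_betw_imp_surj_on[OF tor_koszul_bij[of 0 k]] by (rule S.koszul_gen_closed[OF J])
      then obtain t' where t'': "koszul_gen S (J, {#}) = tor_koszul 0 k t'" and t'0: "t' \<in> carrier (Tor R I (Q 0) k)"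
        by (rule imageE)
      note t' = t'0 t''[symmetric]
      have g: "koszul_gen R ({}, m) \<in> bideg R n s 0" by (rule koszul_gen_closed[OF m])
      let ?X = "aug (K s) (koszul_gen R ({}, m))"
      have X: "?X \<in> carrier (gr R I s)"
        using lin_homD(1)[OF aug_lin] g by (simp add: koszul_comp_simps(1) del: power_resolution_simps(3))
      have z: "I +>\<^bsub>R\<^esub> \<zero> = \<zero>\<^bsub>S\<^esub>" using coset_zero_iff[of \<zero>] by (simp add: S_simps(1))
      have "sym_tor_product s k ?X t' = koszul_gen S b"
        unfolding sym_tor_product_def gr_to_sym_aug[OF g] t'(2) Jm(1) reduce_def
      proof (intro ext)
        fix J' m'
        show "(I +>\<^bsub>R\<^esub> koszul_gen R ({}, m) {} m') \<otimes>\<^bsub>S\<^esub> koszul_gen S (J, {#}) J' {#} = koszul_gen S (J, m) J' m'"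
          by (cases "J' = J"; cases "m' = m") (simp_all add: koszul_gen_def z S_simps(2)[symmetric])
      qed
      then have "tor_koszul s k (?gm (pure_tensor S ?G ?T0 ?X t')) = koszul_gen S b"
        using gm_pure pe(1) X t'(1) by (simp add: cG cT del: power_resolution_simps(3))
      moreover have "pure_tensor S ?G ?T0 ?X t' \<in> carrier ?GT"
        by (rule TP.pure_tensor_closed) (use X t' in \<open>simp_all add: cG cT del: power_resolution_simps(3)\<close>)
      ultimately show ?thesis by blast
    qed
    then obtain w where w: "\<And>b. b \<in> ?B \<Longrightarrow> w b \<in> carrier ?GT" "\<And>b. b \<in> ?B \<Longrightarrow> tor_koszul s k (?gm (w b)) = koszul_gen S b"
      by metis
    let ?y = "tor_koszul s k t"
    have y: "?y \<in> bideg S n s k" by (rule tor_koszul_closed[OF t])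
    note yR = S.bidegD(1)[OF y]
    let ?w = "\<Oplus>\<^bsub>?GT\<^esub>b\<in>?B. ?y (fst b) (snd b) \<odot>\<^bsub>?GT\<^esub> w b"
    interpret GT: module S ?GT by (rule TP.tensor_module)
    interpret C: module S ?C by (rule mC)
    have wc: "?y (fst b) (snd b) \<odot>\<^bsub>?GT\<^esub> w b \<in> carrier ?GT" if "b \<in> ?B" for b
      using yR w(1)[OF that] by simp
    have "tor_koszul s k (?gm ?w) = (\<Oplus>\<^bsub>?C\<^esub>b\<in>?B. tor_koszul s k (?gm (?y (fst b) (snd b) \<odot>\<^bsub>?GT\<^esub> w b)))"
      by (rule lin_hom_finsum[OF TP.tensor_module mC tg]) (use wc in auto)
    also have "\<dots> = (\<Oplus>\<^bsub>?C\<^esub>b\<in>?B. ?y (fst b) (snd b) \<odot>\<^bsub>?C\<^esub> koszul_gen S b)"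
    proof (rule C.finsum_cong'[OF refl])
      fix b assume b: "b \<in> ?B"
      show "tor_koszul s k (?gm (?y (fst b) (snd b) \<odot>\<^bsub>?GT\<^esub> w b)) = ?y (fst b) (snd b) \<odot>\<^bsub>?C\<^esub> koszul_gen S b"
        using lin_homD(3)[OF tg yR w(1)[OF b]] w(2)[OF b] by simp
    next
      show "(\<lambda>b. ?y (fst b) (snd b) \<odot>\<^bsub>?C\<^esub> koszul_gen S b) \<in> ?B \<rightarrow> carrier ?C"
        using S.koszul_gen_closed yR C.smult_closed by (auto simp: koszul_comp_simps(1))
    qed
    also have "\<dots> = ?y" by (rule S.koszul_expand[OF y, symmetric])
    finally have e: "tor_koszul s k (?gm ?w) = tor_koszul s k t" .
    have wG: "?w \<in> carrier ?GT" by (rule GT.finsum_closed) (use wc in auto)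
    have "?gm ?w = t"
      by (rule inj_onD[OF tor_koszul_inj e]) (use lin_homD(1)[OF gm wG] t in \<open>simp_all add: cT\<close>)
    then show ?thesis using wG by blast
  qed
  then have inv: "inv_into (carrier ?GT) ?gm t \<in> carrier ?GT" "?gm (inv_into (carrier ?GT) ?gm t) = t"
    by (rule inv_into_into, rule f_inv_into_f)
  have "psi R I r n Q s k t = ?l (inv_into (carrier ?GT) ?gm t)"
    unfolding psi_def Let_def gr_tensor_tor_def ..
  then show ?thesis using eq[OF inv(1)] inv(2) by simp
qed

end

section \<open>The unit map\<close>

context cring
begin

lemma trivial_resolution: "proj_resolution R (self_module R) (trivial_resolution R)"
proof -
  let ?M = "self_module R" and ?Z = "(self_module R)\<lparr>carrier := {\<zero>}\<rparr>"
  note M = self_module_module[OF is_cring]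
  interpret M: module R ?M by (rule M)
  have "submodule {\<zero>} R ?M"
    by (rule quotient_by_ideal.I_submodule) (simp add: quotient_by_ideal_def is_cring zeroideal)
  then have Z: "module R ?Z" by (rule submodule.submodule_is_module[OF _ M])
  interpret Z: module R ?Z by (rule Z)
  have "projective R ?M"
    by (rule finite_basis_projective[OF M, of "{()}" "\<lambda>_. \<one>" "\<lambda>_ x. x"]) (auto simp: lin_hom_def)
  moreover have "projective R ?Z"
    by (rule finite_basis_projective[OF Z, of "{}"]) auto
  ultimately show ?thesis
    by (auto simp: proj_resolution_def trivial_resolution_def lin_hom_def cycles_def boundaries_def a_kernel_def')
qed

lemma epsilon_value: "epsilon R n c J m = (if J = {} \<and> m = {#} then c else \<zero>)"
  by (simp add: epsilon_def sym_const_def sym_alg_def)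

lemma bideg_zero_epsilon:
  assumes x: "x \<in> bideg R n 0 0"
  shows "x = epsilon R n (x {} {#})"
proof (intro ext)
  fix J m
  show "x J m = epsilon R n (x {} {#}) J m"
  proof (cases "J = {} \<and> m = {#}")
    case False
    have "\<not> (J \<subseteq> {..<n} \<and> int (card J) = 0 \<and> set_mset m \<subseteq> {..<n} \<and> size m = 0)"
      using False finite_subset[of J "{..<n}"] by auto
    then show ?thesis using bidegD(2)[OF x, of J m] False by (auto simp: epsilon_value)
  qed (simp add: epsilon_value)
qed

lemma epsilon_bideg: "c \<in> carrier R \<Longrightarrow> epsilon R n c \<in> bideg R n 0 0"
  by (auto simp: bideg_def epsilon_value)

lemma epsilon_lin: "epsilon R n \<in> lin_hom R (self_module R) (koszul_comp R n 0 0)"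
  by (rule lin_homI)
    (auto simp: koszul_comp_simps(1,3) koszul_comp_smult epsilon_bideg epsilon_value fun_eq_iff)

end

context koszul_tor
begin

text \<open>In bidegree \<open>(0, 0)\<close> an element is a single coefficient, whose reduction is
  the augmentation. The lift of the projection from \<open>R\<close> to \<open>S\<close> and
  \<open>compare\<close> both respect augmentations, so a representative \<open>a\<close> of
  \<open>c\<close> ends at \<open>c\<close>.\<close>

theorem tor_koszul_eta:
  assumes c: "c \<in> carrier S"
  shows "eta R I (Q 0) c \<in> carrier (Tor R I (Q 0) 0)"
    and "tor_koszul 0 0 (eta R I (Q 0) c) = epsilon S n c"
proof -
  interpret S: cring S by (rule S_cring)
  let ?T = "trivial_resolution R"
  have To: "obj ?T 0 = self_module R" by (simp add: trivial_resolution_def)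
  interpret T: two_resolutions_base_change R "self_module R" ?T "gr R I 0" "Q 0" I
    by (rule two_resolutions_base_changeI[OF proj_resI Q_res'])
      (simp_all add: is_cring self_module_module trivial_resolution)
  obtain a where a: "a \<in> carrier R" "c = I +>\<^bsub>R\<^esub> a" using c by (auto simp: S_carrier)
  have h: "a_r_coset R I \<in> lin_hom R (self_module R) (gr R I 0)"
    using filt_proj_lin[of 0 "Suc 0"] by (simp add: gr_def ideal_pow_one del: ideal_pow.simps(2)) (simp add: lin_hom_def)
  obtain F where F: "chain_lift R ?T (Q 0) (a_r_coset R I) F" using T.chain_lift_exists[OF h] by blast
  have ta: "tor_cycle R I ?T 0 a"
    using T.P.ot_zero[of "-1"] a(1) by (simp add: tor_cycle_def trivial_resolution_def)
  have "pure_tensor R B (obj ?T 0) c \<one> = one_tensor R I (obj ?T 0) a"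
    using base_change.pure_tensor_eq_one_tensor[OF base_changeI[OF self_module_module[OF is_cring]] a(1), of \<one>] a
    by (simp add: To)
  then have e: "eta R I (Q 0) c = tor_class R I (Q 0) 0 (F 0 a)"
    using T.tor_map_class[OF F ta] by (simp add: eta_def Let_def tor_class_def)
  note Fa = T.chain_lift_tor_cycle[OF F ta]
  show "eta R I (Q 0) c \<in> carrier (Tor R I (Q 0) 0)" unfolding e by (rule Qc.tor_class_closed[OF Fa])
  let ?x = "compare 0 0 (F 0 a)"
  have x: "?x \<in> bideg R n 0 0" by (rule compare_bideg[OF Fa])
  have "aug (K 0) ?x = aug (Q 0) (F 0 a)"
    using compare_lift[of 0] Qc.tor_cycle_closed[OF Fa] by (simp add: chain_lift_def del: power_resolution_simps(3))
  also have "\<dots> = c"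
    using F a by (simp add: chain_lift_def To) (simp add: trivial_resolution_def)
  finally have "I +>\<^bsub>R\<^esub> ?x {} {#} = c"
    using sym_eval_degree_zero[of "?x {}"] bidegD(1)[OF x] by (simp add: ideal_pow_one del: ideal_pow.simps(2))
  then have "reduce R I ?x {} {#} = c" by (simp add: reduce_def)
  then show "tor_koszul 0 0 (eta R I (Q 0) c) = epsilon S n c"
    unfolding e tor_koszul_compare[OF Fa] using S.bideg_zero_epsilon[OF reduce_bideg[OF x]] by simp
qed

lemma eta_lin: "eta R I (Q 0) \<in> lin_hom S (self_module S) (TorS R I (Q 0) 0)"
proof -
  interpret S: cring S by (rule S_cring)
  have "(\<lambda>c. tor_koszul 0 0 (eta R I (Q 0) c)) \<in> lin_hom S (self_module S) (koszul_comp S n 0 0)"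
    using lin_homD[OF S.epsilon_lin[of n]] by (intro lin_homI) (auto simp: tor_koszul_eta(2))
  then show ?thesis
    by (intro lin_hom_transfer[OF Qc.TorS_module S.koszul_comp_module tor_koszul_lin tor_koszul_inj _ _ self_module_module[OF S_cring]])
      (use tor_koszul_eta(1) in \<open>auto simp: TorS_def\<close>)
qed

lemma eta_inj: "inj_on (eta R I (Q 0)) (carrier S)"
proof (rule inj_onI)
  fix c d assume c: "c \<in> carrier S" and d: "d \<in> carrier S" and "eta R I (Q 0) c = eta R I (Q 0) d"
  then have "epsilon S n c {} {#} = epsilon S n d {} {#}"
    using tor_koszul_eta(2)[OF c] tor_koszul_eta(2)[OF d] by simp
  then show "c = d" by (simp add: cring.epsilon_value[OF S_cring])
qed

lemma eta_surj: "eta R I (Q 0) ` carrier S = carrier (Tor R I (Q 0) 0)"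
proof
  show "eta R I (Q 0) ` carrier S \<subseteq> carrier (Tor R I (Q 0) 0)" using tor_koszul_eta(1) by blast
  show "carrier (Tor R I (Q 0) 0) \<subseteq> eta R I (Q 0) ` carrier S"
  proof
    fix t assume t: "t \<in> carrier (Tor R I (Q 0) 0)"
    let ?c = "tor_koszul 0 0 t {} {#}"
    have c: "?c \<in> carrier S" by (rule tor_koszul_value[OF t])
    have "tor_koszul 0 0 (eta R I (Q 0) ?c) = tor_koszul 0 0 t"
      unfolding tor_koszul_eta(2)[OF c]
      by (rule cring.bideg_zero_epsilon[OF S_cring tor_koszul_closed[OF t], symmetric])
    then have "eta R I (Q 0) ?c = t"
      by (rule inj_onD[OF tor_koszul_inj]) (use t tor_koszul_eta(1)[OF c] in \<open>simp_all add: TorS_def\<close>)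
    then show "t \<in> eta R I (Q 0) ` carrier S" using c by blast
  qed
qed

end

context koszul_connecting
begin

text \<open>The whole of \<open>Tor\<close> in degree 0 is the kernel, because the target sits in
  exterior degree -1, and by \<open>eta_surj\<close> it is also the image of
  \<open>eta\<close>.\<close>

lemma connecting_kernel_eta:
  "a_kernel (Tor R I (Q 0) 0) (Tor R I (Q (Suc 0)) (- 1)) (connecting 0 0) = eta R I (Q 0) ` carrier S"
proof -
  interpret S: cring S by (rule S_cring)
  have "connecting 0 0 t = \<zero>\<^bsub>Tor R I (Q (Suc 0)) (- 1)\<^esub>" if "t \<in> carrier (Tor R I (Q 0) 0)" for t
    using connecting_zero_iff[OF that] S.sym_koszul_negative[OF tor_koszul_closed[OF that]] by simp
  then show ?thesis unfolding eta_surj by (auto simp: a_kernel_def')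
qed

end

text \<open>The resolutions are arbitrary. A single family \<open>Q\<close> provides the quotient
  term of the sequence for \<open>s + 1\<close> and the submodule term of the one for
  \<open>s\<close>, so that consecutive maps \<open>\<delta>\<close> compose without further
  identifications. The index \<open>k\<close> runs over all integers; the distinction at
  \<open>k = 0\<close> reflects that \<open>\<eta>\<close> has its image in degree 0.\<close>

theorem proposition7:
  fixes R :: "('a, 'c) ring_scheme" and r :: "nat \<Rightarrow> 'a" and n :: nat and I :: "'a set"
    and Q :: "nat \<Rightarrow> ('a, 'q, 'a set) resolution"
    and P :: "nat \<Rightarrow> ('a, 'p, 'a set) resolution"
    and u :: "nat \<Rightarrow> int \<Rightarrow> 'q \<Rightarrow> 'p" and v :: "nat \<Rightarrow> int \<Rightarrow> 'p \<Rightarrow> 'q"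
    and S :: "'a set ring"
    and \<delta> :: "nat \<Rightarrow> int \<Rightarrow> ('a, 'q) tens_el set \<Rightarrow> ('a, 'q) tens_el set"
    and \<psi> :: "nat \<Rightarrow> int \<Rightarrow> ('a, 'q) tens_el set \<Rightarrow> nat set \<Rightarrow> nat multiset \<Rightarrow> 'a set"
    and d :: "(nat set \<Rightarrow> nat multiset \<Rightarrow> 'a set) \<Rightarrow> nat set \<Rightarrow> nat multiset \<Rightarrow> 'a set"
    and \<eta> :: "'a set \<Rightarrow> ('a, 'q) tens_el set"
  assumes "cring R"
    and "regular_seq R r n"
    and "I = genideal R (r ` {..<n})"
    and "S = R Quot I"
    and "\<And>s. proj_resolution R (gr R I s) (Q s)"
    and "\<And>s. proj_resolution R (filt_quot R I s (s + 2)) (P s)"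
    and "\<And>s. ses_of_resolutions R gr_incl (gr_proj R I s) (Q (s + 1)) (P s) (Q s) (u s) (v s)"
    and "\<And>s. \<delta> s = tor_connecting R I (Q (s + 1)) (P s) (Q s) (u s) (v s)"
    and "\<psi> = psi R I r n Q"
    and "d = koszul_diff (sym_alg S n) n (sym_var S)"
    and "\<eta> = eta R I (Q 0)"
  shows
    "(\<forall>s k. \<psi> s k \<in> lin_hom S (TorS R I (Q s) k) (koszul_comp S n s k) \<and>
        bij_betw (\<psi> s k) (carrier (Tor R I (Q s) k)) (carrier (koszul_comp S n s k))) \<and>
     (\<forall>s k. \<delta> s k \<in> lin_hom S (TorS R I (Q s) k) (TorS R I (Q (s + 1)) (k - 1))) \<and>
     \<eta> \<in> lin_hom S (self_module S) (TorS R I (Q 0) 0) \<and>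
     (\<forall>s k. \<forall>x\<in>carrier (Tor R I (Q s) k). \<psi> (s + 1) (k - 1) (\<delta> s k x) = d (\<psi> s k x)) \<and>
     (\<forall>c\<in>carrier S. \<psi> 0 0 (\<eta> c) = epsilon S n c) \<and>
     inj_on \<eta> (carrier S) \<and>
     (\<forall>k. a_kernel (Tor R I (Q 0) k) (Tor R I (Q 1) (k - 1)) (\<delta> 0 k) =
        (if k = 0 then \<eta> ` carrier S else {\<zero>\<^bsub>Tor R I (Q 0) k\<^esub>})) \<and>
     (\<forall>s k. a_kernel (Tor R I (Q (s + 1)) k) (Tor R I (Q (s + 2)) (k - 1)) (\<delta> (s + 1) k) =
        \<delta> s (k + 1) ` carrier (Tor R I (Q s) (k + 1)))"
proof -
  interpret cring R by fact
  have rR: "r j \<in> carrier R" if "j < n" for j using assms(2) that by (simp add: regular_seq_def)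
  have I: "ideal I R" unfolding assms(3) by (rule genideal_ideal) (use rR in auto)
  interpret koszul_connecting R I r n Q P u v
    by (intro koszul_connecting.intro koszul_tor.intro koszul_setting.intro quotient_by_ideal.intro
        elements.intro elements_axioms.intro koszul_setting_axioms.intro koszul_tor_axioms.intro
        koszul_connecting_axioms.intro is_cring I rR assms(2,3,5))
      (use assms(6,7) in simp_all)
  interpret S: cring "R Quot I" by (rule S_cring)
  have S: "S = R Quot I" by fact
  have carrier_TorS: "carrier (TorS R I (Q s) k) = carrier (Tor R I (Q s) k)" for s k by (simp add: TorS_def)
  have psi: "\<psi> s k t = tor_koszul s k t" if "t \<in> carrier (Tor R I (Q s) k)" for s k t
    unfolding assms(9) by (rule psi_eq[OF that])
  have delta: "\<delta> s = connecting s" for s using assms(8) by simp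
  have "\<psi> s k \<in> lin_hom S (TorS R I (Q s) k) (koszul_comp S n s k)" for s k
    unfolding S
  proof (rule lin_homI)
    fix t assume t: "t \<in> carrier (TorS R I (Q s) k)"
    note tl = lin_homD[OF tor_koszul_lin[of s k]]
    interpret T: module "R Quot I" "TorS R I (Q s) k" by (rule Qc.TorS_module)
    show "\<psi> s k t \<in> carrier (koszul_comp (R Quot I) n s k)" using tl(1)[OF t] psi t carrier_TorS by simp
    show "\<psi> s k (a \<odot>\<^bsub>TorS R I (Q s) k\<^esub> t) = a \<odot>\<^bsub>koszul_comp (R Quot I) n s k\<^esub> \<psi> s k t"
      if "a \<in> carrier (R Quot I)" for a
      using tl(3)[OF that t] psi t T.smult_closed[OF that t] carrier_TorS by simp
    fix t' assume t': "t' \<in> carrier (TorS R I (Q s) k)"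
    show "\<psi> s k (t \<oplus>\<^bsub>TorS R I (Q s) k\<^esub> t') = \<psi> s k t \<oplus>\<^bsub>koszul_comp (R Quot I) n s k\<^esub> \<psi> s k t'"
      using tl(2)[OF t t'] psi t t' T.a_closed[OF t t'] carrier_TorS by simp
  qed
  moreover have "bij_betw (\<psi> s k) (carrier (Tor R I (Q s) k)) (carrier (koszul_comp S n s k))" for s k
    using tor_koszul_bij[of s k] bij_betw_cong[of "carrier (Tor R I (Q s) k)" "\<psi> s k" "tor_koszul s k"] psi
    by (simp add: S koszul_comp_simps(1))
  moreover have "\<delta> s k \<in> lin_hom S (TorS R I (Q s) k) (TorS R I (Q (s + 1)) (k - 1))" for s k
    using connecting_lin[of s k] by (simp add: delta S)
  moreover have "\<eta> \<in> lin_hom S (self_module S) (TorS R I (Q 0) 0)" unfolding assms(11) S by (rule eta_lin)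
  moreover have "\<psi> (s + 1) (k - 1) (\<delta> s k t) = d (\<psi> s k t)" if t: "t \<in> carrier (Tor R I (Q s) k)" for s k t
    using connecting_properties[OF t] psi t S.koszul_diff_sym_alg[OF tor_koszul_closed[OF t]]
    by (simp add: delta assms(10) S)
  moreover have "\<psi> 0 0 (\<eta> c) = epsilon S n c" if "c \<in> carrier S" for c
    using tor_koszul_eta that psi by (simp add: S assms(11))
  moreover have "inj_on \<eta> (carrier S)" unfolding assms(11) S by (rule eta_inj)
  moreover have "a_kernel (Tor R I (Q 0) k) (Tor R I (Q 1) (k - 1)) (\<delta> 0 k) =
      (if k = 0 then \<eta> ` carrier S else {\<zero>\<^bsub>Tor R I (Q 0) k\<^esub>})" for k
    using connecting_kernel_eta connecting_kernel_zero[of k] by (simp add: delta S assms(11))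
  moreover have "a_kernel (Tor R I (Q (s + 1)) k) (Tor R I (Q (s + 2)) (k - 1)) (\<delta> (s + 1) k) =
      \<delta> s (k + 1) ` carrier (Tor R I (Q s) (k + 1))" for s k
    using connecting_kernel_Suc[of s k] by (simp add: delta)
  ultimately show ?thesis by simp
qed

end
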